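(* Let $d>0$, $\alpha\in\mathbb{R}$, $k_0,k_1>0$ (neither a Wood frequency), $\sigma_1>0$, $\kappa_1=k_1+i\sigma_1$, $L\in\{0,1,2\}$. Let $\widetilde F_0$ be a real-analytic $d$-periodic function, $\varepsilon>0$, $F_0=\varepsilon\widetilde F_0$, and $\Gamma_0=\{(x_1,F_0(x_1)):0\le x_1\le d\}$. Let $Z_{1,0}^L=Y^-_L(\kappa_1,F_0)$. Then, provided $\varepsilon$ is small enough, the operator $$\mathcal{A}_{1,0}:=\tfrac12 I+(K^w_{\Gamma_0,k_0})^\top+Z^L_{1,0}S^w_{\Gamma_0,k_0}:H^{-1/2}(\Gamma_0)\to H^{-1/2}(\Gamma_0)$$ is invertible with continuous inverse.
   Context: Set $\alpha_n=\alpha+\frac{2\pi}{d}n$. $H^s(\Gamma_0)$ is the space of $\alpha$-quasiperiodic functions $\varphi(x_1)=\sum_n\varphi_ne^{i\alpha_nx_1}$ (identified as functions on $\Gamma_0$ via $x_1$) with $\sum_n(1+\alpha_n^2)^s|\varphi_n|^2<\infty$. Square roots use the branch with $\sqrt1=1$ and cut along the negative imaginary axis; $k$ is a Wood frequency if $k^2=\alpha_n^2$ for some $n$. The $\alpha$-quasiperiodic Green function is $G^q_k(x_1,x_2)=\sum_{m\in\mathbb{Z}}e^{-i\alpha md}G_k(x_1+md,x_2)$ with $G_k(\mathbf{x})=\frac i4H_0^{(1)}(k|\mathbf{x}|)$. With $\mathbf{x}=(x,F_0(x))$, $\mathbf{y}=(y,F_0(y))$ and $n_0(x)=(F_0'(x),-1)$: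 $[S^w_{\Gamma_0,k}\varphi](\mathbf{x})=\int_0^dG^q_k(x-y,F_0(x)-F_0(y))\varphi(y)\,dy$ and $[(K^w_{\Gamma_0,k})^\top\varphi](\mathbf{x})=\int_0^d\frac{\partial G^q_k(\mathbf{x}-\mathbf{y})}{\partial n_0(\mathbf{x})}\varphi(y)\,dy$. The operator $Y^-_L(\kappa,F)$ for $F=\varepsilon\widetilde F$ is $\sum_{\ell=0}^L Y^-_\ell(\kappa,\widetilde F)\varepsilon^\ell$ with $Y_0^-[\varphi]=-i\beta_D(\kappa)[\varphi]$, $Y_1^-[\varphi]=(D\widetilde F)(D\varphi)-[\beta_D(\kappa),\widetilde F][\beta_D(\kappa)\varphi]$, $Y_2^-[\varphi]=i\beta_D(\kappa)\big(-[\beta_D(\kappa),\widetilde F^2/2][\beta_D(\kappa)\varphi]+\widetilde F[\beta_D(\kappa),\widetilde F][\beta_D(\kappa)\varphi]\big)$, where $\beta_D(\kappa)[\varphi]=\sum_n(\kappa^2-\alpha_n^2)^{1/2}\varphi_ne^{i\alpha_nx_1}$, $D=\partial_{x_1}$, and $[\beta_D,\widetilde F][\varphi]=\beta_D[\widetilde F\varphi]-\widetilde F\beta_D[\varphi]$. (For real $k$ these are the first Taylor coefficients in $\varepsilon$ of the Dirichlet-to-Neumann map $g\mapsto-\partial_{n}v|_{\Gamma}$, $n=(F',-1)$, of the radiating $\alpha$-quasiperiodic Helmholtz problem below the graph of $F$ with Dirichlet data $g$; "$\varepsilon$ small enough" includes $\varepsilon$ smaller than the radii of convergence of these perturbation series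 for $k_0,k_1$.) *)

theory Defs
  imports "HOL-Analysis.Analysis"
begin

definition alpha_n :: "real \<Rightarrow> real \<Rightarrow> int \<Rightarrow> real" where
  "alpha_n d \<alpha> n = \<alpha> + 2 * pi / d * of_int n"

definition wood :: "real \<Rightarrow> real \<Rightarrow> real \<Rightarrow> bool" where
  "wood d \<alpha> k \<longleftrightarrow> (\<exists>n::int. k^2 = (alpha_n d \<alpha> n)^2)"

text \<open>Square root with sqrt 1 = 1 and branch cut along the negative imaginary axis.\<close>
definition psqrt :: "complex \<Rightarrow> complex" where
  "psqrt z = (if Re z < 0 \<and> Im z < 0 then - csqrt z else csqrt z)"

definition real_analytic :: "(real \<Rightarrow> real) \<Rightarrow> bool" where
  "real_analytic f \<longleftrightarrow> (\<forall>x. \<exists>r>0. \<exists>a::nat \<Rightarrow> real.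
      \<forall>y. \<bar>y - x\<bar> < r \<longrightarrow> (\<lambda>n. a n * (y - x)^n) sums f y)"

definition bessel_J0 :: "real \<Rightarrow> real" where
  "bessel_J0 x = (\<Sum>m. (-1)^m * (x/2)^(2*m) / (fact m)^2)"

definition bessel_Y0 :: "real \<Rightarrow> real" where
  "bessel_Y0 x = 2 / pi * ((ln (x/2) + euler_mascheroni) * bessel_J0 x
     + (\<Sum>m. (-1)^(m+2) * harm (m+1) * (x/2)^(2*(m+1)) / (fact (m+1))^2))"

definition hankel1_0 :: "real \<Rightarrow> complex" where
  "hankel1_0 x = complex_of_real (bessel_J0 x) + \<i> * complex_of_real (bessel_Y0 x)"

definition green :: "real \<Rightarrow> real \<Rightarrow> real \<Rightarrow> complex" where
  "green k x1 x2 = \<i> / 4 * hankel1_0 (k * sqrt (x1^2 + x2^2))"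

definition green_q :: "real \<Rightarrow> real \<Rightarrow> real \<Rightarrow> real \<Rightarrow> real \<Rightarrow> complex" where
  "green_q d \<alpha> k x1 x2 = lim (\<lambda>M::nat. \<Sum>m\<in>{- int M..int M}.
      exp (- \<i> * complex_of_real (\<alpha> * of_int m * d)) * green k (x1 + of_int m * d) x2)"

definition green_q_d1 :: "real \<Rightarrow> real \<Rightarrow> real \<Rightarrow> real \<Rightarrow> real \<Rightarrow> complex" where
  "green_q_d1 d \<alpha> k x1 x2 = vector_derivative (\<lambda>t. green_q d \<alpha> k t x2) (at x1)"

definition green_q_d2 :: "real \<Rightarrow> real \<Rightarrow> real \<Rightarrow> real \<Rightarrow> real \<Rightarrow> complex" where
  "green_q_d2 d \<alpha> k x1 x2 = vector_derivative (\<lambda>t. green_q d \<alpha> k x1 t) (at x2)"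

type_synonym coeffs = "int \<Rightarrow> complex"

text \<open>The function sum_n c_n e^{i alpha_n x} (used for finitely supported c).\<close>
definition qp_fun :: "real \<Rightarrow> real \<Rightarrow> coeffs \<Rightarrow> real \<Rightarrow> complex" where
  "qp_fun d \<alpha> c x = infsum (\<lambda>n. c n * exp (\<i> * complex_of_real (alpha_n d \<alpha> n * x))) UNIV"

definition qp_coef :: "real \<Rightarrow> real \<Rightarrow> (real \<Rightarrow> complex) \<Rightarrow> coeffs" where
  "qp_coef d \<alpha> g n = 1 / complex_of_real d *
     integral {0..d} (\<lambda>x. g x * exp (- \<i> * complex_of_real (alpha_n d \<alpha> n * x)))"

definition per_coef :: "real \<Rightarrow> (real \<Rightarrow> real) \<Rightarrow> coeffs" where
  "per_coef d f j = 1 / complex_of_real d *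
     integral {0..d} (\<lambda>x. complex_of_real (f x) * exp (- \<i> * complex_of_real (2 * pi * of_int j * x / d)))"

definition sob_mem :: "real \<Rightarrow> real \<Rightarrow> real \<Rightarrow> coeffs \<Rightarrow> bool" where
  "sob_mem d \<alpha> s c \<longleftrightarrow>
     (\<lambda>n. (1 + (alpha_n d \<alpha> n)^2) powr s * (cmod (c n))^2) summable_on UNIV"

definition sob_norm :: "real \<Rightarrow> real \<Rightarrow> real \<Rightarrow> coeffs \<Rightarrow> real" where
  "sob_norm d \<alpha> s c = sqrt (infsum (\<lambda>n. (1 + (alpha_n d \<alpha> n)^2) powr s * (cmod (c n))^2) UNIV)"

definition betaD :: "real \<Rightarrow> real \<Rightarrow> complex \<Rightarrow> coeffs \<Rightarrow> coeffs" where
  "betaD d \<alpha> \<kappa> c n = psqrt (\<kappa>^2 - complex_of_real ((alpha_n d \<alpha> n)^2)) * c n"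

definition Dop :: "real \<Rightarrow> real \<Rightarrow> coeffs \<Rightarrow> coeffs" where
  "Dop d \<alpha> c n = \<i> * complex_of_real (alpha_n d \<alpha> n) * c n"

definition mulop :: "real \<Rightarrow> (real \<Rightarrow> real) \<Rightarrow> coeffs \<Rightarrow> coeffs" where
  "mulop d g c n = infsum (\<lambda>j. per_coef d g (n - j) * c j) UNIV"

definition commut :: "real \<Rightarrow> real \<Rightarrow> complex \<Rightarrow> (real \<Rightarrow> real) \<Rightarrow> coeffs \<Rightarrow> coeffs" where
  "commut d \<alpha> \<kappa> g c n = betaD d \<alpha> \<kappa> (mulop d g c) n - mulop d g (betaD d \<alpha> \<kappa> c) n"

definition Y0m :: "real \<Rightarrow> real \<Rightarrow> complex \<Rightarrow> (real \<Rightarrow> real) \<Rightarrow> coeffs \<Rightarrow> coeffs" where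
  "Y0m d \<alpha> \<kappa> Ft c n = - \<i> * betaD d \<alpha> \<kappa> c n"

definition Y1m :: "real \<Rightarrow> real \<Rightarrow> complex \<Rightarrow> (real \<Rightarrow> real) \<Rightarrow> coeffs \<Rightarrow> coeffs" where
  "Y1m d \<alpha> \<kappa> Ft c n = mulop d (deriv Ft) (Dop d \<alpha> c) n
      - commut d \<alpha> \<kappa> Ft (betaD d \<alpha> \<kappa> c) n"

definition Y2m :: "real \<Rightarrow> real \<Rightarrow> complex \<Rightarrow> (real \<Rightarrow> real) \<Rightarrow> coeffs \<Rightarrow> coeffs" where
  "Y2m d \<alpha> \<kappa> Ft c n = \<i> * betaD d \<alpha> \<kappa>
      (\<lambda>m. - commut d \<alpha> \<kappa> (\<lambda>x. (Ft x)^2 / 2) (betaD d \<alpha> \<kappa> c) m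
           + mulop d Ft (commut d \<alpha> \<kappa> Ft (betaD d \<alpha> \<kappa> c)) m) n"

definition Yell :: "nat \<Rightarrow> real \<Rightarrow> real \<Rightarrow> complex \<Rightarrow> (real \<Rightarrow> real) \<Rightarrow> coeffs \<Rightarrow> coeffs" where
  "Yell l d \<alpha> \<kappa> Ft = (if l = 0 then Y0m d \<alpha> \<kappa> Ft else if l = 1 then Y1m d \<alpha> \<kappa> Ft
                        else if l = 2 then Y2m d \<alpha> \<kappa> Ft else (\<lambda>c n. 0))"

definition YL :: "nat \<Rightarrow> real \<Rightarrow> real \<Rightarrow> complex \<Rightarrow> real \<Rightarrow> (real \<Rightarrow> real) \<Rightarrow> coeffs \<Rightarrow> coeffs" where
  "YL L d \<alpha> \<kappa> \<epsilon> Ft c n = (\<Sum>l\<le>L. complex_of_real (\<epsilon>^l) * Yell l d \<alpha> \<kappa> Ft c n)"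

definition single_layer :: "real \<Rightarrow> real \<Rightarrow> real \<Rightarrow> (real \<Rightarrow> real) \<Rightarrow> coeffs \<Rightarrow> real \<Rightarrow> complex" where
  "single_layer d \<alpha> k F0 c x = integral {0..d}
     (\<lambda>y. green_q d \<alpha> k (x - y) (F0 x - F0 y) * qp_fun d \<alpha> c y)"

definition adj_double_layer :: "real \<Rightarrow> real \<Rightarrow> real \<Rightarrow> (real \<Rightarrow> real) \<Rightarrow> coeffs \<Rightarrow> real \<Rightarrow> complex" where
  "adj_double_layer d \<alpha> k F0 c x = integral {0..d}
     (\<lambda>y. (complex_of_real (deriv F0 x) * green_q_d1 d \<alpha> k (x - y) (F0 x - F0 y)
           - green_q_d2 d \<alpha> k (x - y) (F0 x - F0 y)) * qp_fun d \<alpha> c y)"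

text \<open>A_{1,0} = 1/2 I + (K^w)^T + Z^L_{1,0} S^w, in Fourier coefficients; meaningful
  on finitely supported (trigonometric polynomial) densities.\<close>
definition A10 :: "real \<Rightarrow> real \<Rightarrow> real \<Rightarrow> complex \<Rightarrow> nat \<Rightarrow> real \<Rightarrow> (real \<Rightarrow> real) \<Rightarrow> coeffs \<Rightarrow> coeffs" where
  "A10 d \<alpha> k0 \<kappa>1 L \<epsilon> Ft c n =
     c n / 2 + qp_coef d \<alpha> (adj_double_layer d \<alpha> k0 (\<lambda>x. \<epsilon> * Ft x) c) n
     + YL L d \<alpha> \<kappa>1 \<epsilon> Ft (qp_coef d \<alpha> (single_layer d \<alpha> k0 (\<lambda>x. \<epsilon> * Ft x) c)) n"

definition bounded_op_on :: "real \<Rightarrow> real \<Rightarrow> real \<Rightarrow> (coeffs \<Rightarrow> coeffs) \<Rightarrow> bool" where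
  "bounded_op_on d \<alpha> s T \<longleftrightarrow>
     (\<forall>c. sob_mem d \<alpha> s c \<longrightarrow> sob_mem d \<alpha> s (T c)) \<and>
     (\<forall>b c. sob_mem d \<alpha> s b \<longrightarrow> sob_mem d \<alpha> s c \<longrightarrow> T (\<lambda>n. b n + c n) = (\<lambda>n. T b n + T c n)) \<and>
     (\<forall>a c. sob_mem d \<alpha> s c \<longrightarrow> T (\<lambda>n. a * c n) = (\<lambda>n. a * T c n)) \<and>
     (\<exists>C. \<forall>c. sob_mem d \<alpha> s c \<longrightarrow> sob_norm d \<alpha> s (T c) \<le> C * sob_norm d \<alpha> s c)"

definition invertible_on_sob :: "real \<Rightarrow> real \<Rightarrow> real \<Rightarrow> (coeffs \<Rightarrow> coeffs) \<Rightarrow> bool" where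
  "invertible_on_sob d \<alpha> s A \<longleftrightarrow>
     (\<exists>T. bounded_op_on d \<alpha> s T \<and>
          (\<forall>c. finite {n. c n \<noteq> 0} \<longrightarrow> T c = A c) \<and>
          (\<exists>B. bounded_op_on d \<alpha> s B \<and>
               (\<forall>c. sob_mem d \<alpha> s c \<longrightarrow> B (T c) = c \<and> T (B c) = c)))"

end

theory Submission
 imports Defs "HOL-Probability.Probability" "HOL-Real_Asymp.Real_Asymp"
begin

text \<open>
 In Fourier coefficients, \<open>A\<^sub>1\<^sub>0\<close> for the flat interface \<open>\<epsilon> = 0\<close> is diagonal with entries
 \<open>(1 + \<beta>\<^sub>n(\<kappa>\<^sub>1) / \<beta>\<^sub>n(k\<^sub>0)) / 2\<close>. Since \<open>\<beta>\<^sub>n(\<kappa>\<^sub>1)\<close> lies in the open first quadrant and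
 \<open>\<beta>\<^sub>n(k\<^sub>0)\<close> on its boundary, the real parts are at least \<open>1/2\<close>. For small \<open>\<epsilon>\<close> the operator differs
 from this one by a matrix with entries bounded by \<open>C \<epsilon> (1 + \<bar>n - j\<bar>)\<^sup>-\<^sup>3\<close>; such matrices are bounded on
 \<open>H\<^sup>-\<^sup>1\<^sup>/\<^sup>2\<close> and closed under products, so a Neumann series inverts the sum.

 The decay of the perturbation comes from the smoothness in \<open>x\<close>, uniform in \<open>s = x - y\<close>, of the kernels after
 the flat kernel is subtracted. The singular part of the Green function is a function of
 \<open>k \<bar>s\<bar> sqrt (1 + \<epsilon>\<^sup>2 Q\<^sup>2)\<close> with the difference quotient \<open>Q = (F(x) - F(x - s)) / s\<close>; its logarithm
 contributes only \<open>ln (1 + \<epsilon>\<^sup>2 Q\<^sup>2)\<close>. The rest of the lattice sum is a geometric series under a plane wave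
 integral for the Hankel function, and so is smooth.
\<close>

section \<open>Matrices with polynomial off-diagonal decay\<close>

text \<open>The difficulty is one of orders. \<open>Y2m\<close> contains three factors of the size
  of the weight \<open>jw\<close>, while the single layer gains only one order, so boundedness on
  H^(-1/2) rests on cancellation: commutators contain only differences of the symbol, and the two
  terms of \<open>Y2m\<close> combine, after their convolution sum is symmetrised, into a second
  difference that pays for the outer \<open>betaD\<close>. Each term of the expansion thus becomes a
  decaying matrix times \<open>jw\<close>, and \<open>jw\<close> is absorbed by the single layer:
  smoothness in x gives decay in n - j, and one integration by parts in s gives the factor 1 /
  alpha_j. Since the Green function is defined by Bessel series, the plane wave integral must first
  be identified with it; both solve the same singular first-order system, and the logarithm and the
  constants ln 2, the Euler constant and pi / 2 are matched at the origin. As \<open>A10\<close> is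
  meaningful only on finitely supported sequences, the bounded operator is built from its matrix and
  compared with \<open>A10\<close> there.\<close>

definition br :: "int => real" where
 "br n = 1 + \<bar>real_of_int n\<bar>"

lemma br_ge1 [simp]: "1 \<le> br n" and br_pos [simp]: "0 < br n" and br_nonneg [simp]: "0 \<le> br n"
 and br_nz [simp]: "br n \<noteq> 0"
 by (auto simp: br_def)

lemma br_minus [simp]: "br (- n) = br n"
 by (simp add: br_def)

lemma br_0 [simp]: "br 0 = 1"
 by (simp add: br_def)

lemma br_diff_commute: "br (n - k) = br (k - n)"
 by (simp add: br_def)

lemma br_triangle: "br (a + b) \<le> br a + br b"
 by (simp add: br_def)

lemma br_mult: "br (a + b) \<le> br a * br b"
proof -
 have "br (a + b) \<le> 1 + \<bar>real_of_int a\<bar> + \<bar>real_of_int b\<bar>" by (simp add: br_def)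
 also have "\<dots> \<le> br a * br b" by (simp add: br_def algebra_simps)
 finally show ?thesis .
qed

section \<open>Summability and convolution of the weights\<close>

lemma summable_on_nat_int:
 fixes f :: "int => real"
 assumes "\<And>n. f n \<ge> 0" "summable (\<lambda>k. f (int k))" "summable (\<lambda>k. f (- int k))"
 shows "f summable_on UNIV"
proof -
 have a: "(\<lambda>k. f (int k)) summable_on UNIV" "(\<lambda>k. f (- int k)) summable_on UNIV"
  using assms by (auto simp: summable_on_UNIV_nonneg_real_iff)
 have "f summable_on (range int)"
  using a(1) by (subst summable_on_reindex) (auto simp: o_def)
 moreover have "f summable_on (range (\<lambda>k. - int k))"
  using a(2) by (subst summable_on_reindex) (auto simp: o_def inj_on_def)
 ultimately have "f summable_on (range int \<union> range (\<lambda>k. - int k))"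
  by (rule summable_on_union)
 moreover have "range int \<union> range (\<lambda>k. - int k) = UNIV"
 proof (intro set_eqI iffI UNIV_I)
  fix n :: int
  have "n = int (nat n) \<or> n = - int (nat (-n))" by linarith
  then show "n \<in> range int \<union> range (\<lambda>k. - int k)" by blast
 qed
 ultimately show ?thesis by simp
qed

lemma summable_br:
 assumes "2 \<le> p"
 shows "(\<lambda>n. 1 / br n ^ p) summable_on UNIV"
proof (rule summable_on_nat_int)
 have "summable (\<lambda>k. 1 / real (Suc k) ^ p)"
  using assms inverse_power_summable[of p, where 'a=real] summable_Suc_iff[of "\<lambda>n. inverse (real n ^ p)"]
  by (simp add: inverse_eq_divide)
 then show "summable (\<lambda>k. 1 / br (int k) ^ p)" "summable (\<lambda>k. 1 / br (- int k) ^ p)"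
  by (auto simp: br_def add.commute)
qed auto

lemma summable_br_shift:
 assumes "2 \<le> p"
 shows "(\<lambda>k. 1 / br (n - k) ^ p) summable_on UNIV" "(\<lambda>k. 1 / br (k - n) ^ p) summable_on UNIV"
proof -
 have "bij (\<lambda>k::int. k - n)" by (rule bij_betwI[of _ _ _ "\<lambda>k. k + n"]) auto
 then show "(\<lambda>k. 1 / br (k - n) ^ p) summable_on UNIV"
  using summable_on_reindex_bij_betw[of "\<lambda>k. k - n" UNIV UNIV "\<lambda>k. 1 / br k ^ p"] summable_br[OF assms]
  by simp
 then show "(\<lambda>k. 1 / br (n - k) ^ p) summable_on UNIV"
  by (simp add: br_diff_commute)
qed

definition brsum :: "nat => real" where
 "brsum p = infsum (\<lambda>n. 1 / br n ^ p) UNIV"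

lemma infsum_br_shift:
 "infsum (\<lambda>k. 1 / br (n - k) ^ p) UNIV = brsum p" "infsum (\<lambda>k. 1 / br (k - n) ^ p) UNIV = brsum p"
proof -
 have "bij (\<lambda>k::int. k - n)" by (rule bij_betwI[of _ _ _ "\<lambda>k. k + n"]) auto
 then show "infsum (\<lambda>k. 1 / br (k - n) ^ p) UNIV = brsum p"
  using infsum_reindex_bij_betw[of "\<lambda>k. k - n" UNIV UNIV "\<lambda>k. 1 / br k ^ p"]
  by (simp add: brsum_def)
 then show "infsum (\<lambda>k. 1 / br (n - k) ^ p) UNIV = brsum p"
  by (simp add: br_diff_commute)
qed

lemma brsum_ge1: assumes "2 \<le> p" shows "1 \<le> brsum p"
proof -
 have "sum (\<lambda>n. 1 / br n ^ p) {0} \<le> brsum p"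
  unfolding brsum_def by (rule finite_sum_le_infsum) (use summable_br[OF assms] in auto)
 then show ?thesis by simp
qed

lemma power_add_le:
 fixes x y :: real assumes "0 \<le> x" "0 \<le> y"
 shows "(x + y) ^ p \<le> 2 ^ p * (x ^ p + y ^ p)"
proof -
 have "(x + y) ^ p \<le> (2 * max x y) ^ p" using assms by (intro power_mono) auto
 also have "\<dots> = 2 ^ p * max x y ^ p" by (simp add: power_mult_distrib)
 also have "max x y ^ p \<le> x ^ p + y ^ p" using assms by (auto simp: max_def)
 finally show ?thesis by simp
qed

text \<open>One of the two distances is at least half of \<open>br (n - j)\<close> by the triangle
  inequality, so one factor can be traded for the decay while the other stays summable in k.\<close>

lemma br_conv_pointwise:
 "1 / br (n - k) ^ p * (1 / br (k - j) ^ p)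
  \<le> 2 ^ p / br (n - j) ^ p * (1 / br (n - k) ^ p + 1 / br (k - j) ^ p)"
proof -
 let ?x = "br (n - k)" and ?y = "br (k - j)"
 have "br (n - j) \<le> ?x + ?y" using br_triangle[of "n - k" "k - j"] by simp
 then have "br (n - j) ^ p \<le> (?x + ?y) ^ p" by (intro power_mono) auto
 also have "\<dots> \<le> 2 ^ p * (?x ^ p + ?y ^ p)" by (rule power_add_le) auto
 finally have *: "br (n - j) ^ p \<le> 2 ^ p * (?x ^ p + ?y ^ p)" .
 have "1 / ?x ^ p * (1 / ?y ^ p) = br (n - j) ^ p / (br (n - j) ^ p * ?x ^ p * ?y ^ p)" by simp
 also have "\<dots> \<le> 2 ^ p * (?x ^ p + ?y ^ p) / (br (n - j) ^ p * ?x ^ p * ?y ^ p)"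
  using * by (intro divide_right_mono) auto
 also have "\<dots> = 2 ^ p / br (n - j) ^ p * (1 / br (n - k) ^ p + 1 / br (k - j) ^ p)"
  by (simp add: field_simps)
 finally show ?thesis .
qed

lemma br_conv:
 assumes "2 \<le> p"
 shows "(\<lambda>k. 1 / br (n - k) ^ p * (1 / br (k - j) ^ p)) summable_on UNIV"
  and "infsum (\<lambda>k. 1 / br (n - k) ^ p * (1 / br (k - j) ^ p)) UNIV
     \<le> 2 ^ (p + 1) * brsum p / br (n - j) ^ p"
proof -
 have s: "(\<lambda>k. 2 ^ p / br (n - j) ^ p * (1 / br (n - k) ^ p + 1 / br (k - j) ^ p)) summable_on UNIV"
  by (intro summable_on_cmult_right summable_on_add summable_br_shift assms)
 show s': "(\<lambda>k. 1 / br (n - k) ^ p * (1 / br (k - j) ^ p)) summable_on UNIV"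
  by (rule summable_on_comparison_test[OF s]) (use br_conv_pointwise in auto)
 have "infsum (\<lambda>k. 1 / br (n - k) ^ p * (1 / br (k - j) ^ p)) UNIV
   \<le> infsum (\<lambda>k. 2 ^ p / br (n - j) ^ p * (1 / br (n - k) ^ p + 1 / br (k - j) ^ p)) UNIV"
  by (rule infsum_mono[OF s' s]) (use br_conv_pointwise in auto)
 also have "\<dots> = 2 ^ p / br (n - j) ^ p * (brsum p + brsum p)"
  by (simp only: infsum_cmult_right' infsum_add summable_br_shift[OF assms] infsum_br_shift)
 also have "\<dots> = 2 ^ (p + 1) * brsum p / br (n - j) ^ p" by simp
 finally show "infsum (\<lambda>k. 1 / br (n - k) ^ p * (1 / br (k - j) ^ p)) UNIV
     \<le> 2 ^ (p + 1) * brsum p / br (n - j) ^ p" .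
qed

text \<open>The exponent 3 is chosen with the Sobolev weight in mind: comparing \<open>jw\<close> in
  row and column costs one power of \<open>br\<close>, and the remaining exponent 2 is still
  summable. Convolution reproduces the exponent, so the class is closed under products up to the
  factor \<open>convK\<close>.\<close>

definition mdec :: "real => (int => int => complex) => bool" where
 "mdec C a \<longleftrightarrow> (\<forall>n j. cmod (a n j) \<le> C / br (n - j) ^ 3)"

lemma mdecD: "mdec C a ==> cmod (a n j) \<le> C / br (n - j) ^ 3"
 by (simp add: mdec_def)

lemma mdec_nonneg: assumes "mdec C a" shows "0 \<le> C"
 using order_trans[OF norm_ge_zero mdecD[OF assms, of 0 0]] by simp

definition mmul :: "(int => int => complex) => (int => int => complex) => int => int => complex" where
 "mmul a b n j = infsum (\<lambda>k. a n k * b k j) UNIV"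

definition mapp :: "(int => int => complex) => coeffs => coeffs" where
 "mapp a c n = infsum (\<lambda>k. a n k * c k) UNIV"

text \<open>The growth condition under which \<open>mapp\<close> converges absolutely. It covers
  H^(-1/2) sequences (\<open>sob_adm\<close>) and columns of decaying matrices
  (\<open>mdec_col_adm\<close>) alike, so vectors and products are treated by the same
  lemmas.\<close>

definition adm :: "coeffs => bool" where
 "adm c \<longleftrightarrow> (\<lambda>k. cmod (c k) / br k ^ 3) summable_on UNIV"

lemma adm_shift:
 assumes "adm c" shows "(\<lambda>k. 1 / br (n - k) ^ 3 * cmod (c k)) summable_on UNIV"
proof -
 have s: "(\<lambda>k. br n ^ 3 * (cmod (c k) / br k ^ 3)) summable_on UNIV"
  using assms unfolding adm_def by (intro summable_on_cmult_right)
 show ?thesis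
 proof (rule summable_on_comparison_test[OF s])
  fix k :: int
  have "br k \<le> br n * br (n - k)" using br_mult[of n "k - n"] by (simp add: br_diff_commute)
  then have "br k ^ 3 \<le> (br n * br (n - k)) ^ 3" by (intro power_mono) auto
  then have "1 / br (n - k) ^ 3 \<le> br n ^ 3 / br k ^ 3"
   by (simp add: field_simps)
  then have "1 / br (n - k) ^ 3 * cmod (c k) \<le> br n ^ 3 / br k ^ 3 * cmod (c k)"
   by (rule mult_right_mono) auto
  then show "1 / br (n - k) ^ 3 * cmod (c k) \<le> br n ^ 3 * (cmod (c k) / br k ^ 3)" by simp
 qed auto
qed

lemma mapp_abs_summable:
 assumes "mdec C a" "adm c"
 shows "(\<lambda>k. norm (a n k * c k)) summable_on UNIV"
proof (rule summable_on_comparison_test)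
 show "(\<lambda>k. C * (1 / br (n - k) ^ 3 * cmod (c k))) summable_on UNIV"
  by (intro summable_on_cmult_right adm_shift assms)
 show "norm (a n k * c k) \<le> C * (1 / br (n - k) ^ 3 * cmod (c k))" for k
  using mult_right_mono[OF mdecD[OF assms(1), of n k], of "cmod (c k)"] by (simp add: norm_mult)
qed auto

lemma mapp_summable:
 assumes "mdec C a" "adm c" shows "(\<lambda>k. a n k * c k) summable_on UNIV"
 using mapp_abs_summable[OF assms] by (rule abs_summable_summable)

lemma mdec_col_adm: assumes "mdec C a" shows "adm (\<lambda>k. a k j)"
 unfolding adm_def
proof (rule summable_on_comparison_test)
 show "(\<lambda>k. C * (1 / br (0 - k) ^ 3 * (1 / br (k - j) ^ 3))) summable_on UNIV"
  by (intro summable_on_cmult_right br_conv) auto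
 show "cmod (a k j) / br k ^ 3 \<le> C * (1 / br (0 - k) ^ 3 * (1 / br (k - j) ^ 3))" for k
  using divide_right_mono[OF mdecD[OF assms, of k j], of "br k ^ 3"] by (simp add: mult.commute)
qed auto

definition convK :: real where "convK = 16 * brsum 3"

lemma convK_ge1: "1 \<le> convK"
 using brsum_ge1[of 3] by (simp add: convK_def)

lemma mdec_mmul_norm:
 assumes "mdec A a" "mdec B b"
 shows "(\<lambda>k. cmod (a n k) * cmod (b k j)) summable_on UNIV"
  and "infsum (\<lambda>k. cmod (a n k) * cmod (b k j)) UNIV \<le> convK * A * B / br (n - j) ^ 3"
proof -
 note nn = mdec_nonneg[OF assms(1)] mdec_nonneg[OF assms(2)]
 have s: "(\<lambda>k. A * B * (1 / br (n - k) ^ 3 * (1 / br (k - j) ^ 3))) summable_on UNIV"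
  by (intro summable_on_cmult_right br_conv) auto
 have le: "cmod (a n k) * cmod (b k j) \<le> A * B * (1 / br (n - k) ^ 3 * (1 / br (k - j) ^ 3))" for k
  using mult_mono[OF mdecD[OF assms(1), of n k] mdecD[OF assms(2), of k j]] nn by simp
 show s': "(\<lambda>k. cmod (a n k) * cmod (b k j)) summable_on UNIV"
  by (rule summable_on_comparison_test[OF s]) (use le in auto)
 have "infsum (\<lambda>k. cmod (a n k) * cmod (b k j)) UNIV
    \<le> infsum (\<lambda>k. A * B * (1 / br (n - k) ^ 3 * (1 / br (k - j) ^ 3))) UNIV"
  by (rule infsum_mono[OF s' s]) (use le in auto)
 also have "\<dots> = A * B * infsum (\<lambda>k. 1 / br (n - k) ^ 3 * (1 / br (k - j) ^ 3)) UNIV"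
  by (rule infsum_cmult_right')
 also have "\<dots> \<le> A * B * (convK / br (n - j) ^ 3)"
  using br_conv(2)[of 3 n j] nn by (intro mult_left_mono) (auto simp: convK_def)
 finally show "infsum (\<lambda>k. cmod (a n k) * cmod (b k j)) UNIV \<le> convK * A * B / br (n - j) ^ 3"
  by (simp add: mult_ac)
qed

lemma mdec_mmul:
 assumes "mdec A a" "mdec B b" shows "mdec (convK * A * B) (mmul a b)"
 unfolding mdec_def mmul_def
proof (intro allI)
 fix n j
 have "cmod (infsum (\<lambda>k. a n k * b k j) UNIV) \<le> infsum (\<lambda>k. norm (a n k * b k j)) UNIV"
  using mdec_mmul_norm(1)[OF assms, of n j] by (intro norm_infsum_bound) (simp add: norm_mult)
 also have "\<dots> \<le> convK * A * B / br (n - j) ^ 3"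
  using mdec_mmul_norm(2)[OF assms, of n j] by (simp add: norm_mult)
 finally show "cmod (infsum (\<lambda>k. a n k * b k j) UNIV) \<le> convK * A * B / br (n - j) ^ 3" .
qed

text \<open>Absolute convergence of a double series from its iterated norm sums; it supplies the
  hypothesis of \<open>infsum_swap_banach\<close> in \<open>mapp_mapp\<close> and in the Neumann
  series.\<close>

lemma double_summableI:
 fixes f :: "'a => 'b => complex"
 assumes "\<And>k. (\<lambda>l. norm (f k l)) summable_on UNIV"
  and "\<And>k. infsum (\<lambda>l. norm (f k l)) UNIV \<le> g k" "g summable_on UNIV"
 shows "(\<lambda>(k, l). f k l) summable_on (UNIV \<times> UNIV)"
proof (rule abs_summable_summable, subst Infinite_Sum.abs_summable_on_Sigma_iff, intro conjI ballI)
 show "(\<lambda>k. norm (infsum (\<lambda>l. norm (case (k, l) of (k, l) => f k l)) UNIV)) summable_on UNIV"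
 proof (rule summable_on_comparison_test[OF assms(3)])
  fix k
  have "0 \<le> infsum (\<lambda>l. norm (f k l)) UNIV" by (rule infsum_nonneg) simp
  then show "norm (infsum (\<lambda>l. norm (case (k, l) of (k, l) => f k l)) UNIV) \<le> g k"
   using assms(2)[of k] by simp
 qed simp
next
 fix k
 show "(\<lambda>l. norm (case (k, l) of (k, l) => f k l)) summable_on UNIV" using assms(1)[of k] by simp
qed

lemma mapp_mapp:
 assumes "mdec A a" "mdec B b" "adm c"
 shows "mapp a (mapp b c) = mapp (mmul a b) c"
proof
 fix n
 have "(\<lambda>(l, k). a n k * b k l * c l) summable_on (UNIV \<times> UNIV)"
 proof (rule double_summableI)
  show "(\<lambda>k. norm (a n k * b k l * c l)) summable_on UNIV" for l
   using summable_on_cmult_left[OF mdec_mmul_norm(1)[OF assms(1,2), of n l], of "cmod (c l)"]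
   by (simp add: norm_mult)
 next
  fix l :: int
  show "infsum (\<lambda>k. norm (a n k * b k l * c l)) UNIV \<le> convK * A * B * (1 / br (n - l) ^ 3 * cmod (c l))"
   using mult_right_mono[OF mdec_mmul_norm(2)[OF assms(1,2), of n l], of "cmod (c l)"]
   by (simp add: norm_mult infsum_cmult_left')
 qed (intro summable_on_cmult_right adm_shift assms)
 from infsum_swap_banach[OF this]
 have "infsum (\<lambda>l. infsum (\<lambda>k. a n k * b k l * c l) UNIV) UNIV
   = infsum (\<lambda>k. infsum (\<lambda>l. a n k * b k l * c l) UNIV) UNIV" .
 moreover have "mapp a (mapp b c) n = infsum (\<lambda>k. infsum (\<lambda>l. a n k * b k l * c l) UNIV) UNIV"
  unfolding mapp_def mult.assoc infsum_cmult_right' ..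
 moreover have "mapp (mmul a b) c n = infsum (\<lambda>l. infsum (\<lambda>k. a n k * b k l * c l) UNIV) UNIV"
  unfolding mapp_def mmul_def infsum_cmult_left' ..
 ultimately show "mapp a (mapp b c) n = mapp (mmul a b) c n" by simp
qed

text \<open>Each column of \<open>c\<close> is \<open>adm\<close>, so \<open>mapp_mapp\<close>
  applied column by column is already associativity.\<close>

lemma mmul_assoc:
 assumes "mdec A a" "mdec B b" "mdec C c"
 shows "mmul a (mmul b c) = mmul (mmul a b) c"
proof (intro ext)
 fix n j
 have "mapp a (mapp b (\<lambda>k. c k j)) n = mapp (mmul a b) (\<lambda>k. c k j) n"
  using mapp_mapp[OF assms(1,2) mdec_col_adm[OF assms(3)]] by simp
 then show "mmul a (mmul b c) n j = mmul (mmul a b) c n j"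
  by (simp add: mapp_def mmul_def)
qed

definition mid :: "int => int => complex" where
 "mid n j = (if n = j then 1 else 0)"

lemma mdec_mid: "mdec 1 mid"
 by (auto simp: mdec_def mid_def)

lemma mapp_mid [simp]: "mapp mid c = c"
proof
 fix n
 have "infsum (\<lambda>k. mid n k * c k) UNIV = infsum (\<lambda>k. mid n k * c k) {n}"
  by (rule infsum_cong_neutral) (auto simp: mid_def)
 then show "mapp mid c n = c n" by (simp add: mapp_def mid_def)
qed

lemma mmul_mid_left [simp]: "mmul mid a = a"
proof (intro ext)
 fix n j
 show "mmul mid a n j = a n j" using fun_cong[OF mapp_mid[of "\<lambda>k. a k j"], of n] by (simp only: mapp_def mmul_def)
qed

lemma mmul_mid_right [simp]: "mmul a mid = a"
proof (intro ext)
 fix n j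
 have "infsum (\<lambda>k. a n k * mid k j) UNIV = infsum (\<lambda>k. a n k * mid k j) {j}"
  by (rule infsum_cong_neutral) (auto simp: mid_def)
 then show "mmul a mid n j = a n j" by (simp add: mmul_def mid_def)
qed

subsection \<open>Neumann series\<close>

fun mpow :: "(int => int => complex) => nat => int => int => complex" where
 "mpow E 0 = mid"
| "mpow E (Suc k) = mmul E (mpow E k)"

lemma mdec_mpow:
 assumes "mdec \<theta> E" "convK * \<theta> \<le> 1 / 2" shows "mdec ((1 / 2) ^ k) (mpow E k)"
proof (induction k)
 case 0 show ?case by (simp add: mdec_mid)
next
 case (Suc k)
 have "convK * \<theta> * (1/2)^k \<le> (1/2) * (1/2)^k" using assms(2) by (intro mult_right_mono) auto
 then have "cmod (mmul E (mpow E k) n j) \<le> (1/2)^Suc k / br (n - j) ^ 3" for n j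
  using mdecD[OF mdec_mmul[OF assms(1) Suc], of n j]
   divide_right_mono[of "convK * \<theta> * (1/2)^k" "(1/2)^Suc k" "br (n - j) ^ 3"] by auto
 then show ?case by (simp add: mdec_def)
qed

lemma mpow_commute:
 assumes "mdec \<theta> E" "convK * \<theta> \<le> 1 / 2" shows "mmul (mpow E k) E = mpow E (Suc k)"
proof (induction k)
 case (Suc k)
 have "mmul (mpow E (Suc k)) E = mmul E (mmul (mpow E k) E)"
  using mmul_assoc[OF assms(1) mdec_mpow[OF assms] assms(1)] by simp
 then show ?case using Suc by simp
qed simp

definition neumann :: "(int => int => complex) => int => int => complex" where
 "neumann E n j = infsum (\<lambda>k. (-1) ^ k * mpow E k n j) UNIV"

lemma half_powers: "(\<lambda>k::nat. (1/2::real) ^ k) summable_on UNIV" "infsum (\<lambda>k::nat. (1/2::real) ^ k) UNIV = 2"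
proof -
 have "((\<lambda>k::nat. (1/2::real) ^ k) has_sum 2) UNIV"
  using sums_nonneg_imp_has_sum[OF geometric_sums[of "1/2::real"]] by simp
 then show "(\<lambda>k::nat. (1/2::real) ^ k) summable_on UNIV" "infsum (\<lambda>k::nat. (1/2::real) ^ k) UNIV = 2"
  by (auto simp: has_sum_iff)
qed

context
 fixes E \<theta> assumes E: "mdec \<theta> E" and th: "convK * \<theta> \<le> 1 / 2"
begin

lemma neumann_abs: "(\<lambda>k. norm ((-1) ^ k * mpow E k n j)) summable_on UNIV"
 and neumann_dec: "mdec 2 (neumann E)"
proof -
 have s: "(\<lambda>k::nat. (1/2) ^ k * (1 / br (n - j) ^ 3)) summable_on UNIV" for n j
  by (intro summable_on_cmult_left half_powers)
 have le: "norm ((-1) ^ k * mpow E k n j) \<le> (1/2) ^ k * (1 / br (n - j) ^ 3)" for k n j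
  using mdecD[OF mdec_mpow[OF E th], of k n j] by (simp add: norm_mult norm_power)
 show a: "(\<lambda>k. norm ((-1) ^ k * mpow E k n j)) summable_on UNIV" for n j
  by (rule summable_on_comparison_test[OF s[of n j]]) (use le in auto)
 show "mdec 2 (neumann E)" unfolding mdec_def neumann_def
 proof (intro allI)
  fix n j
  have "cmod (infsum (\<lambda>k. (-1) ^ k * mpow E k n j) UNIV) \<le> infsum (\<lambda>k. norm ((-1) ^ k * mpow E k n j)) UNIV"
   by (rule norm_infsum_bound[OF a])
  also have "\<dots> \<le> infsum (\<lambda>k::nat. (1/2) ^ k * (1 / br (n - j) ^ 3)) UNIV"
   by (rule infsum_mono[OF a s[of n j]]) (use le in auto)
  also have "\<dots> = 2 / br (n - j) ^ 3" by (simp only: infsum_cmult_left' half_powers)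
  finally show "cmod (infsum (\<lambda>k. (-1) ^ k * mpow E k n j) UNIV) \<le> 2 / br (n - j) ^ 3" .
 qed
qed

lemma neumann_eq: "infsum (\<lambda>k. (-1) ^ k * mpow E (Suc k) n j) UNIV = mid n j - neumann E n j"
proof -
 let ?f = "\<lambda>k. (-1) ^ k * mpow E k n j"
 have s: "?f summable_on UNIV" by (rule abs_summable_summable[OF neumann_abs])
 have sh: "(\<lambda>k. norm (?f (Suc k))) summable_on UNIV"
 proof -
  have "(\<lambda>k. norm (?f k)) summable_on range Suc"
   by (rule summable_on_subset_banach[OF neumann_abs]) simp
  then show ?thesis by (subst (asm) summable_on_reindex) (auto simp: o_def)
 qed
 have "?f sums neumann E n j" using s unfolding neumann_def by (intro has_sum_imp_sums) simp
 then have "(\<lambda>k. ?f (Suc k)) sums (neumann E n j - mid n j)" by (subst sums_Suc_iff) simp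
 moreover have "(\<lambda>k. ?f (Suc k)) sums infsum (\<lambda>k. ?f (Suc k)) UNIV"
  using abs_summable_summable[OF sh] by (intro has_sum_imp_sums) simp
 ultimately have "infsum (\<lambda>k. ?f (Suc k)) UNIV = neumann E n j - mid n j" by (simp add: sums_iff)
 moreover have "infsum (\<lambda>k. ?f (Suc k)) UNIV = - infsum (\<lambda>k. (-1) ^ k * mpow E (Suc k) n j) UNIV"
  by (simp flip: infsum_uminus)
 ultimately show ?thesis by (simp add: algebra_simps)
qed

lemma sum_norm_mpow:
 "infsum (\<lambda>l. cmod (mpow E k n l) * cmod (E l j)) UNIV \<le> (1/2) ^ k * (convK * \<theta> / br (n - j) ^ 3)"
 "infsum (\<lambda>l. cmod (E n l) * cmod (mpow E k l j)) UNIV \<le> (1/2) ^ k * (convK * \<theta> / br (n - j) ^ 3)"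
 using mdec_mmul_norm(2)[OF mdec_mpow[OF E th, of k] E, of n j] mdec_mmul_norm(2)[OF E mdec_mpow[OF E th, of k], of n j]
 by (simp_all add: mult_ac)

lemma neumann_swap_left:
 "(\<lambda>(k, l). E n l * ((-1) ^ k * mpow E k l j)) summable_on (UNIV \<times> UNIV)"
 and neumann_swap_right:
 "(\<lambda>(k, l). ((-1) ^ k * mpow E k n l) * E l j) summable_on (UNIV \<times> UNIV)"
proof -
 have s: "(\<lambda>k::nat. (1/2) ^ k * (convK * \<theta> / br (n - j) ^ 3)) summable_on UNIV"
  by (intro summable_on_cmult_left half_powers)
 show "(\<lambda>(k, l). E n l * ((-1) ^ k * mpow E k l j)) summable_on (UNIV \<times> UNIV)"
 proof (rule double_summableI[OF _ _ s])
  fix k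
  show "(\<lambda>l. norm (E n l * ((-1) ^ k * mpow E k l j))) summable_on UNIV"
   using mdec_mmul_norm(1)[OF E mdec_mpow[OF E th, of k], of n j] by (simp add: norm_mult norm_power)
  show "infsum (\<lambda>l. norm (E n l * ((-1) ^ k * mpow E k l j))) UNIV \<le> (1/2) ^ k * (convK * \<theta> / br (n - j) ^ 3)"
   using sum_norm_mpow(2)[of n k j] by (simp add: norm_mult norm_power)
 qed
 show "(\<lambda>(k, l). ((-1) ^ k * mpow E k n l) * E l j) summable_on (UNIV \<times> UNIV)"
 proof (rule double_summableI[OF _ _ s])
  fix k
  show "(\<lambda>l. norm ((-1) ^ k * mpow E k n l * E l j)) summable_on UNIV"
   using mdec_mmul_norm(1)[OF mdec_mpow[OF E th, of k] E, of n j] by (simp add: norm_mult norm_power)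
  show "infsum (\<lambda>l. norm ((-1) ^ k * mpow E k n l * E l j)) UNIV \<le> (1/2) ^ k * (convK * \<theta> / br (n - j) ^ 3)"
   using sum_norm_mpow(1)[of k n j] by (simp add: norm_mult norm_power)
 qed
qed

lemma neumann_left: "mmul E (neumann E) n j = mid n j - neumann E n j"
proof -
 have "mmul E (neumann E) n j = infsum (\<lambda>l. infsum (\<lambda>k. E n l * ((-1) ^ k * mpow E k l j)) UNIV) UNIV"
  by (simp add: mmul_def neumann_def infsum_cmult_right')
 also have "\<dots> = infsum (\<lambda>k. infsum (\<lambda>l. E n l * ((-1) ^ k * mpow E k l j)) UNIV) UNIV"
  using infsum_swap_banach[OF neumann_swap_left[of n j]] by simp
 also have "\<dots> = infsum (\<lambda>k. (-1) ^ k * mpow E (Suc k) n j) UNIV"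
  by (simp add: mmul_def mult.left_commute[of "E _ _"] infsum_cmult_right')
 finally show ?thesis unfolding neumann_eq .
qed

lemma neumann_right: "mmul (neumann E) E n j = mid n j - neumann E n j"
proof -
 have "mmul (neumann E) E n j = infsum (\<lambda>l. infsum (\<lambda>k. ((-1) ^ k * mpow E k n l) * E l j) UNIV) UNIV"
  by (simp add: mmul_def neumann_def infsum_cmult_left')
 also have "\<dots> = infsum (\<lambda>k. infsum (\<lambda>l. ((-1) ^ k * mpow E k n l) * E l j) UNIV) UNIV"
  using infsum_swap_banach[OF neumann_swap_right[of n j]] by simp
 also have "\<dots> = infsum (\<lambda>k. (-1) ^ k * mmul (mpow E k) E n j) UNIV"
  by (simp add: mmul_def mult.assoc infsum_cmult_right')
 also have "\<dots> = infsum (\<lambda>k. (-1) ^ k * mpow E (Suc k) n j) UNIV"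
  by (simp only: mpow_commute[OF E th])
 finally show ?thesis unfolding neumann_eq .
qed

lemma mapp_neumann:
 assumes "adm c"
 shows "(\<lambda>n. mapp E (mapp (neumann E) c) n) = (\<lambda>n. c n - mapp (neumann E) c n)"
  and "(\<lambda>n. mapp (neumann E) (mapp E c) n) = (\<lambda>n. c n - mapp (neumann E) c n)"
proof -
 have sub: "infsum (\<lambda>k. (mid n k - neumann E n k) * c k) UNIV = c n - mapp (neumann E) c n" for n
 proof -
  have "infsum (\<lambda>k. mid n k * c k + - (neumann E n k * c k)) UNIV
    = infsum (\<lambda>k. mid n k * c k) UNIV + infsum (\<lambda>k. - (neumann E n k * c k)) UNIV"
   by (intro infsum_add mapp_summable[OF mdec_mid assms]
    mapp_summable[OF neumann_dec assms, THEN summable_on_uminus[THEN iffD2]])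
  then show ?thesis
   using fun_cong[OF mapp_mid[of c], of n] unfolding mapp_def
   by (simp only: left_diff_distrib infsum_uminus) (simp add: infsum_uminus)
 qed
 show "(\<lambda>n. mapp E (mapp (neumann E) c) n) = (\<lambda>n. c n - mapp (neumann E) c n)"
  unfolding mapp_mapp[OF E neumann_dec assms] using sub by (simp add: mapp_def neumann_left)
 show "(\<lambda>n. mapp (neumann E) (mapp E c) n) = (\<lambda>n. c n - mapp (neumann E) c n)"
  unfolding mapp_mapp[OF neumann_dec E assms] using sub by (simp add: mapp_def neumann_right)
qed

end

subsection \<open>Bounded operators on the Sobolev sequence spaces\<close>

text \<open>The H^(-1/2) norm weights squares by 1 / \<open>jw\<close> (\<open>powr_jw\<close>). The
  same weight of order one is inserted later between the single layer and the expansion operators to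
  make both factors bounded.\<close>

definition jw :: "real => real => int => real" where
 "jw d \<alpha> n = sqrt (1 + (alpha_n d \<alpha> n)^2)"

lemma jw_ge1: "1 \<le> jw d \<alpha> n" and jw_pos: "0 < jw d \<alpha> n"
proof -
 show "1 \<le> jw d \<alpha> n" by (simp add: jw_def)
 then show "0 < jw d \<alpha> n" by linarith
qed

lemma powr_jw: "(1 + (alpha_n d \<alpha> n)^2) powr (-1/2) = 1 / jw d \<alpha> n"
 using powr_minus_divide[of "1 + (alpha_n d \<alpha> n)^2" "1/2"] powr_half_sqrt[of "1 + (alpha_n d \<alpha> n)^2"]
 by (simp add: jw_def)

definition jwK :: "real => real" where
 "jwK d = sqrt (2 * (1 + (2 * pi / d)^2))"

lemma jwK_ge1: "1 \<le> jwK d"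
 by (auto simp: jwK_def intro!: add_increasing2)

lemma square_add_le: "(x + y)\<^sup>2 \<le> 2 * x\<^sup>2 + 2 * (y::real)\<^sup>2"
 using zero_le_power2[of "x - y"] by (simp add: power2_eq_square algebra_simps)

text \<open>Peetre's inequality. Since alpha_n is affine in n with slope q = 2 pi / d, the bound (a
  + q m)^2 <= 2 a^2 + 2 q^2 m^2 yields the constant \<open>jwK\<close>.\<close>

lemma jw_le: "jw d \<alpha> j \<le> jwK d * jw d \<alpha> n * br (n - j)"
proof -
 let ?q = "2 * pi / d" and ?a = "alpha_n d \<alpha> n" and ?m = "real_of_int (j - n)"
 have "alpha_n d \<alpha> j = ?a + ?q * ?m" by (simp add: alpha_n_def field_split_simps) (simp add: algebra_simps)?
 moreover have "(?a + ?q * ?m)\<^sup>2 \<le> 2 * ?a\<^sup>2 + 2 * ?q\<^sup>2 * ?m\<^sup>2"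
  using square_add_le[of ?a "?q * ?m"] unfolding power_mult_distrib by linarith
 ultimately have "1 + (alpha_n d \<alpha> j)\<^sup>2 \<le> 1 + 2 * ?a\<^sup>2 + 2 * ?q\<^sup>2 * ?m\<^sup>2" by simp
 also have "\<dots> \<le> 2 * (1 + ?q\<^sup>2) * (1 + ?a\<^sup>2) * (1 + ?m\<^sup>2)"
 proof -
  have "2 * (1 + ?q\<^sup>2) * (1 + ?a\<^sup>2) * (1 + ?m\<^sup>2) = (1 + 2 * ?a\<^sup>2 + 2 * ?q\<^sup>2 * ?m\<^sup>2)
   + (1 + 2 * ?m\<^sup>2 + 2 * ?a\<^sup>2 * ?m\<^sup>2 + 2 * ?q\<^sup>2 * (1 + ?a\<^sup>2 + ?a\<^sup>2 * ?m\<^sup>2))"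
   by (simp add: algebra_simps)
  moreover have "0 \<le> 1 + 2 * ?m\<^sup>2 + 2 * ?a\<^sup>2 * ?m\<^sup>2 + 2 * ?q\<^sup>2 * (1 + ?a\<^sup>2 + ?a\<^sup>2 * ?m\<^sup>2)"
   by (intro add_nonneg_nonneg mult_nonneg_nonneg) auto
  ultimately show ?thesis by linarith
 qed
 also have "\<dots> \<le> 2 * (1 + ?q\<^sup>2) * (1 + ?a\<^sup>2) * (br (n - j))\<^sup>2"
 proof (intro mult_left_mono)
  show "1 + ?m\<^sup>2 \<le> (br (n - j))\<^sup>2"
   using abs_ge_zero[of ?m] power2_abs[of ?m] by (simp add: br_def power2_eq_square algebra_simps abs_minus_commute)
 qed auto
 finally have "sqrt (1 + (alpha_n d \<alpha> j)\<^sup>2) \<le> sqrt (2 * (1 + ?q\<^sup>2) * (1 + ?a\<^sup>2) * (br (n - j))\<^sup>2)"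
  by (rule real_sqrt_le_mono)
 then show ?thesis by (simp add: jw_def jwK_def real_sqrt_mult)
qed

lemma sob_mem_half: "sob_mem d \<alpha> (-1/2) c \<longleftrightarrow> (\<lambda>n. (cmod (c n))^2 / jw d \<alpha> n) summable_on UNIV"
 and sob_norm_half: "sob_norm d \<alpha> (-1/2) c = sqrt (infsum (\<lambda>n. (cmod (c n))^2 / jw d \<alpha> n) UNIV)"
 unfolding sob_mem_def sob_norm_def powr_jw by simp_all

text \<open>The elementary bound t <= t^2 + 1 with t = |c k| br^2 splits each term into one
  controlled by the Sobolev norm, through \<open>jw_le\<close> at 0, and the summable 1 /
  br^5.\<close>

lemma sob_adm: assumes "sob_mem d \<alpha> (-1/2) c" shows "adm c"
 unfolding adm_def
proof (rule summable_on_comparison_test)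
 let ?C = "jwK d * jw d \<alpha> 0"
 show "(\<lambda>k. ?C * ((cmod (c k))^2 / jw d \<alpha> k) + 1 / br k ^ 5) summable_on UNIV"
  by (intro summable_on_add summable_on_cmult_right assms[unfolded sob_mem_half] summable_br) auto
 fix k
 let ?x = "cmod (c k)" and ?b = "br k"
 have "jw d \<alpha> k \<le> ?C * ?b" using jw_le[of d \<alpha> k 0] by simp
 then have "?x\<^sup>2 / ?b \<le> ?C * (?x\<^sup>2 / jw d \<alpha> k)"
  using mult_right_mono[of "jw d \<alpha> k" "?C * ?b" "?x\<^sup>2"] jw_pos[of d \<alpha> k] by (simp add: field_simps)
 moreover have "?x / ?b ^ 3 \<le> ?x\<^sup>2 / ?b + 1 / ?b ^ 5"
 proof -
  have "?x * ?b\<^sup>2 \<le> ?x\<^sup>2 * ?b ^ 4 + 1"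
  proof -
   have "t \<le> t\<^sup>2 + 1" for t :: real
    using zero_le_power2[of "t - 1"] zero_le_power2[of "t + 1"] by (simp add: power2_eq_square algebra_simps)
   from this[of "?x * ?b\<^sup>2"] show ?thesis by (simp add: power_mult_distrib flip: power_mult)
  qed
  then have "?x * ?b\<^sup>2 / ?b ^ 5 \<le> (?x\<^sup>2 * ?b ^ 4 + 1) / ?b ^ 5" by (intro divide_right_mono) auto
  moreover have "?x * ?b\<^sup>2 / ?b ^ 5 = ?x / ?b ^ 3" by (simp add: field_simps eval_nat_numeral)
  moreover have "(?x\<^sup>2 * ?b ^ 4 + 1) / ?b ^ 5 = ?x\<^sup>2 / ?b + 1 / ?b ^ 5"
   by (simp add: field_simps eval_nat_numeral)
  ultimately show ?thesis by simp
 qed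
 ultimately show "?x / ?b ^ 3 \<le> ?C * (?x\<^sup>2 / jw d \<alpha> k) + 1 / ?b ^ 5" by linarith
qed auto

text \<open>Row estimate of a Schur test. Cauchy-Schwarz spends one factor 1 / br^3 on the row sum;
  in the other, \<open>jw_le\<close> exchanges the weight of column j for that of row n, lowering
  the exponent from 3 to 2.\<close>

lemma schur_pointwise:
 assumes "mdec C a" "sob_mem d \<alpha> (-1/2) c"
 shows "(cmod (mapp a c n))^2 / jw d \<alpha> n
   \<le> C^2 * brsum 3 * jwK d * infsum (\<lambda>j. 1 / br (n - j) ^ 2 * ((cmod (c j))^2 / jw d \<alpha> j)) UNIV"
  and "(\<lambda>j. 1 / br (n - j) ^ 2 * ((cmod (c j))^2 / jw d \<alpha> j)) summable_on UNIV"
proof -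
 define V where "V j = (cmod (c j))^2 / jw d \<alpha> j" for j
 have V: "V summable_on UNIV" using assms(2) unfolding sob_mem_half V_def[abs_def] .
 have V0: "0 \<le> V j" for j using jw_pos[of d \<alpha> j] by (simp add: V_def)
 note C0 = mdec_nonneg[OF assms(1)] and adm = sob_adm[OF assms(2)]
 have s2: "(\<lambda>j. 1 / br (n - j) ^ 2 * V j) summable_on UNIV"
 proof (rule summable_on_comparison_test[OF V])
  show "1 / br (n - j) ^ 2 * V j \<le> V j" for j
   using V0[of j] mult_right_mono[of "1 / br (n - j) ^ 2" 1 "V j"] by simp
 qed (use V0 in auto)
 then show "(\<lambda>j. 1 / br (n - j) ^ 2 * ((cmod (c j))^2 / jw d \<alpha> j)) summable_on UNIV" by (simp add: V_def)
 let ?J = "jw d \<alpha> n" and ?S = "infsum (\<lambda>j. 1 / br (n - j) ^ 2 * V j) UNIV"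
 have S0: "0 \<le> ?S" by (rule infsum_nonneg) (use V0 in auto)
 have le3: "1 / br (n - j) ^ 3 * (cmod (c j))^2 \<le> jwK d * ?J * (1 / br (n - j) ^ 2 * V j)" for j
 proof -
  have "(cmod (c j))^2 = jw d \<alpha> j * V j" using jw_pos[of d \<alpha> j] by (simp add: V_def)
  also have "\<dots> \<le> jwK d * ?J * br (n - j) * V j" by (intro mult_right_mono jw_le V0)
  finally have "1 / br (n - j) ^ 3 * (cmod (c j))^2 \<le> 1 / br (n - j) ^ 3 * (jwK d * ?J * br (n - j) * V j)"
   by (intro mult_left_mono) auto
  then show ?thesis by (simp add: field_simps eval_nat_numeral)
 qed
 \<comment> \<open>Cauchy-Schwarz is used on finite index sets, with the kernel split into two equal
   square roots; the infinite sum inherits the bound as a supremum of these.\<close>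
 have fin: "(\<Sum>j\<in>F. 1 / br (n - j) ^ 3 * cmod (c j)) \<le> sqrt (brsum 3 * (jwK d * ?J * ?S))" if F: "finite F" for F
 proof -
  have "(\<Sum>j\<in>F. 1 / br (n - j) ^ 3 * cmod (c j))\<^sup>2
   = (\<Sum>j\<in>F. sqrt (1 / br (n - j) ^ 3) * (sqrt (1 / br (n - j) ^ 3) * cmod (c j)))\<^sup>2"
   by (simp flip: mult.assoc)
  also have "\<dots> \<le> (\<Sum>j\<in>F. (sqrt (1 / br (n - j) ^ 3))\<^sup>2) * (\<Sum>j\<in>F. (sqrt (1 / br (n - j) ^ 3) * cmod (c j))\<^sup>2)"
   by (rule Cauchy_Schwarz_ineq_sum)
  also have "\<dots> = (\<Sum>j\<in>F. 1 / br (n - j) ^ 3) * (\<Sum>j\<in>F. 1 / br (n - j) ^ 3 * (cmod (c j))\<^sup>2)"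
   by (simp add: power_mult_distrib)
  also have "\<dots> \<le> brsum 3 * (jwK d * ?J * ?S)"
  proof (rule mult_mono)
   show "(\<Sum>j\<in>F. 1 / br (n - j) ^ 3) \<le> brsum 3"
    unfolding infsum_br_shift(1)[of n 3, symmetric] using F
    by (intro finite_sum_le_infsum summable_br_shift) auto
   have "(\<Sum>j\<in>F. 1 / br (n - j) ^ 3 * (cmod (c j))\<^sup>2) \<le> (\<Sum>j\<in>F. jwK d * ?J * (1 / br (n - j) ^ 2 * V j))"
    by (intro sum_mono le3)
   also have "\<dots> = jwK d * ?J * (\<Sum>j\<in>F. 1 / br (n - j) ^ 2 * V j)" by (simp only: sum_distrib_left)
   also have "\<dots> \<le> jwK d * ?J * ?S"
    using F jwK_ge1[of d] jw_pos[of d \<alpha> n] V0 by (intro mult_left_mono finite_sum_le_infsum s2) auto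
   finally show "(\<Sum>j\<in>F. 1 / br (n - j) ^ 3 * (cmod (c j))\<^sup>2) \<le> jwK d * ?J * ?S" .
  qed (use brsum_ge1[of 3] in \<open>auto intro!: sum_nonneg\<close>)
  finally show ?thesis by (rule real_le_rsqrt)
 qed
 have s1: "(\<lambda>j. 1 / br (n - j) ^ 3 * cmod (c j)) summable_on UNIV" by (rule adm_shift[OF adm])
 have "cmod (mapp a c n) \<le> infsum (\<lambda>j. norm (a n j * c j)) UNIV"
  unfolding mapp_def by (rule norm_infsum_bound[OF mapp_abs_summable[OF assms(1) adm]])
 also have "\<dots> \<le> infsum (\<lambda>j. C * (1 / br (n - j) ^ 3 * cmod (c j))) UNIV"
 proof (rule infsum_mono[OF mapp_abs_summable[OF assms(1) adm] summable_on_cmult_right[OF s1]])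
  show "norm (a n j * c j) \<le> C * (1 / br (n - j) ^ 3 * cmod (c j))" for j
   using mult_right_mono[OF mdecD[OF assms(1), of n j], of "cmod (c j)"] by (simp add: norm_mult)
 qed
 also have "\<dots> = C * infsum (\<lambda>j. 1 / br (n - j) ^ 3 * cmod (c j)) UNIV" by (rule infsum_cmult_right')
 also have "\<dots> \<le> C * sqrt (brsum 3 * (jwK d * ?J * ?S))"
  using fin by (intro mult_left_mono infsum_le_finite_sums s1 C0) auto
 finally have "(cmod (mapp a c n))\<^sup>2 \<le> (C * sqrt (brsum 3 * (jwK d * ?J * ?S)))\<^sup>2"
  by (intro power_mono) auto
 also have "\<dots> = C^2 * brsum 3 * jwK d * ?S * ?J"
  using brsum_ge1[of 3] jwK_ge1[of d] jw_pos[of d \<alpha> n] S0 by (simp add: power_mult_distrib)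
 finally show "(cmod (mapp a c n))^2 / jw d \<alpha> n
   \<le> C^2 * brsum 3 * jwK d * infsum (\<lambda>j. 1 / br (n - j) ^ 2 * ((cmod (c j))^2 / jw d \<alpha> j)) UNIV"
  using jw_pos[of d \<alpha> n] by (simp add: V_def pos_divide_le_eq)
qed

lemma infsum_finite_sum:
 fixes f :: "'a => 'b => 'c::real_normed_vector"
 assumes "finite N" "\<And>n. f n summable_on A"
 shows "(\<lambda>j. \<Sum>n\<in>N. f n j) summable_on A" "infsum (\<lambda>j. \<Sum>n\<in>N. f n j) A = (\<Sum>n\<in>N. infsum (f n) A)"
proof -
 have "((\<lambda>j. \<Sum>n\<in>N. f n j) has_sum (\<Sum>n\<in>N. infsum (f n) A)) A"
  using assms by (induction N rule: finite_induct) (auto intro!: has_sum_add)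
 then show "(\<lambda>j. \<Sum>n\<in>N. f n j) summable_on A" "infsum (\<lambda>j. \<Sum>n\<in>N. f n j) A = (\<Sum>n\<in>N. infsum (f n) A)"
  by (auto simp: has_sum_iff)
qed

text \<open>Second half of the Schur test: summing the row bounds over n and exchanging the order
  leaves the column sums of 1 / br^2, hence the factor \<open>brsum 2\<close>.\<close>

lemma sob_mapp:
 assumes "mdec C a" "sob_mem d \<alpha> (-1/2) c"
 shows "sob_mem d \<alpha> (-1/2) (mapp a c)"
  and "sob_norm d \<alpha> (-1/2) (mapp a c) \<le> sqrt (C^2 * brsum 3 * jwK d * brsum 2) * sob_norm d \<alpha> (-1/2) c"
proof -
 define V where "V j = (cmod (c j))^2 / jw d \<alpha> j" for j
 have V: "V summable_on UNIV" using assms(2) unfolding sob_mem_half V_def[abs_def] .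
 have V0: "0 \<le> V j" for j using jw_pos[of d \<alpha> j] by (simp add: V_def)
 let ?R = "C^2 * brsum 3 * jwK d" and ?G = "\<lambda>n. (cmod (mapp a c n))^2 / jw d \<alpha> n"
 have R0: "0 \<le> ?R" using brsum_ge1[of 3] jwK_ge1[of d] by simp
 note sp = schur_pointwise[OF assms, folded V_def]
 have fin: "sum ?G N \<le> ?R * brsum 2 * infsum V UNIV" if N: "finite N" for N
 proof -
  have "sum ?G N \<le> (\<Sum>n\<in>N. ?R * infsum (\<lambda>j. 1 / br (n - j) ^ 2 * V j) UNIV)"
   by (intro sum_mono sp(1))
  also have "\<dots> = ?R * (\<Sum>n\<in>N. infsum (\<lambda>j. 1 / br (n - j) ^ 2 * V j) UNIV)" by (simp only: sum_distrib_left)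
  also have "(\<Sum>n\<in>N. infsum (\<lambda>j. 1 / br (n - j) ^ 2 * V j) UNIV)
    = infsum (\<lambda>j. \<Sum>n\<in>N. 1 / br (n - j) ^ 2 * V j) UNIV"
   by (rule infsum_finite_sum(2)[OF N sp(2), symmetric])
  also have "\<dots> \<le> infsum (\<lambda>j. brsum 2 * V j) UNIV"
  proof (rule infsum_mono)
   show "(\<lambda>j. \<Sum>n\<in>N. 1 / br (n - j) ^ 2 * V j) summable_on UNIV" by (rule infsum_finite_sum(1)[OF N sp(2)])
   show "(\<lambda>j. brsum 2 * V j) summable_on UNIV" by (intro summable_on_cmult_right V)
   fix j
   have "(\<Sum>n\<in>N. 1 / br (n - j) ^ 2) \<le> brsum 2"
    unfolding infsum_br_shift(2)[of j 2, symmetric] using N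
    by (intro finite_sum_le_infsum summable_br_shift) auto
   then have "(\<Sum>n\<in>N. 1 / br (n - j) ^ 2) * V j \<le> brsum 2 * V j" by (intro mult_right_mono V0)
   then show "(\<Sum>n\<in>N. 1 / br (n - j) ^ 2 * V j) \<le> brsum 2 * V j" by (simp only: sum_distrib_right)
  qed
  also have "infsum (\<lambda>j. brsum 2 * V j) UNIV = brsum 2 * infsum V UNIV" by (rule infsum_cmult_right')
  finally show ?thesis using R0 unfolding mult.assoc[symmetric] by (auto intro: mult_left_mono)
 qed
 have G: "?G summable_on UNIV"
  by (rule nonneg_bounded_partial_sums_imp_summable_on[where C = "?R * brsum 2 * infsum V UNIV"])
   (use fin jw_pos[of d \<alpha>] in \<open>auto intro!: eventually_finite_subsets_at_top_weakI divide_nonneg_pos\<close>)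
 then show "sob_mem d \<alpha> (-1/2) (mapp a c)" unfolding sob_mem_half .
 have "infsum ?G UNIV \<le> ?R * brsum 2 * infsum V UNIV"
  by (rule infsum_le_finite_sums[OF G]) (use fin in auto)
 then have "sqrt (infsum ?G UNIV) \<le> sqrt (?R * brsum 2 * infsum V UNIV)" by (rule real_sqrt_le_mono)
 then show "sob_norm d \<alpha> (-1/2) (mapp a c) \<le> sqrt (?R * brsum 2) * sob_norm d \<alpha> (-1/2) c"
  by (simp only: sob_norm_half V_def[abs_def] real_sqrt_mult)
qed

lemma bounded_op_mapp:
 assumes "mdec C a" shows "bounded_op_on d \<alpha> (-1/2) (mapp a)"
 unfolding bounded_op_on_def
proof (intro conjI allI impI exI)
 fix b c assume b: "sob_mem d \<alpha> (-1/2) b" and c: "sob_mem d \<alpha> (-1/2) c"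
 show "mapp a (\<lambda>n. b n + c n) = (\<lambda>n. mapp a b n + mapp a c n)"
  unfolding mapp_def distrib_left
  using mapp_summable[OF assms sob_adm[OF b]] mapp_summable[OF assms sob_adm[OF c]] by (intro ext infsum_add) auto
next
 fix z c
 show "mapp a (\<lambda>n. z * c n) = (\<lambda>n. z * mapp a c n)"
  unfolding mapp_def by (simp only: mult.left_commute[of _ z] infsum_cmult_right')
qed (use sob_mapp[OF assms] in auto)

lemma bounded_op_diag:
 assumes "\<And>n. cmod (a n) \<le> M" shows "bounded_op_on d \<alpha> (-1/2) (\<lambda>c n. a n * c n)"
proof -
 have M: "0 \<le> M" using order_trans[OF norm_ge_zero assms[of 0]] .
 have le: "(cmod (a n * c n))^2 / jw d \<alpha> n \<le> M^2 * ((cmod (c n))^2 / jw d \<alpha> n)" for c n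
  using mult_right_mono[OF power_mono[OF assms[of n], of 2], of "(cmod (c n))^2 / jw d \<alpha> n"] jw_pos[of d \<alpha> n]
  by (simp add: norm_mult power_mult_distrib)
 have mem: "sob_mem d \<alpha> (-1/2) (\<lambda>n. a n * c n)" if "sob_mem d \<alpha> (-1/2) c" for c
  unfolding sob_mem_half
  by (rule summable_on_comparison_test[OF summable_on_cmult_right[OF that[unfolded sob_mem_half], of "M^2"]])
   (use le jw_pos[of d \<alpha>] in \<open>auto intro!: divide_nonneg_pos\<close>)
 have "sob_norm d \<alpha> (-1/2) (\<lambda>n. a n * c n) \<le> M * sob_norm d \<alpha> (-1/2) c" if c: "sob_mem d \<alpha> (-1/2) c" for c
 proof -
  have "infsum (\<lambda>n. (cmod (a n * c n))^2 / jw d \<alpha> n) UNIV \<le> infsum (\<lambda>n. M^2 * ((cmod (c n))^2 / jw d \<alpha> n)) UNIV"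
   by (rule infsum_mono[OF mem[OF c, unfolded sob_mem_half] summable_on_cmult_right[OF c[unfolded sob_mem_half]]]) (rule le)
  also have "\<dots> = M^2 * infsum (\<lambda>n. (cmod (c n))^2 / jw d \<alpha> n) UNIV" by (rule infsum_cmult_right')
  finally have "sqrt (infsum (\<lambda>n. (cmod (a n * c n))^2 / jw d \<alpha> n) UNIV)
    \<le> sqrt (M^2 * infsum (\<lambda>n. (cmod (c n))^2 / jw d \<alpha> n) UNIV)" by (rule real_sqrt_le_mono)
  then show ?thesis using M unfolding sob_norm_half real_sqrt_mult by simp
 qed
 then show ?thesis unfolding bounded_op_on_def using mem
  by (intro conjI allI impI exI[of _ M]) (auto simp: distrib_left mult.left_commute)
qed

lemma bounded_op_comp:
 assumes "bounded_op_on d \<alpha> s A" "bounded_op_on d \<alpha> s B" shows "bounded_op_on d \<alpha> s (\<lambda>c. A (B c))"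
proof -
 obtain CA CB where CA: "\<And>c. sob_mem d \<alpha> s c ==> sob_norm d \<alpha> s (A c) \<le> CA * sob_norm d \<alpha> s c"
  and CB: "\<And>c. sob_mem d \<alpha> s c ==> sob_norm d \<alpha> s (B c) \<le> CB * sob_norm d \<alpha> s c"
  using assms unfolding bounded_op_on_def by blast
 have mem: "\<And>c. sob_mem d \<alpha> s c ==> sob_mem d \<alpha> s (B c)" "\<And>c. sob_mem d \<alpha> s c ==> sob_mem d \<alpha> s (A c)"
  using assms unfolding bounded_op_on_def by auto
 have "sob_norm d \<alpha> s (A (B c)) \<le> \<bar>CA\<bar> * CB * sob_norm d \<alpha> s c" if c: "sob_mem d \<alpha> s c" for c
 proof -
  have nn: "0 \<le> sob_norm d \<alpha> s (B c)" unfolding sob_norm_def by (intro real_sqrt_ge_zero infsum_nonneg) simp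
  have "sob_norm d \<alpha> s (A (B c)) \<le> CA * sob_norm d \<alpha> s (B c)" by (rule CA[OF mem(1)[OF c]])
  also have "\<dots> \<le> \<bar>CA\<bar> * sob_norm d \<alpha> s (B c)" using nn by (intro mult_right_mono) auto
  also have "\<dots> \<le> \<bar>CA\<bar> * (CB * sob_norm d \<alpha> s c)" by (intro mult_left_mono CB c) auto
  finally show ?thesis by (simp add: mult.assoc)
 qed
 moreover have "A (B (\<lambda>n. b n + c n)) = (\<lambda>n. A (B b) n + A (B c) n)"
  if "sob_mem d \<alpha> s b" "sob_mem d \<alpha> s c" for b c
  using assms that mem unfolding bounded_op_on_def by simp
 moreover have "A (B (\<lambda>n. z * c n)) = (\<lambda>n. z * A (B c) n)" if "sob_mem d \<alpha> s c" for z c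
  using assms that mem unfolding bounded_op_on_def by simp
 ultimately show ?thesis unfolding bounded_op_on_def using mem by blast
qed

text \<open>Factor the operator as diag(a) (I + E') with E' n j = E n j / a n. Dividing by a at most
  doubles the constant, which turns 1 / 4 into the 1 / 2 that the Neumann series needs.
  \<open>A\<close> enters only through finitely supported sequences, because only there is
  \<open>A10\<close> meaningful; elsewhere T is defined by the matrix.\<close>

lemma invertible_on_sob_diag_plus_small:
 assumes a: "\<And>n. 1 / 2 \<le> cmod (a n)" "\<And>n. cmod (a n) \<le> M"
  and E: "mdec \<theta> E" and th: "convK * \<theta> \<le> 1 / 4"
  and A: "\<And>c n. finite {n. c n \<noteq> 0} ==> A c n = a n * c n + (\<Sum>j | c j \<noteq> 0. E n j * c j)"
 shows "invertible_on_sob d \<alpha> (-1/2) A"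
proof -
 have a0: "a n \<noteq> 0" for n using a(1)[of n] by auto
 define E' where "E' n j = E n j / a n" for n j
 have E': "mdec (2 * \<theta>) E'" unfolding mdec_def
 proof (intro allI)
  fix n j
  have "cmod (E n j) / cmod (a n) \<le> (\<theta> / br (n - j) ^ 3) / (1 / 2)"
   using mdecD[OF E, of n j] a(1)[of n] mdec_nonneg[OF E] by (intro frac_le) auto
  then show "cmod (E' n j) \<le> 2 * \<theta> / br (n - j) ^ 3" by (simp add: E'_def norm_divide mult.commute)
 qed
 have th': "convK * (2 * \<theta>) \<le> 1 / 2" using th by simp
 define F where "F n j = mid n j + E' n j" for n j
 have F: "mdec (1 + 2 * \<theta>) F" unfolding mdec_def
 proof (intro allI)
  fix n j
  show "cmod (F n j) \<le> (1 + 2 * \<theta>) / br (n - j) ^ 3"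
   unfolding F_def add_divide_distrib
   by (intro order_trans[OF norm_triangle_ineq] add_mono mdecD[OF mdec_mid] mdecD[OF E'])
 qed
 have mappF: "mapp F c = (\<lambda>n. c n + mapp E' c n)" if "adm c" for c
 proof
  fix n
  have "mapp F c n = mapp mid c n + mapp E' c n"
   unfolding mapp_def F_def distrib_right
   by (intro infsum_add mapp_summable[OF mdec_mid that] mapp_summable[OF E' that])
  then show "mapp F c n = c n + mapp E' c n" by simp
 qed
 let ?T = "\<lambda>c n. a n * mapp F c n" and ?B = "\<lambda>c. mapp (neumann E') (\<lambda>n. 1 / a n * c n)"
 have dec: "mdec 2 (neumann E')" by (rule neumann_dec[OF E' th'])
 have inv: "cmod (1 / a n) \<le> 2" for n
  using a(1)[of n] a0[of n] by (simp add: norm_divide pos_divide_le_eq)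
 have T: "bounded_op_on d \<alpha> (-1/2) ?T"
  by (rule bounded_op_comp[OF bounded_op_diag[of a, OF a(2)] bounded_op_mapp[OF F]])
 have B: "bounded_op_on d \<alpha> (-1/2) ?B"
  by (rule bounded_op_comp[OF bounded_op_mapp[OF dec] bounded_op_diag[of "\<lambda>n. 1 / a n", OF inv]])
 have "?T c = A c" if c: "finite {n. c n \<noteq> 0}" for c
 proof
  fix n
  have adm: "adm c" unfolding adm_def
  proof -
   have "(\<lambda>k. cmod (c k) / br k ^ 3) summable_on {n. c n \<noteq> 0}" using c by simp
   then show "(\<lambda>k. cmod (c k) / br k ^ 3) summable_on UNIV"
    by (subst summable_on_cong_neutral[where T = "{n. c n \<noteq> 0}" and g = "\<lambda>k. cmod (c k) / br k ^ 3"]) auto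
  qed
  have "mapp E' c n = infsum (\<lambda>k. E' n k * c k) {n. c n \<noteq> 0}"
   unfolding mapp_def by (rule infsum_cong_neutral) auto
  also have "\<dots> = (\<Sum>j | c j \<noteq> 0. E n j * c j) / a n"
   using c by (simp add: E'_def sum_divide_distrib)
  finally show "?T c n = A c n" using A[OF c, of n] a0[of n] by (simp add: mappF[OF adm] distrib_left)
 qed
 moreover have "?B (?T c) = c" if c: "sob_mem d \<alpha> (-1/2) c" for c
 proof -
  note adm = sob_adm[OF c]
  have admE: "adm (mapp E' c)" by (rule sob_adm[OF sob_mapp(1)[OF E' c]])
  have "?B (?T c) = mapp (neumann E') (\<lambda>n. c n + mapp E' c n)" using a0 by (simp add: mappF[OF adm])
  also have "\<dots> = (\<lambda>n. mapp (neumann E') c n + mapp (neumann E') (mapp E' c) n)"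
   using bounded_op_mapp[OF dec, of d \<alpha>] c sob_mapp(1)[OF E' c] unfolding bounded_op_on_def by blast
  also have "\<dots> = c" using fun_cong[OF mapp_neumann(2)[OF E' th' adm]] by simp
  finally show ?thesis .
 qed
 moreover have "?T (?B c) = c" if c: "sob_mem d \<alpha> (-1/2) c" for c
 proof -
  let ?c = "\<lambda>n. 1 / a n * c n"
  have c': "sob_mem d \<alpha> (-1/2) ?c"
   using bounded_op_diag[of "\<lambda>n. 1 / a n", OF inv, of d \<alpha>] c unfolding bounded_op_on_def by blast
  have N: "sob_mem d \<alpha> (-1/2) (mapp (neumann E') ?c)" by (rule sob_mapp(1)[OF dec c'])
  have "?T (?B c) = (\<lambda>n. a n * (mapp (neumann E') ?c n + mapp E' (mapp (neumann E') ?c) n))"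
   by (simp only: mappF[OF sob_adm[OF N]])
  also have "\<dots> = c" using fun_cong[OF mapp_neumann(1)[OF E' th' sob_adm[OF c']]] a0 by simp
  finally show ?thesis .
 qed
 ultimately show ?thesis unfolding invertible_on_sob_def using T B by blast
qed

section \<open>Differentiation under the integral sign\<close>

lemma vector_derivative_bound:
 fixes f :: "real => 'b::real_normed_vector"
 assumes "convex S" "\<And>x. x \<in> S ==> (f has_vector_derivative f' x) (at x within S)"
  and "\<And>x. x \<in> S ==> norm (f' x) \<le> B" and "x \<in> S" "y \<in> S"
 shows "norm (f x - f y) \<le> B * \<bar>x - y\<bar>"
proof -
 have "norm (f x - f y) \<le> B * norm (x - y)"
 proof (rule differentiable_bound[OF assms(1)])
  show "(f has_derivative (\<lambda>h. h *\<^sub>R f' z)) (at z within S)" if "z \<in> S" for z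
   using assms(2)[OF that] by (simp add: has_vector_derivative_def)
  show "onorm (\<lambda>h. h *\<^sub>R f' z) \<le> B" if "z \<in> S" for z
   using assms(3)[OF that] by (intro onorm_le) (auto simp: mult.commute[of B] intro: mult_left_mono)
 qed (use assms in auto)
 then show ?thesis by simp
qed

text \<open>Dominated convergence for the difference quotients, with the mean value inequality
  supplying the majorant \<open>w\<close>. Measurability of \<open>f' t\<close> comes out of the
  proof, as it is a pointwise limit of quotients.\<close>

lemma has_vector_derivative_lebesgue:
 fixes f f' :: "real => 'a => complex"
 assumes int: "\<And>t. t \<in> {a<..<b} ==> integrable M (f t)"
  and der: "\<And>t x. t \<in> {a<..<b} ==> x \<in> space M ==> ((\<lambda>t. f t x) has_vector_derivative f' t x) (at t)"
  and bd: "\<And>t x. t \<in> {a<..<b} ==> x \<in> space M ==> norm (f' t x) \<le> w x"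
  and w: "integrable M w" and t: "t \<in> {a<..<b}"
 shows "integrable M (f' t)"
  and "((\<lambda>t. integral\<^sup>L M (f t)) has_vector_derivative integral\<^sup>L M (f' t)) (at t)"
proof -
 define q where "q h x = (f (t + h) x - f t x) /\<^sub>R h" for h x
 have norm_q: "norm (F' + h *\<^sub>R (- G)) / norm h = norm (F' /\<^sub>R h - G)" if "h \<noteq> 0" for F' G :: complex and h :: real
 proof -
  have "F' /\<^sub>R h - G = (F' + h *\<^sub>R (- G)) /\<^sub>R h" using that by (simp add: scaleR_right_diff_distrib)
  then show ?thesis by (simp add: divide_inverse mult.commute)
 qed
 have qlim: "(\<lambda>n. q (S n) x) \<longlonglongrightarrow> f' t x" if S: "\<And>n. S n \<noteq> 0" "S \<longlonglongrightarrow> 0" and x: "x \<in> space M" for S x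
 proof -
  have "((\<lambda>h. norm (f (t + h) x - f t x - h *\<^sub>R f' t x) / norm h) \<longlongrightarrow> 0) (at 0)"
   using der[OF t x] unfolding has_vector_derivative_def has_derivative_at by blast
  then have "(\<lambda>n. norm (f (t + S n) x - f t x - S n *\<^sub>R f' t x) / norm (S n)) \<longlonglongrightarrow> 0"
   using S unfolding LIMSEQ_SEQ_conv[symmetric] by blast
  moreover have "norm (f (t + S n) x - f t x - S n *\<^sub>R f' t x) / norm (S n) = norm (q (S n) x - f' t x)" for n
   using norm_q[OF S(1)[of n], of "f (t + S n) x - f t x" "f' t x"] by (simp add: q_def)
  ultimately have "(\<lambda>n. norm (q (S n) x - f' t x)) \<longlonglongrightarrow> 0" by simp
  then show ?thesis using LIM_zero_iff tendsto_norm_zero_iff by blast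
 qed
 have qbd: "norm (q h x) \<le> w x" if h: "t + h \<in> {a<..<b}" "h \<noteq> 0" and x: "x \<in> space M" for h x
 proof -
  have "norm (f (t + h) x - f t x) \<le> w x * \<bar>t + h - t\<bar>"
   by (rule vector_derivative_bound[where S = "{a<..<b}" and f' = "\<lambda>s. f' s x"])
    (use der bd x h t in \<open>auto intro: has_vector_derivative_at_within\<close>)
  then have "norm (f (t + h) x - f t x) / \<bar>h\<bar> \<le> w x" using h by (simp add: pos_divide_le_eq)
  then show ?thesis by (simp add: q_def divide_inverse mult.commute)
 qed
 have qint: "integrable M (q h)" if "t + h \<in> {a<..<b}" for h
  unfolding q_def[abs_def] by (intro integrable_scaleR_right Bochner_Integration.integrable_diff int that t)
 obtain e where e: "e > 0" "\<And>h. \<bar>h\<bar> < e ==> t + h \<in> {a<..<b}"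
 proof
  show "min (t - a) (b - t) > 0" using t by auto
  show "\<bar>h\<bar> < min (t - a) (b - t) ==> t + h \<in> {a<..<b}" for h by auto
 qed
 have dc: "integrable M (f' t) \<and> (\<lambda>n. integral\<^sup>L M (q (S n))) \<longlonglongrightarrow> integral\<^sup>L M (f' t)"
  if S: "\<And>n. S n \<noteq> 0" "S \<longlonglongrightarrow> 0" "\<And>n. \<bar>S n\<bar> < e" for S
 proof -
  have meas: "q (S n) \<in> borel_measurable M" for n
   using qint[OF e(2)[OF S(3)]] by (rule borel_measurable_integrable)
  have m: "f' t \<in> borel_measurable M"
   by (rule borel_measurable_LIMSEQ_metric[OF meas qlim[OF S(1,2)]])
  have lim: "AE x in M. (\<lambda>n. q (S n) x) \<longlonglongrightarrow> f' t x" using qlim[OF S(1,2)] by simp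
  have b: "AE x in M. norm (q (S n) x) \<le> w x" for n using qbd[OF e(2)[OF S(3)] S(1)] by simp
  show ?thesis
   using integrable_dominated_convergence[OF m meas w lim b] integral_dominated_convergence[OF m meas w lim b]
   by blast
 qed
 \<comment> \<open>A concrete admissible null sequence; n + 2 keeps every step strictly below e. It
   yields integrability of \<open>f' t\<close> before arbitrary sequences are treated.\<close>
 define S0 where "S0 n = e / real (n + 2)" for n
 have "integrable M (f' t) \<and> (\<lambda>n. integral\<^sup>L M (q (S0 n))) \<longlonglongrightarrow> integral\<^sup>L M (f' t)"
 proof (rule dc)
  show "S0 \<longlonglongrightarrow> 0" unfolding S0_def by real_asymp
 qed (use e(1) in \<open>auto simp: S0_def field_simps intro: add_pos_nonneg\<close>)
 then show I: "integrable M (f' t)" by simp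
 show "((\<lambda>t. integral\<^sup>L M (f t)) has_vector_derivative integral\<^sup>L M (f' t)) (at t)"
  unfolding has_vector_derivative_def has_derivative_at
 proof (intro conjI bounded_linear_scaleR_left)
  show "((\<lambda>h. norm (integral\<^sup>L M (f (t + h)) - integral\<^sup>L M (f t) - h *\<^sub>R integral\<^sup>L M (f' t)) / norm h) \<longlongrightarrow> 0) (at 0)"
   unfolding LIMSEQ_SEQ_conv[symmetric]
  proof (intro allI impI, elim conjE)
   fix S :: "nat => real" assume S: "\<forall>n. S n \<noteq> 0" "S \<longlonglongrightarrow> 0"
   \<comment> \<open>The first N terms of an arbitrary sequence may leave the interval and are
     dropped; \<open>LIMSEQ_offset\<close> restores them.\<close>
   from S(2) e(1) obtain N where N: "\<And>n. n \<ge> N ==> \<bar>S n\<bar> < e"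
    unfolding lim_sequentially by (auto simp: dist_real_def)
   have "(\<lambda>n. integral\<^sup>L M (q (S (n + N)))) \<longlonglongrightarrow> integral\<^sup>L M (f' t)"
    using dc[of "\<lambda>n. S (n + N)"] S N LIMSEQ_ignore_initial_segment[OF S(2), of N] by auto
   then have "(\<lambda>n. norm (integral\<^sup>L M (q (S (n + N))) - integral\<^sup>L M (f' t))) \<longlonglongrightarrow> 0"
    using LIM_zero tendsto_norm_zero by blast
   moreover have "norm (integral\<^sup>L M (q (S (n + N))) - integral\<^sup>L M (f' t)) =
     norm (integral\<^sup>L M (f (t + S (n + N))) - integral\<^sup>L M (f t) - S (n + N) *\<^sub>R integral\<^sup>L M (f' t)) / norm (S (n + N))" for n
   proof -
    have h: "t + S (n + N) \<in> {a<..<b}" using e(2) N by auto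
    have "integral\<^sup>L M (q (S (n + N))) = (integral\<^sup>L M (f (t + S (n + N))) - integral\<^sup>L M (f t)) /\<^sub>R S (n + N)"
     unfolding q_def[abs_def] using int[OF h] int[OF t] by simp
    then show ?thesis
     using norm_q[of "S (n + N)" "integral\<^sup>L M (f (t + S (n + N))) - integral\<^sup>L M (f t)" "integral\<^sup>L M (f' t)"] S(1) by simp
   qed
   ultimately have "(\<lambda>n. norm (integral\<^sup>L M (f (t + S (n + N))) - integral\<^sup>L M (f t) - S (n + N) *\<^sub>R integral\<^sup>L M (f' t)) / norm (S (n + N))) \<longlonglongrightarrow> 0"
    by simp
   then show "(\<lambda>n. norm (integral\<^sup>L M (f (t + S n)) - integral\<^sup>L M (f t) - S n *\<^sub>R integral\<^sup>L M (f' t)) / norm (S n)) \<longlonglongrightarrow> 0"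
    by (rule LIMSEQ_offset)
  qed
 qed
qed

section \<open>Plane wave integrals\<close>

text \<open>The Hankel function is written as a superposition of plane waves \<open>exp (i g x) cos (\<xi> y)\<close> with
 \<open>g\<^sup>2 + \<xi>\<^sup>2 = 1\<close>. The parametrisation \<open>g = 1 + i v\<^sup>2\<close> is the contour of steepest descent.\<close>

definition eta :: "real => complex" where "eta v = csqrt (of_real (v^2) - 2 * \<i>)"
definition gg :: "real => complex" where "gg v = 1 + \<i> * of_real (v^2)"
text \<open>1 - gg^2 = v^2 (v^2 - 2 i). Pulling the factor v out of the root keeps \<open>xi\<close>
  smooth through v = 0, where the principal root of 1 - gg^2 would produce |v|.\<close>

definition xi :: "real => complex" where "xi v = of_real v * eta v"

abbreviation "ew v x \<equiv> exp (\<i> * gg v * of_real x)"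
abbreviation "cx v x \<equiv> cos (xi v * of_real x)"
abbreviation "sx v x \<equiv> sin (xi v * of_real x)"
abbreviation "ig h \<equiv> (\<lambda>v. \<i> * gg v * h v)"
abbreviation "xm h \<equiv> (\<lambda>v. xi v * h v)"
abbreviation "hq u x \<equiv> csqrt (of_real (u^2) - 2 * \<i> * of_real x)"
abbreviation "qd a d \<equiv> exp (\<i> * of_real (a * d))"

lemma eta_square: "eta v ^ 2 = of_real (v^2) - 2 * \<i>"
 by (simp add: eta_def)

lemma xi_square: "xi v ^ 2 = 1 - gg v ^ 2"
 unfolding xi_def gg_def power_mult_distrib eta_square by (simp add: power2_eq_square algebra_simps)

lemma eta_Re_Im: "Re (eta v) * Im (eta v) = -1" and eta_Re2: "(Re (eta v))^2 - (Im (eta v))^2 = v^2"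
 using arg_cong[OF eta_square[of v], of Im] arg_cong[OF eta_square[of v], of Re]
 by (auto simp: power2_eq_square mult.commute)

lemma eta_Re_pos: "0 < Re (eta v)"
 using csqrt_principal[of "of_real (v^2) - 2 * \<i>"] eta_Re_Im[of v] by (auto simp: eta_def)

lemma eta_Im_neg: "Im (eta v) < 0"
 using eta_Re_Im[of v] eta_Re_pos[of v] by (smt (verit) mult_nonneg_nonneg)

lemma eta_nz [simp]: "eta v \<noteq> 0"
 using eta_Re_pos[of v] by auto

lemma eta_Re_ge: "\<bar>v\<bar> \<le> Re (eta v)"
proof -
 have "v^2 \<le> (Re (eta v))^2" using eta_Re2[of v] zero_le_power2[of "Im (eta v)"] by linarith
 then show ?thesis using eta_Re_pos[of v] abs_le_square_iff[of v "Re (eta v)"] by auto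
qed

lemma norm_eta_square: "cmod (eta v) ^ 2 = sqrt (v ^ 4 + 4)"
proof -
 have "cmod (eta v) ^ 2 = cmod (of_real (v^2) - 2 * \<i>)" using eta_square[of v] by (metis norm_power)
 then show ?thesis by (simp add: cmod_def flip: power_mult)
qed

lemma norm_eta_bounds: "2 \<le> cmod (eta v) ^ 2" "cmod (eta v) ^ 2 \<le> v^2 + 2" "1 \<le> cmod (eta v)"
proof -
 show a: "2 \<le> cmod (eta v) ^ 2" unfolding norm_eta_square
  by (rule real_le_rsqrt) simp
 show "cmod (eta v) ^ 2 \<le> v^2 + 2" unfolding norm_eta_square
  by (rule real_le_lsqrt) (auto simp: power2_eq_square algebra_simps eval_nat_numeral)
 show "1 \<le> cmod (eta v)" using a power2_le_imp_le[of 1 "cmod (eta v)"] by simp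
qed

lemma norm_xi_le: "cmod (xi v) \<le> 1 + v^2"
proof (rule power2_le_imp_le)
 have "cmod (xi v) ^ 2 \<le> v^2 * (v^2 + 2)"
  using mult_left_mono[OF norm_eta_bounds(2)[of v], of "v^2"] by (simp add: xi_def norm_mult power_mult_distrib)
 also have "\<dots> \<le> (1 + v^2)^2" by (simp add: power2_eq_square algebra_simps)
 finally show "cmod (xi v) ^ 2 \<le> (1 + v^2)^2" .
qed simp

lemma norm_gg_le: "cmod (gg v) \<le> 1 + v^2"
 unfolding gg_def using norm_triangle_ineq[of 1 "\<i> * of_real (v^2)"] by (simp add: norm_mult norm_power)

text \<open>From Re eta Im eta = - 1 and Re eta >= |v|. It bounds cosine and sine of xi y by exp |y|
  along the whole contour, so the plane wave loses nothing in v through its y-dependence.\<close>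

lemma abs_Im_xi_le: "\<bar>Im (xi v)\<bar> \<le> 1"
proof -
 have "\<bar>v\<bar> * \<bar>Im (eta v)\<bar> \<le> Re (eta v) * \<bar>Im (eta v)\<bar>" by (intro mult_right_mono eta_Re_ge) auto
 also have "\<dots> = \<bar>Re (eta v) * Im (eta v)\<bar>" using eta_Re_pos[of v] by (simp add: abs_mult)
 finally show ?thesis by (simp add: eta_Re_Im xi_def abs_mult)
qed

lemma Re_xi_nonneg: "0 \<le> v ==> 0 \<le> Re (xi v)" and Re_xi_pos: "0 < v ==> 0 < Re (xi v)"
 and Im_xi_neg: "0 < v ==> Im (xi v) < 0"
 using eta_Re_pos[of v] eta_Im_neg[of v] by (auto simp: xi_def mult_pos_neg)

lemma of_real_square_deriv: "((\<lambda>v. of_real (v^2) :: complex) has_vector_derivative of_real (2 * v)) (at v)"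
 by (rule has_vector_derivative_of_real) (auto intro!: derivative_eq_intros)

lemma eta_deriv: "(eta has_vector_derivative of_real v / eta v) (at v)"
proof -
 have nz: "of_real (v^2) - 2 * \<i> \<notin> \<real>\<^sub>\<le>\<^sub>0" by (auto simp: complex_nonpos_Reals_iff)
 have "((\<lambda>v. of_real (v^2) - 2 * \<i> :: complex) has_vector_derivative of_real (2 * v)) (at v)"
  using has_vector_derivative_diff[OF of_real_square_deriv[of v] has_vector_derivative_const[of "2 * \<i>"]] by simp
 note * = field_vector_diff_chain_at[OF this has_field_derivative_csqrt[OF nz]]
 have e: "csqrt \<circ> (\<lambda>v. of_real (v^2) - 2 * \<i>) = eta" by (rule ext) (simp add: eta_def)
 have "of_real (2 * v) * inverse (2 * eta v) = of_real v / eta v" by (simp add: field_simps)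
 then show ?thesis using *[unfolded e, folded eta_def] by (simp only:)
qed

lemma gg_deriv: "(gg has_vector_derivative 2 * \<i> * of_real v) (at v)"
 using has_vector_derivative_add[OF has_vector_derivative_const[of 1] has_vector_derivative_mult_right[OF of_real_square_deriv[of v], of \<i>]]
 by (simp add: gg_def[abs_def] mult_ac)

lemma xi_deriv: "(xi has_vector_derivative - 2 * \<i> * gg v / eta v) (at v)"
proof -
 have "(xi has_vector_derivative (of_real v * (of_real v / eta v) + of_real 1 * eta v)) (at v)"
  unfolding xi_def[abs_def]
  by (rule has_vector_derivative_mult[OF has_vector_derivative_of_real[OF DERIV_ident] eta_deriv])
 moreover have "of_real v * (of_real v / eta v) + of_real 1 * eta v = - 2 * \<i> * gg v / eta v"
 proof -
  have "of_real v * (of_real v / eta v) + of_real 1 * eta v = (of_real (v^2) + eta v ^ 2) / eta v"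
   by (simp add: power2_eq_square add_divide_distrib)
  then show ?thesis unfolding eta_square gg_def by (simp add: algebra_simps)
 qed
 ultimately show ?thesis by simp
qed

lemma continuous_on_eta [continuous_intros]: "continuous_on S eta"
 and continuous_on_gg [continuous_intros]: "continuous_on S gg"
 and continuous_on_xi [continuous_intros]: "continuous_on S xi"
 using eta_deriv gg_deriv xi_deriv by (auto intro!: continuous_at_imp_continuous_on has_vector_derivative_continuous)

section \<open>The half-line measure and exponential majorants\<close>

abbreviation Mv :: "real measure" where "Mv \<equiv> restrict_space lborel {0<..}"

lemma space_Mv [simp]: "space Mv = {0<..}"
 by (simp add: space_restrict_space)

lemma measurable_Mv:
 fixes f :: "real => complex"
 assumes "continuous_on {0<..} f" shows "f \<in> borel_measurable Mv"
 using borel_measurable_continuous_on_restrict[OF assms]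
 by (simp cong: measurable_cong_sets add: sets_restrict_space)

lemma integrable_inverse_square_Mv: "integrable Mv (\<lambda>v. 1 / (1 + v^2))"
proof -
 have "set_integrable lborel (einterval (-\<infinity>) \<infinity>) (\<lambda>x. inverse (1 + x^2) :: real)"
  by (rule integrable_inverse_1_plus_square)
 then have "set_integrable lborel {0<..} (\<lambda>x. inverse (1 + x^2) :: real)"
  by (rule set_integrable_subset) auto
 then show ?thesis
  by (subst integrable_restrict_space) (auto simp: set_integrable_def inverse_eq_divide)
qed

text \<open>One term of the exponential series at a (1 + v^2) dominates the power. The function 1 /
  (1 + v^2) serves as the common integrable majorant on the half-line.\<close>

lemma poly_exp_bound:
 fixes a :: real assumes "0 < a" obtains K where "0 < K" "\<And>v. (1 + v^2) ^ p * exp (- a * v^2) \<le> K / (1 + v^2)"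
proof
 let ?K = "fact (p + 1) / a ^ (p + 1) * exp a"
 have f: "(0::real) < fact (p + 1)" by (rule fact_gt_zero)
 have pa: "0 < a ^ (p + 1)" by (rule zero_less_power[OF assms])
 show "0 < ?K" by (intro mult_pos_pos divide_pos_pos f pa exp_gt_zero)
 fix v :: real
 let ?y = "a * (1 + v^2)"
 have y0: "0 \<le> ?y" using assms by simp
 have "?y ^ (p + 1) / fact (p + 1) \<le> exp ?y"
 proof -
  have "(\<Sum>k\<in>{p + 1}. inverse (fact k) * ?y ^ k) \<le> (\<Sum>k. inverse (fact k) * ?y ^ k)"
   using y0 by (intro sum_le_suminf summable_exp) auto
  then show ?thesis by (simp add: exp_def divide_inverse mult.commute scaleR_conv_of_real)
 qed
 then have "a ^ (p + 1) * (1 + v^2) ^ (p + 1) \<le> exp (a + a * v^2) * fact (p + 1)"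
  by (subst (asm) pos_divide_le_eq[OF fact_gt_zero]) (simp only: power_mult_distrib, simp only: distrib_left mult_1_right)
 then have "(1 + v^2) ^ (p + 1) \<le> exp (a + a * v^2) * fact (p + 1) / a ^ (p + 1)"
  by (subst pos_le_divide_eq[OF pa]) (simp only: mult.commute)
 then have "(1 + v^2) ^ (p + 1) * exp (- a * v^2) \<le> exp (a + a * v^2) * fact (p + 1) / a ^ (p + 1) * exp (- a * v^2)"
  by (rule mult_right_mono) simp
 also have "\<dots> = fact (p + 1) / a ^ (p + 1) * (exp (a + a * v^2) * exp (- a * v^2))" by (simp only: times_divide_eq_left times_divide_eq_right mult_ac)
 also have "exp (a + a * v^2) * exp (- a * v^2) = exp a" by (simp flip: exp_add)
 finally have "(1 + v^2) ^ (p + 1) * exp (- a * v^2) \<le> ?K" .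
 then show "(1 + v^2) ^ p * exp (- a * v^2) \<le> ?K / (1 + v^2)"
  by (subst pos_le_divide_eq) (auto simp: add_pos_nonneg mult_ac)
qed

text \<open>Amplitudes of decay rate a, up to powers of v: the plane wave integral with amplitude h
  then converges for x > - a. The rate is 0 for \<open>rho\<close> and k d for the lattice amplitude
  \<open>hf\<close>.\<close>

definition hb :: "real => (real => complex) => bool" where
 "hb a h \<longleftrightarrow> continuous_on {0<..} h \<and> (\<exists>C p. \<forall>v>0. cmod (h v) \<le> C * (1 + v^2) ^ p * exp (- a * v^2))"

lemma hbE:
 assumes "hb a h" obtains C p where "0 \<le> C" "\<And>v. v > 0 ==> cmod (h v) \<le> C * (1 + v^2) ^ p * exp (- a * v^2)"
proof -
 obtain C p where *: "\<And>v. v > 0 ==> cmod (h v) \<le> C * (1 + v^2) ^ p * exp (- a * v^2)"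
  using assms by (auto simp: hb_def)
 have "0 \<le> C * ((1 + 1^2) ^ p * exp (- a * 1^2))" using order_trans[OF norm_ge_zero *[of 1]] by (simp add: mult.assoc)
 moreover have "0 < (1 + 1^2 :: real) ^ p * exp (- a * 1^2)" by simp
 ultimately have "0 \<le> C" by (simp only: zero_le_mult_iff) linarith
 with * that show ?thesis by blast
qed

lemma hb_cont: "hb a h ==> continuous_on {0<..} h" by (simp add: hb_def)

lemma hb_mult:
 assumes "hb a f" "hb b g" shows "hb (a + b) (\<lambda>v. f v * g v)"
proof -
 obtain C p where f: "0 \<le> C" "\<And>v. v > 0 ==> cmod (f v) \<le> C * (1 + v^2) ^ p * exp (- a * v^2)"
  by (rule hbE[OF assms(1)]) (rule that)
 obtain D q where g: "0 \<le> D" "\<And>v. v > 0 ==> cmod (g v) \<le> D * (1 + v^2) ^ q * exp (- b * v^2)"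
  by (rule hbE[OF assms(2)]) (rule that)
 have "cmod (f v * g v) \<le> (C * D) * (1 + v^2) ^ (p + q) * exp (- (a + b) * v^2)" if "v > 0" for v
 proof -
  have "cmod (f v * g v) \<le> (C * (1 + v^2) ^ p * exp (- a * v^2)) * (D * (1 + v^2) ^ q * exp (- b * v^2))"
   unfolding norm_mult using f g that by (intro mult_mono) auto
  also have "\<dots> = (C * D) * (1 + v^2) ^ (p + q) * (exp (- a * v^2) * exp (- b * v^2))"
   by (simp add: power_add mult_ac)
  also have "exp (- a * v^2) * exp (- b * v^2) = exp (- (a + b) * v^2)" by (simp add: algebra_simps flip: exp_add)
  finally show ?thesis .
 qed
 then show ?thesis unfolding hb_def using hb_cont[OF assms(1)] hb_cont[OF assms(2)]
  by (intro conjI continuous_on_mult exI[of _ "C * D"] exI[of _ "p + q"]) auto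
qed

lemma hb_mult0: "hb 0 f ==> hb b g ==> hb b (\<lambda>v. f v * g v)"
 using hb_mult[of 0 f b g] by simp

lemma hb_const: "hb 0 (\<lambda>v. c)"
 unfolding hb_def by (intro conjI exI[of _ "cmod c"] exI[of _ 0]) auto
lemma hb_gg: "hb 0 gg" unfolding hb_def using norm_gg_le
 by (intro conjI exI[of _ 1] exI[of _ 1] continuous_intros) auto
lemma hb_xi: "hb 0 xi" unfolding hb_def using norm_xi_le
 by (intro conjI exI[of _ 1] exI[of _ 1] continuous_intros) auto

lemma hb_cmult: "hb b g ==> hb b (\<lambda>v. c * g v)" by (rule hb_mult0[OF hb_const])
lemma hb_ggm: "hb b g ==> hb b (\<lambda>v. gg v * g v)" by (rule hb_mult0[OF hb_gg])
lemma hb_xim: "hb b g ==> hb b (xm g)" by (rule hb_mult0[OF hb_xi])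

text \<open>The density d xi / gg of the plane wave representation: d xi / dv = - 2 i gg / eta gives
  rho dv = i d xi / gg.\<close>

definition rho :: "real => complex" where "rho v = 2 / eta v"

lemma norm_rho_le: "cmod (rho v) \<le> 2"
 using norm_eta_bounds(3)[of v] by (simp add: rho_def norm_divide divide_le_eq)

lemma hb_rho: "hb 0 rho" unfolding hb_def
proof (intro conjI exI[of _ "2::real"] exI[of _ "0::nat"])
 show "continuous_on {0<..} rho" unfolding rho_def[abs_def] by (intro continuous_intros) auto
qed (use norm_rho_le in auto)

lemma hb_dominated:
 assumes "hb a h" "- a < x0"
 obtains K where "0 \<le> K" "\<And>v x. v > 0 ==> x0 \<le> x ==> cmod (h v) * exp (- x * v^2) \<le> K / (1 + v^2)"
proof -
 obtain C p where h: "0 \<le> C" "\<And>v. v > 0 ==> cmod (h v) \<le> C * (1 + v^2) ^ p * exp (- a * v^2)"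
  by (rule hbE[OF assms(1)]) (rule that)
 obtain K where K: "0 < K" "\<And>v. (1 + v^2) ^ p * exp (- (a + x0) * v^2) \<le> K / (1 + v^2)"
  using poly_exp_bound[of "a + x0" p] assms(2) by auto
 show ?thesis
 proof (rule that[of "C * K"])
  show "0 \<le> C * K" using h K by simp
  fix v x :: real assume v: "v > 0" and x: "x0 \<le> x"
  have "cmod (h v) * exp (- x * v^2) \<le> (C * (1 + v^2) ^ p * exp (- a * v^2)) * exp (- x0 * v^2)"
   using h v x by (intro mult_mono) (auto intro!: mult_right_mono)
  also have "\<dots> = C * ((1 + v^2) ^ p * exp (- (a + x0) * v^2))"
   by (simp add: algebra_simps flip: exp_add)
  also have "\<dots> \<le> C * (K / (1 + v^2))" using K h by (intro mult_left_mono) auto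
  finally show "cmod (h v) * exp (- x * v^2) \<le> C * K / (1 + v^2)" by simp
 qed
qed

lemma norm_cos_sin_le: "cmod (cos z) \<le> exp \<bar>Im z\<bar>" "cmod (sin z) \<le> exp \<bar>Im z\<bar>"
proof -
 have e: "cmod (exp (\<i> * z)) \<le> exp \<bar>Im z\<bar>" "cmod (exp (- (\<i> * z))) \<le> exp \<bar>Im z\<bar>" by (auto simp: norm_exp_eq_Re)
 have "cmod (exp (\<i> * z) + exp (- (\<i> * z))) \<le> exp \<bar>Im z\<bar> + exp \<bar>Im z\<bar>"
  using norm_triangle_mono[OF e] .
 then show "cmod (cos z) \<le> exp \<bar>Im z\<bar>" by (simp add: cos_exp_eq norm_divide)
 have "cmod (exp (\<i> * z) - exp (- (\<i> * z))) \<le> exp \<bar>Im z\<bar> + exp \<bar>Im z\<bar>"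
  using norm_triangle_le_diff[of "exp (\<i> * z)" "exp (- (\<i> * z))" "exp \<bar>Im z\<bar> + exp \<bar>Im z\<bar>"] e by linarith
 then show "cmod (sin z) \<le> exp \<bar>Im z\<bar>" by (simp add: sin_exp_eq norm_divide norm_mult)
qed

lemma norm_wave: "cmod (ew v x) = exp (- x * v^2)"
 by (simp add: norm_exp_eq_Re gg_def)

lemma norm_trig_xi: "cmod (cx v y) \<le> exp \<bar>y\<bar>" "cmod (sx v y) \<le> exp \<bar>y\<bar>"
proof -
 have "\<bar>Im (xi v * of_real y)\<bar> \<le> \<bar>y\<bar>"
  using mult_right_mono[OF abs_Im_xi_le[of v], of "\<bar>y\<bar>"] by (simp add: abs_mult)
 then have "exp \<bar>Im (xi v * of_real y)\<bar> \<le> exp \<bar>y\<bar>" by simp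
 then show "cmod (cx v y) \<le> exp \<bar>y\<bar>" "cmod (sx v y) \<le> exp \<bar>y\<bar>"
  using norm_cos_sin_le[of "xi v * of_real y"] order_trans by blast+
qed

text \<open>As gg^2 + xi^2 = 1, this is a superposition of solutions of the Helmholtz equation with
  wavenumber one. The sine companion appears because differentiation in y exchanges the two.\<close>

definition Jc :: "(real => complex) => real => real => complex" where
 "Jc h x y = (LINT v|Mv. h v * ew v x * cx v y)"
definition Js :: "(real => complex) => real => real => complex" where
 "Js h x y = (LINT v|Mv. h v * ew v x * sx v y)"

text \<open>The free factor t stands for \<open>cx\<close> or \<open>sx\<close>, so cosine and sine
  integrals share one majorant, uniform for x >= x0.\<close>

lemma wave_bound:
 assumes h: "hb a h" "- a < x0"
 obtains K where "0 \<le> K" and "\<And>v x y t. v > 0 ==> x0 \<le> x ==> cmod t \<le> exp \<bar>y\<bar> ==>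
   cmod (h v * ew v x * t) \<le> K * exp \<bar>y\<bar> / (1 + v^2)"
proof -
 obtain K where K: "0 \<le> K" "\<And>v x. v > 0 ==> x0 \<le> x ==> cmod (h v) * exp (- x * v^2) \<le> K / (1 + v^2)"
  by (rule hb_dominated[OF h]) (rule that)
 show ?thesis
 proof (rule that[OF K(1)])
  fix v x y :: real and t assume "v > 0" "x0 \<le> x" "cmod t \<le> exp \<bar>y\<bar>"
  then have "cmod (h v) * exp (- x * v^2) * cmod t \<le> K / (1 + v^2) * exp \<bar>y\<bar>"
   using K by (intro mult_mono) auto
  then show "cmod (h v * ew v x * t) \<le> K * exp \<bar>y\<bar> / (1 + v^2)"
   unfolding norm_mult norm_wave by simp
 qed
qed

lemma wave_integrable:
 assumes h: "hb a h" "- a < x"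
 shows "integrable Mv (\<lambda>v. h v * ew v x * cx v y)"
  and "integrable Mv (\<lambda>v. h v * ew v x * sx v y)"
proof -
 obtain K where K: "0 \<le> K" "\<And>v x' y t. v > 0 ==> x \<le> x' ==> cmod t \<le> exp \<bar>y\<bar> ==>
   cmod (h v * ew v x' * t) \<le> K * exp \<bar>y\<bar> / (1 + v^2)"
  by (rule wave_bound[OF h]) (rule that)
 have w: "integrable Mv (\<lambda>v. K * exp \<bar>y\<bar> * (1 / (1 + v^2)))" by (intro integrable_mult_right integrable_inverse_square_Mv)
 have m: "(\<lambda>v. h v * ew v x * cx v y) \<in> borel_measurable Mv"
  "(\<lambda>v. h v * ew v x * sx v y) \<in> borel_measurable Mv"
  by (intro measurable_Mv continuous_intros hb_cont[OF h(1)])+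
 show "integrable Mv (\<lambda>v. h v * ew v x * cx v y)"
  by (rule Bochner_Integration.integrable_bound[OF w m(1)], rule AE_I2) (use K norm_trig_xi in auto)
 show "integrable Mv (\<lambda>v. h v * ew v x * sx v y)"
  by (rule Bochner_Integration.integrable_bound[OF w m(2)], rule AE_I2) (use K norm_trig_xi in auto)
qed

lemma J_bounded:
 assumes h: "hb a h" "- a < x0"
 obtains B where "0 \<le> B" "\<And>x y. x0 \<le> x ==> cmod (Jc h x y) \<le> B * exp \<bar>y\<bar>" "\<And>x y. x0 \<le> x ==> cmod (Js h x y) \<le> B * exp \<bar>y\<bar>"
proof -
 obtain K where K: "0 \<le> K" "\<And>v x y t. v > 0 ==> x0 \<le> x ==> cmod t \<le> exp \<bar>y\<bar> ==>
   cmod (h v * ew v x * t) \<le> K * exp \<bar>y\<bar> / (1 + v^2)"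
  by (rule wave_bound[OF h]) (rule that)
 let ?I = "LINT v|Mv. 1 / (1 + v^2)"
 have w: "integrable Mv (\<lambda>v. K * exp \<bar>y\<bar> * (1 / (1 + v^2)))" for y :: real
  by (intro integrable_mult_right integrable_inverse_square_Mv)
 have I: "(LINT v|Mv. K * exp \<bar>y\<bar> * (1 / (1 + v^2))) = K * ?I * exp \<bar>y\<bar>" for y :: real
  unfolding Bochner_Integration.integral_mult_right_zero by simp
 have I0: "0 \<le> ?I" by (rule integral_nonneg_AE) auto
 show ?thesis
 proof (rule that[of "K * ?I"])
  show "0 \<le> K * ?I" using K I0 by simp
  fix x y assume x: "x0 \<le> x"
  have ax: "- a < x" using x h by simp
  show "cmod (Jc h x y) \<le> K * ?I * exp \<bar>y\<bar>"
   unfolding Jc_def I[symmetric]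
   by (rule Bochner_Integration.integral_norm_bound_integral[OF wave_integrable(1)[OF h(1) ax] w]) (use K x norm_trig_xi in auto)
  show "cmod (Js h x y) \<le> K * ?I * exp \<bar>y\<bar>"
   unfolding Js_def I[symmetric]
   by (rule Bochner_Integration.integral_norm_bound_integral[OF wave_integrable(2)[OF h(1) ax] w]) (use K x norm_trig_xi in auto)
 qed
qed

text \<open>The derivative is taken along a curve (X, Y) at once, so that rotations, coordinate
  lines and the interface are all covered without a detour through joint differentiability of
  \<open>Jc\<close>.\<close>

lemma Jc_curve_deriv:
 assumes h: "hb a h" and X: "\<And>t. t \<in> {l<..<u} ==> (X has_real_derivative X' t) (at t)"
  and Y: "\<And>t. t \<in> {l<..<u} ==> (Y has_real_derivative Y' t) (at t)"
  and x0: "- a < x0" "\<And>t. t \<in> {l<..<u} ==> x0 \<le> X t"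
  and bd: "\<And>t. t \<in> {l<..<u} ==> \<bar>X' t\<bar> \<le> L" "\<And>t. t \<in> {l<..<u} ==> \<bar>Y' t\<bar> \<le> L" "\<And>t. t \<in> {l<..<u} ==> \<bar>Y t\<bar> \<le> L"
  and t: "t \<in> {l<..<u}"
 defines "c' \<equiv> \<lambda>t v. of_real (X' t) * ((\<i> * gg v * h v) * ew v (X t) * cx v (Y t))
      - of_real (Y' t) * ((xi v * h v) * ew v (X t) * sx v (Y t))"
  and "s' \<equiv> \<lambda>t v. of_real (X' t) * ((\<i> * gg v * h v) * ew v (X t) * sx v (Y t))
      + of_real (Y' t) * ((xi v * h v) * ew v (X t) * cx v (Y t))"
 shows "((\<lambda>t. Jc h (X t) (Y t)) has_vector_derivative integral\<^sup>L Mv (c' t)) (at t)"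
  and "((\<lambda>t. Js h (X t) (Y t)) has_vector_derivative integral\<^sup>L Mv (s' t)) (at t)"
proof -
 have hg: "hb a (ig h)" using hb_cmult[OF hb_ggm[OF h], of \<i>] by (simp add: mult.assoc)
 have hx: "hb a (xm h)" by (rule hb_xim[OF h])
 obtain K1 where K1: "0 \<le> K1" "\<And>v x y t. v > 0 ==> x0 \<le> x ==> cmod t \<le> exp \<bar>y\<bar> ==>
   cmod ((\<i> * gg v * h v) * ew v x * t) \<le> K1 * exp \<bar>y\<bar> / (1 + v^2)"
  by (rule wave_bound[OF hg x0(1)]) (rule that)
 obtain K2 where K2: "0 \<le> K2" "\<And>v x y t. v > 0 ==> x0 \<le> x ==> cmod t \<le> exp \<bar>y\<bar> ==>
   cmod ((xi v * h v) * ew v x * t) \<le> K2 * exp \<bar>y\<bar> / (1 + v^2)"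
  by (rule wave_bound[OF hx x0(1)]) (rule that)
 have L0: "0 \<le> L" using bd(1)[OF t] by linarith
 have gen: "cmod (of_real (X' t) * A) \<le> L * K1 * exp L / (1 + v^2) \<and> cmod (of_real (Y' t) * B) \<le> L * K2 * exp L / (1 + v^2)"
  if "t \<in> {l<..<u}" "cmod A \<le> K1 * exp \<bar>Y t\<bar> / (1 + v^2)" "cmod B \<le> K2 * exp \<bar>Y t\<bar> / (1 + v^2)" for t v A B
 proof -
  have e: "exp \<bar>Y t\<bar> \<le> exp L" using bd(3)[OF that(1)] by simp
  have "cmod A \<le> K1 * exp L / (1 + v^2)"
   using that(2) K1(1) e by (elim order_trans) (auto intro!: divide_right_mono mult_left_mono)
  moreover have "cmod B \<le> K2 * exp L / (1 + v^2)"
   using that(3) K2(1) e by (elim order_trans) (auto intro!: divide_right_mono mult_left_mono)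
  ultimately show ?thesis
   using mult_mono[OF bd(1)[OF that(1)], of "cmod A" "K1 * exp L / (1 + v^2)"]
    mult_mono[OF bd(2)[OF that(1)], of "cmod B" "K2 * exp L / (1 + v^2)"] L0
   by (auto simp: norm_mult mult.assoc)
 qed
 define w where "w v = (L * K1 * exp L + L * K2 * exp L) * (1 / (1 + v^2))" for v :: real
 have w: "integrable Mv w" unfolding w_def by (intro integrable_mult_right integrable_inverse_square_Mv)
 have w_eq: "w v = L * K1 * exp L / (1 + v^2) + L * K2 * exp L / (1 + v^2)" for v
  by (simp add: w_def add_divide_distrib)
 have ax: "t \<in> {l<..<u} ==> - a < X t" for t using x0 by force
 have dE: "((\<lambda>t. ew v (X t)) has_vector_derivative of_real (X' t) * (\<i> * gg v * ew v (X t))) (at t)"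
  and dC: "((\<lambda>t. cx v (Y t)) has_vector_derivative - of_real (Y' t) * (xi v * sx v (Y t))) (at t)"
  and dS: "((\<lambda>t. sx v (Y t)) has_vector_derivative of_real (Y' t) * (xi v * cx v (Y t))) (at t)"
  if "t \<in> {l<..<u}" for t v
 proof -
  have x: "((\<lambda>t. of_real (X t) :: complex) has_vector_derivative of_real (X' t)) (at t)"
   and y: "((\<lambda>t. of_real (Y t) :: complex) has_vector_derivative of_real (Y' t)) (at t)"
   by (intro has_vector_derivative_of_real X Y that)+
  have 1: "((\<lambda>z. exp (\<i> * gg v * z)) has_field_derivative \<i> * gg v * ew v (X t)) (at (of_real (X t)))"
   "((\<lambda>z. cos (xi v * z)) has_field_derivative - (xi v * sx v (Y t))) (at (of_real (Y t)))"
   "((\<lambda>z. sin (xi v * z)) has_field_derivative xi v * cx v (Y t)) (at (of_real (Y t)))"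
   by (auto intro!: derivative_eq_intros)
  show "((\<lambda>t. ew v (X t)) has_vector_derivative of_real (X' t) * (\<i> * gg v * ew v (X t))) (at t)"
   using field_vector_diff_chain_at[OF x 1(1)] by (simp add: comp_def mult.commute)
  show "((\<lambda>t. cx v (Y t)) has_vector_derivative - of_real (Y' t) * (xi v * sx v (Y t))) (at t)"
   using field_vector_diff_chain_at[OF y 1(2)] by (simp add: comp_def mult.commute)
  show "((\<lambda>t. sx v (Y t)) has_vector_derivative of_real (Y' t) * (xi v * cx v (Y t))) (at t)"
   using field_vector_diff_chain_at[OF y 1(3)] by (simp add: comp_def mult.commute)
 qed
 show "((\<lambda>t. Jc h (X t) (Y t)) has_vector_derivative integral\<^sup>L Mv (c' t)) (at t)"
  unfolding Jc_def
 proof (rule has_vector_derivative_lebesgue(2)[OF _ _ _ w t])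
  fix t assume t: "t \<in> {l<..<u}"
  show "integrable Mv (\<lambda>v. h v * ew v (X t) * cx v (Y t))"
   by (rule wave_integrable[OF h ax[OF t]])
  fix v assume "v \<in> space Mv" then have v: "v > 0" by simp
  show "((\<lambda>t. h v * ew v (X t) * cx v (Y t)) has_vector_derivative c' t v) (at t)"
   using has_vector_derivative_mult[OF has_vector_derivative_mult_right[OF dE[OF t, of v], of "h v"] dC[OF t, of v]]
   by (rule has_vector_derivative_eq_rhs) (simp add: c'_def algebra_simps)
  show "cmod (c' t v) \<le> w v"
   unfolding c'_def w_eq
   using gen[OF t K1(2)[OF v x0(2)[OF t] norm_trig_xi(1)] K2(2)[OF v x0(2)[OF t] norm_trig_xi(2)]]
   by (intro order_trans[OF norm_triangle_ineq4] add_mono) auto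
 qed
 show "((\<lambda>t. Js h (X t) (Y t)) has_vector_derivative integral\<^sup>L Mv (s' t)) (at t)"
  unfolding Js_def
 proof (rule has_vector_derivative_lebesgue(2)[OF _ _ _ w t])
  fix t assume t: "t \<in> {l<..<u}"
  show "integrable Mv (\<lambda>v. h v * ew v (X t) * sx v (Y t))"
   by (rule wave_integrable[OF h ax[OF t]])
  fix v assume "v \<in> space Mv" then have v: "v > 0" by simp
  show "((\<lambda>t. h v * ew v (X t) * sx v (Y t)) has_vector_derivative s' t v) (at t)"
   using has_vector_derivative_mult[OF has_vector_derivative_mult_right[OF dE[OF t, of v], of "h v"] dS[OF t, of v]]
   by (rule has_vector_derivative_eq_rhs) (simp add: s'_def algebra_simps)
  show "cmod (s' t v) \<le> w v"
   unfolding s'_def w_eq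
   using gen[OF t K1(2)[OF v x0(2)[OF t] norm_trig_xi(2)] K2(2)[OF v x0(2)[OF t] norm_trig_xi(1)]]
   by (intro order_trans[OF norm_triangle_ineq] add_mono) auto
 qed
qed

lemma J_partial_derivs:
 assumes h: "hb a h" and x: "- a < x"
 shows "((\<lambda>x. Jc h x y) has_vector_derivative Jc (ig h) x y) (at x)"
  and "((\<lambda>x. Js h x y) has_vector_derivative Js (ig h) x y) (at x)"
  and "((\<lambda>y. Jc h x y) has_vector_derivative - Js (xm h) x y) (at y)"
  and "((\<lambda>y. Js h x y) has_vector_derivative Jc (xm h) x y) (at y)"
proof -
 obtain x0 where x0: "- a < x0" "x0 < x" using dense[OF x] by blast
 \<comment> \<open>The disjunction lists the two coordinate lines, so that one use of the curve
   lemma provides all four partial derivatives.\<close>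
 have ax: "((\<lambda>t. Jc h (X t) (Y t)) has_vector_derivative (LINT v|Mv. of_real (X' t) * ((\<i> * gg v * h v) * ew v (X t) * cx v (Y t))
      - of_real (Y' t) * ((xi v * h v) * ew v (X t) * sx v (Y t)))) (at t)
   \<and> ((\<lambda>t. Js h (X t) (Y t)) has_vector_derivative (LINT v|Mv. of_real (X' t) * ((\<i> * gg v * h v) * ew v (X t) * sx v (Y t))
      + of_real (Y' t) * ((xi v * h v) * ew v (X t) * cx v (Y t)))) (at t)"
  if "X = (\<lambda>t. t) \<and> X' = (\<lambda>t. 1) \<and> Y = (\<lambda>t. y) \<and> Y' = (\<lambda>t. 0) \<and> l = x0 \<and> u = x + 1 \<and> t = x
   \<or> X = (\<lambda>t. x) \<and> X' = (\<lambda>t. 0) \<and> Y = (\<lambda>t. t) \<and> Y' = (\<lambda>t. 1) \<and> l = y - 1 \<and> u = y + 1 \<and> t = y" for X X' Y Y' l u t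
  by (intro conjI Jc_curve_deriv[OF h, where ?x0.0 = x0 and L = "\<bar>y\<bar> + 1" and l = l and u = u])
   (use that x0 in \<open>auto intro!: derivative_eq_intros\<close>)
 show "((\<lambda>x. Jc h x y) has_vector_derivative Jc (ig h) x y) (at x)"
  and "((\<lambda>x. Js h x y) has_vector_derivative Js (ig h) x y) (at x)"
  using ax[of "\<lambda>t. t" "\<lambda>t. 1" "\<lambda>t. y" "\<lambda>t. 0" x0 "x + 1" x] by (simp_all add: Jc_def Js_def)
 show "((\<lambda>y. Jc h x y) has_vector_derivative - Js (xm h) x y) (at y)"
  and "((\<lambda>y. Js h x y) has_vector_derivative Jc (xm h) x y) (at y)"
  using ax[of "\<lambda>t. x" "\<lambda>t. 0" "\<lambda>t. t" "\<lambda>t. 1" "y - 1" "y + 1" y] by (simp_all add: Jc_def Js_def)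
qed

lemma poly_exp_bound_ex:
 fixes a :: real assumes "0 < a" shows "\<exists>K>0. \<forall>v. (1 + v^2) ^ p * exp (- a * v^2) \<le> K / (1 + v^2)"
proof (rule poly_exp_bound[OF assms])
 fix K :: real assume "0 < K" "\<And>v. (1 + v^2) ^ p * exp (- a * v^2) \<le> K / (1 + v^2)"
 then show ?thesis by blast
qed

lemma integral_Mv_FTC:
 fixes F f :: "real => complex"
 assumes F: "\<And>v. 0 < v ==> (F has_vector_derivative f v) (at v)" and f: "continuous_on {0<..} f"
  and i: "integrable Mv f" and A: "(F \<longlongrightarrow> A) (at_right 0)" and B: "(F \<longlongrightarrow> B) at_top"
 shows "integral\<^sup>L Mv f = B - A"
proof -
 have e: "einterval 0 \<infinity> = {0<..}" by (auto simp: einterval_def zero_ereal_def)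
 have "set_integrable lborel {0<..} f"
  using i by (subst (asm) integrable_restrict_space) (auto simp: set_integrable_def)
 then have s: "set_integrable lborel (einterval 0 \<infinity>) f" unfolding e .
 have "(LBINT v=0..\<infinity>. f v) = B - A"
 proof (rule interval_integral_FTC_integrable[OF _ _ _ s])
  show "isCont f v" if "0 < ereal v" for v
   using f that by (simp add: continuous_on_eq_continuous_at)
 qed (use F A B in \<open>auto simp: zero_ereal_def ereal_tendsto_simps\<close>)
 moreover have "(LBINT v=0..\<infinity>. f v) = integral\<^sup>L Mv f"
  unfolding interval_lebesgue_integral_def e set_lebesgue_integral_def
  by (subst integral_restrict_space) auto
 ultimately show ?thesis by simp
qed

lemma tendsto_zero_inverse_square:
 fixes F :: "real => complex"
 assumes "\<And>v. 0 < v ==> cmod (F v) \<le> K / (1 + v^2)"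
 shows "(F \<longlongrightarrow> 0) at_top"
proof (rule Lim_null_comparison)
 show "\<forall>\<^sub>F v in at_top. norm (F v) \<le> K / (1 + v^2)"
  using eventually_gt_at_top[of 0] by eventually_elim (rule assms)
 show "((\<lambda>v. K / (1 + v^2)) \<longlongrightarrow> 0) at_top" by real_asymp
qed

lemma wave_deriv_v:
 "((\<lambda>v. ew v x) has_vector_derivative - 2 * of_real v * of_real x * ew v x) (at v)"
 "((\<lambda>v. sx v y) has_vector_derivative (- 2 * \<i> * gg v / eta v) * of_real y * cx v y) (at v)"
proof -
 have 1: "((\<lambda>z. exp (\<i> * z * of_real x)) has_field_derivative \<i> * of_real x * ew v x) (at (gg v))"
  "((\<lambda>z. sin (z * of_real y)) has_field_derivative of_real y * cx v y) (at (xi v))"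
  by (auto intro!: derivative_eq_intros)
 show "((\<lambda>v. ew v x) has_vector_derivative - 2 * of_real v * of_real x * ew v x) (at v)"
  using field_vector_diff_chain_at[OF gg_deriv 1(1)]
  unfolding comp_def
 proof (rule has_vector_derivative_eq_rhs)
  have "2 * \<i> * of_real v * (\<i> * of_real x * ew v x)
    = (\<i> * \<i>) * 2 * of_real v * of_real x * ew v x" by (simp only: mult_ac)
  then show "2 * \<i> * of_real v * (\<i> * of_real x * ew v x)
    = - 2 * of_real v * of_real x * ew v x"
   by (simp only: i_squared mult_minus_left mult_1_left)
 qed
 show "((\<lambda>v. sx v y) has_vector_derivative (- 2 * \<i> * gg v / eta v) * of_real y * cx v y) (at v)"
  using field_vector_diff_chain_at[OF xi_deriv 1(2)] by (simp add: comp_def mult.assoc)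
qed

section \<open>Identification of the Hankel function\<close>

text \<open>The candidate for (i pi / 2) times the Hankel function; \<open>VP\<close> is x VV'. With
  this choice Bessel's equation becomes the system VV' = VP / x, VP' = - x VV.\<close>

definition VV :: "real => complex" where "VV x = Jc rho x 0"
definition VP :: "real => complex" where "VP x = of_real x * Jc (ig rho) x 0"

lemma VV_deriv: assumes "0 < x" shows "(VV has_vector_derivative VP x / of_real x) (at x)"
 using J_partial_derivs(1)[OF hb_rho, of x 0] assms by (simp add: VV_def[abs_def] VP_def)

lemma xi_mult_rho: "xi v * eta v = of_real v * eta v ^ 2" "of_real v * eta v = xi v"
 by (simp_all add: xi_def power2_eq_square)

text \<open>Bessel's operator applied to the integrand is the v-derivative of - xi exp (i gg x),
  which vanishes at v = 0 because xi does and at infinity because x > 0.\<close>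

lemma VP_deriv: assumes x: "0 < x" shows "(VP has_vector_derivative - of_real x * VV x) (at x)"
proof -
 let ?h = "\<lambda>v. \<i> * gg v * rho v" and ?h2 = "\<lambda>v. \<i> * gg v * (\<i> * gg v * rho v)"
 have h: "hb 0 ?h" using hb_cmult[OF hb_ggm[OF hb_rho], of \<i>] by (simp add: mult.assoc)
 have h2: "hb 0 ?h2" using hb_cmult[OF hb_ggm[OF h], of \<i>] by (simp add: mult.assoc)
 have hx: "hb 0 xi" by (rule hb_xi)
 have d: "(VP has_vector_derivative of_real x * Jc ?h2 x 0 + of_real 1 * Jc ?h x 0) (at x)"
  unfolding VP_def[abs_def]
  by (rule has_vector_derivative_mult[OF has_vector_derivative_of_real[OF DERIV_ident] J_partial_derivs(1)[OF h]]) (use x in simp)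
 have a: "- 0 < x" using x by simp
 note I = wave_integrable(1)[OF h2 a, of 0] wave_integrable(1)[OF h a, of 0] wave_integrable(1)[OF hb_rho a, of 0]
 let ?f = "\<lambda>v. of_real x * (?h2 v * ew v x) + ?h v * ew v x
   + of_real x * (rho v * ew v x)"
 have "integral\<^sup>L Mv ?f = of_real x * Jc ?h2 x 0 + Jc ?h x 0 + of_real x * VV x"
  unfolding Jc_def VV_def using I by simp
 moreover have "integral\<^sup>L Mv ?f = 0 - 0"
 proof (rule integral_Mv_FTC[where F = "\<lambda>v. - (xi v * ew v x)"])
  fix v :: real assume v: "0 < v"
  have d: "((\<lambda>v. - (xi v * ew v x)) has_vector_derivative - (xi v * (- 2 * of_real v * of_real x * ew v x)
    + (- 2 * \<i> * gg v / eta v) * ew v x)) (at v)"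
   by (intro has_vector_derivative_minus has_vector_derivative_mult xi_deriv wave_deriv_v)
  have "?f v = (of_real x * (1 - gg v ^ 2) + \<i> * gg v) * rho v * ew v x"
   by (simp add: algebra_simps power2_eq_square)
  also have "\<dots> = (of_real x * (xi v * xi v) + \<i> * gg v) * rho v * ew v x"
   by (simp only: power2_eq_square[of "xi v", symmetric] xi_square)
  also have "\<dots> = - (xi v * (- 2 * of_real v * of_real x * ew v x)
    + (- 2 * \<i> * gg v / eta v) * ew v x)"
   unfolding rho_def by (simp add: field_simps xi_def power2_eq_square)
  finally show "((\<lambda>v. - (xi v * ew v x)) has_vector_derivative ?f v) (at v)" using d by simp
 next
  show "continuous_on {0<..} ?f" by (intro continuous_intros hb_cont[OF hb_rho])
  show "integrable Mv ?f" using I by simp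
  have "isCont (\<lambda>v. - (xi v * ew v x)) 0"
   by (rule continuous_on_interior[of UNIV]) (auto intro!: continuous_intros)
  then have "((\<lambda>v. - (xi v * ew v x)) \<longlongrightarrow> - (xi 0 * exp (\<i> * gg 0 * of_real x))) (at_right 0)"
   by (meson continuous_at filterlim_at_split isCont_def)
  then show "((\<lambda>v. - (xi v * ew v x)) \<longlongrightarrow> 0) (at_right 0)" by (simp add: xi_def)
  obtain K where K: "\<And>v x' y t. v > 0 ==> x \<le> x' ==> cmod t \<le> exp \<bar>y\<bar> ==>
   cmod (xi v * ew v x' * t) \<le> K * exp \<bar>y\<bar> / (1 + v^2)"
   by (rule wave_bound[OF hx a]) (rule that)
  show "((\<lambda>v. - (xi v * ew v x)) \<longlongrightarrow> 0) at_top"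
   by (rule tendsto_zero_inverse_square[where K = K]) (use K[of _ x 1 0] in simp)
 qed
 ultimately have "of_real x * Jc ?h2 x 0 + of_real 1 * Jc ?h x 0 = - of_real x * VV x"
  by (simp add: add_eq_0_iff)
 with d show ?thesis by simp
qed

subsection \<open>Behaviour at the origin\<close>

text \<open>The derivative of Gamma at 1 is minus the Euler constant: substitute t = u^2 in Euler's
  integral and differentiate in the exponent under the integral sign.\<close>

lemma integral_log_Gaussian:
 "integrable Mv (\<lambda>u. of_real (2 * u * exp (- (u^2)) * ln (u^2)) :: complex)"
 "(LINT u|Mv. of_real (2 * u * exp (- (u^2)) * ln (u^2)) :: complex) = - of_real euler_mascheroni"
proof -
 define F :: "real => real => complex" where "F x u = of_real (2 * u * (u^2) powr (x - 1) * exp (- (u^2)))" for x u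
 have gam: "integrable Mv (F x) \<and> integral\<^sup>L Mv (F x) = of_real (Gamma x)" if x: "0 < x" for x
 proof -
  let ?f = "\<lambda>t::real. t powr (x - 1) / exp t"
  have hi: "(?f has_integral Gamma x) {0<..}"
   using Gamma_integral_real[OF x]
   by (subst has_integral_spike_set_eq[of "{0<..}" "{0..}"]) (auto intro: negligible_subset[of "{0}"])
  have ab: "?f absolutely_integrable_on {0<..}"
   by (rule nonnegative_absolutely_integrable_1) (use hi in auto)
  have im: "(\<lambda>u::real. u^2) ` {0<..} = {0<..}"
  proof (intro set_eqI iffI)
   fix t :: real assume "t \<in> {0<..}"
   then show "t \<in> (\<lambda>u::real. u^2) ` {0<..}" by (intro image_eqI[of _ _ "sqrt t"]) auto
  qed auto
  have cv: "(\<lambda>u::real. \<bar>2 * u\<bar> * ?f (u^2)) absolutely_integrable_on {0<..} \<and>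
    integral {0<..} (\<lambda>u. \<bar>2 * u\<bar> * ?f (u^2)) = Gamma x"
  proof (subst has_absolute_integral_change_of_variables_1'[where g = "\<lambda>u::real. u^2"])
   show "inj_on (\<lambda>u::real. u\<^sup>2) {0<..}" by (auto simp: inj_on_def power2_eq_iff)
   show "((\<lambda>u::real. u\<^sup>2) has_real_derivative 2 * u) (at u within {0<..})" for u
    by (auto intro!: derivative_eq_intros)
   show "?f absolutely_integrable_on (\<lambda>u::real. u\<^sup>2) ` {0<..} \<and> integral ((\<lambda>u::real. u\<^sup>2) ` {0<..}) ?f = Gamma x"
    unfolding im using ab hi by (auto simp: integral_unique)
  qed auto
  have m: "(\<lambda>u::real. \<bar>2 * u\<bar> * ?f (u^2)) \<in> borel_measurable borel" by measurable
  have si: "set_integrable lborel {0<..} (\<lambda>u::real. \<bar>2 * u\<bar> * ?f (u^2))"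
   using cv m unfolding set_integrable_def
   by (subst integrable_completion[symmetric]) auto
  have sI: "(LINT u:{0<..}|lborel. \<bar>2 * u\<bar> * ?f (u^2)) = Gamma x"
   using set_borel_integral_eq_integral(2)[OF si] cv by simp
  have r: "integrable Mv (\<lambda>u::real. \<bar>2 * u\<bar> * ?f (u^2))" "integral\<^sup>L Mv (\<lambda>u::real. \<bar>2 * u\<bar> * ?f (u^2)) = Gamma x"
   using si sI by (subst integrable_restrict_space integral_restrict_space; simp add: set_integrable_def set_lebesgue_integral_def)+
  have e: "F x u = of_real (\<bar>2 * u\<bar> * ?f (u^2))" if "u \<in> space Mv" for u
   using that by (simp add: F_def exp_minus divide_inverse mult_ac)
  have "integrable Mv (F x) \<longleftrightarrow> integrable Mv (\<lambda>u. of_real (\<bar>2 * u\<bar> * ?f (u^2)) :: complex)"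
   by (rule Bochner_Integration.integrable_cong) (use e in auto)
  moreover have "integral\<^sup>L Mv (F x) = (LINT u|Mv. of_real (\<bar>2 * u\<bar> * ?f (u^2)) :: complex)"
   by (rule Bochner_Integration.integral_cong) (use e in auto)
  ultimately show ?thesis using r by (simp only: integrable_of_real integral_of_real)
 qed
 define F' :: "real => real => complex" where "F' x u = of_real (2 * u * ((u^2) powr (x - 1) * ln (u^2)) * exp (- (u^2)))" for x u
 obtain K :: real where K: "0 < K" "\<And>u. (1 + u^2) ^ 2 * exp (- 1 * u^2) \<le> K / (1 + u^2)"
  using poly_exp_bound_ex[OF zero_less_one, of 2] by blast
 define w where "w u = 16 * K * (1 / (1 + u^2))" for u :: real
 have w: "integrable Mv w" unfolding w_def by (intro integrable_mult_right integrable_inverse_square_Mv)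
 have P1: "integrable Mv (F x)" if "x \<in> {3/4<..<5/4}" for x using gam[of x] that by simp
 have P2: "((\<lambda>x. F x u) has_vector_derivative F' x u) (at x)" if "u \<in> space Mv" for x u
 proof -
  from that have u: "0 < u" by simp
  show ?thesis
   unfolding F_def F'_def using u
   by (intro has_vector_derivative_of_real) (auto intro!: derivative_eq_intros)
 qed
 \<comment> \<open>Bounding - ln u by 2 / sqrt u costs half a power, so near 0 the exponent is 2 x -
   3 / 2; the interval around 1 is taken so that this and 2 x - 1 stay between 0 and 2.\<close>
 have P3: "cmod (F' x u) \<le> w u" if x: "x \<in> {3/4<..<5/4}" and "u \<in> space Mv" for x u
 proof -
  from that(2) have u: "0 < u" by simp
  have l: "\<bar>ln (u^2)\<bar> \<le> 4 / sqrt u + 2 * u"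
  proof -
   have "ln u \<le> u" using ln_bound[OF u] by simp
   moreover have "- ln u \<le> 2 / sqrt u"
   proof -
    have "ln (1 / sqrt u) \<le> 1 / sqrt u" by (rule ln_bound) (use u in simp)
    then show ?thesis using u by (simp add: ln_div ln_sqrt)
   qed
   ultimately have "\<bar>ln u\<bar> \<le> 2 / sqrt u + u" using u by (auto simp: abs_if add_increasing add_increasing2)
   moreover have "ln (u^2) = 2 * ln u" using u by (simp add: ln_realpow)
   ultimately show ?thesis by simp
  qed
  have p: "(u^2) powr (x - 1) = u powr (2 * x - 2)"
  proof -
   have "u^2 = u powr 2" using u by simp
   then have "(u^2) powr (x - 1) = u powr (2 * (x - 1))" by (simp only: powr_powr)
   then show ?thesis by (simp add: algebra_simps)
  qed
  have pb: "u powr a \<le> 1 + u^2" if "0 \<le> a" "a \<le> 2" for a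
  proof (cases "u \<le> 1")
   case True
   then have "u powr a \<le> 1" using u that by (simp add: powr_le1)
   then show ?thesis by (simp add: add_increasing2)
  next
   case False
   then have "u powr a \<le> u powr 2" using that by (intro powr_mono) auto
   then show ?thesis using u by simp
  qed
  have "2 * u * (u powr (2 * x - 2) * \<bar>ln (u^2)\<bar>) \<le> 2 * u * (u powr (2 * x - 2) * (4 / sqrt u + 2 * u))"
   using u l by (intro mult_left_mono) auto
  also have "\<dots> = 8 * u powr (2 * x - 3 / 2) + 4 * (u * u powr (2 * x - 1))"
  proof -
   have "u powr (2 * x - 3/2) = u * u powr (2 * x - 2) / sqrt u"
   proof -
    have "u powr (2 * x - 3/2) = u powr (1 + (2 * x - 2) - 1/2)" by (simp add: algebra_simps)
    also have "\<dots> = u powr (1 + (2 * x - 2)) / u powr (1/2)" by (rule powr_diff)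
    also have "u powr (1 + (2 * x - 2)) = u powr 1 * u powr (2 * x - 2)" by (rule powr_add)
    finally show ?thesis using u by (simp add: powr_half_sqrt)
   qed
   moreover have "u powr (2 * x - 1) = u * u powr (2 * x - 2)"
    using powr_add[of u 1 "2 * x - 2"] u by (simp add: algebra_simps)
   ultimately show ?thesis by (simp add: distrib_left)
  qed
  also have "\<dots> \<le> 8 * (1 + u^2) + 4 * ((1 + u^2) * (1 + u^2))"
  proof -
   have "u \<le> 1 + u^2" using pb[of 1] u by simp
   then show ?thesis using pb[of "2 * x - 3/2"] pb[of "2 * x - 1"] x u
    by (intro add_mono mult_left_mono mult_mono) auto
  qed
  also have "\<dots> \<le> 16 * (1 + u^2)^2"
  proof -
   have "1 + u^2 \<le> (1 + u^2)^2" by (rule self_le_power) auto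
   moreover have "0 \<le> (1 + u^2)^2" by simp
   moreover have "8 * a + 4 * b \<le> 16 * b" if "a \<le> b" "0 \<le> b" for a b :: real using that by linarith
   ultimately have "8 * (1 + u^2) + 4 * (1 + u^2)^2 \<le> 16 * (1 + u^2)^2" by blast
   then show ?thesis by (simp only: power2_eq_square[of "1 + u^2"])
  qed
  finally have "2 * u * (u powr (2 * x - 2) * \<bar>ln (u^2)\<bar>) * exp (- (u^2)) \<le> 16 * (1 + u^2)^2 * exp (- (u^2))"
   by (rule mult_right_mono) simp
  also have "\<dots> \<le> w u" using K(2)[of u] by (simp add: w_def)
  finally show ?thesis
   using u unfolding F'_def p by (simp add: norm_mult abs_mult)
 qed
 have "(1::real) \<in> {3/4<..<5/4}" by simp
 note L = has_vector_derivative_lebesgue[of "3/4" "5/4" Mv F F' w 1, OF P1 P2 P3 w this]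
 have e: "F' 1 u = of_real (2 * u * exp (- (u^2)) * ln (u^2))" if "u \<in> space Mv" for u using that by (simp add: F'_def)
 have "integrable Mv (F' 1) \<longleftrightarrow> integrable Mv (\<lambda>u. of_real (2 * u * exp (- (u^2)) * ln (u^2)) :: complex)"
  by (rule Bochner_Integration.integrable_cong) (use e in auto)
 with L(1) show "integrable Mv (\<lambda>u. of_real (2 * u * exp (- (u^2)) * ln (u^2)) :: complex)" by blast
 have "((\<lambda>x. of_real (Gamma x) :: complex) has_vector_derivative of_real (Gamma 1 * Digamma 1)) (at 1)"
  by (rule has_vector_derivative_of_real[OF has_field_derivative_Gamma]) auto
 moreover have "((\<lambda>x. of_real (Gamma x) :: complex) has_vector_derivative integral\<^sup>L Mv (F' 1)) (at 1)"
 proof (rule has_vector_derivative_transform_within_open[OF L(2), of "{0<..}"])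
  show "integral\<^sup>L Mv (F x) = of_real (Gamma x)" if "x \<in> {0<..}" for x using gam[of x] that by simp
 qed auto
 ultimately have "of_real (Gamma 1 * Digamma 1) = integral\<^sup>L Mv (F' 1)" by (rule vector_derivative_unique_at)
 moreover have "integral\<^sup>L Mv (F' 1) = (LINT u|Mv. of_real (2 * u * exp (- (u^2)) * ln (u^2)) :: complex)"
  by (rule Bochner_Integration.integral_cong) (use e in auto)
 ultimately show "(LINT u|Mv. of_real (2 * u * exp (- (u^2)) * ln (u^2)) :: complex) = - of_real euler_mascheroni"
  by (simp only: Gamma_1 Digamma_1) simp
qed

section \<open>The antiderivative of the density and its scaling\<close>

lemma integral_Mv_scale:
 fixes f :: "real => complex"
 assumes c: "0 < c" shows "integral\<^sup>L Mv f = of_real c * integral\<^sup>L Mv (\<lambda>v. f (c * v))"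
proof -
 have "integral\<^sup>L Mv f = (LINT v|lborel. indicator {0<..} v *\<^sub>R f v)"
  by (subst integral_restrict_space) auto
 also have "\<dots> = \<bar>c\<bar> *\<^sub>R (LINT v|lborel. indicator {0<..} (0 + c * v) *\<^sub>R f (0 + c * v))"
  by (rule lborel_integral_real_affine) (use c in simp)
 also have "(\<lambda>v. indicator {0<..} (0 + c * v) *\<^sub>R f (0 + c * v)) = (\<lambda>v. indicator {0<..} v *\<^sub>R f (c * v))"
  using c by (auto simp: fun_eq_iff indicator_def zero_less_mult_iff)
 also have "\<bar>c\<bar> *\<^sub>R (LINT v|lborel. indicator {0<..} v *\<^sub>R f (c * v)) = of_real c * integral\<^sup>L Mv (\<lambda>v. f (c * v))"
  using c by (subst integral_restrict_space) (auto simp: scaleR_conv_of_real)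
 finally show ?thesis .
qed

text \<open>An antiderivative of \<open>rho\<close>, essentially an area hyperbolic sine.
  Integrating by parts with it exposes the logarithmic singularity of \<open>VV\<close> at the
  origin.\<close>

definition lneta :: "real => complex" where "lneta v = 2 * Ln (of_real v + eta v)"

lemma lneta_deriv: assumes "0 \<le> v" shows "(lneta has_vector_derivative rho v) (at v)"
proof -
 have "0 < Re (of_real v + eta v)" using eta_Re_pos[of v] assms by simp
 then have nz: "of_real v + eta v \<notin> \<real>\<^sub>\<le>\<^sub>0" by (auto simp: complex_nonpos_Reals_iff)
 have nz0: "of_real v + eta v \<noteq> 0" using nz by force
 have "((\<lambda>v. of_real v + eta v) has_vector_derivative of_real 1 + of_real v / eta v) (at v)"
  by (intro has_vector_derivative_add has_vector_derivative_of_real DERIV_ident eta_deriv)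
 from field_vector_diff_chain_at[OF this has_field_derivative_Ln[OF nz]]
 have "((\<lambda>v. Ln (of_real v + eta v)) has_vector_derivative (of_real 1 + of_real v / eta v) * inverse (of_real v + eta v)) (at v)"
  unfolding comp_def .
 moreover have "(of_real 1 + of_real v / eta v) * inverse (of_real v + eta v) = 1 / eta v"
 proof -
  have "of_real 1 + of_real v / eta v = (of_real v + eta v) / eta v" by (simp add: add_divide_distrib)
  then show ?thesis using nz0 by simp
 qed
 ultimately have "((\<lambda>v. Ln (of_real v + eta v)) has_vector_derivative 1 / eta v) (at v)" by simp
 from has_vector_derivative_mult_right[OF this, of 2] show ?thesis by (simp add: lneta_def[abs_def] rho_def)
qed

text \<open>Here \<open>eta 0\<close> = 1 - i. The imaginary part - pi / 2 later produces the value
  J_0(0) = 1 in the comparison with the Hankel function.\<close>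

lemma lneta_0: "lneta 0 = of_real (ln 2) - \<i> * of_real (pi / 2)"
proof -
 have e: "eta 0 = 1 - \<i>"
 proof (unfold eta_def, rule csqrt_unique)
  show "(1 - \<i>)\<^sup>2 = complex_of_real (0\<^sup>2) - 2 * \<i>" by (simp add: power2_eq_square algebra_simps)
 qed simp
 have "1 - \<i> = of_real (sqrt 2) * exp (- \<i> * of_real (pi / 4))"
  by (auto simp: complex_eq_iff Re_exp Im_exp cos_45 sin_45)
 then have "1 - \<i> = exp (of_real (ln 2 / 2) - \<i> * of_real (pi / 4))"
 proof -
  have "exp (ln 2 / 2) = sqrt 2" by (simp flip: ln_sqrt)
  then have "exp (of_real (ln 2 / 2)) = (of_real (sqrt 2) :: complex)" by (simp only: exp_of_real)
  moreover have "exp (of_real (ln 2 / 2) - \<i> * of_real (pi / 4)) = exp (of_real (ln 2 / 2)) * exp (- \<i> * of_real (pi / 4))"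
   by (simp only: exp_add[symmetric] mult_minus_left) simp
  ultimately show ?thesis using \<open>1 - \<i> = of_real (sqrt 2) * exp (- \<i> * of_real (pi / 4))\<close> by (simp only:)
 qed
 then have "Ln (1 - \<i>) = of_real (ln 2 / 2) - \<i> * of_real (pi / 4)"
 proof -
  have "Ln (exp (of_real (ln 2 / 2) - \<i> * of_real (pi / 4))) = of_real (ln 2 / 2) - \<i> * of_real (pi / 4)"
   by (rule Ln_exp) (simp, simp, use pi_gt_zero in linarith)
  then show ?thesis using \<open>1 - \<i> = exp _\<close> by (simp only:)
 qed
 then show ?thesis by (simp add: lneta_def e algebra_simps)
qed

text \<open>Under v = u / sqrt x the Gaussian exp (- x v^2) loses its parameter, and x survives only
  inside the root \<open>hq\<close>, where the limit x = 0 is harmless.\<close>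

lemma eta_scale: assumes "0 < x"
 shows "of_real (sqrt x) * eta (u / sqrt x) = hq u x"
proof (rule csqrt_unique[symmetric])
 have "(of_real (sqrt x) * eta (u / sqrt x))\<^sup>2 = of_real (sqrt x) ^ 2 * (of_real ((u / sqrt x)^2) - 2 * \<i>)"
  by (simp only: power_mult_distrib eta_square)
 also have "of_real (sqrt x) ^ 2 = (of_real x :: complex)" using assms by (simp flip: of_real_power)
 also have "of_real x * (of_real ((u / sqrt x)^2) - 2 * \<i>) = of_real (u^2) - 2 * \<i> * of_real x"
  using assms by (simp add: power_divide right_diff_distrib field_simps)
 finally show "(of_real (sqrt x) * eta (u / sqrt x))\<^sup>2 = of_real (u^2) - 2 * \<i> * of_real x" .
 show "0 < Re (of_real (sqrt x) * eta (u / sqrt x)) \<or>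
  Re (of_real (sqrt x) * eta (u / sqrt x)) = 0 \<and> 0 \<le> Im (of_real (sqrt x) * eta (u / sqrt x))"
  using eta_Re_pos[of "u / sqrt x"] assms by simp
qed

text \<open>A majorant independent of x in (0, 1], as dominated convergence for x tending to 0
  requires; 1 / u comes from - ln u near 0, and the constant absorbs the bounded argument.\<close>

lemma norm_Ln_bound:
 assumes u: "0 < u" and x: "0 < x" "x \<le> 1"
 shows "cmod (Ln (of_real u + hq u x)) \<le> 2 * u + 8 + 1 / u"
proof -
 let ?q = "hq u x" let ?z = "of_real u + ?q"
 have re: "0 \<le> Re ?q" using Re_csqrt by simp
 have lo: "u \<le> cmod ?z" using complex_Re_le_cmod[of ?z] re
  unfolding plus_complex.sel Re_complex_of_real by linarith
 then have z0: "?z \<noteq> 0" using u by (metis norm_zero not_less)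
 have "cmod ?q ^ 2 = cmod (of_real (u^2) - 2 * \<i> * of_real x)" by (metis norm_power power2_csqrt)
 also have "\<dots> \<le> u^2 + 2 * x"
  using norm_triangle_ineq4[of "of_real (u^2)" "2 * \<i> * of_real x"] x by (simp add: norm_mult norm_power)
 also have "\<dots> \<le> (u + 2)^2" using x u by (simp add: power2_eq_square algebra_simps)
 finally have "cmod ?q \<le> u + 2" by (rule power2_le_imp_le) (use u in linarith)
 then have hi: "cmod ?z \<le> 2 * u + 2" using norm_triangle_ineq[of "of_real u" ?q] u by simp
 have "ln (cmod ?z) \<le> 2 * u + 2" using ln_bound[of "cmod ?z"] hi z0 by simp
 moreover have "- ln (cmod ?z) \<le> 1 / u"
 proof -
  have "0 < cmod ?z" using lo u by linarith
  from iffD2[OF ln_le_cancel_iff[OF u this] lo] have "- ln (cmod ?z) \<le> - ln u" by linarith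
  also have "\<dots> = ln (1 / u)" using u by (simp add: ln_div)
  also have "\<dots> \<le> 1 / u" by (rule ln_bound) (use u in simp)
  finally show ?thesis .
 qed
 moreover have "0 < 1 / u" using u by simp
 ultimately have "\<bar>Re (Ln ?z)\<bar> \<le> 2 * u + 2 + 1 / u"
  using Re_Ln[OF z0] u unfolding abs_le_iff by linarith
 moreover have "\<bar>Im (Ln ?z)\<bar> \<le> 4" using Im_Ln_le_pi[OF z0] mpi_less_Im_Ln[OF z0] pi_less_4 by linarith
 ultimately show ?thesis using cmod_le[of "Ln ?z"] by linarith
qed

lemma tendsto_at_right_sequentially_pos:
 fixes f :: "real => 'b::metric_space"
 assumes "\<And>S. (\<And>n. 0 < S n) ==> (\<And>n. S n \<le> 1) ==> S \<longlonglongrightarrow> 0 ==> (\<lambda>n. f (S n)) \<longlonglongrightarrow> L"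
 shows "(f \<longlongrightarrow> L) (at_right 0)"
proof (rule tendsto_at_right_sequentially[of 0 1])
 fix S :: "nat => real" assume "\<And>n. 0 < S n" "\<And>n. S n < 1" "S \<longlonglongrightarrow> 0"
 then show "(\<lambda>n. f (S n)) \<longlonglongrightarrow> L" by (intro assms) (auto intro: less_imp_le)
qed simp

text \<open>Integrate by parts with \<open>lneta\<close> and rescale v = u / sqrt x: the logarithm
  of the scale splits off - ln x exactly, and the rest converges to 2 ln 2 - gamma - lneta 0, with
  gamma the Euler constant from \<open>integral_log_Gaussian\<close>.\<close>

lemma VV_at_0: "((\<lambda>x. VV x + of_real (ln x)) \<longlongrightarrow> of_real (ln 2 - euler_mascheroni) + \<i> * of_real (pi / 2)) (at_right 0)"
proof -
 define g where "g x u = of_real (2 * u * exp (- (u^2))) * (2 * Ln (of_real u + hq u x))"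
  for x u :: real
 define g0 where "g0 u = of_real (2 * u * exp (- (u^2)) * ln (u^2)) + of_real (2 * u * exp (- (u^2))) * (of_real (2 * ln 2) :: complex)" for u :: real
 obtain K :: real where K: "0 < K" "\<And>v. (1 + v^2) ^ 2 * exp (- 1 * v^2) \<le> K / (1 + v^2)"
  using poly_exp_bound_ex[OF zero_less_one, of 2] by blast
 have ga: "cmod (g x u) \<le> 48 * K * (1 / (1 + u^2))" if "0 < u" "0 < x" "x \<le> 1" for x u
 proof -
  have "cmod (g x u) = (4 * u * exp (- (u^2))) * cmod (Ln (of_real u + hq u x))"
   using that by (simp add: g_def norm_mult del: Ln_of_real)
  also have "\<dots> \<le> (4 * u * exp (- (u^2))) * (2 * u + 8 + 1 / u)"
   using that by (intro mult_left_mono norm_Ln_bound) auto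
  also have "\<dots> = (8 * u^2 + 32 * u + 4) * exp (- (u^2))" using that by (simp add: field_simps power2_eq_square)
  also have "\<dots> \<le> (48 * (1 + u^2)^2) * exp (- (u^2))"
  proof (rule mult_right_mono)
   have "u \<le> 1 + u^2" using zero_le_power2[of "u - 1"] that by (simp add: power2_eq_square algebra_simps)
   moreover have "1 + u^2 \<le> (1 + u^2)^2" by (rule self_le_power) auto
   moreover have "0 \<le> u^2" by simp
   ultimately show "8 * u^2 + 32 * u + 4 \<le> 48 * (1 + u^2)^2" by linarith
  qed simp
  also have "\<dots> \<le> 48 * (K / (1 + u^2))" using K(2)[of u] by simp
  finally show ?thesis by simp
 qed
 have w: "integrable Mv (\<lambda>u. 48 * K * (1 / (1 + u^2)))" by (intro integrable_mult_right integrable_inverse_square_Mv)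
 have gm: "g x \<in> borel_measurable Mv" if "0 < x" for x
 proof (rule measurable_Mv)
  have "of_real (u^2) - 2 * \<i> * of_real x \<notin> \<real>\<^sub>\<le>\<^sub>0" for u :: real using that by (auto simp: complex_nonpos_Reals_iff)
  then have c: "continuous_on {0<..} (\<lambda>u::real. hq u x)"
   by (intro continuous_at_imp_continuous_on ballI isCont_o2[OF _ continuous_at_csqrt] continuous_intros)
  have "of_real u + hq u x \<notin> \<real>\<^sub>\<le>\<^sub>0" if "0 < u" for u
   using that Re_csqrt[of "of_real (u^2) - 2 * \<i> * of_real x"] by (auto simp: complex_nonpos_Reals_iff simp del: csqrt.sel)
  then show "continuous_on {0<..} (g x)" unfolding g_def
   by (intro continuous_intros continuous_on_Ln c) auto
 qed
 have gi: "integrable Mv (g x)" if "0 < x" "x \<le> 1" for x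
  by (rule Bochner_Integration.integrable_bound[OF w gm], rule that, rule AE_I2) (use ga that K(1) in auto)
 have one: "integrable Mv (\<lambda>u. of_real (2 * u * exp (- (u^2))) :: complex)" "(LINT u|Mv. of_real (2 * u * exp (- (u^2))) :: complex) = 1"
 proof -
  show i: "integrable Mv (\<lambda>u. of_real (2 * u * exp (- (u^2))) :: complex)"
  proof (rule Bochner_Integration.integrable_bound[OF w], rule measurable_Mv, intro continuous_intros, rule AE_I2)
   fix u assume "u \<in> space Mv" then have u: "0 < u" by simp
   have "2 * u * exp (- (u^2)) \<le> (48 * (1 + u^2)^2) * exp (- (u^2))"
   proof (rule mult_right_mono)
    have "u \<le> 1 + u^2" using zero_le_power2[of "u - 1"] u by (simp add: power2_eq_square algebra_simps)
    moreover have "1 + u^2 \<le> (1 + u^2)^2" by (rule self_le_power) auto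
    moreover have "0 \<le> u^2" by simp
    ultimately show "2 * u \<le> 48 * (1 + u^2)^2" by linarith
   qed simp
   also have "\<dots> \<le> 48 * (K / (1 + u^2))" using K(2)[of u] by simp
   finally show "norm (of_real (2 * u * exp (- (u^2))) :: complex) \<le> norm (48 * K * (1 / (1 + u^2)))"
    using u K(1) by (simp add: norm_mult)
  qed
  have "(LINT u|Mv. of_real (2 * u * exp (- (u^2))) :: complex) = of_real 0 - of_real (- 1)"
  proof (rule integral_Mv_FTC[where F = "\<lambda>u. of_real (- exp (- (u^2)))", OF _ _ i])
   show "((\<lambda>u. of_real (- exp (- (u^2))) :: complex) has_vector_derivative of_real (2 * u * exp (- (u^2)))) (at u)" for u
    by (rule has_vector_derivative_of_real) (auto intro!: derivative_eq_intros)
   show "((\<lambda>u. of_real (- exp (- (u^2))) :: complex) \<longlongrightarrow> of_real (-1)) (at_right 0)"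
    by (intro tendsto_of_real) real_asymp
   show "((\<lambda>u. of_real (- exp (- (u^2))) :: complex) \<longlongrightarrow> of_real 0) at_top"
    by (intro tendsto_of_real) real_asymp
  qed (intro continuous_intros)
  then show "(LINT u|Mv. of_real (2 * u * exp (- (u^2))) :: complex) = 1" by simp
 qed
 have g0: "integrable Mv g0" "integral\<^sup>L Mv g0 = of_real (2 * ln 2 - euler_mascheroni)"
 proof -
  have i2: "integrable Mv (\<lambda>u. of_real (2 * u * exp (- (u^2))) * (of_real (2 * ln 2) :: complex))"
   by (rule integrable_mult_left[OF one(1)])
  show "integrable Mv g0" unfolding g0_def by (rule Bochner_Integration.integrable_add[OF integral_log_Gaussian(1) i2])
  show "integral\<^sup>L Mv g0 = of_real (2 * ln 2 - euler_mascheroni)"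
   unfolding g0_def Bochner_Integration.integral_add[OF integral_log_Gaussian(1) i2] integral_log_Gaussian(2)
    Bochner_Integration.integral_mult_left_zero one(2) by simp
 qed
 have lim: "((\<lambda>x. integral\<^sup>L Mv (g x)) \<longlongrightarrow> of_real (2 * ln 2 - euler_mascheroni)) (at_right 0)"
  unfolding g0(2)[symmetric]
 proof (rule tendsto_at_right_sequentially_pos)
  fix S :: "nat => real" assume S: "\<And>n. 0 < S n" "\<And>n. S n \<le> 1" "S \<longlonglongrightarrow> 0"
  show "(\<lambda>n. integral\<^sup>L Mv (g (S n))) \<longlonglongrightarrow> integral\<^sup>L Mv g0"
  proof (rule integral_dominated_convergence[OF _ _ w])
   show "g0 \<in> borel_measurable Mv" using g0(1) by (rule borel_measurable_integrable)
   show "g (S n) \<in> borel_measurable Mv" for n by (rule gm[OF S(1)])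
   show "AE u in Mv. norm (g (S n) u) \<le> 48 * K * (1 / (1 + u^2))" for n by (rule AE_I2) (use ga S in simp)
   show "AE u in Mv. (\<lambda>n. g (S n) u) \<longlonglongrightarrow> g0 u"
   proof (rule AE_I2)
    fix u assume "u \<in> space Mv" then have u: "0 < u" by simp
    have a: "(\<lambda>n. of_real (u^2) - 2 * \<i> * of_real (S n)) \<longlonglongrightarrow> of_real (u^2) - 2 * \<i> * of_real 0"
     by (intro tendsto_intros S)
    have "(\<lambda>n. hq u (S n)) \<longlonglongrightarrow> hq u 0"
     by (rule isCont_tendsto_compose[OF continuous_at_csqrt a]) (use u in \<open>simp add: complex_nonpos_Reals_iff\<close>)
    then have b: "(\<lambda>n. hq u (S n)) \<longlonglongrightarrow> of_real u"
     using u by (simp add: of_real_sqrt[symmetric] csqrt_of_real_nonneg flip: of_real_power)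
    have "(\<lambda>n. g (S n) u) \<longlonglongrightarrow> of_real (2 * u * exp (- (u^2))) * (2 * Ln (of_real u + of_real u))"
     unfolding g_def by (intro tendsto_intros b) (use u in \<open>auto simp: complex_nonpos_Reals_iff\<close>)
    moreover have "Ln (of_real u + of_real u) = of_real (ln 2 + ln u)"
    proof -
     have "Ln (of_real u + of_real u) = Ln (of_real (2 * u))" by simp
     also have "\<dots> = of_real (ln (2 * u))" by (rule Ln_of_real) (use u in simp)
     finally show ?thesis using u by (simp add: ln_mult)
    qed
    moreover have "of_real (2 * u * exp (- (u^2))) * (2 * of_real (ln 2 + ln u)) = g0 u"
     unfolding g0_def using u by (simp add: ln_realpow algebra_simps)
    ultimately show "(\<lambda>n. g (S n) u) \<longlonglongrightarrow> g0 u" by (simp only:)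
   qed
  qed
 qed
 have V: "VV x = exp (\<i> * of_real x) * (integral\<^sup>L Mv (g x) - of_real (ln x) - lneta 0)" if x: "0 < x" "x \<le> 1" for x
 proof -
  let ?e = "\<lambda>v. of_real (exp (- (x * v^2))) :: complex"
  let ?G = "\<lambda>v. of_real (2 * x * v * exp (- (x * v^2))) * lneta v"
  have sx: "0 < sqrt x" "sqrt x * sqrt x = x" using x by auto
  have ew: "ew v x = exp (\<i> * of_real x) * ?e v" for v
  proof -
   have "\<i> * gg v * of_real x = \<i> * of_real x + of_real (- (x * v^2))"
    unfolding gg_def
    by (auto simp: complex_eq_iff algebra_simps)
   then show ?thesis by (simp only: exp_add exp_of_real)
  qed
  have lsc: "lneta (u / sqrt x) = 2 * Ln (of_real u + hq u x) - of_real (ln x)" if u: "0 < u" for u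
  proof -
   let ?z = "of_real u + hq u x"
   have z: "?z = of_real (sqrt x) * (of_real (u / sqrt x) + eta (u / sqrt x))"
   proof -
    have a: "sqrt x * (u / sqrt x) = u" using sx(1) by simp
    show ?thesis unfolding distrib_left eta_scale[OF x(1)] of_real_mult[symmetric] a ..
   qed
   have "of_real (u / sqrt x) + eta (u / sqrt x) \<noteq> 0"
   proof -
    have "0 < u / sqrt x" using u sx(1) by simp
    then have "0 < Re (of_real (u / sqrt x) + eta (u / sqrt x))" using eta_Re_pos[of "u / sqrt x"]
     unfolding plus_complex.sel Re_complex_of_real by linarith
    then show ?thesis by (metis less_irrefl zero_complex.sel(1))
   qed
   then have "Ln ?z = of_real (ln (sqrt x)) + Ln (of_real (u / sqrt x) + eta (u / sqrt x))"
    unfolding z by (subst Ln_times_of_real[OF sx(1)]) (use sx in \<open>auto simp: Ln_of_real\<close>)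
   then show ?thesis using x by (simp add: lneta_def ln_sqrt)
  qed
  have sc: "of_real (1 / sqrt x) * ?G (1 / sqrt x * u) = g x u - of_real (2 * u * exp (- (u^2))) * of_real (ln x)" if "0 < u" for u
  proof -
   have "1 / sqrt x * (2 * x * (1 / sqrt x * u) * exp (- (x * (1 / sqrt x * u)^2))) = 2 * u * exp (- (u^2))"
    using x by (simp add: power_mult_distrib power_divide field_simps)
   then have "of_real (1 / sqrt x) * ?G (1 / sqrt x * u) = of_real (2 * u * exp (- (u^2))) * lneta (u / sqrt x)"
    by (simp only: mult.assoc[symmetric] of_real_mult[symmetric]) simp
   then show ?thesis unfolding g_def lsc[OF that] by (simp add: algebra_simps)
  qed
  have Gs: "integrable Mv (\<lambda>u. of_real (1 / sqrt x) * ?G (1 / sqrt x * u))"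
   "(LINT u|Mv. of_real (1 / sqrt x) * ?G (1 / sqrt x * u)) = integral\<^sup>L Mv (g x) - of_real (ln x)"
  proof -
   have i: "integrable Mv (\<lambda>u. g x u - of_real (2 * u * exp (- (u^2))) * of_real (ln x))"
    "(LINT u|Mv. g x u - of_real (2 * u * exp (- (u^2))) * of_real (ln x)) = integral\<^sup>L Mv (g x) - of_real (ln x)"
    using gi[OF x] one by simp_all
   have "integrable Mv (\<lambda>u. of_real (1 / sqrt x) * ?G (1 / sqrt x * u)) \<longleftrightarrow>
     integrable Mv (\<lambda>u. g x u - of_real (2 * u * exp (- (u^2))) * of_real (ln x))"
    by (rule Bochner_Integration.integrable_cong) (use sc in auto)
   then show "integrable Mv (\<lambda>u. of_real (1 / sqrt x) * ?G (1 / sqrt x * u))" using i by blast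
   have "(LINT u|Mv. of_real (1 / sqrt x) * ?G (1 / sqrt x * u))
     = (LINT u|Mv. g x u - of_real (2 * u * exp (- (u^2))) * of_real (ln x))"
    by (rule Bochner_Integration.integral_cong) (use sc in auto)
   then show "(LINT u|Mv. of_real (1 / sqrt x) * ?G (1 / sqrt x * u)) = integral\<^sup>L Mv (g x) - of_real (ln x)"
    using i by simp
  qed
  have IG: "integral\<^sup>L Mv ?G = integral\<^sup>L Mv (g x) - of_real (ln x)"
  proof -
   have "integral\<^sup>L Mv ?G = of_real (1 / sqrt x) * integral\<^sup>L Mv (\<lambda>u. ?G (1 / sqrt x * u))"
    by (rule integral_Mv_scale) (use sx in simp)
   then show ?thesis using Gs(2) by (simp only: Bochner_Integration.integral_mult_right_zero)
  qed
  have cl: "continuous_on {0<..} lneta"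
   by (intro continuous_at_imp_continuous_on ballI has_vector_derivative_continuous[OF lneta_deriv]) auto
  have iG: "integrable Mv ?G"
  proof -
   have lb: "cmod (lneta v) \<le> 2 * (2 * v + 8 + 1 / v)" if "0 < v" for v
    using norm_Ln_bound[OF that zero_less_one order_refl] by (simp add: lneta_def eta_def norm_mult)
   obtain K2 where K2: "0 < K2" "\<And>v. (1 + v^2) ^ 2 * exp (- x * v^2) \<le> K2 / (1 + v^2)"
    using poly_exp_bound_ex[OF x(1), of 2] by blast
   have w2: "integrable Mv (\<lambda>v. 48 * K2 * (1 / (1 + v^2)))" by (intro integrable_mult_right integrable_inverse_square_Mv)
   show ?thesis
   proof (rule Bochner_Integration.integrable_bound[OF w2], rule measurable_Mv, intro continuous_intros cl, rule AE_I2)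
    fix v assume "v \<in> space Mv" then have v: "0 < v" by simp
    have "cmod (?G v) = 2 * x * v * exp (- (x * v^2)) * cmod (lneta v)"
     using x v by (simp add: norm_mult)
    also have "\<dots> \<le> 2 * x * v * exp (- (x * v^2)) * (2 * (2 * v + 8 + 1 / v))"
     using x v lb[OF v] by (intro mult_left_mono) auto
    also have "\<dots> = x * ((8 * v^2 + 32 * v + 4) * exp (- (x * v^2)))"
     using v by (simp add: field_simps power2_eq_square)
    also have "\<dots> \<le> 1 * ((48 * (1 + v^2)^2) * exp (- (x * v^2)))"
    proof (intro mult_mono mult_right_mono)
     have "v \<le> 1 + v^2" using zero_le_power2[of "v - 1"] v by (simp add: power2_eq_square algebra_simps)
     moreover have "1 + v^2 \<le> (1 + v^2)^2" by (rule self_le_power) auto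
     moreover have "0 \<le> v^2" by simp
     ultimately show "8 * v^2 + 32 * v + 4 \<le> 48 * (1 + v^2)^2" by linarith
    qed (use x v in auto)
    also have "\<dots> \<le> 48 * (K2 / (1 + v^2))" using K2(2)[of v] by simp
    finally show "norm (?G v) \<le> norm (48 * K2 * (1 / (1 + v^2)))" using K2(1) by simp
   qed
  qed
  have ax: "- 0 < x" using x by simp
  have ie: "integrable Mv (\<lambda>v. rho v * ?e v)"
  proof -
   have "integrable Mv (\<lambda>v. exp (- \<i> * of_real x) * (rho v * ew v x * cx v 0))"
    by (intro integrable_mult_right wave_integrable[OF hb_rho ax])
   moreover have "exp (- \<i> * of_real x) * (rho v * ew v x * cx v 0) = rho v * ?e v" for v
    unfolding ew by (simp add: exp_minus)
   ultimately show ?thesis by (simp only:)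
  qed
  have "(LINT v|Mv. rho v * ?e v - ?G v) = 0 - lneta 0"
  proof (rule integral_Mv_FTC[where F = "\<lambda>v. lneta v * ?e v"])
   show "((\<lambda>v. lneta v * ?e v) has_vector_derivative rho v * ?e v - ?G v) (at v)" if v: "0 < v" for v
   proof -
    have de: "(?e has_vector_derivative of_real (- (2 * x * v) * exp (- (x * v^2)))) (at v)"
     by (rule has_vector_derivative_of_real) (auto intro!: derivative_eq_intros)
    have "((\<lambda>v. lneta v * ?e v) has_vector_derivative lneta v * of_real (- (2 * x * v) * exp (- (x * v^2))) + rho v * ?e v) (at v)"
     by (rule has_vector_derivative_mult[OF lneta_deriv de]) (use v in simp)
    then show ?thesis by (rule has_vector_derivative_eq_rhs) simp
   qed
   show "continuous_on {0<..} (\<lambda>v. rho v * ?e v - ?G v)" by (intro continuous_intros cl hb_cont[OF hb_rho])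
   show "integrable Mv (\<lambda>v. rho v * ?e v - ?G v)" using ie iG by simp
   have "isCont (\<lambda>v. lneta v * ?e v) 0"
    by (intro continuous_intros has_vector_derivative_continuous[OF lneta_deriv]) simp
   then have "((\<lambda>v. lneta v * ?e v) \<longlongrightarrow> lneta 0 * ?e 0) (at_right 0)"
    unfolding isCont_def by (rule filterlim_mono) (auto simp: at_within_le_at)
   then show "((\<lambda>v. lneta v * ?e v) \<longlongrightarrow> lneta 0) (at_right 0)" by simp
   show "((\<lambda>v. lneta v * ?e v) \<longlongrightarrow> 0) at_top"
   proof (rule Lim_null_comparison)
    have lb: "cmod (lneta v) \<le> 2 * (2 * v + 8 + 1 / v)" if "0 < v" for v
     using norm_Ln_bound[OF that zero_less_one order_refl] by (simp add: lneta_def eta_def norm_mult)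
    show "\<forall>\<^sub>F v in at_top. norm (lneta v * ?e v) \<le> 2 * (2 * v + 8 + 1 / v) * exp (- (x * v^2))"
     using eventually_gt_at_top[of 0] by eventually_elim (use lb in \<open>auto simp: norm_mult intro!: mult_right_mono\<close>)
    show "((\<lambda>v. 2 * (2 * v + 8 + 1 / v) * exp (- (x * v^2))) \<longlongrightarrow> 0) at_top" using x by real_asymp
   qed
  qed
  then have "(LINT v|Mv. rho v * ?e v) - integral\<^sup>L Mv ?G = 0 - lneta 0"
   by (simp only: Bochner_Integration.integral_diff[OF ie iG])
  moreover have "a = b - c" if "a - b = 0 - c" for a b c :: complex using that by (simp add: algebra_simps)
  ultimately have "(LINT v|Mv. rho v * ?e v) = integral\<^sup>L Mv ?G - lneta 0" by blast
  moreover have "VV x = (LINT v|Mv. exp (\<i> * of_real x) * (rho v * ?e v))"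
   unfolding VV_def Jc_def
   by (rule Bochner_Integration.integral_cong[OF refl]) (unfold ew of_real_0 mult_zero_right cos_zero mult_1_right, simp only: mult_ac)
  ultimately show ?thesis by (simp only: IG Bochner_Integration.integral_mult_right_zero)
 qed
 let ?E = "\<lambda>x. exp (\<i> * of_real x) :: complex"
 have El: "(?E \<longlongrightarrow> 1) (at_right 0)" by (rule tendsto_eq_intros refl | simp)+
 \<comment> \<open>The phase exp (i x) also multiplies ln x; the discrepancy is of size x |ln x| and
   vanishes.\<close>
 have Ell: "((\<lambda>x. (1 - ?E x) * of_real (ln x)) \<longlongrightarrow> 0) (at_right 0)"
 proof (rule Lim_null_comparison)
  show "\<forall>\<^sub>F x in at_right 0. norm ((1 - ?E x) * of_real (ln x)) \<le> \<bar>x * ln x\<bar>"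
   using eventually_at_right_less[of 0]
  proof eventually_elim
   case (elim x)
   have "cmod (1 - ?E x) \<le> \<bar>x\<bar>"
    using iexp_approx1[of x 0] by (simp add: norm_minus_commute)
   then have "cmod (1 - ?E x) * \<bar>ln x\<bar> \<le> \<bar>x\<bar> * \<bar>ln x\<bar>" by (rule mult_right_mono) simp
   then show ?case by (simp add: norm_mult abs_mult)
  qed
  show "((\<lambda>x. \<bar>x * ln x\<bar>) \<longlongrightarrow> 0) (at_right (0::real))" by real_asymp
 qed
 have l: "((\<lambda>x. ?E x * (integral\<^sup>L Mv (g x) - lneta 0) + (1 - ?E x) * of_real (ln x))
   \<longlongrightarrow> 1 * (of_real (2 * ln 2 - euler_mascheroni) - lneta 0) + 0) (at_right 0)"
  by (intro tendsto_intros El Ell lim)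
 have e: "1 * (of_real (2 * ln 2 - euler_mascheroni) - lneta 0) + 0
   = of_real (ln 2 - euler_mascheroni) + \<i> * of_real (pi / 2)"
  by (simp add: lneta_0)
 have ev: "\<forall>\<^sub>F x in at_right 0. ?E x * (integral\<^sup>L Mv (g x) - lneta 0) + (1 - ?E x) * of_real (ln x) = VV x + of_real (ln x)"
 proof -
  have "\<forall>\<^sub>F x in at_right (0::real). x < 1" by (rule eventually_at_right_real[of 0 1, THEN eventually_mono]) auto
  then show ?thesis using eventually_at_right_less[of 0]
   by eventually_elim (simp add: V algebra_simps)
 qed
 show ?thesis using tendsto_cong[OF ev, THEN iffD1, OF l] unfolding e .
qed

text \<open>Uniqueness for the singular Bessel system when only f is known to vanish at 0. A
  solution of the second kind would have p tending to a nonzero constant; this is excluded first,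
  and then a decreasing energy that tends to 0 at the origin forces f = 0.\<close>

lemma ode_zero_real:
 fixes f p :: "real => real"
 assumes f: "\<And>x. 0 < x ==> (f has_real_derivative p x / x) (at x)"
  and p: "\<And>x. 0 < x ==> (p has_real_derivative - x * f x) (at x)"
  and lim: "(f \<longlongrightarrow> 0) (at_right 0)" and x: "0 < x"
 shows "f x = 0"
proof -
 have "\<forall>\<^sub>F x in at_right 0. \<bar>f x\<bar> < 1" using tendstoD[OF lim, of 1] by (simp add: dist_real_def)
 then obtain b where b: "0 < b" "\<And>x. 0 < x ==> x < b ==> \<bar>f x\<bar> < 1"
  by (auto simp: eventually_at_right_field)
 define \<delta> where "\<delta> = min b 1"
 have d: "0 < \<delta>" "\<delta> \<le> 1" "\<And>x. 0 < x ==> x < \<delta> ==> \<bar>f x\<bar> \<le> 1"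
  using b by (auto simp: \<delta>_def intro: less_imp_le)
 have pl: "\<bar>p u - p v\<bar> \<le> u * \<bar>u - v\<bar>" if "0 < v" "v \<le> u" "u < \<delta>" for u v
 proof -
  have "norm (p u - p v) \<le> u * \<bar>u - v\<bar>"
  proof (rule vector_derivative_bound[where S = "{v..u}" and f' = "\<lambda>x. - x * f x"])
   fix x assume "x \<in> {v..u}"
   then have x: "0 < x" "x \<le> u" "x < \<delta>" using that by auto
   show "(p has_vector_derivative - x * f x) (at x within {v..u})"
    by (rule has_vector_derivative_at_within[OF p[OF x(1), unfolded has_real_derivative_iff_has_vector_derivative]])
   have "x * \<bar>f x\<bar> \<le> u * 1" using d(3)[OF x(1,3)] x by (intro mult_mono) auto
   then show "norm (- x * f x) \<le> u" using x by (simp add: abs_mult)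
  qed (use that in auto)
  then show ?thesis by simp
 qed
 \<comment> \<open>g' = x f ln x is bounded near 0: subtracting p ln x cancels the singular term p /
   x. Hence p ln x is bounded and p tends to 0.\<close>
 define g where "g x = f x - p x * ln x" for x
 have gl: "\<bar>g u - g v\<bar> \<le> 1 * \<bar>u - v\<bar>" if "0 < u" "u < \<delta>" "0 < v" "v < \<delta>" for u v
 proof -
  have "norm (g u - g v) \<le> 1 * \<bar>u - v\<bar>"
  proof (rule vector_derivative_bound[where S = "{0<..<\<delta>}" and f' = "\<lambda>x. x * f x * ln x"])
   fix x assume "x \<in> {0<..<\<delta>}"
   then have x: "0 < x" "x < \<delta>" by auto
   have "(g has_real_derivative x * f x * ln x) (at x)"
    unfolding g_def using x by (auto intro!: derivative_eq_intros f p simp: field_simps)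
   from has_vector_derivative_at_within[OF this[unfolded has_real_derivative_iff_has_vector_derivative]]
   show "(g has_vector_derivative x * f x * ln x) (at x within {0<..<\<delta>})" .
   have "\<bar>ln x\<bar> \<le> 1 / x"
   proof -
    have "ln (1 / x) \<le> 1 / x" by (rule ln_bound) (use x in simp)
    moreover have "ln x \<le> 0" using x d by simp
    ultimately show ?thesis using x by (simp add: ln_div)
   qed
   then have "x * \<bar>ln x\<bar> \<le> 1" using x by (simp add: field_simps)
   then have "\<bar>f x\<bar> * (x * \<bar>ln x\<bar>) \<le> 1 * 1" using d(3)[OF x] x by (intro mult_mono) auto
   then show "norm (x * f x * ln x) \<le> 1" using x by (simp add: abs_mult mult_ac)
  qed (use that in auto)
  then show ?thesis by simp
 qed
 define M where "M = \<bar>g (\<delta> / 2)\<bar> + 2"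
 have pln: "\<bar>p u\<bar> \<le> M / \<bar>ln u\<bar>" if u: "0 < u" "u < \<delta>" for u
 proof -
  have "\<bar>g u - g (\<delta> / 2)\<bar> \<le> 1" using gl[of u "\<delta> / 2"] u d by auto
  then have "\<bar>p u * ln u\<bar> \<le> M" using d(3)[OF u] unfolding M_def g_def by linarith
  moreover have "ln u < 0" using u d by simp
  then have "0 < \<bar>ln u\<bar>" by simp
  ultimately show ?thesis by (simp only: pos_le_divide_eq abs_mult)
 qed
 \<comment> \<open>Let v tend to 0 in |p u| <= |p u - p v| + |p v|. The quadratic bound makes p / x
   vanish at 0, as the energy below needs.\<close>
 have pb: "\<bar>p u\<bar> \<le> u * u" if u: "0 < u" "u < \<delta>" for u
 proof (rule tendsto_lowerbound)
  show "((\<lambda>v. u * \<bar>u - v\<bar> + M / \<bar>ln v\<bar>) \<longlongrightarrow> u * u) (at_right 0)"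
  proof -
   have "((\<lambda>v::real. M / \<bar>ln v\<bar>) \<longlongrightarrow> 0) (at_right 0)" by real_asymp
   moreover have "((\<lambda>v. u * \<bar>u - v\<bar>) \<longlongrightarrow> u * \<bar>u - 0\<bar>) (at_right 0)" by (intro tendsto_intros)
   ultimately show ?thesis using tendsto_add u by fastforce
  qed
  have "\<forall>\<^sub>F v in at_right 0. 0 < v \<and> v < u" using u by (auto simp: eventually_at_right_field)
  then show "\<forall>\<^sub>F v in at_right 0. \<bar>p u\<bar> \<le> u * \<bar>u - v\<bar> + M / \<bar>ln v\<bar>"
  proof eventually_elim
   case (elim v)
   then show ?case using pl[of v u] pln[of v] u by linarith
  qed
 qed simp
 \<comment> \<open>The derivative of this energy is - 2 (p / x)^2 / x, so its value at x is at most
   its limit at 0.\<close>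
 define E where "E x = (f x)^2 + (p x / x)^2" for x
 have Emono: "E v \<le> E u" if "0 < u" "u \<le> v" for u v
 proof (rule DERIV_nonpos_imp_nonincreasing[OF that(2)])
  fix x assume "u \<le> x" "x \<le> v"
  then have x: "0 < x" using that by simp
  have "(E has_real_derivative - 2 * (p x / x)^2 / x) (at x)"
   unfolding E_def[abs_def] using x
   by (auto intro!: derivative_eq_intros f p simp: field_simps power2_eq_square)
  moreover have "- 2 * (p x / x)^2 / x \<le> 0" using x by (simp add: divide_nonpos_pos)
  ultimately show "\<exists>y. (E has_real_derivative y) (at x) \<and> y \<le> 0" by blast
 qed
 have "E x \<le> 0"
 proof (rule tendsto_lowerbound)
  have "((\<lambda>v. (f v)^2 + v^2) \<longlongrightarrow> 0^2 + 0^2) (at_right 0)" by (intro tendsto_intros lim)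
  then show "((\<lambda>v. (f v)^2 + v^2) \<longlongrightarrow> 0) (at_right 0)" by simp
  have "\<forall>\<^sub>F v in at_right 0. 0 < v \<and> v < min x \<delta>" using x d by (auto simp: eventually_at_right_field intro!: exI[of _ "min x \<delta>"])
  then show "\<forall>\<^sub>F v in at_right 0. E x \<le> (f v)^2 + v^2"
  proof eventually_elim
   case (elim v)
   have "\<bar>p v / v\<bar> \<le> \<bar>v\<bar>" using pb[of v] elim by (simp add: abs_divide pos_divide_le_eq)
   then have "(p v / v)^2 \<le> v^2" by (simp only: abs_le_square_iff)
   then show ?case using Emono[of v x] elim by (simp add: E_def)
  qed
 qed simp
 moreover have "0 \<le> (f x)^2" "0 \<le> (p x / x)^2" by simp_all
 ultimately have "(f x)^2 = 0" unfolding E_def by linarith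
 then show ?thesis by simp
qed

lemma ode_zero:
 fixes f p :: "real => complex"
 assumes f: "\<And>x. 0 < x ==> (f has_vector_derivative p x / of_real x) (at x)"
  and p: "\<And>x. 0 < x ==> (p has_vector_derivative - of_real x * f x) (at x)"
  and lim: "(f \<longlongrightarrow> 0) (at_right 0)" and x: "0 < x"
 shows "f x = 0"
proof -
 have "Re (f x) = 0"
 proof (rule ode_zero_real[of "\<lambda>x. Re (f x)" "\<lambda>x. Re (p x)", OF _ _ _ x])
  show "((\<lambda>x. Re (f x)) has_real_derivative Re (p x) / x) (at x)" if "0 < x" for x
   using bounded_linear.has_vector_derivative[OF bounded_linear_Re f[OF that]]
   by (simp add: has_real_derivative_iff_has_vector_derivative Re_divide_of_real)
  show "((\<lambda>x. Re (p x)) has_real_derivative - x * Re (f x)) (at x)" if "0 < x" for x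
   using bounded_linear.has_vector_derivative[OF bounded_linear_Re p[OF that]]
   by (simp add: has_real_derivative_iff_has_vector_derivative)
  show "((\<lambda>x. Re (f x)) \<longlongrightarrow> 0) (at_right 0)" using tendsto_Re[OF lim] by simp
 qed
 moreover have "Im (f x) = 0"
 proof (rule ode_zero_real[of "\<lambda>x. Im (f x)" "\<lambda>x. Im (p x)", OF _ _ _ x])
  show "((\<lambda>x. Im (f x)) has_real_derivative Im (p x) / x) (at x)" if "0 < x" for x
   using bounded_linear.has_vector_derivative[OF bounded_linear_Im f[OF that]]
   by (simp add: has_real_derivative_iff_has_vector_derivative Im_divide_of_real)
  show "((\<lambda>x. Im (p x)) has_real_derivative - x * Im (f x)) (at x)" if "0 < x" for x
   using bounded_linear.has_vector_derivative[OF bounded_linear_Im p[OF that]]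
   by (simp add: has_real_derivative_iff_has_vector_derivative)
  show "((\<lambda>x. Im (f x)) \<longlongrightarrow> 0) (at_right 0)" using tendsto_Im[OF lim] by simp
 qed
 ultimately show ?thesis by (simp add: complex_eq_iff)
qed

subsection \<open>Bessel series\<close>

definition entire_coeffs :: "(nat => real) => bool" where
 "entire_coeffs c \<longleftrightarrow> (\<forall>y. summable (\<lambda>n. c n * y ^ n))"

definition ps :: "(nat => real) => real => real" where "ps c t = (\<Sum>n. c n * t ^ n)"

lemma ps_deriv: "entire_coeffs c ==> (ps c has_real_derivative ps (diffs c) t) (at t)"
 unfolding ps_def[abs_def] entire_coeffs_def by (rule termdiffs_strong_converges_everywhere) blast

lemma entire_diffs: "entire_coeffs c ==> entire_coeffs (diffs c)"
 unfolding entire_coeffs_def using termdiff_converges_all by blast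

lemma ps_euler:
 assumes "entire_coeffs c"
 shows "entire_coeffs (\<lambda>n. real n * c n)" "ps (\<lambda>n. real n * c n) t = t * ps (diffs c) t"
proof -
 have s: "(\<lambda>n. (real n * c n) * y ^ n) sums (y * ps (diffs c) y)" for y
 proof -
  have "summable (\<lambda>n. diffs c n * y ^ n)" using entire_diffs[OF assms] by (simp add: entire_coeffs_def)
  from sums_mult[OF diffs_equiv[OF this], of y]
  have "(\<lambda>n. y * (real n * c n * y ^ (n - Suc 0))) sums (y * ps (diffs c) y)" by (simp add: ps_def)
  moreover have "y * (real n * c n * y ^ (n - Suc 0)) = (real n * c n) * y ^ n" for n by (cases n) auto
  ultimately show ?thesis by simp
 qed
 show "entire_coeffs (\<lambda>n. real n * c n)" unfolding entire_coeffs_def using s sums_summable by blast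
 show "ps (\<lambda>n. real n * c n) t = t * ps (diffs c) t" unfolding ps_def[of "\<lambda>n. real n * c n"] using sums_unique[OF s[of t]] by simp
qed

lemma entire_fact_bound:
 assumes "\<And>n. \<bar>c n\<bar> \<le> 1 / fact n" shows "entire_coeffs c"
 unfolding entire_coeffs_def
proof
 fix y :: real
 show "summable (\<lambda>n. c n * y ^ n)"
 proof (rule summable_comparison_test'[OF summable_exp[of "\<bar>y\<bar>"]])
  show "norm (c n * y ^ n) \<le> inverse (fact n) * \<bar>y\<bar> ^ n" for n
   using mult_right_mono[OF assms[of n], of "\<bar>y\<bar> ^ n"] by (simp add: abs_mult power_abs inverse_eq_divide)
 qed
qed

text \<open>Coefficients in t = x^2 / 4 of J_0 and, for \<open>jb\<close>, of the non-logarithmic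
  part of (pi / 2) Y_0. As \<open>harm 0\<close> = 0, the shifted series in \<open>bessel_Y0\<close>
  may start at index 0.\<close>

definition ja :: "nat => real" where "ja m = (-1) ^ m / (fact m)^2"
definition jb :: "nat => real" where "jb m = (-1) ^ (m + 1) * harm m / (fact m)^2"

lemma entire_ja: "entire_coeffs ja"
proof (rule entire_fact_bound)
 show "\<bar>ja n\<bar> \<le> 1 / fact n" for n
  by (simp add: ja_def abs_mult power2_eq_square divide_le_eq)
qed

lemma harm_le_fact: "harm n \<le> (fact n :: real)"
proof -
 have "harm n \<le> real n"
 proof (induction n)
  case (Suc n)
  have "inverse (real (Suc n)) \<le> 1" by (simp add: field_simps)
  then show ?case using Suc by (simp add: harm_Suc)
 qed (simp add: harm_def)
 also have "\<dots> \<le> fact n" using fact_ge_self[of n] by (metis of_nat_fact of_nat_le_iff)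
 finally show ?thesis .
qed

lemma entire_jb: "entire_coeffs jb"
proof (rule entire_fact_bound)
 show "\<bar>jb n\<bar> \<le> 1 / fact n" for n
  using harm_le_fact[of n] harm_nonneg[of n, where 'a = real]
  by (simp add: jb_def abs_mult power2_eq_square field_simps)
qed

text \<open>Multiplication by n is the Euler operator t d/dt on the series. As x d/dx = 2 t d/dt for
  t = x^2 / 4, these series enter \<open>hankelP\<close> with a factor 2.\<close>

abbreviation jq :: "nat => real" where "jq \<equiv> (\<lambda>n. real n * ja n)"
abbreviation jbq :: "nat => real" where "jbq \<equiv> (\<lambda>n. real n * jb n)"

text \<open>Bessel's equation in the variable t, i.e. the recurrence (n + 1)^2 ja (n + 1) = - ja
  n.\<close>

lemma ps_jq_deriv: "(ps jq has_real_derivative - ps ja t) (at t)"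
proof -
 have "diffs jq n = - ja n" for n
  by (simp add: diffs_def ja_def power2_eq_square divide_simps)
 then have "ps (diffs jq) t = - ps ja t"
  using entire_ja by (simp add: ps_def entire_coeffs_def suminf_minus)
 then show ?thesis using ps_deriv[OF ps_euler(1)[OF entire_ja], of t] by simp
qed

text \<open>The increment 1 / (n + 1) of the harmonic numbers leaves the term with
  \<open>diffs ja\<close>; in \<open>hankel_deriv\<close> it cancels the two terms created by the
  logarithm.\<close>

lemma ps_jbq_deriv: "(ps jbq has_real_derivative - ps jb t - ps (diffs ja) t) (at t)"
proof -
 have e: "diffs jbq n = - (jb n + diffs ja n)" for n
 proof -
  have "harm (Suc n) = harm n + 1 / real (Suc n)" by (simp add: harm_Suc inverse_eq_divide)
  then show ?thesis
   by (simp add: diffs_def ja_def jb_def power2_eq_square divide_simps) (simp add: algebra_simps)?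
 qed
 have "ps (diffs jbq) t = - (ps jb t + ps (diffs ja) t)"
  using entire_jb entire_diffs[OF entire_ja]
  by (simp add: ps_def e entire_coeffs_def suminf_minus suminf_add[symmetric] summable_add distrib_right minus_mult_left[symmetric] del: minus_add_distrib)
 then show ?thesis using ps_deriv[OF ps_euler(1)[OF entire_jb], of t] by simp
qed

lemma bessel_J0_ps: "bessel_J0 x = ps ja (x^2 / 4)"
proof -
 have "(x / 2) ^ (2 * m) = (x^2 / 4) ^ m" for m by (simp add: power_mult power_divide)
 then show ?thesis by (simp add: bessel_J0_def ps_def ja_def)
qed

lemma bessel_Y0_ps:
 "bessel_Y0 x = 2 / pi * ((ln (x / 2) + euler_mascheroni) * ps ja (x^2 / 4) + ps jb (x^2 / 4))"
proof -
 let ?t = "x^2 / 4"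
 have p: "(x / 2) ^ (2 * m) = ?t ^ m" for m by (simp add: power_mult power_divide)
 have "(\<lambda>n. jb n * ?t ^ n) sums ps jb ?t"
  using entire_jb by (simp add: ps_def entire_coeffs_def summable_sums)
 then have "(\<lambda>n. jb (Suc n) * ?t ^ Suc n) sums ps jb ?t"
  by (subst sums_Suc_iff) (simp add: jb_def harm_def)
 then have "(\<Sum>m. jb (Suc m) * ?t ^ Suc m) = ps jb ?t" by (rule sums_unique[symmetric])
 moreover have "jb (Suc m) * ?t ^ Suc m = (-1) ^ (m + 2) * harm (m + 1) * (x / 2) ^ (2 * (m + 1)) / (fact (m + 1))^2" for m
  unfolding p by (simp add: jb_def)
 ultimately have "(\<Sum>m. (-1) ^ (m + 2) * harm (m + 1) * (x / 2) ^ (2 * (m + 1)) / (fact (m + 1))^2) = ps jb ?t"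
  by (simp only:)
 then show ?thesis unfolding bessel_Y0_def bessel_J0_ps by (simp only:)
qed

text \<open>x times the derivative of \<open>hankel1_0\<close>, the counterpart of
  \<open>VP\<close>: both pairs solve the same first-order system.\<close>

definition hankelP :: "real => complex" where
 "hankelP x = of_real (2 * ps jq (x^2 / 4)) + \<i> * of_real (2 / pi * (ps ja (x^2 / 4)
   + (ln (x / 2) + euler_mascheroni) * (2 * ps jq (x^2 / 4)) + 2 * ps jbq (x^2 / 4)))"

lemma ps_square_deriv:
 assumes "\<And>t. (ps c has_real_derivative D t) (at t)"
 shows "((\<lambda>x. ps c (x^2 / 4)) has_real_derivative D (x^2 / 4) * (x / 2)) (at x)"
 by (rule DERIV_chain2[OF assms]) (auto intro!: derivative_eq_intros)

lemma hankel_deriv: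
 assumes x: "0 < x"
 shows "(hankel1_0 has_vector_derivative hankelP x / of_real x) (at x)"
  and "(hankelP has_vector_derivative - of_real x * hankel1_0 x) (at x)"
proof -
 let ?t = "x^2 / 4"
 note da = ps_square_deriv[OF ps_deriv[OF entire_ja], of x] and db = ps_square_deriv[OF ps_deriv[OF entire_jb], of x]
  and dq = ps_square_deriv[OF ps_jq_deriv, of x] and dbq = ps_square_deriv[OF ps_jbq_deriv, of x]
 have dl: "((\<lambda>x. ln (x / 2)) has_real_derivative 1 / x) (at x)"
  using x by (auto intro!: derivative_eq_intros)
 have eq: "ps jq ?t = ?t * ps (diffs ja) ?t" "ps jbq ?t = ?t * ps (diffs jb) ?t"
  by (rule ps_euler(2)[OF entire_ja] ps_euler(2)[OF entire_jb])+
 have J: "(bessel_J0 has_real_derivative 2 * ps jq ?t / x) (at x)"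
  unfolding bessel_J0_ps[abs_def] eq
  by (rule DERIV_cong[OF da]) (use x in \<open>simp add: field_simps power2_eq_square\<close>)
 have Y: "(bessel_Y0 has_real_derivative (2 / pi * (ps ja ?t + (ln (x / 2) + euler_mascheroni) * (2 * ps jq ?t) + 2 * ps jbq ?t)) / x) (at x)"
  unfolding bessel_Y0_ps[abs_def] eq
  by (rule DERIV_cong[OF DERIV_cmult[OF DERIV_add[OF DERIV_mult[OF DERIV_add[OF dl DERIV_const] da] db]]])
   (use x in \<open>simp add: field_simps power2_eq_square\<close>)
 show "(hankel1_0 has_vector_derivative hankelP x / of_real x) (at x)"
  unfolding hankel1_0_def[abs_def] hankelP_def
  by (rule has_vector_derivative_eq_rhs[OF has_vector_derivative_add[OF has_vector_derivative_of_real[OF J]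
     has_vector_derivative_mult_right[OF has_vector_derivative_of_real[OF Y], of \<i>]]])
   (simp only: of_real_divide add_divide_distrib times_divide_eq_right)
 have PJ: "((\<lambda>x. 2 * ps jq (x^2 / 4)) has_real_derivative - x * ps ja ?t) (at x)"
  by (rule DERIV_cong[OF DERIV_cmult[OF dq]]) simp
 have PY: "((\<lambda>x. 2 / pi * (ps ja (x^2 / 4) + (ln (x / 2) + euler_mascheroni) * (2 * ps jq (x^2 / 4)) + 2 * ps jbq (x^2 / 4)))
   has_real_derivative - x * (2 / pi * ((ln (x / 2) + euler_mascheroni) * ps ja ?t + ps jb ?t))) (at x)"
  by (rule DERIV_cong[OF DERIV_cmult[OF DERIV_add[OF DERIV_add[OF da DERIV_mult[OF DERIV_add[OF dl DERIV_const] DERIV_cmult[OF dq]]] DERIV_cmult[OF dbq]]]])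
   (unfold eq, use x in \<open>simp add: field_simps power2_eq_square\<close>)
 show "(hankelP has_vector_derivative - of_real x * hankel1_0 x) (at x)"
  unfolding hankel1_0_def hankelP_def[abs_def] bessel_J0_ps bessel_Y0_ps
  by (rule has_vector_derivative_eq_rhs[OF has_vector_derivative_add[OF has_vector_derivative_of_real[OF PJ]
     has_vector_derivative_mult_right[OF has_vector_derivative_of_real[OF PY], of \<i>]]])
   (simp only: of_real_mult of_real_minus of_real_add distrib_left mult_ac)
qed

lemma hankel_at_0:
 "((\<lambda>x. hankel1_0 x - 2 * \<i> / of_real pi * of_real (ln x))
   \<longlongrightarrow> 1 + 2 * \<i> / of_real pi * of_real (euler_mascheroni - ln 2)) (at_right 0)"
proof -
 have c: "((\<lambda>x. ps c (x^2 / 4)) \<longlongrightarrow> c 0) (at_right 0)" if "entire_coeffs c" for c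
 proof -
  have "isCont (\<lambda>x. ps c (x^2 / 4)) 0"
   using ps_square_deriv[OF ps_deriv[OF that]] by (rule DERIV_isCont)
  then have "((\<lambda>x. ps c (x^2 / 4)) \<longlongrightarrow> ps c (0^2 / 4)) (at_right 0)"
   unfolding isCont_def by (rule filterlim_mono) (auto simp: at_within_le_at)
  moreover have "ps c 0 = c 0" using powser_zero[of c] by (simp add: ps_def)
  ultimately show ?thesis by simp
 qed
 have ja0: "ja 0 = 1" and jb0: "jb 0 = 0" by (simp_all add: ja_def jb_def harm_def)
 \<comment> \<open>J_0 - 1 is a difference quotient in x^2 / 4 times x^2 / 4, and x^2 ln x tends to
   0.\<close>
 have ln0: "((\<lambda>x. ln x * (ps ja (x^2 / 4) - 1)) \<longlongrightarrow> 0) (at_right 0)"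
 proof -
  have ev: "\<forall>\<^sub>F x in at_right (0::real). 0 < x" by (rule eventually_at_right_less)
  have "((\<lambda>h. (ps ja (0 + h) - ps ja 0) / h) \<longlongrightarrow> ps (diffs ja) 0) (at 0)"
   using ps_deriv[OF entire_ja, of 0] by (simp add: DERIV_def)
  moreover have "filterlim (\<lambda>x::real. x^2 / 4) (at 0) (at_right 0)"
  proof (rule filterlim_atI)
   show "((\<lambda>x::real. x^2 / 4) \<longlongrightarrow> 0) (at_right 0)" by real_asymp
   show "\<forall>\<^sub>F x in at_right (0::real). x^2 / 4 \<noteq> 0" using ev by eventually_elim simp
  qed
  ultimately have q: "((\<lambda>x. (ps ja (0 + x^2 / 4) - ps ja 0) / (x^2 / 4)) \<longlongrightarrow> ps (diffs ja) 0) (at_right 0)"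
   by (rule filterlim_compose)
  have "((\<lambda>x::real. ln x * (x^2 / 4)) \<longlongrightarrow> 0) (at_right 0)" by real_asymp
  from tendsto_mult[OF this q] have l: "((\<lambda>x. ln x * (x^2 / 4) * ((ps ja (0 + x^2 / 4) - ps ja 0) / (x^2 / 4))) \<longlongrightarrow> 0) (at_right 0)"
   by simp
  have p0: "ps ja 0 = 1" using powser_zero[of ja] by (simp add: ps_def ja0)
  have ee: "\<forall>\<^sub>F x in at_right (0::real). ln x * (x^2 / 4) * ((ps ja (0 + x^2 / 4) - ps ja 0) / (x^2 / 4)) = ln x * (ps ja (x^2 / 4) - 1)"
   using ev by eventually_elim (simp add: p0)
  show ?thesis using tendsto_cong[OF ee, THEN iffD1, OF l] .
 qed
 have l: "((\<lambda>x. of_real (ps ja (x^2/4)) + \<i> * of_real (2 / pi * (ln x * (ps ja (x^2 / 4) - 1) + (euler_mascheroni - ln 2) * ps ja (x^2 / 4) + ps jb (x^2 / 4))))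
   \<longlongrightarrow> of_real 1 + \<i> * of_real (2 / pi * (0 + (euler_mascheroni - ln 2) * 1 + 0))) (at_right 0)"
  by (intro tendsto_intros ln0 c[OF entire_ja, unfolded ja0] c[OF entire_jb, unfolded jb0])
 have ee: "\<forall>\<^sub>F x in at_right (0::real). of_real (ps ja (x^2/4)) + \<i> * of_real (2 / pi * (ln x * (ps ja (x^2 / 4) - 1) + (euler_mascheroni - ln 2) * ps ja (x^2 / 4) + ps jb (x^2 / 4)))
   = hankel1_0 x - 2 * \<i> / of_real pi * of_real (ln x)"
  using eventually_at_right_less[of 0]
 proof eventually_elim
  case (elim x)
  have "2 / pi * (ln x * (ps ja (x^2 / 4) - 1) + (euler_mascheroni - ln 2) * ps ja (x^2 / 4) + ps jb (x^2 / 4))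
   = bessel_Y0 x - 2 / pi * ln x"
   unfolding bessel_Y0_ps using elim by (simp add: ln_div field_simps)
  then show ?case by (simp add: hankel1_0_def bessel_J0_ps field_simps)
 qed
 have "of_real 1 + \<i> * of_real (2 / pi * (0 + (euler_mascheroni - ln 2) * 1 + 0)) = 1 + 2 * \<i> / of_real pi * of_real (euler_mascheroni - ln 2)"
  by (simp add: field_simps)
 then show ?thesis using tendsto_cong[OF ee, THEN iffD1, OF l] by (simp only:)
qed

text \<open>The sum of the Hankel function and (2 i / pi) \<open>VV\<close> solves the Bessel
  system. The factor is dictated by the coefficient of ln x; with it the constants at the origin
  cancel as well, so \<open>ode_zero\<close> applies.\<close>

theorem hankel_VV: assumes x: "0 < x" shows "hankel1_0 x = - (2 * \<i> / of_real pi) * VV x"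
proof -
 let ?c = "2 * \<i> / of_real pi :: complex"
 have "hankel1_0 x + ?c * VV x = 0"
 proof (rule ode_zero[of "\<lambda>x. hankel1_0 x + ?c * VV x" "\<lambda>x. hankelP x + ?c * VP x", OF _ _ _ x])
  fix x :: real assume x: "0 < x"
  show "((\<lambda>x. hankel1_0 x + ?c * VV x) has_vector_derivative (hankelP x + ?c * VP x) / of_real x) (at x)"
   by (rule has_vector_derivative_eq_rhs[OF has_vector_derivative_add[OF hankel_deriv(1)[OF x] has_vector_derivative_mult_right[OF VV_deriv[OF x]]]])
    (simp only: add_divide_distrib times_divide_eq_right)
  show "((\<lambda>x. hankelP x + ?c * VP x) has_vector_derivative - of_real x * (hankel1_0 x + ?c * VV x)) (at x)"
   by (rule has_vector_derivative_eq_rhs[OF has_vector_derivative_add[OF hankel_deriv(2)[OF x] has_vector_derivative_mult_right[OF VP_deriv[OF x]]]])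
    (simp only: distrib_left mult_ac mult_minus_left mult_minus_right)
 next
  have "((\<lambda>x. (hankel1_0 x - ?c * of_real (ln x)) + ?c * (VV x + of_real (ln x))) \<longlongrightarrow>
   (1 + ?c * of_real (euler_mascheroni - ln 2)) + ?c * (of_real (ln 2 - euler_mascheroni) + \<i> * of_real (pi / 2))) (at_right 0)"
   by (intro tendsto_intros hankel_at_0 VV_at_0)
  moreover have "(1 + ?c * of_real (euler_mascheroni - ln 2)) + ?c * (of_real (ln 2 - euler_mascheroni) + \<i> * of_real (pi / 2)) = 0"
   by (simp add: field_simps)
  moreover have "(\<lambda>x. (hankel1_0 x - ?c * of_real (ln x)) + ?c * (VV x + of_real (ln x))) = (\<lambda>x. hankel1_0 x + ?c * VV x)"
   by (simp add: fun_eq_iff distrib_left)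
  ultimately show "((\<lambda>x. hankel1_0 x + ?c * VV x) \<longlongrightarrow> 0) (at_right 0)" by (simp only:)
 qed
 then show ?thesis by (simp add: add_eq_0_iff2)
qed

lemma green_VV:
 assumes "x1 \<noteq> 0 \<or> x2 \<noteq> 0" "0 < k"
 shows "green k x1 x2 = VV (k * sqrt (x1^2 + x2^2)) / of_real (2 * pi)"
proof -
 have "0 < sqrt (x1^2 + x2^2)" using assms(1) by (auto simp: sum_power2_gt_zero_iff)
 then have "0 < k * sqrt (x1^2 + x2^2)" using assms(2) by simp
 then show ?thesis unfolding green_def by (subst hankel_VV) (auto simp: field_simps)
qed

subsection \<open>Rotation invariance\<close>

text \<open>The angular derivative of the integrand is the v-derivative of exp (i gg x) sin (xi y),
  which vanishes at both ends: rotating the point amounts to moving along the contour.\<close>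

lemma Jc_rotation_deriv:
 assumes r: "0 < r" and th: "\<bar>\<theta>\<bar> < pi / 2"
 shows "((\<lambda>t. Jc rho (r * cos t) (r * sin t)) has_vector_derivative 0) (at \<theta>)"
proof -
 let ?X = "\<lambda>t. r * cos t" and ?Y = "\<lambda>t. r * sin t"
 have c: "0 < cos \<theta>" using th by (intro cos_gt_zero_pi) auto
 have "\<forall>\<^sub>F t in at \<theta>. cos \<theta> / 2 < cos t"
  using isCont_cos[of \<theta>] c by (intro order_tendstoD(1)) (auto simp: isCont_def)
 then obtain \<delta> where d: "0 < \<delta>" "\<And>t. t \<noteq> \<theta> ==> \<bar>t - \<theta>\<bar> < \<delta> ==> cos \<theta> / 2 < cos t"
  unfolding eventually_at dist_real_def by auto
 \<comment> \<open>Keeps X uniformly positive near the given angle, which the dominated derivative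
   formula requires.\<close>
 have d': "cos \<theta> / 2 \<le> cos t" if "t \<in> {\<theta> - \<delta><..<\<theta> + \<delta>}" for t
  using d(2)[of t] that c by (cases "t = \<theta>") (auto simp: abs_less_iff)
 let ?x = "r * cos \<theta>" and ?y = "r * sin \<theta>"
 let ?f = "\<lambda>v. of_real (- r * sin \<theta>) * ((\<i> * gg v * rho v) * ew v ?x * cx v ?y)
      - of_real (r * cos \<theta>) * ((xi v * rho v) * ew v ?x * sx v ?y)"
 have x0: "0 < ?x" using r c by simp
 have D: "((\<lambda>t. Jc rho (?X t) (?Y t)) has_vector_derivative integral\<^sup>L Mv ?f) (at \<theta>)"
 proof (rule Jc_curve_deriv(1)[OF hb_rho, of "\<theta> - \<delta>" "\<theta> + \<delta>" ?X "\<lambda>t. - r * sin t" ?Y "\<lambda>t. r * cos t" "r * (cos \<theta> / 2)" r \<theta>])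
  show "- 0 < r * (cos \<theta> / 2)" using r c by simp
  show "r * (cos \<theta> / 2) \<le> r * cos t" if "t \<in> {\<theta> - \<delta><..<\<theta> + \<delta>}" for t
   using d'[OF that] r by (intro mult_left_mono) auto
  show "\<bar>- r * sin t\<bar> \<le> r" "\<bar>r * cos t\<bar> \<le> r" "\<bar>r * sin t\<bar> \<le> r" for t
   using r by (simp_all add: abs_mult abs_sin_le_one abs_cos_le_one)
  show "\<theta> \<in> {\<theta> - \<delta><..<\<theta> + \<delta>}" using d by simp
 qed (auto intro!: derivative_eq_intros)
 have hg: "hb 0 (ig rho)" using hb_cmult[OF hb_ggm[OF hb_rho], of \<i>] by (simp add: mult.assoc)
 have hx: "hb 0 (xm rho)" by (rule hb_xim[OF hb_rho])
 have ax: "- 0 < ?x" using x0 by simp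
 have "integral\<^sup>L Mv ?f = 0 - 0"
 proof (rule integral_Mv_FTC[where F = "\<lambda>v. ew v ?x * sx v ?y"])
  fix v :: real assume v: "0 < v"
  have "((\<lambda>v. ew v ?x * sx v ?y) has_vector_derivative
    ew v ?x * ((- 2 * \<i> * gg v / eta v) * of_real ?y * cx v ?y)
    + (- 2 * of_real v * of_real ?x * ew v ?x) * sx v ?y) (at v)"
   by (rule has_vector_derivative_mult[OF wave_deriv_v])
  moreover have "- 2 * of_real v = - (xi v * rho v)" by (simp add: xi_def rho_def)
  ultimately show "((\<lambda>v. ew v ?x * sx v ?y) has_vector_derivative ?f v) (at v)"
   by (elim has_vector_derivative_eq_rhs) (simp add: rho_def field_simps)
 next
  show "continuous_on {0<..} ?f" by (intro continuous_intros hb_cont[OF hb_rho])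
  show "integrable Mv ?f"
   by (intro Bochner_Integration.integrable_diff integrable_mult_right wave_integrable[OF hg ax] wave_integrable[OF hx ax])
  have "continuous_on UNIV (\<lambda>v. ew v ?x * sx v ?y)" by (intro continuous_intros)
  then have "isCont (\<lambda>v. ew v ?x * sx v ?y) 0" by (simp add: continuous_on_eq_continuous_at)
  then have "((\<lambda>v. ew v ?x * sx v ?y) \<longlongrightarrow> exp (\<i> * gg 0 * of_real ?x) * sin (xi 0 * of_real ?y)) (at_right 0)"
   unfolding isCont_def by (rule filterlim_mono) (auto simp: at_within_le_at)
  then show "((\<lambda>v. ew v ?x * sx v ?y) \<longlongrightarrow> 0) (at_right 0)" by (simp add: xi_def)
  obtain K where K: "\<And>v x' y t. v > 0 ==> ?x \<le> x' ==> cmod t \<le> exp \<bar>y\<bar> ==>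
   cmod (1 * ew v x' * t) \<le> K * exp \<bar>y\<bar> / (1 + v^2)"
   by (rule wave_bound[OF hb_const[of 1] ax]) (rule that)
  show "((\<lambda>v. ew v ?x * sx v ?y) \<longlongrightarrow> 0) at_top"
   by (rule tendsto_zero_inverse_square[where K = "K * exp \<bar>?y\<bar>"]) (use K[OF _ order_refl norm_trig_xi(2)[of _ ?y]] in simp)
 qed
 with D show ?thesis by simp
qed

text \<open>\<open>Jc rho\<close> is constant on circular arcs in the right half-plane, so it can be
  evaluated where the arc meets the axis. This writes the radial Hankel kernel in Cartesian plane
  waves, ready for the lattice sum in x.\<close>

theorem Jc_rotation:
 assumes x: "0 < x" shows "Jc rho x y = VV (sqrt (x^2 + y^2))"
proof -
 let ?r = "sqrt (x^2 + y^2)" and ?t = "arctan (y / x)"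
 have r: "0 < ?r" using x by (simp add: sum_power2_gt_zero_iff)
 have e: "sqrt (1 + (y / x)^2) = ?r / x"
 proof -
  have "1 + (y / x)^2 = (x^2 + y^2) / x^2" using x by (simp add: field_simps)
  then show ?thesis using x by (simp add: real_sqrt_divide)
 qed
 have c: "?r * cos ?t = x" "?r * sin ?t = y"
  unfolding cos_arctan sin_arctan e using r x by auto
 have t: "?t \<in> {- (pi / 2)<..<pi / 2}" using arctan_bounded[of "y / x"] by simp
 have "norm (Jc rho (?r * cos ?t) (?r * sin ?t) - Jc rho (?r * cos 0) (?r * sin 0)) \<le> 0 * \<bar>?t - 0\<bar>"
  by (rule vector_derivative_bound[where S = "{- (pi / 2)<..<pi / 2}" and f' = "\<lambda>_. 0"])
   (use t pi_gt_zero in \<open>auto intro!: has_vector_derivative_at_within[OF Jc_rotation_deriv[OF r]]\<close>)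
 then show ?thesis unfolding c by (simp add: VV_def)
qed

text \<open>\<open>VV\<close> is logarithmic at 0, but VP' = - x VV stays bounded, so
  \<open>VP\<close> is bounded up to the origin. The estimates for the singular kernels rely on this
  contrast.\<close>

lemma VV_bound:
 assumes "0 < R" obtains C where "0 \<le> C" "\<And>x. 0 < x ==> x \<le> R ==> cmod (VV x) \<le> C + \<bar>ln x\<bar>"
  "\<And>x. 0 < x ==> x \<le> R ==> cmod (VP x) \<le> C" "\<And>x. 0 < x ==> x \<le> R ==> x * cmod (VV x) \<le> C"
proof -
 let ?L = "of_real (ln 2 - euler_mascheroni) + \<i> * of_real (pi / 2) :: complex"
 have "\<forall>\<^sub>F x in at_right 0. dist (VV x + of_real (ln x)) ?L < 1" by (rule tendstoD[OF VV_at_0]) simp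
 then obtain b where b: "0 < b" "\<And>x. 0 < x ==> x < b ==> dist (VV x + of_real (ln x)) ?L < 1"
  by (auto simp: eventually_at_right_field)
 have "continuous_on {b / 2..R} VV"
  using b by (intro continuous_at_imp_continuous_on ballI has_vector_derivative_continuous[OF VV_deriv]) auto
 then have "bounded (VV ` {b / 2..R})" by (intro compact_imp_bounded compact_continuous_image) auto
 then obtain B where B: "\<And>x. x \<in> {b / 2..R} ==> cmod (VV x) \<le> B" unfolding bounded_iff by blast
 define C1 where "C1 = cmod ?L + 1 + \<bar>B\<bar>"
 have C1: "cmod (VV x) \<le> C1 + \<bar>ln x\<bar>" if x: "0 < x" "x \<le> R" for x
 proof (cases "x < b")
  case True
  have "cmod (VV x) \<le> cmod (VV x + of_real (ln x) - ?L) + cmod ?L + cmod (of_real (ln x) :: complex)"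
  proof -
   have "cmod (p + q - l) \<le> cmod p + cmod q + cmod l" for p q l :: complex
    using norm_triangle_ineq[of p q] norm_triangle_ineq4[of "p + q" l] by linarith
   from this[of "VV x + of_real (ln x) - ?L" ?L "of_real (ln x)"] show ?thesis
    by (simp only: diff_add_cancel add_diff_cancel_right')
  qed
  then show ?thesis using b(2)[OF x(1) True] by (simp add: C1_def dist_norm)
 next
  case False
  then show ?thesis using B[of x] x b(1) norm_ge_zero[of ?L] unfolding C1_def by (simp del: norm_ge_zero)
 qed
 define C2 where "C2 = R * C1 + R * R + 1"
 have C10: "0 \<le> C1" by (simp add: C1_def)
 have xl: "x * cmod (VV x) \<le> C2" if x: "0 < x" "x \<le> R" for x
 proof -
  have "x * \<bar>ln x\<bar> \<le> 1 + x * x"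
  proof -
   have "ln x \<le> x" "ln (1 / x) \<le> 1 / x" using x by (intro ln_bound; simp)+
   then have "\<bar>ln x\<bar> \<le> x + 1 / x" using x by (auto simp: ln_div abs_if intro: add_increasing add_increasing2)
   then have "x * \<bar>ln x\<bar> \<le> x * (x + 1 / x)" using x by (intro mult_left_mono) auto
   then show ?thesis using x by (simp add: distrib_left)
  qed
  moreover have "x * cmod (VV x) \<le> x * (C1 + \<bar>ln x\<bar>)" using C1[OF x] x by (intro mult_left_mono) auto
  moreover have "x * C1 \<le> R * C1" "x * x \<le> R * R" using x C10 by (auto intro: mult_right_mono mult_mono)
  ultimately show ?thesis unfolding C2_def distrib_left by linarith
 qed
 have C20: "0 \<le> C2" using assms C10 by (simp add: C2_def)
 have P: "cmod (VP x) \<le> cmod (VP R) + C2 * R" if x: "0 < x" "x \<le> R" for x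
 proof -
  have "norm (VP x - VP R) \<le> C2 * \<bar>x - R\<bar>"
  proof (rule vector_derivative_bound[where S = "{0<..R}" and f' = "\<lambda>x. - of_real x * VV x"])
   show "(VP has_vector_derivative - of_real t * VV t) (at t within {0<..R})" if "t \<in> {0<..R}" for t
    by (rule has_vector_derivative_at_within[OF VP_deriv]) (use that in auto)
   show "norm (- of_real t * VV t) \<le> C2" if "t \<in> {0<..R}" for t using xl[of t] that by (simp add: norm_mult)
  qed (use x assms in auto)
  also have "\<dots> \<le> C2 * R" using x C20 by (intro mult_left_mono) auto
  finally show ?thesis using norm_triangle_sub[of "VP x" "VP R"] by simp
 qed
 show ?thesis
 proof (rule that[of "C1 + C2 + (cmod (VP R) + C2 * R)"])
  have nn: "0 \<le> C2 * R" "0 \<le> cmod (VP R)" using C20 assms by auto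
  show "0 \<le> C1 + C2 + (cmod (VP R) + C2 * R)" using C10 C20 nn by simp
  fix x assume x: "0 < x" "x \<le> R"
  show "cmod (VV x) \<le> C1 + C2 + (cmod (VP R) + C2 * R) + \<bar>ln x\<bar>" using C1[OF x] C20 nn by linarith
  show "cmod (VP x) \<le> C1 + C2 + (cmod (VP R) + C2 * R)" using P[OF x] C10 C20 by linarith
  show "x * cmod (VV x) \<le> C1 + C2 + (cmod (VP R) + C2 * R)" using xl[OF x] C10 nn by linarith
 qed
qed

lemma VV_at_top: "(VV \<longlongrightarrow> 0) at_top"
proof -
 obtain K where K: "0 \<le> K" "\<And>v x y t. v > 0 ==> 1 \<le> x ==> cmod t \<le> exp \<bar>y\<bar> ==>
   cmod (rho v * ew v x * t) \<le> K * exp \<bar>y\<bar> / (1 + v^2)"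
   by (rule wave_bound[OF hb_rho, of 1]) (simp, rule that)
 have "((\<lambda>x. LINT v|Mv. rho v * ew v x) \<longlongrightarrow> (LINT v|Mv. 0)) at_top"
 proof (rule integral_dominated_convergence_at_top[where w = "\<lambda>v. K * (1 / (1 + v^2))"])
  show "integrable Mv (\<lambda>v. K * (1 / (1 + v^2)))" by (intro integrable_mult_right integrable_inverse_square_Mv)
  show "\<forall>\<^sub>F x in at_top. AE v in Mv. norm (rho v * ew v x) \<le> K * (1 / (1 + v^2))"
   using eventually_ge_at_top[of 1]
  proof eventually_elim
   case (elim x)
   show ?case by (rule AE_I2) (use K(2)[of _ x 1 0] elim in simp)
  qed
  show "(\<lambda>v. rho v * ew v x) \<in> borel_measurable Mv" for x
   by (intro measurable_Mv continuous_intros hb_cont[OF hb_rho])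
  show "AE v in Mv. ((\<lambda>x. rho v * ew v x) \<longlongrightarrow> 0) at_top"
  proof (rule AE_I2)
   fix v assume "v \<in> space Mv" then have v: "0 < v" by simp
   show "((\<lambda>x. rho v * ew v x) \<longlongrightarrow> 0) at_top"
   proof (rule Lim_null_comparison)
    show "\<forall>\<^sub>F x in at_top. norm (rho v * ew v x) \<le> 2 * exp (- x * v^2)"
     using norm_rho_le[of v] by (auto simp: norm_mult norm_wave simp del: norm_exp_eq_Re intro!: mult_right_mono)
    show "((\<lambda>x. 2 * exp (- x * v^2)) \<longlongrightarrow> 0) at_top" using v by real_asymp
   qed
  qed
 qed auto
 then show ?thesis by (simp add: VV_def[abs_def] Jc_def)
qed

section \<open>The quasi-periodic Green function\<close>

text \<open>Ratio of successive lattice terms: translation by d multiplies the plane wave by exp (i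
  gg k d), and the quasi-periodic phase contributes exp (- i a d).\<close>

definition qf :: "real => real => real => real => complex" where
 "qf d k a v = exp (\<i> * (gg v * of_real (k * d) - of_real (a * d)))"

text \<open>Geometric series over the translates m >= 1, already summed under the integral. The
  leading factor \<open>qf\<close> gives decay rate k d in v, hence validity for all x > -
  d.\<close>

definition hf :: "real => real => real => real => complex" where
 "hf d k a v = rho v * (qf d k a v / (1 - qf d k a v))"

text \<open>The exponential is \<open>qf\<close> at v = 0, the only parameter where its modulus is
  1.\<close>

definition nonres :: "real => real => real => bool" where
 "nonres d k a \<longleftrightarrow> 0 < d \<and> 0 < k \<and> exp (\<i> * of_real ((k - a) * d)) \<noteq> 1"

lemma nonres_of_not_wood:
 assumes "0 < d" "0 < k" "\<not> wood d \<alpha> k" shows "nonres d k \<alpha>" "nonres d k (- \<alpha>)"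
proof -
 have "exp (\<i> * of_real ((k - a) * d)) \<noteq> 1" if a: "a = \<alpha> \<or> a = - \<alpha>" for a
 proof
  assume "exp (\<i> * of_real ((k - a) * d)) = 1"
  then obtain n :: int where "(k - a) * d = of_int (2 * n) * pi" by (auto simp: exp_eq_1)
  then have "k = a + 2 * pi / d * of_int n" using assms(1) by (simp add: field_simps)
  then have "k = alpha_n d \<alpha> n \<or> k = - alpha_n d \<alpha> (- n)" using a by (auto simp: alpha_n_def)
  then have "\<exists>m. k^2 = (alpha_n d \<alpha> m)^2" by (auto intro: exI[of _ n] exI[of _ "- n"])
  then show False using assms(3) by (simp add: wood_def)
 qed
 from this[of \<alpha>] this[of "- \<alpha>"] show "nonres d k \<alpha>" "nonres d k (- \<alpha>)"
  using assms unfolding nonres_def by blast+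
qed

lemma norm_qf: "cmod (qf d k a v) = exp (- (k * d) * v^2)"
 by (simp add: qf_def norm_exp_eq_Re gg_def)

lemma continuous_on_qf [continuous_intros]: "continuous_on S (qf d k a)"
 unfolding qf_def[abs_def] by (intro continuous_intros)

text \<open>Compactness gives a positive minimum on [0, 1]; beyond 1 the modulus of
  \<open>qf\<close> is at most exp (- k d).\<close>

lemma one_minus_qf:
 assumes "nonres d k a"
 obtains c where "0 < c" "\<And>v. 0 \<le> v ==> c \<le> cmod (1 - qf d k a v)"
proof -
 have d: "0 < d" "0 < k" and ne: "exp (\<i> * of_real ((k - a) * d)) \<noteq> 1" using assms by (auto simp: nonres_def)
 have "\<exists>v\<in>{0..1}. \<forall>u\<in>{0..1}. cmod (1 - qf d k a v) \<le> cmod (1 - qf d k a u)"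
  by (rule continuous_attains_inf) (auto intro!: continuous_intros)
 then obtain w where w: "w \<in> {0..1}" "\<And>u. u \<in> {0..1} ==> cmod (1 - qf d k a w) \<le> cmod (1 - qf d k a u)" by blast
 have lt: "cmod (qf d k a v) < 1" if "v \<noteq> 0" for v
  using d that by (simp add: norm_qf)
 have "qf d k a w \<noteq> 1"
 proof (cases "w = 0")
  case True
  have "qf d k a 0 = exp (\<i> * of_real ((k - a) * d))" by (simp add: qf_def gg_def algebra_simps)
  then show ?thesis using ne True by simp
 next
  case False
  then show ?thesis using lt[of w] by auto
 qed
 then have p1: "0 < cmod (1 - qf d k a w)" by simp
 have p2: "0 < 1 - exp (- (k * d))" using d by simp
 show ?thesis
 proof (rule that[of "min (cmod (1 - qf d k a w)) (1 - exp (- (k * d)))"])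
  show "0 < min (cmod (1 - qf d k a w)) (1 - exp (- (k * d)))" using p1 p2 by simp
  fix v :: real assume v: "0 \<le> v"
  show "min (cmod (1 - qf d k a w)) (1 - exp (- (k * d))) \<le> cmod (1 - qf d k a v)"
  proof (cases "v \<le> 1")
   case True then show ?thesis using w(2)[of v] v by auto
  next
   case False
   then have "1 \<le> v^2" by simp
   then have "k * d * 1 \<le> k * d * v^2" using d by (intro mult_left_mono) auto
   then have "cmod (qf d k a v) \<le> exp (- (k * d))" by (simp add: norm_qf)
   then show ?thesis using norm_triangle_ineq2[of 1 "qf d k a v"] by simp
  qed
 qed
qed

lemma hb_hf: assumes "nonres d k a" shows "hb (k * d) (hf d k a)"
proof -
 obtain c where c: "0 < c" "\<And>v. 0 \<le> v ==> c \<le> cmod (1 - qf d k a v)"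
  by (rule one_minus_qf[OF assms]) (rule that)
 show ?thesis unfolding hb_def
 proof (intro conjI exI[of _ "2 / c"] exI[of _ "0::nat"] allI impI)
  have "1 - qf d k a v \<noteq> 0" if "0 < v" for v using c(1) c(2)[of v] that by auto
  then show "continuous_on {0<..} (hf d k a)"
   unfolding hf_def[abs_def] by (intro continuous_intros hb_cont[OF hb_rho]) auto
  fix v :: real assume v: "0 < v"
  have p: "0 < cmod (1 - qf d k a v)" using c(1) c(2)[of v] v by linarith
  have "cmod (hf d k a v) \<le> 2 * (exp (- (k * d) * v^2) / c)"
   unfolding hf_def norm_mult norm_divide norm_qf using c(1) c(2)[of v] v norm_rho_le[of v] p
   by (intro mult_mono divide_left_mono mult_pos_pos) auto
  then show "cmod (hf d k a v) \<le> 2 / c * (1 + v^2) ^ 0 * exp (- (k * d) * v^2)" by simp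
 qed
qed

lemma green_even: "green k (- x) y = green k x y" "green k x (- y) = green k x y"
 by (simp_all add: green_def)

lemma green_Jc: assumes "0 < x" "0 < k" shows "green k x y = Jc rho (k * x) (k * y) / of_real (2 * pi)"
proof -
 have "sqrt ((k * x)^2 + (k * y)^2) = k * sqrt (x^2 + y^2)"
  using assms(2) by (simp add: power_mult_distrib real_sqrt_mult flip: distrib_left)
 then show ?thesis using green_VV[of x y k] Jc_rotation[of "k * x" "k * y"] assms by simp
qed

text \<open>The finite geometric sum differs from \<open>hf\<close> by the factor 1 - qf^M, bounded
  by 2 and tending to 1 for v > 0. Dominated convergence under the integral thus replaces a direct
  summation of the slowly decaying Hankel terms.\<close>

lemma green_sum_lim:
 assumes nr: "nonres d k a" and x: "- d < x"
 shows "(\<lambda>M. \<Sum>m=1..M. exp (- \<i> * of_real (a * real m * d)) * green k (x + real m * d) y)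
  \<longlonglongrightarrow> Jc (hf d k a) (k * x) (k * y) / of_real (2 * pi)"
proof -
 have dk: "0 < d" "0 < k" using nr by (auto simp: nonres_def)
 obtain c where c: "0 < c" "\<And>v. 0 \<le> v ==> c \<le> cmod (1 - qf d k a v)"
  by (rule one_minus_qf[OF nr]) (rule that)
 have n1: "qf d k a v \<noteq> 1" if "0 < v" for v using c(1) c(2)[of v] that by auto
 let ?q = "qf d k a" and ?w = "\<lambda>v. ew v (k * x) * cx v (k * y)"
 have ax: "- (k * d) < k * x" using mult_strict_left_mono[OF x dk(2)] by simp
 have trm: "exp (- \<i> * of_real (a * real m * d)) * green k (x + real m * d) y = (LINT v|Mv. rho v * ?q v ^ m * ?w v) / of_real (2 * pi)
   \<and> integrable Mv (\<lambda>v. rho v * ?q v ^ m * ?w v)" if m: "1 \<le> m" for m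
 proof -
  have "d * 1 \<le> d * real m" using m dk by (intro mult_left_mono) auto
  then have pos: "0 < x + real m * d" using x by (simp add: mult.commute)
  have e: "exp (- \<i> * of_real (a * real m * d)) * (rho v * ew v (k * (x + real m * d)) * cx v (k * y))
   = rho v * ?q v ^ m * ?w v" for v
  proof -
   have "?q v ^ m = exp (of_nat m * (\<i> * (gg v * of_real (k * d) - of_real (a * d))))" unfolding qf_def by (simp only: exp_of_nat_mult)
   moreover have "exp (- \<i> * of_real (a * real m * d)) * ew v (k * (x + real m * d))
     = exp (of_nat m * (\<i> * (gg v * of_real (k * d) - of_real (a * d)))) * ew v (k * x)"
    unfolding exp_add[symmetric] by (rule arg_cong[of _ _ exp]) (simp add: algebra_simps)
   ultimately show ?thesis by (simp add: mult_ac)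
  qed
  have p': "- 0 < k * (x + real m * d)" using pos dk by simp
  have "exp (- \<i> * of_real (a * real m * d)) * Jc rho (k * (x + real m * d)) (k * y) = (LINT v|Mv. rho v * ?q v ^ m * ?w v)"
   by (simp only: Jc_def Bochner_Integration.integral_mult_right_zero[symmetric] e)
  moreover have "integrable Mv (\<lambda>v. rho v * ?q v ^ m * ?w v)"
   using integrable_mult_right[OF wave_integrable(1)[OF hb_rho p', of "k * y"], of "exp (- \<i> * of_real (a * real m * d))"]
   unfolding e .
  ultimately show ?thesis using green_Jc[OF pos dk(2), of y] by simp
 qed
 have ih: "integrable Mv (\<lambda>v. hf d k a v * ?w v)"
  using wave_integrable(1)[OF hb_hf[OF nr] ax, of "k * y"] unfolding mult.assoc .
 have sumM: "(\<Sum>m=1..M. exp (- \<i> * of_real (a * real m * d)) * green k (x + real m * d) y)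
   = (LINT v|Mv. hf d k a v * ?w v * (1 - ?q v ^ M)) / of_real (2 * pi)" for M
 proof -
  have "(\<Sum>m=1..M. exp (- \<i> * of_real (a * real m * d)) * green k (x + real m * d) y)
    = (\<Sum>m=1..M. (LINT v|Mv. rho v * ?q v ^ m * ?w v) / of_real (2 * pi))" using trm by (intro sum.cong) auto
  also have "\<dots> = (\<Sum>m=1..M. (LINT v|Mv. rho v * ?q v ^ m * ?w v)) / of_real (2 * pi)" by (simp only: sum_divide_distrib)
  also have "(\<Sum>m=1..M. (LINT v|Mv. rho v * ?q v ^ m * ?w v)) = (LINT v|Mv. (\<Sum>m=1..M. rho v * ?q v ^ m * ?w v))"
   using trm by (intro Bochner_Integration.integral_sum[symmetric]) auto
  also have "\<dots> = (LINT v|Mv. hf d k a v * ?w v * (1 - ?q v ^ M))"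
  proof (rule Bochner_Integration.integral_cong[OF refl])
   fix v assume "v \<in> space Mv" then have v: "0 < v" by simp
   have g: "(\<Sum>m=1..M. z ^ m) = z / (1 - z) * (1 - z ^ M)" if "z \<noteq> 1" for z :: complex
   proof -
    have "(1 - z) * (\<Sum>m=1..M. z ^ m) = z * (1 - z ^ M)"
    proof (induction M)
     case (Suc M)
     have "(\<Sum>m=1..Suc M. z ^ m) = (\<Sum>m=1..M. z ^ m) + z ^ Suc M" by simp
     then have "(1 - z) * (\<Sum>m=1..Suc M. z ^ m) = z * (1 - z ^ M) + (1 - z) * z ^ Suc M"
      by (simp only: distrib_left Suc.IH)
     also have "\<dots> = z * (1 - z ^ Suc M)" by (simp add: algebra_simps)
     finally show ?case .
    qed simp
    then have "(\<Sum>m=1..M. z ^ m) = z * (1 - z ^ M) / (1 - z)" using that by (simp add: eq_divide_eq mult.commute)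
    then show ?thesis by simp
   qed
   have "(\<Sum>m=1..M. rho v * ?q v ^ m * ?w v) = rho v * ?w v * (\<Sum>m=1..M. ?q v ^ m)"
    unfolding sum_distrib_left by (rule sum.cong[OF refl]) (simp only: mult_ac)
   then show "(\<Sum>m=1..M. rho v * ?q v ^ m * ?w v) = hf d k a v * ?w v * (1 - ?q v ^ M)"
    unfolding g[OF n1[OF v]] hf_def by (simp only: mult_ac)
  qed
  finally show ?thesis .
 qed
 have "(\<lambda>M. LINT v|Mv. hf d k a v * ?w v * (1 - ?q v ^ M)) \<longlonglongrightarrow> (LINT v|Mv. hf d k a v * ?w v)"
 proof (rule integral_dominated_convergence[where w = "\<lambda>v. 2 * cmod (hf d k a v * ?w v)"])
  show "(\<lambda>v. hf d k a v * ?w v) \<in> borel_measurable Mv" using ih by (rule borel_measurable_integrable)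
  show "(\<lambda>v. hf d k a v * ?w v * (1 - ?q v ^ M)) \<in> borel_measurable Mv" for M
   by (intro measurable_Mv continuous_intros hb_cont[OF hb_hf[OF nr]])
  show "integrable Mv (\<lambda>v. 2 * cmod (hf d k a v * ?w v))" using ih by simp
  have lt: "cmod (?q v) < 1" if "v \<noteq> 0" for v using dk that by (simp add: norm_qf)
  show "AE v in Mv. (\<lambda>M. hf d k a v * ?w v * (1 - ?q v ^ M)) \<longlonglongrightarrow> hf d k a v * ?w v"
  proof (rule AE_I2)
   fix v assume v: "v \<in> space Mv"
   have "(\<lambda>M. ?q v ^ M) \<longlonglongrightarrow> 0" by (rule LIMSEQ_power_zero[OF lt]) (use v in simp)
   then have "(\<lambda>M. hf d k a v * ?w v * (1 - ?q v ^ M)) \<longlonglongrightarrow> hf d k a v * ?w v * (1 - 0)"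
    by (intro tendsto_mult[OF tendsto_const] tendsto_diff[OF tendsto_const])
   then show "(\<lambda>M. hf d k a v * ?w v * (1 - ?q v ^ M)) \<longlonglongrightarrow> hf d k a v * ?w v" by simp
  qed
  show "AE v in Mv. norm (hf d k a v * ?w v * (1 - ?q v ^ M)) \<le> 2 * cmod (hf d k a v * ?w v)" for M
  proof (rule AE_I2)
   fix v assume "v \<in> space Mv"
   then have "cmod (?q v ^ M) \<le> 1" using lt[of v] by (simp add: norm_power power_le_one)
   then have "cmod (1 - ?q v ^ M) \<le> 2" using norm_triangle_ineq4[of 1 "?q v ^ M"] by simp
   then show "norm (hf d k a v * ?w v * (1 - ?q v ^ M)) \<le> 2 * cmod (hf d k a v * ?w v)"
    unfolding norm_mult[of "hf d k a v * ?w v"] using mult_left_mono[of "cmod (1 - ?q v ^ M)" 2 "cmod (hf d k a v * ?w v)"] by simp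
  qed
 qed
 then have "(\<lambda>M. (LINT v|Mv. hf d k a v * ?w v * (1 - ?q v ^ M)) / of_real (2 * pi)) \<longlonglongrightarrow> (LINT v|Mv. hf d k a v * ?w v) / of_real (2 * pi)"
  by (rule tendsto_divide[OF _ tendsto_const]) simp
 moreover have "(LINT v|Mv. hf d k a v * ?w v) = Jc (hf d k a) (k * x) (k * y)" unfolding Jc_def by (simp only: mult.assoc)
 ultimately show ?thesis unfolding sumM by (simp only:)
qed

definition gqs :: "real => real => real => real => real => nat => complex" where
 "gqs d \<alpha> k x y M = (\<Sum>m\<in>{- int M..int M}. exp (- \<i> * of_real (\<alpha> * of_int m * d)) * green k (x + of_int m * d) y)"

lemma green_q_gqs: "green_q d \<alpha> k x y = lim (gqs d \<alpha> k x y)"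
 unfolding green_q_def gqs_def[abs_def] ..

lemma int_interval_Suc: "{- int (Suc M)..int (Suc M)} = insert (int (Suc M)) (insert (- int (Suc M)) {- int M..int M})"
 by auto

lemma sum_int_interval_Suc:
 fixes g :: "int => complex"
 shows "(\<Sum>m\<in>{- int (Suc M)..int (Suc M)}. g m) = g (int (Suc M)) + (g (- int (Suc M)) + (\<Sum>m\<in>{- int M..int M}. g m))"
proof -
 have "int (Suc M) \<notin> insert (- int (Suc M)) {- int M..int M}" "- int (Suc M) \<notin> {- int M..int M}" by auto
 then show ?thesis unfolding int_interval_Suc by (simp only: sum.insert finite_insert finite_atLeastAtMost_int not_False_eq_True)
qed

lemma sum_int_interval_shift:
 fixes f :: "int => complex"
 shows "(\<Sum>m\<in>{- int M..int M}. f (m + 1)) = (\<Sum>m\<in>{- int M..int M}. f m) + f (int (Suc M)) - f (- int M)"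
proof (induction M)
 case (Suc M)
 have e: "- int (Suc M) + 1 = - int M" "int (Suc M) + 1 = int (Suc (Suc M))" by simp_all
 show ?case unfolding sum_int_interval_Suc Suc.IH e by simp
qed simp

lemma gqs_split:
 "gqs d \<alpha> k x y M = green k x y + (\<Sum>m=1..M. exp (- \<i> * of_real (\<alpha> * real m * d)) * green k (x + real m * d) y)
   + (\<Sum>m=1..M. exp (- \<i> * of_real ((- \<alpha>) * real m * d)) * green k (- x + real m * d) y)"
proof (induction M)
 case 0 show ?case by (simp add: gqs_def)
next
 case (Suc M)
 have g: "green k (x + of_int (- int (Suc M)) * d) y = green k (- x + real (Suc M) * d) y"
  using green_even(1)[of k "x + of_int (- int (Suc M)) * d" y] by (simp add: algebra_simps)
 have "gqs d \<alpha> k x y (Suc M) = exp (- \<i> * of_real (\<alpha> * of_int (int (Suc M)) * d)) * green k (x + of_int (int (Suc M)) * d) y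
   + (exp (- \<i> * of_real (\<alpha> * of_int (- int (Suc M)) * d)) * green k (x + of_int (- int (Suc M)) * d) y + gqs d \<alpha> k x y M)"
  unfolding gqs_def by (rule sum_int_interval_Suc)
 also have "\<dots> = exp (- \<i> * of_real (\<alpha> * real (Suc M) * d)) * green k (x + real (Suc M) * d) y
   + (exp (- \<i> * of_real ((- \<alpha>) * real (Suc M) * d)) * green k (- x + real (Suc M) * d) y + gqs d \<alpha> k x y M)"
  unfolding g by (simp del: of_nat_Suc)
 finally show ?case unfolding Suc.IH by (simp del: of_nat_Suc)
qed

text \<open>The lattice sum without its term m = 0. Evenness of the Hankel kernel turns the left
  half into a right half with x and alpha negated.\<close>

definition Rq :: "real => real => real => real => real => complex" where
 "Rq d \<alpha> k x y = (Jc (hf d k \<alpha>) (k * x) (k * y) + Jc (hf d k (- \<alpha>)) (k * (- x)) (k * y)) / of_real (2 * pi)"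

context
 fixes d \<alpha> k :: real
 assumes d: "0 < d" and k: "0 < k" and nw: "\<not> wood d \<alpha> k"
begin

lemma gqs_lim: assumes "\<bar>x\<bar> < d" shows "gqs d \<alpha> k x y \<longlonglongrightarrow> green k x y + Rq d \<alpha> k x y"
proof -
 have "gqs d \<alpha> k x y \<longlonglongrightarrow> green k x y + Jc (hf d k \<alpha>) (k * x) (k * y) / of_real (2 * pi) + Jc (hf d k (- \<alpha>)) (k * (- x)) (k * y) / of_real (2 * pi)"
  unfolding gqs_split[abs_def] using assms
  by (intro tendsto_add tendsto_const green_sum_lim nonres_of_not_wood d k nw) auto
 then show ?thesis by (simp add: Rq_def add_divide_distrib add.assoc)
qed

lemma green_q_eq: assumes "\<bar>x\<bar> < d" shows "green_q d \<alpha> k x y = green k x y + Rq d \<alpha> k x y"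
 unfolding green_q_gqs by (rule limI[OF gqs_lim[OF assms]])

lemma green_decay: "(\<lambda>M. green k (x + real M * d) y) \<longlonglongrightarrow> 0"
proof (rule Lim_transform_eventually)
 have "filterlim (\<lambda>M. k * sqrt ((x + real M * d)^2 + y^2)) at_top sequentially"
 proof (rule filterlim_at_top_mono)
  show "filterlim (\<lambda>M. k * (x + real M * d)) at_top sequentially"
   using d k by real_asymp
  have "x + real M * d \<le> sqrt ((x + real M * d)^2 + y^2)" for M
   by (rule real_le_rsqrt) simp
  then show "\<forall>\<^sub>F M in sequentially. k * (x + real M * d) \<le> k * sqrt ((x + real M * d)^2 + y^2)"
   using k by (intro always_eventually allI mult_left_mono) auto
 qed
 from filterlim_compose[OF VV_at_top this]
 show "(\<lambda>M. VV (k * sqrt ((x + real M * d)^2 + y^2)) / of_real (2 * pi)) \<longlonglongrightarrow> 0"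
  by (rule tendsto_divide_zero)
 have "filterlim (\<lambda>M. x + real M * d) at_top sequentially" using d by real_asymp
 then have "\<forall>\<^sub>F M in sequentially. 0 < x + real M * d" by (rule filterlim_at_top_dense[THEN iffD1, rule_format])
 then show "\<forall>\<^sub>F M in sequentially. VV (k * sqrt ((x + real M * d)^2 + y^2)) / of_real (2 * pi) = green k (x + real M * d) y"
  by eventually_elim (use green_VV k in auto)
qed

text \<open>A translation by d exchanges one term at each end of the symmetric partial sum. These
  terms tend to 0 by \<open>green_decay\<close>, so quasi-periodicity follows without absolute
  convergence.\<close>

lemma gqs_shift:
 "gqs d \<alpha> k (x + d) y M = (qd \<alpha> d) * (gqs d \<alpha> k x y M
   + (exp (- \<i> * of_real (\<alpha> * real (Suc M) * d)) * green k (x + real (Suc M) * d) y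
    - exp (\<i> * of_real (\<alpha> * real M * d)) * green k (- x + real M * d) y))"
proof -
 let ?f = "\<lambda>m::int. exp (- \<i> * of_real (\<alpha> * of_int m * d)) * green k (x + of_int m * d) y"
 have "gqs d \<alpha> k (x + d) y M = (\<Sum>m\<in>{- int M..int M}. (qd \<alpha> d) * ?f (m + 1))"
  unfolding gqs_def
 proof (rule sum.cong[OF refl])
  fix m
  have "exp (- \<i> * of_real (\<alpha> * of_int m * d)) = (qd \<alpha> d) * exp (- \<i> * of_real (\<alpha> * of_int (m + 1) * d))"
   unfolding exp_add[symmetric] by (rule arg_cong[of _ _ exp]) (simp add: algebra_simps)
  moreover have "x + d + of_int m * d = x + of_int (m + 1) * d" by (simp add: algebra_simps)
  ultimately show "exp (- \<i> * of_real (\<alpha> * of_int m * d)) * green k (x + d + of_int m * d) y = (qd \<alpha> d) * ?f (m + 1)"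
   by (simp only: mult.assoc)
 qed
 also have "\<dots> = (qd \<alpha> d) * (\<Sum>m\<in>{- int M..int M}. ?f (m + 1))" by (simp only: sum_distrib_left)
 also have "(\<Sum>m\<in>{- int M..int M}. ?f (m + 1)) = (\<Sum>m\<in>{- int M..int M}. ?f m) + ?f (int (Suc M)) - ?f (- int M)"
  by (rule sum_int_interval_shift)
 also have "?f (int (Suc M)) = exp (- \<i> * of_real (\<alpha> * real (Suc M) * d)) * green k (x + real (Suc M) * d) y"
  by (simp only: of_int_of_nat_eq)
 also have "?f (- int M) = exp (\<i> * of_real (\<alpha> * real M * d)) * green k (- x + real M * d) y"
 proof -
  have "x + of_int (- int M) * d = - (- x + real M * d)" by simp
  then have "green k (x + of_int (- int M) * d) y = green k (- x + real M * d) y"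
   by (simp only: green_even)
  then show ?thesis by simp
 qed
 also have "(\<Sum>m\<in>{- int M..int M}. ?f m) = gqs d \<alpha> k x y M" by (simp only: gqs_def)
 also have "(qd \<alpha> d) * (gqs d \<alpha> k x y M + exp (- \<i> * of_real (\<alpha> * real (Suc M) * d)) * green k (x + real (Suc M) * d) y
    - exp (\<i> * of_real (\<alpha> * real M * d)) * green k (- x + real M * d) y) = (qd \<alpha> d) * (gqs d \<alpha> k x y M
   + (exp (- \<i> * of_real (\<alpha> * real (Suc M) * d)) * green k (x + real (Suc M) * d) y
    - exp (\<i> * of_real (\<alpha> * real M * d)) * green k (- x + real M * d) y))" by (simp only: add_diff_eq)
 finally show ?thesis .
qed

lemma gqs_shift_lim: "gqs d \<alpha> k (x + d) y \<longlonglongrightarrow> (qd \<alpha> d) * L \<longleftrightarrow> gqs d \<alpha> k x y \<longlonglongrightarrow> L"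
proof -
 let ?e = "\<lambda>M. exp (- \<i> * of_real (\<alpha> * real (Suc M) * d)) * green k (x + real (Suc M) * d) y
    - exp (\<i> * of_real (\<alpha> * real M * d)) * green k (- x + real M * d) y"
 let ?E = "(qd \<alpha> d)"
 have n: "cmod (exp (\<i> * of_real t)) = 1" "cmod (exp (- \<i> * of_real t)) = 1" for t by (simp_all add: norm_exp_eq_Re)
 have "(\<lambda>M. exp (- \<i> * of_real (\<alpha> * real (Suc M) * d)) * green k (x + real (Suc M) * d) y) \<longlonglongrightarrow> 0"
  by (rule tendsto_norm_zero_cancel) (simp only: norm_mult n mult_1_left, rule tendsto_norm_zero, rule LIMSEQ_Suc[OF green_decay])
 moreover have "(\<lambda>M. exp (\<i> * of_real (\<alpha> * real M * d)) * green k (- x + real M * d) y) \<longlonglongrightarrow> 0"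
  by (rule tendsto_norm_zero_cancel) (simp only: norm_mult n mult_1_left, rule tendsto_norm_zero, rule green_decay)
 ultimately have "?e \<longlonglongrightarrow> 0 - 0" by (rule tendsto_diff)
 then have e: "?e \<longlonglongrightarrow> 0" by (simp only: diff_zero)
 have nz: "?E \<noteq> 0" by simp
 show ?thesis
 proof
  assume "gqs d \<alpha> k x y \<longlonglongrightarrow> L"
  from tendsto_mult[OF tendsto_const[of ?E] tendsto_add[OF this e]]
  show "gqs d \<alpha> k (x + d) y \<longlonglongrightarrow> ?E * L" unfolding gqs_shift[abs_def] by simp
 next
  assume "gqs d \<alpha> k (x + d) y \<longlonglongrightarrow> ?E * L"
  from tendsto_diff[OF tendsto_divide[OF this tendsto_const[of ?E] nz] e]
  show "gqs d \<alpha> k x y \<longlonglongrightarrow> L" unfolding gqs_shift[abs_def] by simp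
 qed
qed

text \<open>\<open>green_q\<close> is a \<open>lim\<close>, which says nothing unless the sequence
  converges. Convergence is known for |x| < d and is carried to every x by steps of d.\<close>

lemma gqs_convergent: "convergent (gqs d \<alpha> k x y)"
proof -
 have step: "convergent (gqs d \<alpha> k (x + d) y) \<longleftrightarrow> convergent (gqs d \<alpha> k x y)" for x
 proof
  assume "convergent (gqs d \<alpha> k (x + d) y)"
  then obtain L where "gqs d \<alpha> k (x + d) y \<longlonglongrightarrow> L" by (auto simp: convergent_def)
  then have "gqs d \<alpha> k (x + d) y \<longlonglongrightarrow> (qd \<alpha> d) * (L / (qd \<alpha> d))" by simp
  then have "gqs d \<alpha> k x y \<longlonglongrightarrow> L / (qd \<alpha> d)" by (rule gqs_shift_lim[THEN iffD1])
  then show "convergent (gqs d \<alpha> k x y)" by (rule convergentI)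
 next
  assume "convergent (gqs d \<alpha> k x y)"
  then obtain L where "gqs d \<alpha> k x y \<longlonglongrightarrow> L" by (auto simp: convergent_def)
  then have "gqs d \<alpha> k (x + d) y \<longlonglongrightarrow> (qd \<alpha> d) * L" by (rule gqs_shift_lim[THEN iffD2])
  then show "convergent (gqs d \<alpha> k (x + d) y)" by (rule convergentI)
 qed
 have nat: "convergent (gqs d \<alpha> k (x + real n * d) y) \<longleftrightarrow> convergent (gqs d \<alpha> k x y)" for n x
 proof (induction n)
  case (Suc n)
  have "x + real (Suc n) * d = (x + real n * d) + d" by (simp add: algebra_simps)
  then show ?case using step[of "x + real n * d"] Suc by (simp only:)
 qed simp
 define z where "z = \<lfloor>x / d\<rfloor>"
 define x0 where "x0 = x - of_int z * d"
 have "of_int z \<le> x / d" "x / d < of_int z + 1" unfolding z_def by linarith+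
 then have "\<bar>x0\<bar> < d" using d by (auto simp: x0_def field_simps)
 then have c0: "convergent (gqs d \<alpha> k x0 y)" using gqs_lim by (auto simp: convergent_def)
 show ?thesis
 proof (cases "0 \<le> z")
  case True
  then have "x = x0 + real (nat z) * d" by (simp add: x0_def)
  then show ?thesis using nat[of x0 "nat z"] c0 by simp
 next
  case False
  then have "x0 = x + real (nat (- z)) * d" by (simp add: x0_def)
  then show ?thesis using nat[of x "nat (- z)"] c0 by simp
 qed
qed

lemma green_q_qp: "green_q d \<alpha> k (x + d) y = (qd \<alpha> d) * green_q d \<alpha> k x y"
proof -
 have "gqs d \<alpha> k x y \<longlonglongrightarrow> green_q d \<alpha> k x y" unfolding green_q_gqs
  using gqs_convergent by (simp add: convergent_LIMSEQ_iff)
 from gqs_shift_lim[THEN iffD2, OF this] show ?thesis by (subst green_q_gqs) (rule limI)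
qed

end

subsection \<open>Fourier coefficients on the line\<close>

text \<open>Over one period the exponential picks up exactly the factor \<open>qf\<close>, so the
  endpoint difference cancels the denominator 1 - qf and a rational integrand remains. At s = 0
  there is no exponential decay in v, hence the version of the fundamental theorem with derivatives
  in the interior only.\<close>

lemma wave_line_integral:
 assumes nr: "nonres d k a" and ab: "exp (\<i> * of_real ((b - a) * d)) = 1" and kb: "k \<noteq> b"
 shows "((\<lambda>s. LINT v|Mv. rho v / (1 - qf d k a v) * exp (\<i> * (gg v * of_real k - of_real b) * of_real s))
   has_integral (LINT v|Mv. \<i> * rho v / (gg v * of_real k - of_real b))) {0..d}"
  and "integrable Mv (\<lambda>v. \<i> * rho v / (gg v * of_real k - of_real b))"
proof -
 have dk: "0 < d" "0 < k" using nr by (auto simp: nonres_def)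
 obtain c where c: "0 < c" "\<And>v. 0 \<le> v ==> c \<le> cmod (1 - qf d k a v)"
  by (rule one_minus_qf[OF nr]) (rule that)
 let ?B = "\<lambda>v. gg v * of_real k - of_real b" and ?r = "\<lambda>v. rho v / (1 - qf d k a v)"
 have ReIm: "Re (?B v) = k - b" "Im (?B v) = k * v^2" for v by (simp_all add: gg_def)
 \<comment> \<open>The real part of ?B is k - b and the imaginary part k v^2; averaging the two
   lower bounds gives c' (1 + v^2).\<close>
 define c' where "c' = min \<bar>k - b\<bar> k / 2"
 have c'0: "0 < c'" using kb dk by (simp add: c'_def)
 have Blow: "c' * (1 + v^2) \<le> cmod (?B v)" for v
 proof -
  have "\<bar>k - b\<bar> \<le> cmod (?B v)" "\<bar>k * v^2\<bar> \<le> cmod (?B v)"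
   using abs_Re_le_cmod[of "?B v"] abs_Im_le_cmod[of "?B v"] unfolding ReIm by auto
  moreover have "2 * c' \<le> \<bar>k - b\<bar>" "2 * c' * v^2 \<le> \<bar>k * v^2\<bar>"
   using dk by (auto simp: c'_def abs_mult intro: mult_right_mono)
  ultimately show ?thesis by (simp add: distrib_left)
 qed
 have B0: "?B v \<noteq> 0" for v
 proof -
  have "0 < 1 + v^2" by (rule add_pos_nonneg) auto
  then have "0 < c' * (1 + v^2)" by (rule mult_pos_pos[OF c'0])
  then have "0 < cmod (?B v)" using Blow[of v] by linarith
  then show ?thesis by simp
 qed
 have B0': "gg v * of_real k \<noteq> of_real b" for v using B0[of v] by simp
 have n1: "1 - qf d k a v \<noteq> 0" if "0 \<le> v" for v using c(1) c(2)[OF that] by auto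
 have rb: "cmod (?r v) \<le> 2 / c" if "0 < v" for v
  using norm_rho_le[of v] c(2)[of v] c(1) that unfolding norm_divide by (intro frac_le) auto
 have cr: "continuous_on {0<..} ?r"
  using n1 by (intro continuous_on_divide hb_cont[OF hb_rho] continuous_intros) auto
 have ne: "cmod (exp (\<i> * ?B v * of_real s)) = exp (- (k * s) * v^2)" for v s
  by (simp add: norm_exp_eq_Re gg_def)
 let ?f = "\<lambda>s v. ?r v * exp (\<i> * ?B v * of_real s) / (\<i> * ?B v)"
 let ?f' = "\<lambda>s v. ?r v * exp (\<i> * ?B v * of_real s)"
 define w where "w v = 2 / c / c' * (1 / (1 + v^2))" for v :: real
 have w: "integrable Mv w" unfolding w_def by (intro integrable_mult_right integrable_inverse_square_Mv)
 have inv: "1 / cmod (?B v) \<le> 1 / c' * (1 / (1 + v^2))" for v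
 proof -
  have "1 / cmod (?B v) \<le> 1 / (c' * (1 + v^2))"
  proof (rule divide_left_mono[OF Blow])
   have "0 < 1 + v^2" by (rule add_pos_nonneg) auto
   then show "0 < cmod (?B v) * (c' * (1 + v^2))" using B0[of v] c'0 by (intro mult_pos_pos) auto
  qed simp
  then show ?thesis by simp
 qed
 \<comment> \<open>The factor 1 / ?B gained by integrating in s makes the majorant integrable for
   every s >= 0, including s = 0, where the exponential gives no decay.\<close>
 have fb: "cmod (?f s v) \<le> w v" if "0 < v" "0 \<le> s" for s v
 proof -
  have "cmod (?f s v) = cmod (?r v) * exp (- (k * s) * v^2) * (1 / cmod (?B v))"
   unfolding norm_divide[of "?r v * exp (\<i> * ?B v * of_real s)"] norm_mult[of "?r v"] ne by (simp add: norm_mult)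
  also have "\<dots> \<le> 2 / c * 1 * (1 / c' * (1 / (1 + v^2)))"
   using rb[OF that(1)] inv[of v] that dk c(1) by (intro mult_mono) auto
  finally show ?thesis by (simp add: w_def)
 qed
 have fm: "?f s \<in> borel_measurable Mv" for s
  by (intro measurable_Mv continuous_on_divide continuous_intros cr) (simp add: B0')
 have fi: "integrable Mv (?f s)" if "0 \<le> s" for s
 proof (rule Bochner_Integration.integrable_bound[OF w fm], rule AE_I2)
  fix v assume "v \<in> space Mv"
  then have "cmod (?f s v) \<le> w v" using fb that by simp
  then show "norm (?f s v) \<le> norm (w v)" by simp
 qed
 have der: "((\<lambda>s. integral\<^sup>L Mv (?f s)) has_vector_derivative integral\<^sup>L Mv (?f' s)) (at s)" if s: "0 < s" for s
 proof -
  obtain K :: real where K: "0 < K" "\<And>v. (1 + v^2) ^ 0 * exp (- (k * (s / 2)) * v^2) \<le> K / (1 + v^2)"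
   using poly_exp_bound_ex[of "k * (s / 2)" 0] dk s by auto
  have w2: "integrable Mv (\<lambda>v. 2 / c * K * (1 / (1 + v^2)))" by (intro integrable_mult_right integrable_inverse_square_Mv)
  have t: "s \<in> {s / 2<..<s + 1}" using s by simp
  show ?thesis
  proof (rule has_vector_derivative_lebesgue(2)[of "s / 2" "s + 1" Mv ?f ?f' "\<lambda>v. 2 / c * K * (1 / (1 + v^2))" s, OF _ _ _ w2 t])
   fix t assume t: "t \<in> {s / 2<..<s + 1}"
   show "integrable Mv (?f t)" using fi[of t] t s by simp
   fix v assume "v \<in> space Mv" then have v: "0 < v" by simp
   have e: "((\<lambda>z. exp (\<i> * ?B v * z)) has_field_derivative \<i> * ?B v * exp (\<i> * ?B v * of_real t)) (at (of_real t))"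
    by (auto intro!: derivative_eq_intros)
   have "((\<lambda>t. exp (\<i> * ?B v * of_real t)) has_vector_derivative of_real 1 * (\<i> * ?B v * exp (\<i> * ?B v * of_real t))) (at t)"
    using field_vector_diff_chain_at[OF has_vector_derivative_of_real[OF DERIV_ident] e] unfolding comp_def .
   note hd = has_vector_derivative_mult_left[OF has_vector_derivative_mult_right[OF this, of "?r v"], of "1 / (\<i> * ?B v)"]
   have fe: "?f t v = ?r v * exp (\<i> * ?B v * of_real t) * (1 / (\<i> * ?B v))" for t by simp
   have fe': "?r v * (of_real 1 * (\<i> * ?B v * exp (\<i> * ?B v * of_real t))) * (1 / (\<i> * ?B v)) = ?f' t v"
    using B0[of v] by simp
   show "((\<lambda>t. ?f t v) has_vector_derivative ?f' t v) (at t)"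
    unfolding fe by (rule has_vector_derivative_eq_rhs[OF hd fe'])
   have "k * (s / 2) * v^2 \<le> k * t * v^2" using t dk by (intro mult_right_mono mult_left_mono) auto
   then have "cmod (?f' t v) \<le> 2 / c * exp (- (k * (s / 2)) * v^2)"
    unfolding norm_mult[of "?r v"] ne using rb[OF v] c(1) by (intro mult_mono) auto
   also have "\<dots> \<le> 2 / c * (K / (1 + v^2))" using K(2)[of v] c(1) by (intro mult_left_mono) auto
   finally show "cmod (?f' t v) \<le> 2 / c * K * (1 / (1 + v^2))" by simp
  qed
 qed
 have cont: "continuous_on {0..d} (\<lambda>s. integral\<^sup>L Mv (?f s))"
  unfolding continuous_on_sequentially comp_def
 proof (intro allI ballI impI, elim conjE)
  fix x :: "nat => real" and s assume x: "\<forall>n. x n \<in> {0..d}" "x \<longlonglongrightarrow> s"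
  show "(\<lambda>n. integral\<^sup>L Mv (?f (x n))) \<longlonglongrightarrow> integral\<^sup>L Mv (?f s)"
  proof (rule integral_dominated_convergence[OF fm fm w])
   show "AE v in Mv. (\<lambda>n. ?f (x n) v) \<longlonglongrightarrow> ?f s v"
    by (rule AE_I2) (intro tendsto_intros x; simp add: B0')
   show "AE v in Mv. norm (?f (x n) v) \<le> w v" for n
    by (rule AE_I2) (use fb x in auto)
  qed
 qed
 have "0 \<le> d" using dk by simp
 from fundamental_theorem_of_calculus_interior[OF this cont der]
 have FTC: "((\<lambda>s. integral\<^sup>L Mv (?f' s)) has_integral integral\<^sup>L Mv (?f d) - integral\<^sup>L Mv (?f 0)) {0..d}" by simp
 have pt: "?f d v - ?f 0 v = \<i> * rho v / ?B v" if "0 < v" for v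
 proof -
  have "exp (\<i> * ?B v * of_real d) = qf d k a v * exp (- (\<i> * of_real ((b - a) * d)))"
   unfolding qf_def exp_add[symmetric] by (rule arg_cong[of _ _ exp]) (simp add: algebra_simps)
  also have "\<dots> = qf d k a v" using ab by (simp add: exp_minus)
  finally have e: "exp (\<i> * ?B v * of_real d) = qf d k a v" .
  have "?f d v - ?f 0 v = ?r v * (qf d k a v - 1) / (\<i> * ?B v)"
   unfolding e by (simp add: diff_divide_distrib right_diff_distrib)
  also have "?r v * (qf d k a v - 1) = - rho v" using n1[of v] that by (simp add: field_simps)
  also have "- rho v / (\<i> * ?B v) = \<i> * rho v / ?B v" using B0[of v] by (simp add: field_simps)
  finally show ?thesis .
 qed
 have "integrable Mv (\<lambda>v. ?f d v - ?f 0 v)" using fi[of d] fi[of 0] dk by (intro Bochner_Integration.integrable_diff) auto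
 moreover have "integrable Mv (\<lambda>v. ?f d v - ?f 0 v) \<longleftrightarrow> integrable Mv (\<lambda>v. \<i> * rho v / ?B v)"
  by (rule Bochner_Integration.integrable_cong[OF refl]) (use pt in simp)
 ultimately show "integrable Mv (\<lambda>v. \<i> * rho v / ?B v)" by blast
 have "integral\<^sup>L Mv (?f d) - integral\<^sup>L Mv (?f 0) = (LINT v|Mv. ?f d v - ?f 0 v)"
  using fi[of d] fi[of 0] dk by (intro Bochner_Integration.integral_diff[symmetric]) auto
 also have "\<dots> = (LINT v|Mv. \<i> * rho v / ?B v)"
  by (rule Bochner_Integration.integral_cong[OF refl]) (use pt in simp)
 finally show "((\<lambda>s. LINT v|Mv. rho v / (1 - qf d k a v) * exp (\<i> * ?B v * of_real s)) has_integral (LINT v|Mv. \<i> * rho v / ?B v)) {0..d}"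
  using FTC by simp
qed

text \<open>With zeta = k xi the integrand is the derivative of Ln (- i (beta - zeta) / (beta +
  zeta)) / beta. As zeta runs from 0 to infinity in the fourth quadrant, the quotient goes from 1 to
  - 1 through the upper half-plane; the factor - i turns this into the right half-plane, where Ln is
  continuous, and Ln i - Ln (- i) = i pi.\<close>

lemma rational_wave_integral:
 assumes k: "0 < k" and kb: "k \<noteq> b" "k \<noteq> - b" and \<beta>: "\<beta>^2 = of_real (k^2 - b^2)"
  and dir: "(Re \<beta> > 0 \<and> Im \<beta> = 0) \<or> (Re \<beta> = 0 \<and> Im \<beta> > 0)"
  and i1: "integrable Mv (\<lambda>v. \<i> * rho v / (gg v * of_real k - of_real b))"
  and i2: "integrable Mv (\<lambda>v. \<i> * rho v / (gg v * of_real k - of_real (- b)))"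
 shows "(LINT v|Mv. \<i> * rho v / (gg v * of_real k - of_real b)) + (LINT v|Mv. \<i> * rho v / (gg v * of_real k - of_real (- b)))
   = \<i> * of_real pi / \<beta>"
proof -
 define \<zeta> where "\<zeta> v = of_real k * xi v" for v
 let ?z = "\<lambda>v. (\<beta> - \<zeta> v) / (\<beta> + \<zeta> v)" and ?w = "\<lambda>v. - \<i> * ((\<beta> - \<zeta> v) / (\<beta> + \<zeta> v))"
 have b0: "\<beta> \<noteq> 0" using dir by auto
 have zRe: "0 \<le> Re (\<zeta> v)" if "0 \<le> v" for v using Re_xi_nonneg[OF that] k by (simp add: \<zeta>_def)
 have zpos: "0 < Re (\<zeta> v)" "Im (\<zeta> v) < 0" if "0 < v" for v
  using Re_xi_pos[OF that] Im_xi_neg[OF that] k by (auto simp: \<zeta>_def mult_pos_neg)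
 have nz: "\<beta> + \<zeta> v \<noteq> 0" if "0 \<le> v" for v
 proof (cases "v = 0")
  case True then show ?thesis using b0 by (simp add: \<zeta>_def xi_def)
 next
  case False
  then have "0 < Re (\<beta> + \<zeta> v)" using zpos(1)[of v] that dir by auto
  then show ?thesis by (metis less_irrefl zero_complex.sel(1))
 qed
 have Imz: "0 < Im (?z v)" if v: "0 < v" for v
 proof -
  have "0 < (cmod (\<beta> + \<zeta> v))^2" using nz[of v] v by simp
  moreover have "0 < Im (\<beta> - \<zeta> v) * Re (\<beta> + \<zeta> v) - Re (\<beta> - \<zeta> v) * Im (\<beta> + \<zeta> v)"
  proof -
   have e: "Im (\<beta> - \<zeta> v) * Re (\<beta> + \<zeta> v) - Re (\<beta> - \<zeta> v) * Im (\<beta> + \<zeta> v) = 2 * (Im \<beta> * Re (\<zeta> v) - Re \<beta> * Im (\<zeta> v))"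
    by (simp add: algebra_simps)
   show ?thesis unfolding e using dir zpos[OF v] by (auto simp: mult_pos_neg)
  qed
  ultimately show ?thesis by (simp add: Im_divide cmod_power2)
 qed
 have wR: "?w v \<notin> \<real>\<^sub>\<le>\<^sub>0" if v: "0 \<le> v" for v
 proof (cases "v = 0")
  case True then show ?thesis using b0 by (simp add: \<zeta>_def xi_def complex_nonpos_Reals_iff)
 next
  case False
  have "Re (- \<i> * z) = Im z" for z :: complex by simp
  then have "0 < Re (?w v)" using Imz[of v] False v by (simp only:)
  then show ?thesis by (auto simp: complex_nonpos_Reals_iff)
 qed
 let ?L = "\<lambda>v. Ln (?w v) / \<beta>"
 let ?g = "\<lambda>v. \<i> * rho v / (gg v * of_real k - of_real b) + \<i> * rho v / (gg v * of_real k - of_real (- b))"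
 have zd: "(\<zeta> has_vector_derivative of_real k * (- 2 * \<i> * gg v / eta v)) (at v)" for v
  unfolding \<zeta>_def[abs_def] by (rule has_vector_derivative_mult_right[OF xi_deriv])
 have Ld: "(?L has_vector_derivative ?g v) (at v)" if v: "0 \<le> v" for v
 proof -
  let ?z' = "of_real k * (- 2 * \<i> * gg v / eta v)"
  have "((\<lambda>z. Ln (- \<i> * ((\<beta> - z) / (\<beta> + z))) / \<beta>) has_field_derivative - 2 / ((\<beta> - \<zeta> v) * (\<beta> + \<zeta> v))) (at (\<zeta> v))"
  proof -
   have bm: "\<beta> - \<zeta> v \<noteq> 0" using wR[OF v] by auto
   have d1: "((\<lambda>z. - \<i> * ((\<beta> - z) / (\<beta> + z))) has_field_derivative - \<i> * (- 2 * \<beta> / (\<beta> + \<zeta> v)^2)) (at (\<zeta> v))"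
    using nz[OF v] by (auto intro!: derivative_eq_intros simp: field_simps power2_eq_square)
   from DERIV_cdivide[OF DERIV_chain2[OF has_field_derivative_Ln[OF wR[OF v]] d1], of \<beta>]
   show ?thesis
   proof (rule DERIV_cong)
    have gen: "inverse (- \<i> * (D / S)) * (- \<i> * (- 2 * b / S^2)) / b = - 2 / (D * S)" if "D \<noteq> 0" "S \<noteq> 0" "b \<noteq> 0" for D S b :: complex
     using that by (simp add: divide_simps power2_eq_square)
    show "inverse (?w v) * (- \<i> * (- 2 * \<beta> / (\<beta> + \<zeta> v)^2)) / \<beta> = - 2 / ((\<beta> - \<zeta> v) * (\<beta> + \<zeta> v))"
     by (rule gen[OF bm nz[OF v] b0])
   qed
  qed
  from field_vector_diff_chain_at[OF zd this]
  have "(?L has_vector_derivative ?z' * (- 2 / ((\<beta> - \<zeta> v) * (\<beta> + \<zeta> v)))) (at v)" unfolding comp_def .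
  moreover have "?z' * (- 2 / ((\<beta> - \<zeta> v) * (\<beta> + \<zeta> v))) = ?g v"
  proof -
   have bm: "\<beta> - \<zeta> v \<noteq> 0" using wR[OF v] by auto
   have prod: "(\<beta> - \<zeta> v) * (\<beta> + \<zeta> v) = (gg v * of_real k - of_real b) * (gg v * of_real k - of_real (- b))"
   proof -
    have "(\<beta> - \<zeta> v) * (\<beta> + \<zeta> v) = \<beta>^2 - of_real (k^2) * xi v ^ 2" by (simp add: \<zeta>_def power2_eq_square algebra_simps)
    then show ?thesis unfolding \<beta> xi_square by (simp add: power2_eq_square algebra_simps)
   qed
   have fac: "gg v * of_real k - of_real b \<noteq> 0" "gg v * of_real k - of_real (- b) \<noteq> 0"
    using prod bm nz[OF v] by (metis mult_eq_0_iff)+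
   have "?g v = \<i> * rho v * (2 * gg v * of_real k) / ((gg v * of_real k - of_real b) * (gg v * of_real k - of_real (- b)))"
    using fac by (simp add: field_simps)
   also have "\<dots> = ?z' * (- 2 / ((\<beta> - \<zeta> v) * (\<beta> + \<zeta> v)))" unfolding prod by (simp add: rho_def)
   finally show ?thesis by simp
  qed
  ultimately show ?thesis by simp
 qed
 have pos: "k \<noteq> b \<and> k \<noteq> - b" using kb by simp
 have "(LINT v|Mv. ?g v) = (Ln \<i> / \<beta>) - (Ln (- \<i>) / \<beta>)"
 proof (rule integral_Mv_FTC[where F = ?L])
  show "continuous_on {0<..} ?g"
  proof -
   have "gg v * of_real k - of_real b \<noteq> 0 \<and> gg v * of_real k - of_real (- b) \<noteq> 0" for v
    using pos by (auto simp: complex_eq_iff gg_def)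
   then show ?thesis by (intro continuous_intros hb_cont[OF hb_rho]) auto
  qed
  show "integrable Mv ?g" by (rule Bochner_Integration.integrable_add[OF i1 i2])
  have "isCont ?L 0" by (rule has_vector_derivative_continuous[OF Ld]) simp
  then have "(?L \<longlongrightarrow> ?L 0) (at_right 0)" unfolding isCont_def by (rule filterlim_mono) (auto simp: at_within_le_at)
  moreover have "?L 0 = Ln (- \<i>) / \<beta>" using b0 by (simp add: \<zeta>_def xi_def)
  ultimately show "(?L \<longlongrightarrow> Ln (- \<i>) / \<beta>) (at_right 0)" by (simp only:)
  have zl: "(?z \<longlongrightarrow> - 1) at_top"
  proof (rule LIM_zero_cancel, rule Lim_null_comparison)
   have lo: "k * v \<le> cmod (\<zeta> v)" if "0 \<le> v" for v
    using mult_left_mono[OF norm_eta_bounds(3)[of v], of "k * v"] that k by (simp add: \<zeta>_def xi_def norm_mult)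
   show "\<forall>\<^sub>F v in at_top. norm (?z v - (- 1)) \<le> 2 * cmod \<beta> / (k * v - cmod \<beta>)"
    using eventually_gt_at_top[of "max 0 (cmod \<beta> / k)"]
   proof eventually_elim
    case (elim v)
    then have "0 < v" "cmod \<beta> / k < v" by auto
    then have v: "0 \<le> v" "cmod \<beta> < k * v" using k by (auto simp: pos_divide_less_eq mult.commute)
    have "?z v - (- 1) = 2 * \<beta> / (\<beta> + \<zeta> v)" using nz[OF v(1)] by (simp add: field_simps)
    moreover have "k * v - cmod \<beta> \<le> cmod (\<beta> + \<zeta> v)"
     using norm_triangle_ineq2[of "\<zeta> v" "- \<beta>"] lo[OF v(1)] by (simp add: add.commute)
    ultimately show ?case using v nz[OF v(1)]
     by (simp only: norm_divide norm_mult norm_numeral) (intro divide_left_mono mult_pos_pos; simp)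
   qed
   show "((\<lambda>v. 2 * cmod \<beta> / (k * v - cmod \<beta>)) \<longlongrightarrow> 0) at_top" using k by real_asymp
  qed
  have "(?w \<longlongrightarrow> - \<i> * (- 1)) at_top" by (intro tendsto_mult tendsto_const zl)
  then have wl: "(?w \<longlongrightarrow> \<i>) at_top" by simp
  show "(?L \<longlongrightarrow> Ln \<i> / \<beta>) at_top"
   by (rule tendsto_divide[OF tendsto_Ln[OF wl] tendsto_const b0]) (simp add: complex_nonpos_Reals_iff)
 qed (use Ld in auto)
 also have "\<dots> = \<i> * of_real pi / \<beta>" by (simp add: diff_divide_distrib[symmetric])
 finally show ?thesis using Bochner_Integration.integral_add[OF i1 i2] by simp
qed

text \<open>The symbol of \<open>betaD\<close> at a real wavenumber: on the real axis
  \<open>psqrt\<close> agrees with \<open>csqrt\<close>.\<close>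

definition beta0 :: "real => real => real => int => complex" where
 "beta0 d \<alpha> k n = csqrt (of_real (k^2 - (alpha_n d \<alpha> n)^2))"

text \<open>These coefficients are the eigenvalues of the flat single layer. The terms m >= 0 and m
  < 0 of the lattice sum give the two rational integrals with alpha_n and - alpha_n, the second
  after the reflection s -> d - s.\<close>

lemma green_q_coef:
 assumes d: "0 < d" and k: "0 < k" and nw: "\<not> wood d \<alpha> k"
 shows "((\<lambda>s. green_q d \<alpha> k s 0 * exp (- \<i> * of_real (alpha_n d \<alpha> n * s))) has_integral \<i> / (2 * beta0 d \<alpha> k n)) {0..d}"
proof -
 let ?b = "alpha_n d \<alpha> n" and ?\<beta> = "beta0 d \<alpha> k n"
 note nr = nonres_of_not_wood[OF d k nw]
 have kb: "k \<noteq> ?b" "k \<noteq> - ?b" using nw by (auto simp: wood_def)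
 have ea: "(?b - \<alpha>) * d = 2 * pi * of_int n" using d by (simp add: alpha_n_def field_simps)
 have e1: "exp (\<i> * of_real ((?b - \<alpha>) * d)) = 1"
  unfolding ea using exp_integer_2pi[of "of_int n"] by (simp add: mult_ac)
 have e2: "exp (\<i> * of_real ((- ?b - (- \<alpha>)) * d)) = 1"
 proof -
  have "\<i> * of_real ((- ?b - (- \<alpha>)) * d) = - (\<i> * of_real ((?b - \<alpha>) * d))" by (simp add: algebra_simps)
  then show ?thesis using e1 by (simp only: exp_minus) simp
 qed
 have kb2: "k \<noteq> - ?b" using kb by simp
 note W1 = wave_line_integral[OF nr(1) e1 kb(1)] and W2 = wave_line_integral[OF nr(2) e2 kb2]
 let ?F1 = "\<lambda>s. LINT v|Mv. rho v / (1 - qf d k \<alpha> v) * exp (\<i> * (gg v * of_real k - of_real ?b) * of_real s)"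
 let ?F2 = "\<lambda>s. LINT v|Mv. rho v / (1 - qf d k (- \<alpha>) v) * exp (\<i> * (gg v * of_real k - of_real (- ?b)) * of_real s)"
 let ?I1 = "LINT v|Mv. \<i> * rho v / (gg v * of_real k - of_real ?b)" and ?I2 = "LINT v|Mv. \<i> * rho v / (gg v * of_real k - of_real (- ?b))"
 \<comment> \<open>The translates on the other side are written in the variable d - s, so that their
   geometric series also starts with exponent 0.\<close>
 have "((\<lambda>s. ?F2 (- s)) has_integral ?I2) {- d..- 0}" using W2(1) by (subst has_integral_reflect_real)
 from has_integral_affinity[OF this[unfolded cbox_interval[symmetric]], of 1 "- d"]
 have F2r: "((\<lambda>s. ?F2 (d - s)) has_integral ?I2) {0..d}" by (simp add: algebra_simps)
 have R: "((\<lambda>s. (?F1 s + ?F2 (d - s)) / of_real (2 * pi)) has_integral (?I1 + ?I2) / of_real (2 * pi)) {0..d}"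
  by (intro has_integral_divide has_integral_add W1(1) F2r)
 have dir: "(Re ?\<beta> > 0 \<and> Im ?\<beta> = 0) \<or> (Re ?\<beta> = 0 \<and> Im ?\<beta> > 0)"
 proof (cases "0 < k^2 - ?b^2")
  case True
  then have "?\<beta> = of_real (sqrt (k^2 - ?b^2))" unfolding beta0_def by (subst of_real_sqrt) auto
  then show ?thesis using True by simp
 next
  case False
  have "k^2 - ?b^2 \<noteq> 0" using nw by (auto simp: wood_def)
  then have neg: "k^2 - ?b^2 < 0" using False by simp
  then have "?\<beta> = \<i> * of_real (sqrt (?b^2 - k^2))" unfolding beta0_def
   by (subst csqrt_of_real_nonpos) (auto simp: abs_if)
  then show ?thesis using neg by simp
 qed
 have \<beta>2: "?\<beta>^2 = of_real (k^2 - ?b^2)" by (simp add: beta0_def)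
 have val: "(?I1 + ?I2) / of_real (2 * pi) = \<i> / (2 * ?\<beta>)"
  unfolding rational_wave_integral[OF k kb \<beta>2 dir W1(2) W2(2)] by simp
 have eq: "green_q d \<alpha> k s 0 * exp (- \<i> * of_real (?b * s)) = (?F1 s + ?F2 (d - s)) / of_real (2 * pi)" if s: "s \<in> {0<..<d}" for s
 proof -
  have sd: "\<bar>s\<bar> < d" "0 < s" "s < d" using s by auto
  obtain c1 where c1: "0 < c1" "\<And>v. 0 \<le> v ==> c1 \<le> cmod (1 - qf d k \<alpha> v)" by (rule one_minus_qf[OF nr(1)]) (rule that)
  obtain c2 where c2: "0 < c2" "\<And>v. 0 \<le> v ==> c2 \<le> cmod (1 - qf d k (- \<alpha>) v)" by (rule one_minus_qf[OF nr(2)]) (rule that)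
  have n1: "1 - qf d k \<alpha> v \<noteq> 0" and n2: "1 - qf d k (- \<alpha>) v \<noteq> 0" if "0 < v" for v
   using c1(1) c1(2)[of v] c2(1) c2(2)[of v] that by auto
  have ax: "- 0 < k * s" "- (k * d) < k * s" "- (k * d) < k * (- s)"
   using mult_strict_left_mono[OF sd(2) k] mult_strict_left_mono[OF sd(3) k] by auto
  note wi = wave_integrable(1)[OF hb_rho ax(1), of "k * 0"] wave_integrable(1)[OF hb_hf[OF nr(1)] ax(2), of "k * 0"]
  let ?E = "exp (- \<i> * of_real (?b * s))"
  have "(Jc rho (k * s) (k * 0) + Jc (hf d k \<alpha>) (k * s) (k * 0)) * ?E
   = (LINT v|Mv. (rho v * ew v (k * s) * cx v (k * 0) + hf d k \<alpha> v * ew v (k * s) * cx v (k * 0)) * ?E)"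
   unfolding Jc_def Bochner_Integration.integral_add[OF wi, symmetric] Bochner_Integration.integral_mult_left_zero ..
  also have "\<dots> = ?F1 s"
  proof (rule Bochner_Integration.integral_cong[OF refl])
   fix v assume "v \<in> space Mv" then have v: "0 < v" by simp
   have h: "rho v + hf d k \<alpha> v = rho v / (1 - qf d k \<alpha> v)" using n1[OF v] by (simp add: hf_def field_simps)
   have e: "ew v (k * s) * ?E = exp (\<i> * (gg v * of_real k - of_real ?b) * of_real s)"
    unfolding exp_add[symmetric] by (rule arg_cong[of _ _ exp]) (simp add: algebra_simps)
   have c: "cx v (k * 0) = 1" by simp
   have "(rho v * ew v (k * s) * cx v (k * 0) + hf d k \<alpha> v * ew v (k * s) * cx v (k * 0)) * ?E
    = (rho v + hf d k \<alpha> v) * (ew v (k * s) * ?E)" unfolding c mult_1_right by (simp only: distrib_right mult.assoc)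
   then show "(rho v * ew v (k * s) * cx v (k * 0) + hf d k \<alpha> v * ew v (k * s) * cx v (k * 0)) * ?E
     = rho v / (1 - qf d k \<alpha> v) * exp (\<i> * (gg v * of_real k - of_real ?b) * of_real s)" unfolding h e .
  qed
  finally have P1: "(Jc rho (k * s) (k * 0) + Jc (hf d k \<alpha>) (k * s) (k * 0)) * ?E = ?F1 s" .
  have "Jc (hf d k (- \<alpha>)) (k * (- s)) (k * 0) * ?E
   = (LINT v|Mv. (hf d k (- \<alpha>) v * ew v (k * (- s)) * cx v (k * 0)) * ?E)"
   unfolding Jc_def Bochner_Integration.integral_mult_left_zero ..
  also have "\<dots> = ?F2 (d - s)"
  proof (rule Bochner_Integration.integral_cong[OF refl])
   fix v assume "v \<in> space Mv" then have v: "0 < v" by simp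
   have e: "qf d k (- \<alpha>) v * (ew v (k * (- s)) * ?E) = exp (\<i> * (gg v * of_real k - of_real (- ?b)) * of_real (d - s)) * exp (\<i> * of_real ((- ?b - (- \<alpha>)) * d))"
    unfolding qf_def exp_add[symmetric] by (rule arg_cong[of _ _ exp]) (simp add: algebra_simps)
   have c: "cx v (k * 0) = 1" by simp
   have "(hf d k (- \<alpha>) v * ew v (k * (- s)) * cx v (k * 0)) * ?E
    = rho v / (1 - qf d k (- \<alpha>) v) * (qf d k (- \<alpha>) v * (ew v (k * (- s)) * ?E))"
    unfolding c mult_1_right hf_def by (simp only: times_divide_eq_left times_divide_eq_right mult.assoc)
   then show "(hf d k (- \<alpha>) v * ew v (k * (- s)) * cx v (k * 0)) * ?E
    = rho v / (1 - qf d k (- \<alpha>) v) * exp (\<i> * (gg v * of_real k - of_real (- ?b)) * of_real (d - s))" unfolding e e2 mult_1_right .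
  qed
  finally have P2: "Jc (hf d k (- \<alpha>)) (k * (- s)) (k * 0) * ?E = ?F2 (d - s)" .
  have "green_q d \<alpha> k s 0 * ?E = ((Jc rho (k * s) (k * 0) + Jc (hf d k \<alpha>) (k * s) (k * 0)) * ?E + Jc (hf d k (- \<alpha>)) (k * (- s)) (k * 0) * ?E) / of_real (2 * pi)"
   unfolding green_q_eq[OF d k nw sd(1)] green_Jc[OF sd(2) k] Rq_def
   by (simp only: add_divide_distrib[symmetric] distrib_right times_divide_eq_left add.assoc)
  then show ?thesis unfolding P1 P2 .
 qed
 show ?thesis
 proof (rule has_integral_spike_finite[of "{0, d}" _ _ _ _, OF _ _ R[unfolded val]])
  show "green_q d \<alpha> k s 0 * exp (- \<i> * of_real (?b * s)) = (?F1 s + ?F2 (d - s)) / of_real (2 * pi)" if "s \<in> {0..d} - {0, d}" for s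
   using eq[of s] that by auto
 qed simp
qed

subsection \<open>Integrals over a period\<close>

lemma has_integral_shift_real:
 fixes f :: "real => complex"
 assumes "(f has_integral I) {u..v}" "\<And>x. f (x + c) = f x" shows "(f has_integral I) {u + c..v + c}"
proof -
 have f: "f (x + - c) = f x" for x using assms(2)[of "x - c"] by simp
 have "((\<lambda>x. f (1 *\<^sub>R x + - c)) has_integral (1 / \<bar>1\<bar> ^ DIM(real)) *\<^sub>R I) ((\<lambda>x. (1 / 1) *\<^sub>R x + - ((1 / 1) *\<^sub>R - c)) ` cbox u v)"
  by (rule has_integral_affinity) (use assms(1) in auto)
 moreover have "(\<lambda>x. (1 / 1) *\<^sub>R x + - ((1 / 1) *\<^sub>R - c)) ` cbox u v = {u + c..v + c}" by (simp add: add.commute)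
 ultimately show ?thesis using f by simp
qed

lemma has_integral_period_shift:
 fixes f :: "real => complex"
 assumes f: "(f has_integral I) {a..a + d}" and p: "\<And>x. f (x + d) = f x" and c: "0 \<le> c" "c \<le> d"
 shows "(f has_integral I) {a + c..a + c + d}"
proof -
 have int: "f integrable_on {a..a + d}" using f by blast
 have i1: "f integrable_on {a..a + c}" "f integrable_on {a + c..a + d}"
  using c by (auto intro: integrable_subinterval_real[OF int])
 have s1: "(f has_integral integral {a..a + c} f) {a..a + c}" "(f has_integral integral {a + c..a + d} f) {a + c..a + d}"
  using i1 by (auto intro: integrable_integral)
 have "(f has_integral (integral {a..a + c} f + integral {a + c..a + d} f)) {a..a + d}"
  by (rule has_integral_combine[OF _ _ s1]) (use c in auto)
 then have I: "I = integral {a..a + c} f + integral {a + c..a + d} f" using f has_integral_unique by blast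
 have "(f has_integral (integral {a + c..a + d} f + integral {a..a + c} f)) {a + c..a + c + d}"
  by (rule has_integral_combine[OF _ _ s1(2) has_integral_shift_real[OF s1(1) p]]) (use c in auto)
 then show ?thesis unfolding I by (simp add: add.commute)
qed

lemma has_integral_period:
 fixes f :: "real => complex"
 assumes f: "(f has_integral I) {a..a + d}" and p: "\<And>x. f (x + d) = f x" and c: "\<bar>b - a\<bar> \<le> d"
 shows "(f has_integral I) {b..b + d}"
proof (cases "a \<le> b")
 case True
 then show ?thesis using has_integral_period_shift[OF f p, of "b - a"] c by simp
next
 case False
 have p': "f (x + - d) = f x" for x using p[of "x - d"] by simp
 have "(f has_integral I) {a + - d..a + d + - d}" by (rule has_integral_shift_real[OF f p'])
 then have "(f has_integral I) {(a - d)..(a - d) + d}" by simp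
 from has_integral_period_shift[OF this p, of "b - (a - d)"] show ?thesis using False c by simp
qed

section \<open>The expansion of the Dirichlet-to-Neumann operator\<close>

definition bsym :: "real => real => complex => int => complex" where
 "bsym d \<alpha> \<kappa> n = psqrt (\<kappa>^2 - of_real ((alpha_n d \<alpha> n)^2))"

lemma alpha_n_add: "alpha_n d \<alpha> (n + m) = alpha_n d \<alpha> n + 2 * pi / d * of_int m"
 by (simp add: alpha_n_def distrib_left)

lemma abs_alpha_le_jw: "\<bar>alpha_n d \<alpha> n\<bar> \<le> jw d \<alpha> n"
 unfolding jw_def by (rule real_le_rsqrt) simp

lemma csqrt_upper:
 assumes "0 < Im z" shows "0 < Re (csqrt z)" "0 < Im (csqrt z)"
proof -
 have e: "2 * Re (csqrt z) * Im (csqrt z) = Im z"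
 proof -
  have "2 * Re y * Im y = Im z" if "y ^ 2 = z" for y using that by (auto simp: power2_eq_square)
  then show ?thesis using power2_csqrt by blast
 qed
 have "0 \<le> Re (csqrt z)" using csqrt_principal[of z] by auto
 moreover have "Re (csqrt z) \<noteq> 0" using e assms by auto
 ultimately show re: "0 < Re (csqrt z)" by simp
 have "0 < Re (csqrt z) * Im (csqrt z)" using e assms by linarith
 then show "0 < Im (csqrt z)" by (simp only: zero_less_mult_pos[OF _ re])
qed

text \<open>5 = 3 + 2: in \<open>Xmat_bound\<close> the second difference of the symbol may cost two
  powers of each distance, and the exponent 3 must remain.\<close>

definition rapid :: "real => coeffs => bool" where
 "rapid C p \<longleftrightarrow> (\<forall>m. cmod (p m) \<le> C / br m ^ 5)"

lemma rapidD: "rapid C p ==> cmod (p m) \<le> C / br m ^ 5" by (simp add: rapid_def)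

lemma rapid_nonneg: assumes "rapid C p" shows "0 \<le> C"
 using order_trans[OF norm_ge_zero rapidD[OF assms, of 0]] by simp

definition toep :: "coeffs => int => int => complex" where "toep p n j = p (n - j)"

lemma mdec_toep: assumes "rapid C p" shows "mdec C (toep p)"
 unfolding mdec_def toep_def
proof (intro allI)
 fix n j
 have "C / br (n - j) ^ 5 \<le> C / br (n - j) ^ 3"
  by (intro divide_left_mono power_increasing mult_pos_pos rapid_nonneg[OF assms]) auto
 then show "cmod (p (n - j)) \<le> C / br (n - j) ^ 3" using rapidD[OF assms, of "n - j"] by linarith
qed

section \<open>Calculus of diagonal and Toeplitz factors\<close>

definition diagm :: "coeffs => int => int => complex" where "diagm a n j = (if n = j then a n else 0)"

lemma mdec_diagm: assumes "\<And>n. cmod (a n) \<le> C" shows "mdec C (diagm a)"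
 using assms order_trans[OF norm_ge_zero assms[of 0]] by (auto simp: mdec_def diagm_def)

lemma mapp_diagm: "mapp (diagm a) c = (\<lambda>n. a n * c n)"
proof
 fix n
 have "mapp (diagm a) c n = infsum (\<lambda>k. diagm a n k * c k) {n}"
  unfolding mapp_def by (rule infsum_cong_neutral) (auto simp: diagm_def)
 then show "mapp (diagm a) c n = a n * c n" by (simp add: diagm_def)
qed

lemma mapp_diff:
 assumes "mdec K x" "mdec B y" "adm c" shows "mapp (\<lambda>n j. x n j - y n j) c n = mapp x c n - mapp y c n"
proof -
 have "mapp (\<lambda>n j. x n j - y n j) c n = infsum (\<lambda>k. x n k * c k + - (y n k * c k)) UNIV"
  by (simp add: mapp_def algebra_simps)
 also have "\<dots> = mapp x c n - mapp y c n"
  using infsum_add[OF mapp_summable[OF assms(1,3), of n] mapp_summable[OF assms(2,3), of n, THEN summable_on_uminus[THEN iffD2]]]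
  by (simp add: infsum_uminus mapp_def)
 finally show ?thesis .
qed

lemma mdec_mono: "mdec K x ==> K \<le> B ==> mdec B x"
 unfolding mdec_def by (meson br_nonneg divide_right_mono order_trans zero_le_power)

lemma mdec_scale: assumes "mdec K x" shows "mdec (cmod z * K) (\<lambda>n j. z * x n j)"
 using assms mult_left_mono[OF mdecD[OF assms] norm_ge_zero[of z]] by (simp add: mdec_def norm_mult)

text \<open>A sequence concentrated near j is placed as column j of an otherwise zero matrix, so the
  estimates for matrix products apply to \<open>mapp\<close>.\<close>

lemma mapp_adm_mdec:
 assumes "\<And>n. cmod (v n) \<le> C / br (n - j) ^ 3" "mdec D a"
 shows "adm v" "\<And>n. cmod (mapp a v n) \<le> convK * D * C / br (n - j) ^ 3" "adm (mapp a v)"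
proof -
 have m: "mdec (if True then C else 0) (\<lambda>n k. if k = j then v n else 0)"
  using assms(1) order_trans[OF norm_ge_zero assms(1)[of j]] by (auto simp: mdec_def)
 then have m: "mdec C (\<lambda>n k. if k = j then v n else 0)" by simp
 show "adm v" using mdec_col_adm[OF m, of j] by simp
 have e: "mmul a (\<lambda>n k. if k = j then v n else 0) n j = mapp a v n" for n
  by (simp add: mmul_def mapp_def)
 show "cmod (mapp a v n) \<le> convK * D * C / br (n - j) ^ 3" for n
  using mdecD[OF mdec_mmul[OF assms(2) m], of n j] by (simp add: e)
 show "adm (mapp a v)" using mdec_col_adm[OF mdec_mmul[OF assms(2) m], of j] by (simp add: e)
qed

lemma infsum_reflect_int: "infsum (\<lambda>m::int. f (k - m)) UNIV = infsum f UNIV"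
 by (rule infsum_reindex_bij_witness[of UNIV "\<lambda>m. k - m" "\<lambda>m. k - m"]) auto

lemma mulop_mapp: "mulop d g = mapp (toep (per_coef d g))"
 by (simp add: mulop_def[abs_def] mapp_def[abs_def] toep_def fun_eq_iff)

lemma mdec_diff: "mdec K x ==> mdec B y ==> mdec (K + B) (\<lambda>n j. x n j - y n j)"
 unfolding mdec_def add_divide_distrib by (metis add_mono norm_triangle_ineq4 order_trans)

lemma mdec_add: "mdec K x ==> mdec B y ==> mdec (K + B) (\<lambda>n j. x n j + y n j)"
 unfolding mdec_def add_divide_distrib by (metis add_mono norm_triangle_ineq order_trans)

text \<open>Absorption puts every kappa^2 - alpha_n^2 into the open upper half-plane, so the cut is
  avoided and all symbols lie in the open first quadrant.\<close>

locale beta_symbol =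
 fixes d \<alpha> :: real and \<kappa> :: complex
 assumes d: "0 < d" and im: "0 < Im (\<kappa>^2)"
begin

abbreviation "b \<equiv> bsym d \<alpha> \<kappa>"
abbreviation "w \<equiv> jw d \<alpha>"
abbreviation "A \<equiv> alpha_n d \<alpha>"

lemma b_csqrt: "b n = csqrt (\<kappa>^2 - of_real ((A n)^2))"
 using im by (simp add: bsym_def psqrt_def)

lemma Re_b: "0 < Re (b n)" and Im_b: "0 < Im (b n)"
 unfolding b_csqrt by (rule csqrt_upper, use im in simp)+

lemma b_square: "b n ^ 2 = \<kappa>^2 - of_real ((A n)^2)"
 by (simp add: b_csqrt)

lemma norm_b_square_le: "cmod (b n) ^ 2 \<le> cmod \<kappa> ^ 2 + (A n)^2"
 using norm_triangle_ineq4[of "\<kappa>^2" "of_real ((A n)^2)"] b_square[of n] by (metis abs_power2 norm_of_real norm_power)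

lemma norm_b_le: "cmod (b n) \<le> (1 + cmod \<kappa>) * w n"
proof (rule power2_le_imp_le)
 have "cmod (b n) ^ 2 \<le> cmod \<kappa> ^ 2 + (A n)^2" by (rule norm_b_square_le)
 also have "\<dots> \<le> (1 + cmod \<kappa>)^2 * (1 + (A n)^2)"
 proof -
  have "(1 + cmod \<kappa>)^2 * (1 + (A n)^2) = cmod \<kappa> ^ 2 + (A n)^2 + (1 + 2 * cmod \<kappa> + (cmod \<kappa>^2 + 2 * cmod \<kappa>) * (A n)^2)"
   by (simp add: power2_eq_square algebra_simps)
  moreover have "0 \<le> 1 + 2 * cmod \<kappa> + (cmod \<kappa>^2 + 2 * cmod \<kappa>) * (A n)^2" by (intro add_nonneg_nonneg mult_nonneg_nonneg) auto
  ultimately show ?thesis by linarith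
 qed
 finally show "cmod (b n) ^ 2 \<le> ((1 + cmod \<kappa>) * w n)^2" by (simp add: power_mult_distrib jw_def)
 show "0 \<le> (1 + cmod \<kappa>) * w n" using jw_pos[of d \<alpha> n] by (intro mult_nonneg_nonneg) auto
qed

text \<open>What is left of the symbol after its leading part i |alpha_n|; it has order - 1
  (\<open>gam_le\<close>).\<close>

definition gam :: "int => complex" where "gam n = b n - \<i> * of_real \<bar>A n\<bar>"

definition gamK :: real where "gamK = cmod \<kappa> ^ 2 * (1 / sqrt (Im (\<kappa>^2)) + 1)"

lemma gamK_nonneg: "0 \<le> gamK"
 using im by (auto simp: gamK_def intro!: mult_nonneg_nonneg add_nonneg_nonneg)

text \<open>Conjugate trick: gam (b + i |alpha_n|) = kappa^2, and the second factor is at least sqrt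
  (Im kappa^2) and at least |alpha_n|, hence bounded below by a multiple of
  \<open>jw\<close>.\<close>

lemma gam_le: "cmod (gam n) \<le> gamK / w n"
proof -
 let ?z = "b n + \<i> * of_real \<bar>A n\<bar>" and ?m = "sqrt (Im (\<kappa>^2))"
 have m0: "0 < ?m" using im by simp
 have "gam n * ?z = b n ^ 2 + of_real ((A n)^2)"
  by (simp add: gam_def power2_eq_square algebra_simps flip: of_real_mult)
 then have prod: "gam n * ?z = \<kappa>^2" by (simp add: b_square)
 have z1: "cmod (b n) \<le> cmod ?z"
  unfolding cmod_def using Re_b[of n] Im_b[of n] by (intro real_sqrt_le_mono add_mono power_mono) auto
 have "Im (\<kappa>^2) \<le> cmod (b n) ^ 2"
  using abs_Im_le_cmod[of "\<kappa>^2 - of_real ((A n)^2)"] im unfolding b_square[symmetric] norm_power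
  by (simp add: b_square)
 then have "?m \<le> cmod (b n)" by (intro real_le_lsqrt) auto
 then have z2: "?m \<le> cmod ?z" using z1 by simp
 have z3: "\<bar>A n\<bar> \<le> cmod ?z" using abs_Im_le_cmod[of ?z] Im_b[of n] by simp
 have z0: "0 < cmod ?z" using z2 m0 by linarith
 have "w n \<le> 1 + \<bar>A n\<bar>" unfolding jw_def by (rule real_le_lsqrt) (auto simp: power2_eq_square algebra_simps)
 also have "\<dots> \<le> cmod ?z / ?m + cmod ?z" using z2 z3 m0 by (intro add_mono) (auto simp: pos_le_divide_eq)
 finally have w: "w n \<le> (1 / ?m + 1) * cmod ?z" by (simp add: algebra_simps)
 have "cmod (gam n) * w n \<le> cmod (gam n) * ((1 / ?m + 1) * cmod ?z)" by (intro mult_left_mono w) auto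
 also have "\<dots> = (1 / ?m + 1) * cmod (gam n * ?z)" by (simp only: norm_mult mult_ac)
 also have "\<dots> = gamK" by (simp only: prod norm_power gamK_def mult.commute)
 finally show ?thesis using jw_pos[of d \<alpha> n] by (simp add: pos_le_divide_eq)
qed

lemma gam_le_const: "cmod (gam n) \<le> gamK"
proof -
 have "gamK / w n \<le> gamK / 1" by (intro divide_left_mono jw_ge1 gamK_nonneg) (use jw_pos[of d \<alpha> n] in simp)
 then show ?thesis using gam_le[of n] by simp
qed

section \<open>Differences of the symbol\<close>

lemma A_diff: "A n - A m = 2 * pi / d * of_int (n - m)"
 using alpha_n_add[of d \<alpha> m "n - m"] by simp

definition bK :: real where "bK = 2 * gamK + 2 * pi / d"

lemma bK_nonneg: "0 \<le> bK" using gamK_nonneg d by (auto simp: bK_def)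

text \<open>Growth in n - m only, not in n: this is why a commutator with a smooth function loses
  the order of \<open>betaD\<close>.\<close>

lemma b_diff: "cmod (b n - b m) \<le> bK * br (n - m)"
proof -
 have "b n - b m = gam n - gam m + \<i> * of_real (\<bar>A n\<bar> - \<bar>A m\<bar>)" by (simp add: gam_def algebra_simps)
 then have "cmod (b n - b m) \<le> cmod (gam n) + cmod (gam m) + \<bar>\<bar>A n\<bar> - \<bar>A m\<bar>\<bar>"
  using norm_triangle_ineq[of "gam n - gam m" "\<i> * of_real (\<bar>A n\<bar> - \<bar>A m\<bar>)"] norm_triangle_ineq4[of "gam n" "gam m"]
  by (simp add: norm_mult del: of_real_diff)
 also have "\<bar>\<bar>A n\<bar> - \<bar>A m\<bar>\<bar> \<le> \<bar>A n - A m\<bar>" by (rule abs_triangle_ineq3)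
 also have "\<dots> = 2 * pi / d * \<bar>of_int (n - m)\<bar>" using d by (simp add: A_diff abs_mult del: of_int_diff)
 also have "2 * pi / d * \<bar>of_int (n - m)\<bar> \<le> 2 * pi / d * br (n - m)" using d by (intro mult_left_mono) (auto simp: br_def)
 also have "cmod (gam n) + cmod (gam m) \<le> 2 * gamK * 1" using gam_le_const[of n] gam_le_const[of m] by simp
 also have "2 * gamK * 1 \<le> 2 * gamK * br (n - m)" using gamK_nonneg by (intro mult_left_mono) auto
 finally show ?thesis by (simp add: bK_def algebra_simps)
qed

definition bK2 :: real where "bK2 = (1 + 2 * (2 * pi / d)) * (2 * (2 * pi / d)) + gamK * (1 + 3 * jwK d)"

text \<open>The leading part \<open>\<i> \<bar>\<alpha>\<^sub>n\<bar>\<close> of the symbol is linear away from zero, so that this second difference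
 decays and compensates the first order factor in front.\<close>
lemma b_second_diff:
 "w n * cmod (b m + b (n + j - m) - b n - b j) \<le> bK2 * (br (n - m) ^ 2 * br (m - j) ^ 2)"
proof -
 let ?m' = "n + j - m" and ?\<delta> = "2 * pi / d"
 let ?p = "br (n - m)" and ?r = "br (m - j)"
 let ?N = "\<bar>A m\<bar> + \<bar>A ?m'\<bar> - \<bar>A n\<bar> - \<bar>A j\<bar>"
 have \<delta>: "0 < ?\<delta>" using d by simp
 have w0: "0 < w k" for k by (rule jw_pos)
 have pr1: "1 \<le> ?p * ?r" using mult_mono[of 1 ?p 1 ?r] by simp
 have ple: "?p \<le> ?p * ?r" "?r \<le> ?p * ?r" using mult_left_mono[of 1 ?r ?p] mult_right_mono[of 1 ?p ?r] by auto
 have pp: "?p * ?r \<le> ?p ^ 2 * ?r ^ 2"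
 proof -
  have "(?p * ?r) * 1 \<le> (?p * ?r) * (?p * ?r)" by (intro mult_left_mono pr1) auto
  then show ?thesis by (simp add: power2_eq_square mult_ac)
 qed
 define P R where "P = ?\<delta> * of_int (n - m)" and "R = ?\<delta> * of_int (m - j)"
 have Am: "A m = A n - P" "A ?m' = A n - R" "A j = A n - P - R"
  using A_diff[of n m] A_diff[of n ?m'] A_diff[of m j] by (simp_all add: P_def R_def)
 have absP: "\<bar>P\<bar> \<le> ?\<delta> * ?p" and absR: "\<bar>R\<bar> \<le> ?\<delta> * ?r"
  unfolding P_def R_def abs_mult abs_of_pos[OF \<delta>] using \<delta> by (intro mult_left_mono; simp add: br_def)+
 \<comment> \<open>Either no two of the four arguments have opposite signs, |.| is linear there and
   ?N = 0, or |A n| < |P| + |R| and the weight itself is bounded by the two distances.\<close>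
 have lead: "w n * \<bar>?N\<bar> \<le> (1 + 2 * ?\<delta>) * (2 * ?\<delta>) * (?p ^ 2 * ?r ^ 2)"
 proof (cases "\<bar>P\<bar> + \<bar>R\<bar> \<le> \<bar>A n\<bar>")
  case True
  then have "?N = 0" unfolding Am by (auto simp: abs_if split: if_splits)
  moreover have "0 \<le> (1 + 2 * ?\<delta>) * (2 * ?\<delta>) * (?p ^ 2 * ?r ^ 2)" using \<delta> by (intro mult_nonneg_nonneg) auto
  ultimately show ?thesis by simp
 next
  case False
  have PR: "\<bar>P\<bar> + \<bar>R\<bar> \<le> ?\<delta> * (?p * ?r * 2)"
   using absP absR mult_left_mono[OF ple(1), of ?\<delta>] mult_left_mono[OF ple(2), of ?\<delta>] \<delta> by simp
  have "?p + ?r \<le> 1 + ?p * ?r"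
   using mult_nonneg_nonneg[of "?p - 1" "?r - 1"] by (simp add: algebra_simps)
  have "w n \<le> 1 + \<bar>A n\<bar>" unfolding jw_def by (rule real_le_lsqrt) (auto simp: power2_eq_square algebra_simps)
  also have "\<dots> \<le> ?p * ?r + ?\<delta> * (?p * ?r * 2)" using False PR pr1 by linarith
  finally have wn: "w n \<le> (1 + 2 * ?\<delta>) * (?p * ?r)" by (simp add: algebra_simps)
  have "\<bar>?N\<bar> \<le> 2 * \<bar>P\<bar>" unfolding Am by linarith
  also have "\<dots> \<le> 2 * \<delta>' * (?p * ?r)" if "\<delta>' = ?\<delta>" for \<delta>'
   using absP mult_left_mono[OF ple(1), of ?\<delta>] \<delta> that by simp
  finally have N: "\<bar>?N\<bar> \<le> 2 * ?\<delta> * (?p * ?r)" by simp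
  have "w n * \<bar>?N\<bar> \<le> ((1 + 2 * ?\<delta>) * (?p * ?r)) * (2 * ?\<delta> * (?p * ?r))"
   by (rule mult_mono[OF wn N]) (use \<delta> in auto)
  also have "\<dots> = (1 + 2 * ?\<delta>) * (2 * ?\<delta>) * (?p ^ 2 * ?r ^ 2)" by (simp only: power2_eq_square mult_ac)
  finally show ?thesis .
 qed
 have g: "w n * cmod (gam k) \<le> gamK * (jwK d * br (n - k))" for k
 proof -
  have "w n * cmod (gam k) \<le> (jwK d * w k * br (k - n)) * (gamK / w k)"
   by (rule mult_mono[OF jw_le gam_le]) (use w0[of k] jwK_ge1[of d] in auto)
  also have "\<dots> = gamK * (jwK d * br (n - k))" using w0[of k] by (simp add: br_diff_commute[of k n])
  finally show ?thesis .
 qed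
 have K0: "0 \<le> gamK * jwK d" using gamK_nonneg jwK_ge1[of d] by simp
 have gn: "w n * cmod (gam n) \<le> gamK * (?p ^ 2 * ?r ^ 2)"
 proof -
  have "w n * cmod (gam n) \<le> gamK * 1" using gam_le[of n] w0[of n] by (simp add: pos_le_divide_eq mult.commute)
  also have "\<dots> \<le> gamK * (?p ^ 2 * ?r ^ 2)" using pr1 pp by (intro mult_left_mono gamK_nonneg) linarith
  finally show ?thesis .
 qed
 have gk: "w n * cmod (gam k) \<le> gamK * jwK d * (?p ^ 2 * ?r ^ 2)" if "br (n - k) \<le> ?p * ?r" for k
 proof -
  have "gamK * jwK d * br (n - k) \<le> gamK * jwK d * (?p ^ 2 * ?r ^ 2)" using that pp by (intro mult_left_mono K0) linarith
  then show ?thesis using g[of k] by (simp add: mult.assoc)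
 qed
 have g3: "w n * cmod (gam m) \<le> gamK * jwK d * (?p ^ 2 * ?r ^ 2)" "w n * cmod (gam ?m') \<le> gamK * jwK d * (?p ^ 2 * ?r ^ 2)"
  "w n * cmod (gam j) \<le> gamK * jwK d * (?p ^ 2 * ?r ^ 2)"
  using gk[of m] gk[of ?m'] gk[of j] ple br_mult[of "n - m" "m - j"] by auto
 have "b m + b ?m' - b n - b j = gam m + gam ?m' - gam n - gam j + \<i> * of_real ?N"
  by (simp add: gam_def algebra_simps)
 then have "cmod (b m + b ?m' - b n - b j) \<le> cmod (gam m) + cmod (gam ?m') + cmod (gam n) + cmod (gam j) + \<bar>?N\<bar>"
  using norm_triangle_ineq[of "gam m + gam ?m' - gam n - gam j" "\<i> * of_real ?N"]
   norm_triangle_ineq4[of "gam m + gam ?m' - gam n" "gam j"] norm_triangle_ineq4[of "gam m + gam ?m'" "gam n"] norm_triangle_ineq[of "gam m" "gam ?m'"]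
  by (simp add: norm_mult del: of_real_diff of_real_add)
 from mult_left_mono[OF this, of "w n"]
 have "w n * cmod (b m + b ?m' - b n - b j) \<le> w n * cmod (gam m) + w n * cmod (gam ?m') + w n * cmod (gam n) + w n * cmod (gam j) + w n * \<bar>?N\<bar>"
  using w0[of n] by (simp add: distrib_left)
 also have "\<dots> \<le> bK2 * (?p ^ 2 * ?r ^ 2)"
  using lead g3 gn by (simp add: bK2_def algebra_simps)
 finally show ?thesis .
qed

definition comm_mat :: "coeffs => int => int => complex" where "comm_mat p n j = (b n - b j) * p (n - j)"

lemma mdec_comm_mat: assumes "rapid C p" shows "mdec (bK * C) (comm_mat p)"
 unfolding mdec_def comm_mat_def norm_mult
proof (intro allI)
 fix n j
 let ?x = "br (n - j)"
 have "cmod (b n - b j) * cmod (p (n - j)) \<le> (bK * ?x) * (C / ?x ^ 5)"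
  using bK_nonneg by (intro mult_mono b_diff rapidD[OF assms]) auto
 also have "\<dots> = bK * C / ?x ^ 4" by (simp add: field_simps eval_nat_numeral)
 also have "\<dots> \<le> bK * C / ?x ^ 3"
  using bK_nonneg rapid_nonneg[OF assms] by (intro divide_left_mono power_increasing mult_pos_pos mult_nonneg_nonneg) auto
 finally show "cmod (b n - b j) * cmod (p (n - j)) \<le> bK * C / ?x ^ 3" .
qed

lemma betaD_eq: "betaD d \<alpha> \<kappa> c n = b n * c n"
 by (simp add: betaD_def bsym_def)

text \<open>\<open>betaD\<close> c need not be \<open>adm\<close>. Its product with the Toeplitz
  entries is therefore written as b n times one convergent series minus another, the commutator
  series.\<close>

lemma commut_mapp:
 assumes "rapid C (per_coef d g)" "adm c"
 shows "commut d \<alpha> \<kappa> g c = mapp (comm_mat (per_coef d g)) c"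
proof
 fix n
 let ?p = "per_coef d g"
 have s1: "(\<lambda>k. b n * (toep ?p n k * c k)) summable_on UNIV"
  by (intro summable_on_cmult_right mapp_summable[OF mdec_toep[OF assms(1)] assms(2)])
 have s2: "(\<lambda>k. comm_mat ?p n k * c k) summable_on UNIV"
  by (rule mapp_summable[OF mdec_comm_mat[OF assms(1)] assms(2)])
 have e: "toep ?p n k * betaD d \<alpha> \<kappa> c k = b n * (toep ?p n k * c k) - comm_mat ?p n k * c k" for k
  by (simp add: toep_def comm_mat_def betaD_eq algebra_simps)
 have "mulop d g (betaD d \<alpha> \<kappa> c) n = infsum (\<lambda>k. b n * (toep ?p n k * c k) + - (comm_mat ?p n k * c k)) UNIV"
  unfolding mulop_mapp mapp_def e by simp
 also have "\<dots> = infsum (\<lambda>k. b n * (toep ?p n k * c k)) UNIV - mapp (comm_mat ?p) c n"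
  using infsum_add[OF s1 s2[THEN summable_on_uminus[THEN iffD2]]] by (simp add: infsum_uminus mapp_def)
 also have "\<dots> = b n * mulop d g c n - mapp (comm_mat ?p) c n"
  unfolding mulop_mapp by (simp add: mapp_def infsum_cmult_right')
 finally show "commut d \<alpha> \<kappa> g c n = mapp (comm_mat ?p) c n"
  by (simp add: commut_def betaD_eq)
qed

text \<open>The matrix of F [beta, F] - [beta, F^2 / 2], the operator between the outer and the
  inner \<open>betaD\<close> of \<open>Y2m\<close>; p and q are the coefficients of F and F^2 /
  2.\<close>

definition Xmat :: "coeffs => coeffs => int => int => complex" where
 "Xmat p q n j = mmul (toep p) (comm_mat p) n j - comm_mat q n j"

text \<open>As q is half the self-convolution of p, both terms are sums over an intermediate index m
  with the common factor p (n - m) p (m - j). Averaging with the reflection m -> n + j - m turns the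
  first difference of the symbol into the second difference, which absorbs the weight.\<close>

lemma Xmat_bound:
 assumes p: "rapid C p" and q: "\<And>k. q k = infsum (\<lambda>m. p (k - m) * p m) UNIV / 2"
 shows "mdec ((bK2 / 2) * C^2 * convK) (\<lambda>n j. of_real (w n) * Xmat p q n j)"
 unfolding mdec_def
proof (intro allI)
 fix n j
 note C0 = rapid_nonneg[OF p]
 have sP: "(\<lambda>m. toep p n m * toep p m j) summable_on UNIV"
  by (rule mapp_summable[OF mdec_toep[OF p] mdec_col_adm[OF mdec_toep[OF p]]])
 have sC: "(\<lambda>m. toep p n m * comm_mat p m j) summable_on UNIV"
  by (rule mapp_summable[OF mdec_toep[OF p] mdec_col_adm[OF mdec_comm_mat[OF p]]])
 have qe: "q (n - j) = infsum (\<lambda>m. toep p n m * toep p m j) UNIV / 2"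
 proof -
  have "infsum (\<lambda>m. p (n - j - m) * p m) UNIV = infsum (\<lambda>m. toep p n m * toep p m j) UNIV"
   by (rule infsum_reindex_bij_witness[of UNIV "\<lambda>m. m - j" "\<lambda>m. m + j"]) (auto simp: toep_def algebra_simps)
  then show ?thesis by (simp add: q)
 qed
 \<comment> \<open>The bracket is (b m - b j) - (b n - b j) / 2: the commutator with F^2 / 2 enters
   through the convolution formula for q.\<close>
 define Y where "Y m = p (n - m) * p (m - j) * (b m - b j / 2 - b n / 2)" for m
 have Y: "Y m = toep p n m * comm_mat p m j + - ((b n - b j) / 2) * (toep p n m * toep p m j)" for m
  by (simp add: Y_def toep_def comm_mat_def field_simps)
 have sY: "Y summable_on UNIV"
  unfolding Y by (intro summable_on_add sC summable_on_cmult_right sP)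
 have X: "Xmat p q n j = infsum Y UNIV"
  unfolding Y infsum_add[OF sC summable_on_cmult_right[OF sP]] infsum_cmult_right' Xmat_def comm_mat_def[of q] qe
  by (simp add: mmul_def algebra_simps)
 \<comment> \<open>The reflection swaps n - m and m - j, hence preserves the product of
   coefficients.\<close>
 have X': "Xmat p q n j = infsum (\<lambda>m. Y (n + j - m)) UNIV"
  unfolding X infsum_reflect_int ..
 have sY': "(\<lambda>m. Y (n + j - m)) summable_on UNIV"
  by (rule summable_on_reindex_bij_witness[of UNIV "\<lambda>m. n + j - m" "\<lambda>m. n + j - m", THEN iffD1, OF _ _ _ _ _ sY]) auto
 have XX: "2 * Xmat p q n j = infsum (\<lambda>m. p (n - m) * p (m - j) * (b m + b (n + j - m) - b n - b j)) UNIV"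
 proof -
  have "2 * Xmat p q n j = infsum (\<lambda>m. Y m + Y (n + j - m)) UNIV"
   unfolding infsum_add[OF sY sY'] X[symmetric] X'[symmetric] by simp
  moreover have "Y m + Y (n + j - m) = p (n - m) * p (m - j) * (b m + b (n + j - m) - b n - b j)" for m
   by (simp add: Y_def field_simps)
  ultimately show ?thesis by simp
 qed
 let ?G = "\<lambda>m. of_real (w n) * (p (n - m) * p (m - j) * (b m + b (n + j - m) - b n - b j))"
 have le: "norm (?G m) \<le> bK2 * C^2 * (1 / br (n - m) ^ 3 * (1 / br (m - j) ^ 3))" for m
 proof -
  let ?a = "br (n - m)" and ?c = "br (m - j)"
  have "norm (?G m) = cmod (p (n - m)) * cmod (p (m - j)) * (w n * cmod (b m + b (n + j - m) - b n - b j))"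
   using jw_pos[of d \<alpha> n] by (simp add: norm_mult)
  also have "\<dots> \<le> (C / ?a ^ 5) * (C / ?c ^ 5) * (bK2 * (?a ^ 2 * ?c ^ 2))"
   using jw_pos[of d \<alpha> n] C0 by (intro mult_mono rapidD[OF p] b_second_diff) auto
  also have "\<dots> = bK2 * C^2 * (1 / ?a ^ 3 * (1 / ?c ^ 3))"
   by (simp add: field_simps eval_nat_numeral)
  finally show ?thesis .
 qed
 have sB: "(\<lambda>m. bK2 * C^2 * (1 / br (n - m) ^ 3 * (1 / br (m - j) ^ 3))) summable_on UNIV"
  by (intro summable_on_cmult_right br_conv) auto
 have sG: "(\<lambda>m. norm (?G m)) summable_on UNIV"
  by (rule summable_on_comparison_test[OF sB]) (use le in auto)
 have bK20: "0 \<le> bK2"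
  using d gamK_nonneg jwK_ge1[of d] unfolding bK2_def by (intro add_nonneg_nonneg mult_nonneg_nonneg) auto
 have "cmod (infsum ?G UNIV) \<le> infsum (\<lambda>m. norm (?G m)) UNIV" by (rule norm_infsum_bound[OF sG])
 also have "\<dots> \<le> infsum (\<lambda>m. bK2 * C^2 * (1 / br (n - m) ^ 3 * (1 / br (m - j) ^ 3))) UNIV"
  by (rule infsum_mono[OF sG sB le])
 also have "\<dots> = bK2 * C^2 * infsum (\<lambda>m. 1 / br (n - m) ^ 3 * (1 / br (m - j) ^ 3)) UNIV" by (rule infsum_cmult_right')
 also have "\<dots> \<le> bK2 * C^2 * (convK / br (n - j) ^ 3)"
  using br_conv(2)[of 3 n j] bK20 by (intro mult_left_mono) (auto simp: convK_def)
 finally have "cmod (of_real (w n) * (2 * Xmat p q n j)) \<le> bK2 * C^2 * (convK / br (n - j) ^ 3)"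
  unfolding XX infsum_cmult_right' .
 moreover have "cmod (of_real (w n) * (2 * Xmat p q n j)) = 2 * cmod (of_real (w n) * Xmat p q n j)" by (simp add: norm_mult)
 ultimately show "cmod (of_real (w n) * Xmat p q n j) \<le> bK2 / 2 * C^2 * convK / br (n - j) ^ 3" by (simp add: field_simps)
qed

text \<open>The expansion operators with one factor \<open>jw\<close> divided out on the right, so
  that \<open>Yell\<close> is \<open>Zmat\<close> applied to jw c. What remains has order zero and
  decays off the diagonal.\<close>

definition Zmat :: "(real => real) => nat => int => int => complex" where
 "Zmat f l = (let B = diagm (\<lambda>n. b n / of_real (w n)) in
   if l = 0 then diagm (\<lambda>n. - \<i> * (b n / of_real (w n)))
   else if l = 1 then (\<lambda>n j. mmul (toep (per_coef d (deriv f))) (diagm (\<lambda>n. \<i> * of_real (A n) / of_real (w n))) n j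
    - mmul (comm_mat (per_coef d f)) B n j)
   else mmul (\<lambda>n j. \<i> * b n * Xmat (per_coef d f) (per_coef d (\<lambda>x. (f x)^2 / 2)) n j) B)"

lemma norm_bw: "cmod (b n / of_real (w n)) \<le> 1 + cmod \<kappa>"
 using norm_b_le[of n] jw_pos[of d \<alpha> n] by (simp add: norm_divide pos_divide_le_eq)

lemma mdec_B: "mdec (1 + cmod \<kappa>) (diagm (\<lambda>n. b n / of_real (w n)))"
 by (rule mdec_diagm[OF norm_bw])

lemma norm_iAw: "cmod (\<i> * of_real (A n) / of_real (w n)) \<le> 1"
 using abs_alpha_le_jw[of d \<alpha> n] jw_pos[of d \<alpha> n] by (simp add: norm_divide norm_mult)

context
 fixes f :: "real => real" and C :: real
 assumes f: "rapid C (per_coef d f)" and f': "rapid C (per_coef d (deriv f))"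
  and ff: "rapid C (per_coef d (\<lambda>x. (f x)^2 / 2))"
  and conv: "\<And>k. per_coef d (\<lambda>x. (f x)^2 / 2) k = infsum (\<lambda>m. per_coef d f (k - m) * per_coef d f m) UNIV / 2"
begin

lemma mdec_bX: "mdec ((1 + cmod \<kappa>) * ((bK2 / 2) * C^2 * convK))
  (\<lambda>n j. \<i> * b n * Xmat (per_coef d f) (per_coef d (\<lambda>x. (f x)^2 / 2)) n j)"
 unfolding mdec_def
proof (intro allI)
 fix n j
 let ?X = "Xmat (per_coef d f) (per_coef d (\<lambda>x. (f x)^2 / 2)) n j"
 have "cmod (\<i> * b n * ?X) \<le> ((1 + cmod \<kappa>) * w n) * cmod ?X"
  unfolding norm_mult by (intro mult_right_mono) (use norm_b_le[of n] in auto)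
 also have "\<dots> = (1 + cmod \<kappa>) * cmod (of_real (w n) * ?X)" using jw_pos[of d \<alpha> n] by (simp add: norm_mult)
 also have "\<dots> \<le> (1 + cmod \<kappa>) * ((bK2 / 2) * C^2 * convK / br (n - j) ^ 3)"
  by (intro mult_left_mono mdecD[OF Xmat_bound[OF f conv]]) auto
 finally show "cmod (\<i> * b n * ?X) \<le> (1 + cmod \<kappa>) * ((bK2 / 2) * C^2 * convK) / br (n - j) ^ 3" by simp
qed

lemma mdec_Zmat: "\<exists>M. mdec M (Zmat f l)"
proof -
 have 0: "mdec (1 + cmod \<kappa>) (diagm (\<lambda>n. - \<i> * (b n / of_real (w n))))"
  by (rule mdec_diagm) (use norm_bw in \<open>simp only: norm_mult norm_minus_cancel norm_ii mult_1_left\<close>)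
 consider "l = 0" | "l = 1" | "l > 1" by linarith
 then show ?thesis
 proof cases
  case 1 then show ?thesis using 0 by (auto simp: Zmat_def Let_def)
 next
  case 2
  have "mdec (convK * C * 1 + convK * (bK * C) * (1 + cmod \<kappa>)) (Zmat f 1)"
   unfolding Zmat_def Let_def
   using mdec_diff[OF mdec_mmul[OF mdec_toep[OF f'] mdec_diagm[OF norm_iAw]] mdec_mmul[OF mdec_comm_mat[OF f] mdec_B]] by simp
  then show ?thesis using 2 by blast
 next
  case 3
  then show ?thesis using mdec_mmul[OF mdec_bX mdec_B] by (auto simp: Zmat_def Let_def)
 qed
qed

text \<open>The decay hypothesis on jw c is met by single layers of trigonometric polynomials
  (\<open>finite_combination_decay\<close>); it makes the infinite sums in \<open>mulop\<close>
  converge and lets the matrices be composed.\<close>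

lemma Yell_mapp:
 assumes v: "\<And>n. cmod (of_real (w n) * c n) \<le> D / br (n - j) ^ 3" and l: "l \<le> 2"
 shows "Yell l d \<alpha> \<kappa> f c = mapp (Zmat f l) (\<lambda>n. of_real (w n) * c n)"
proof -
 let ?v = "\<lambda>n. of_real (w n) * c n" and ?B = "diagm (\<lambda>n. b n / of_real (w n))"
 have w0: "complex_of_real (w n) \<noteq> 0" for n using jw_pos[of d \<alpha> n] by simp
 note mB = mapp_adm_mdec[OF v mdec_B]
 have D1: "mdec 1 (diagm (\<lambda>n. \<i> * of_real (A n) / of_real (w n)))" by (rule mdec_diagm[OF norm_iAw])
 have bc: "betaD d \<alpha> \<kappa> c = mapp ?B ?v" using w0 by (simp add: fun_eq_iff betaD_eq mapp_diagm)
 have dc: "Dop d \<alpha> c = mapp (diagm (\<lambda>n. \<i> * of_real (A n) / of_real (w n))) ?v"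
  using w0 by (simp add: fun_eq_iff Dop_def mapp_diagm)
 have comm: "commut d \<alpha> \<kappa> g (betaD d \<alpha> \<kappa> c) = mapp (comm_mat (per_coef d g)) (mapp ?B ?v)"
  if "rapid C (per_coef d g)" for g
  unfolding bc by (rule commut_mapp[OF that mB(3)])
 consider "l = 0" | "l = 1" | "l = 2" using l by linarith
 then show ?thesis
 proof cases
  case 1
  then show ?thesis using w0 by (simp add: fun_eq_iff Yell_def Y0m_def Zmat_def betaD_eq mapp_diagm)
 next
  case 2
  have e1: "mulop d (deriv f) (Dop d \<alpha> c) = mapp (mmul (toep (per_coef d (deriv f))) (diagm (\<lambda>n. \<i> * of_real (A n) / of_real (w n)))) ?v"
   unfolding mulop_mapp dc by (rule mapp_mapp[OF mdec_toep[OF f'] D1 mB(1)])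
  have e2: "commut d \<alpha> \<kappa> f (betaD d \<alpha> \<kappa> c) = mapp (mmul (comm_mat (per_coef d f)) ?B) ?v"
   unfolding comm[OF f] by (rule mapp_mapp[OF mdec_comm_mat[OF f] mdec_B mB(1)])
  have m1: "mdec (convK * C * 1) (mmul (toep (per_coef d (deriv f))) (diagm (\<lambda>n. \<i> * of_real (A n) / of_real (w n))))"
   by (rule mdec_mmul[OF mdec_toep[OF f'] D1])
  have m2: "mdec (convK * (bK * C) * (1 + cmod \<kappa>)) (mmul (comm_mat (per_coef d f)) ?B)"
   by (rule mdec_mmul[OF mdec_comm_mat[OF f] mdec_B])
  show ?thesis unfolding 2
   by (simp add: fun_eq_iff Yell_def Y1m_def e1 e2 Zmat_def Let_def mapp_diff[OF m1 m2 mB(1)])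
 next
  case 3
  let ?C = "comm_mat (per_coef d f)" and ?G = "comm_mat (per_coef d (\<lambda>x. (f x)^2 / 2))" and ?T = "toep (per_coef d f)"
  let ?X = "Xmat (per_coef d f) (per_coef d (\<lambda>x. (f x)^2 / 2))"
  have e: "mulop d f (commut d \<alpha> \<kappa> f (betaD d \<alpha> \<kappa> c)) = mapp (mmul ?T ?C) (mapp ?B ?v)"
   unfolding comm[OF f] mulop_mapp by (rule mapp_mapp[OF mdec_toep[OF f] mdec_comm_mat[OF f] mB(3)])
  have X: "mapp (mmul ?T ?C) (mapp ?B ?v) n - mapp ?G (mapp ?B ?v) n = mapp ?X (mapp ?B ?v) n" for n
   unfolding Xmat_def[abs_def] mapp_diff[OF mdec_mmul[OF mdec_toep[OF f] mdec_comm_mat[OF f]] mdec_comm_mat[OF ff] mB(3)] ..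
  have "Yell l d \<alpha> \<kappa> f c n = \<i> * b n * mapp ?X (mapp ?B ?v) n" for n
   unfolding X[symmetric] by (simp add: 3 Yell_def Y2m_def betaD_eq comm[OF ff] e)
  also have "\<i> * b n * mapp ?X (mapp ?B ?v) n = mapp (\<lambda>n j. \<i> * b n * ?X n j) (mapp ?B ?v) n" for n
   by (simp add: mapp_def mult.assoc infsum_cmult_right')
  finally have "Yell l d \<alpha> \<kappa> f c = mapp (\<lambda>n j. \<i> * b n * ?X n j) (mapp ?B ?v)" by (rule ext)
  also have "\<dots> = mapp (mmul (\<lambda>n j. \<i> * b n * ?X n j) ?B) ?v" by (rule mapp_mapp[OF mdec_bX mdec_B mB(1)])
  finally show ?thesis by (simp add: 3 Zmat_def Let_def)
 qed
qed

end

end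

section \<open>Fourier coefficients and smooth periodic functions\<close>

definition ccoef :: "real => (real => complex) => coeffs" where
 "ccoef d g m = 1 / of_real d * integral {0..d} (\<lambda>x. g x * exp (- \<i> * of_real (2 * pi * of_int m * x / d)))"

lemma per_coef_ccoef: "per_coef d f = ccoef d (\<lambda>x. of_real (f x))"
 by (simp add: per_coef_def[abs_def] ccoef_def[abs_def])

definition ee :: "real => int => real => complex" where
 "ee d m x = exp (\<i> * of_real (2 * pi * of_int m * x / d))"

lemma norm_ee [simp]: "cmod (ee d m x) = 1" by (simp add: ee_def)

lemma ee_add: "ee d (m + n) x = ee d m x * ee d n x"
 by (simp add: ee_def algebra_simps add_divide_distrib flip: exp_add)

lemma ee_0 [simp]: "ee d 0 x = 1" by (simp add: ee_def)

lemma ee_period: assumes "d \<noteq> 0" shows "ee d m (x + d) = ee d m x"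
proof -
 have "\<i> * of_real (2 * pi * of_int m * (x + d) / d) = \<i> * of_real (2 * pi * of_int m * x / d) + 2 * of_int m * of_real pi * \<i>"
  using assms by (simp add: field_simps)
 then show ?thesis unfolding ee_def by (simp only: exp_add exp_integer_2pi[OF Ints_of_int, of m]) (simp add: exp_integer_2pi mult_ac)
qed

lemma ee_deriv: "(ee d m has_vector_derivative \<i> * of_real (2 * pi * of_int m / d) * ee d m x) (at x within S)"
proof -
 have "((\<lambda>x. complex_of_real (2 * pi * of_int m * x / d)) has_vector_derivative of_real (2 * pi * of_int m / d)) (at x)"
  by (rule has_vector_derivative_of_real[OF DERIV_cdivide[OF DERIV_cmult_Id]])
 moreover have "((\<lambda>z. exp (\<i> * z)) has_field_derivative \<i> * ee d m x) (at (complex_of_real (2 * pi * of_int m * x / d)))"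
  unfolding ee_def by (auto intro!: derivative_eq_intros)
 ultimately have "(((\<lambda>z. exp (\<i> * z)) \<circ> (\<lambda>x. complex_of_real (2 * pi * of_int m * x / d))) has_vector_derivative of_real (2 * pi * of_int m / d) * (\<i> * ee d m x)) (at x)"
  by (rule field_vector_diff_chain_at)
 then have "(ee d m has_vector_derivative of_real (2 * pi * of_int m / d) * (\<i> * ee d m x)) (at x)"
  by (simp only: comp_def ee_def[abs_def])
 then show ?thesis by (rule has_vector_derivative_at_within[THEN has_vector_derivative_eq_rhs]) (simp only: mult_ac)
qed

lemma continuous_on_ee [continuous_intros]: "continuous_on S (ee d m)"
 using ee_deriv[of d m _ S] by (auto simp: continuous_on_eq_continuous_within intro: has_vector_derivative_continuous)

lemma ccoef_ee: "ccoef d g m = 1 / of_real d * integral {0..d} (\<lambda>x. g x * ee d (- m) x)"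
 by (simp add: ccoef_def ee_def)

lemma ccoef_bound:
 assumes "0 < d" "\<And>x. cmod (g x) \<le> B" "continuous_on {0..d} g" shows "cmod (ccoef d g m) \<le> B"
proof -
 have "norm (integral (cbox 0 d) (\<lambda>x. g x * ee d (- m) x)) \<le> B * measure lborel (cbox 0 d)"
  by (rule integrable_bound)
   (use assms order_trans[OF norm_ge_zero assms(2)] in \<open>auto simp: norm_mult intro!: integrable_continuous_real continuous_intros\<close>)
 then show ?thesis using assms(1) by (simp add: ccoef_ee norm_mult norm_divide pos_divide_le_eq)
qed

lemma ccoef_deriv:
 assumes d: "0 < d" and g: "\<And>x. (g has_vector_derivative g' x) (at x)" and c: "continuous_on {0..d} g'"
  and p: "\<And>x. g (x + d) = g x"
 shows "ccoef d g' m = \<i> * of_real (2 * pi * of_int m / d) * ccoef d g m"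
proof -
 let ?e = "ee d (- m)" and ?\<mu> = "\<i> * of_real (2 * pi * of_int m / d)"
 have gc: "continuous_on {0..d} g"
  by (intro continuous_at_imp_continuous_on ballI has_vector_derivative_continuous[OF g])
 have "((\<lambda>x. g x * (- ?\<mu> * ?e x) + g' x * ?e x) has_integral (g d * ?e d - g 0 * ?e 0)) {0..d}"
 proof (rule fundamental_theorem_of_calculus)
  show "((\<lambda>x. g x * ?e x) has_vector_derivative g x * (- ?\<mu> * ?e x) + g' x * ?e x) (at x within {0..d})" for x
   using has_vector_derivative_mult[OF has_vector_derivative_at_within[OF g] ee_deriv[of d "- m" x "{0..d}"]] by simp
 qed (use d in simp)
 moreover have "g d * ?e d - g 0 * ?e 0 = 0" using p[of 0] ee_period[of d "- m" 0] d by simp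
 ultimately have i: "((\<lambda>x. g x * (- ?\<mu> * ?e x) + g' x * ?e x) has_integral 0) {0..d}" by simp
 have i1: "(\<lambda>x. g x * (- ?\<mu> * ?e x)) integrable_on {0..d}" "(\<lambda>x. g' x * ?e x) integrable_on {0..d}"
  by (intro integrable_continuous_real continuous_intros gc c)+
 have "integral {0..d} (\<lambda>x. g x * (- ?\<mu> * ?e x)) + integral {0..d} (\<lambda>x. g' x * ?e x) = 0"
  using integral_add[OF i1] integral_unique[OF i] by simp
 moreover have "(\<lambda>x. g x * (- ?\<mu> * ?e x)) = (\<lambda>x. - ?\<mu> * (g x * ?e x))" by (simp add: fun_eq_iff mult_ac)
 ultimately have "integral {0..d} (\<lambda>x. g' x * ?e x) = ?\<mu> * integral {0..d} (\<lambda>x. g x * ?e x)"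
  by (simp only: integral_mult_right) (simp add: add_eq_0_iff2)
 then show ?thesis by (simp only: ccoef_ee mult_ac)
qed

subsection \<open>Functions with bounded derivatives\<close>

text \<open>A C^k bound with the same B for all derivatives up to order k. The recursion through an
  existentially chosen derivative avoids iterated derivative operators; the base case keeps
  continuity for the sake of integrability.\<close>

fun Cb :: "nat => real => (real => complex) => bool" where
 "Cb 0 B f \<longleftrightarrow> (\<forall>x. cmod (f x) \<le> B) \<and> continuous_on UNIV f"
| "Cb (Suc k) B f \<longleftrightarrow> (\<forall>x. cmod (f x) \<le> B) \<and>
   (\<exists>f'. (\<forall>x. (f has_vector_derivative f' x) (at x)) \<and> Cb k B f')"

lemma Cb_bound: "Cb k B f ==> cmod (f x) \<le> B" by (cases k) auto

lemma Cb_nonneg: "Cb k B f ==> 0 \<le> B" using Cb_bound[of k B f 0] norm_ge_zero order_trans by blast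

lemma Cb_continuous: "Cb k B f ==> continuous_on S f"
 by (cases k) (auto intro: continuous_on_subset continuous_at_imp_continuous_on has_vector_derivative_continuous)

lemma Cb_mono: "Cb k B f ==> B \<le> B' ==> Cb k B' f"
proof (induction k arbitrary: f)
 case 0 then show ?case by (auto intro: order_trans)
next
 case (Suc k)
 then obtain f' where "\<forall>x. (f has_vector_derivative f' x) (at x)" "Cb k B f'" by auto
 moreover have "cmod (f x) \<le> B'" for x using Cb_bound[OF Suc.prems(1), of x] Suc.prems(2) by simp
 ultimately show ?case using Suc.IH[of f'] Suc.prems(2) by auto
qed

lemma Cb_SucI:
 assumes "\<And>x. cmod (f x) \<le> B" "\<And>x. (f has_vector_derivative f' x) (at x)" "Cb k B f'" shows "Cb (Suc k) B f"
 using assms by auto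

lemma Cb_lower: "Cb (Suc k) B f ==> Cb k B f"
proof (induction k arbitrary: f)
 case 0 then show ?case using Cb_continuous[OF 0] by auto
next
 case (Suc k)
 from Suc.prems obtain f' where "\<forall>x. cmod (f x) \<le> B" "\<forall>x. (f has_vector_derivative f' x) (at x)" "Cb (Suc k) B f'"
  by (subst (asm) Cb.simps(2)) blast
 then show ?case using Suc.IH[of f'] by auto
qed

lemma Cb_add: "Cb k A f ==> Cb k B g ==> Cb k (A + B) (\<lambda>x. f x + g x)"
proof (induction k arbitrary: f g)
 case 0 then show ?case by (auto intro!: norm_triangle_le add_mono continuous_intros)
next
 case (Suc k)
 then obtain f' g' where "\<And>x. (f has_vector_derivative f' x) (at x)" "Cb k A f'" "\<And>x. (g has_vector_derivative g' x) (at x)" "Cb k B g'"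
  by auto
 then show ?case using Cb_bound[OF Suc.prems(1)] Cb_bound[OF Suc.prems(2)]
  by (intro Cb_SucI[where f' = "\<lambda>x. f' x + g' x"] norm_triangle_le add_mono has_vector_derivative_add Suc.IH) auto
qed

text \<open>The Leibniz rule produces two terms per derivative, hence the factor 2 ^ k.\<close>

lemma Cb_mult: "Cb k A f ==> Cb k B g ==> Cb k (2 ^ k * A * B) (\<lambda>x. f x * g x)"
proof (induction k arbitrary: f g)
 case 0
 then show ?case using Cb_nonneg[OF 0(1)] by (auto simp: norm_mult intro!: mult_mono continuous_intros)
next
 case (Suc k)
 from Suc.prems obtain f' g' where f': "\<And>x. (f has_vector_derivative f' x) (at x)" "Cb k A f'"
  and g': "\<And>x. (g has_vector_derivative g' x) (at x)" "Cb k B g'" by auto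
 note nn = Cb_nonneg[OF Suc.prems(1)] Cb_nonneg[OF Suc.prems(2)]
 show ?case
 proof (rule Cb_SucI)
  fix x
  have "cmod (f x * g x) \<le> A * B" unfolding norm_mult
   by (intro mult_mono Cb_bound[OF Suc.prems(1)] Cb_bound[OF Suc.prems(2)] nn) auto
  also have "\<dots> \<le> 2 ^ Suc k * A * B"
  proof -
   have "1 * (A * B) \<le> 2 ^ Suc k * (A * B)" using nn by (intro mult_right_mono one_le_power) auto
   then show ?thesis by (simp only: mult_1_left mult.assoc)
  qed
  finally show "cmod (f x * g x) \<le> 2 ^ Suc k * A * B" .
  show "((\<lambda>x. f x * g x) has_vector_derivative f x * g' x + f' x * g x) (at x)"
   by (rule has_vector_derivative_mult[OF f'(1) g'(1)])
 next
  have "Cb k (2 ^ k * A * B + 2 ^ k * A * B) (\<lambda>x. f x * g' x + f' x * g x)"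
   by (rule Cb_add[OF Suc.IH[OF Cb_lower[OF Suc.prems(1)] g'(2)] Suc.IH[OF f'(2) Cb_lower[OF Suc.prems(2)]]])
  then show "Cb k (2 ^ Suc k * A * B) (\<lambda>x. f x * g' x + f' x * g x)" by (simp add: mult_ac)
 qed
qed

lemma Cb_const: "cmod c \<le> B ==> Cb k B (\<lambda>x. c)"
proof (induction k arbitrary: c)
 case (Suc k)
 have "Cb k B (\<lambda>x. 0)" using Suc.IH[of 0] Suc.prems norm_ge_zero order_trans by (metis norm_zero)
 then show ?case using Suc.prems by (intro Cb_SucI[where f' = "\<lambda>x. 0"]) auto
qed auto

lemma Cb_deriv:
 assumes "Cb (Suc k) B f" "\<And>x. (f has_vector_derivative f' x) (at x)" shows "Cb k B f'"
proof -
 obtain g where g: "\<And>x. (f has_vector_derivative g x) (at x)" "Cb k B g" using assms(1) by auto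
 have "g = f'" using vector_derivative_unique_at[OF g(1) assms(2)] by blast
 then show ?thesis using g by simp
qed

lemma deriv_period:
 assumes "\<And>x. (g has_vector_derivative g' x) (at x)" "\<And>x. g (x + d) = g x"
 shows "g' (x + d) = (g' x :: complex)"
proof -
 have "((g \<circ> (\<lambda>x. x + d)) has_vector_derivative 1 *\<^sub>R g' (x + d)) (at x)"
  by (rule vector_diff_chain_at) (auto intro!: derivative_eq_intros assms(1))
 moreover have "g \<circ> (\<lambda>x. x + d) = g" using assms(2) by auto
 ultimately have "(g has_vector_derivative g' (x + d)) (at x)" by (simp only: scaleR_one)
 then show ?thesis by (rule vector_derivative_unique_at[OF _ assms(1)])
qed

lemma ccoef_decay:
 assumes d: "0 < d"
 shows "Cb k B g ==> (\<And>x. g (x + d) = g x) ==> (2 * pi * \<bar>of_int m\<bar> / d) ^ k * cmod (ccoef d g m) \<le> B"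
proof (induction k arbitrary: g)
 case 0
 then show ?case using ccoef_bound[OF d, of g B m] by (auto intro: continuous_on_subset)
next
 case (Suc k)
 then obtain g' where g': "\<And>x. (g has_vector_derivative g' x) (at x)" "Cb k B g'" by auto
 have "(2 * pi * \<bar>of_int m\<bar> / d) ^ k * cmod (ccoef d g' m) \<le> B"
  by (rule Suc.IH[OF g'(2) deriv_period[OF g'(1) Suc.prems(2)]])
 moreover have "cmod (ccoef d g' m) = (2 * pi * \<bar>of_int m\<bar> / d) * cmod (ccoef d g m)"
  unfolding ccoef_deriv[OF d g'(1) Cb_continuous[OF g'(2)] Suc.prems(2)] using d
  by (simp add: norm_mult norm_divide)
 ultimately show ?case by (simp add: mult_ac)
qed

definition decK :: "real => nat => real" where "decK d k = 2 ^ k * (1 + (d / (2 * pi)) ^ k)"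

lemma decK_nonneg: "0 < d ==> 0 \<le> decK d k" by (auto simp: decK_def intro!: mult_nonneg_nonneg add_nonneg_nonneg)

text \<open>k integrations by parts control |m|^k; together with the plain bound B this upgrades to
  \<open>br m ^ k\<close>, which does not degenerate at m = 0.\<close>

lemma ccoef_decay_br:
 assumes d: "0 < d" and g: "Cb k B g" "\<And>x. g (x + d) = g x"
 shows "cmod (ccoef d g m) \<le> decK d k * B / br m ^ k"
proof -
 let ?c = "cmod (ccoef d g m)" and ?m = "\<bar>real_of_int m\<bar>"
 have c0: "?c \<le> B" by (rule ccoef_bound[OF d Cb_bound[OF g(1)] Cb_continuous[OF g(1)]])
 have "(2 * pi * ?m / d) ^ k * ?c \<le> B" by (rule ccoef_decay[OF d g])
 then have "(d / (2 * pi)) ^ k * ((2 * pi * ?m / d) ^ k * ?c) \<le> (d / (2 * pi)) ^ k * B"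
  using d by (intro mult_left_mono) auto
 moreover have "(d / (2 * pi)) ^ k * ((2 * pi * ?m / d) ^ k * ?c) = ?m ^ k * ?c"
 proof -
  have "d / (2 * pi) * (2 * pi * ?m / d) = ?m" using d by simp
  then show ?thesis by (simp only: mult.assoc[symmetric] power_mult_distrib[symmetric])
 qed
 ultimately have ck: "?m ^ k * ?c \<le> (d / (2 * pi)) ^ k * B" by simp
 have "br m ^ k \<le> 2 ^ k * (1 + ?m ^ k)"
 proof (cases "m = 0")
  case True then show ?thesis using one_le_power[of "2::real" k] by (cases k) auto
 next
  case False
  then have "1 \<le> ?m" by linarith
  then have "br m ^ k \<le> (2 * ?m) ^ k" by (intro power_mono) (auto simp: br_def)
  then show ?thesis by (simp add: power_mult_distrib algebra_simps add_increasing)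
 qed
 then have "br m ^ k * ?c \<le> 2 ^ k * (1 + ?m ^ k) * ?c" by (intro mult_right_mono) auto
 also have "\<dots> = 2 ^ k * (?c + ?m ^ k * ?c)" by (simp add: algebra_simps)
 also have "\<dots> \<le> 2 ^ k * (B + (d / (2 * pi)) ^ k * B)" by (intro mult_left_mono add_mono c0 ck) auto
 finally show ?thesis by (simp add: decK_def pos_le_divide_eq algebra_simps)
qed

subsection \<open>Real-analytic periodic functions\<close>

lemma real_analytic_deriv:
 assumes "real_analytic f"
 shows "\<And>x. (f has_real_derivative deriv f x) (at x)" "real_analytic (deriv f)"
proof -
 have loc: "\<exists>r>0. \<exists>a. \<forall>y. \<bar>y - x\<bar> < r \<longrightarrow> (f has_real_derivative deriv f y) (at y) \<and> (\<lambda>n. a n * (y - x) ^ n) sums deriv f y" for x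
 proof -
  obtain r a where r: "0 < r" and a: "\<And>y. \<bar>y - x\<bar> < r ==> (\<lambda>n. a n * (y - x) ^ n) sums f y"
   using assms unfolding real_analytic_def by metis
  have s: "summable (\<lambda>n. a n * z ^ n)" if "\<bar>z\<bar> < r" for z
   using a[of "x + z"] that by (auto simp: sums_iff)
  have "(f has_real_derivative deriv f y) (at y) \<and> (\<lambda>n. diffs a n * (y - x) ^ n) sums deriv f y" if y: "\<bar>y - x\<bar> < r" for y
  proof -
   let ?z = "y - x"
   have D: "((\<lambda>z. \<Sum>n. a n * z ^ n) has_real_derivative (\<Sum>n. diffs a n * ?z ^ n)) (at ?z)"
    by (rule termdiffs_strong'[of r]) (use s y in auto)
   have "((\<lambda>y. \<Sum>n. a n * (y - x) ^ n) has_real_derivative (\<Sum>n. diffs a n * ?z ^ n)) (at y)"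
    using DERIV_shift[of "\<lambda>z. \<Sum>n. a n * z ^ n" "\<Sum>n. diffs a n * ?z ^ n" y "- x"] D by simp
   then have F: "(f has_real_derivative (\<Sum>n. diffs a n * ?z ^ n)) (at y)"
   proof (rule DERIV_cong_ev[THEN iffD1, rotated -1], goal_cases)
    case 2
    have "open {y. \<bar>y - x\<bar> < r}" by (intro open_Collect_less continuous_intros)
    then have "\<forall>\<^sub>F y in nhds y. \<bar>y - x\<bar> < r" using y by (auto simp: eventually_nhds)
    then show ?case by eventually_elim (use a sums_unique in force)
   qed auto
   have "summable (\<lambda>n. diffs a n * ?z ^ n)" by (rule termdiff_converges[of _ r]) (use s y in auto)
   then show ?thesis using DERIV_imp_deriv[OF F] F by (auto simp: sums_iff)
  qed
  then show ?thesis using r by blast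
 qed
 show "(f has_real_derivative deriv f x) (at x)" for x using loc[of x] by force
 show "real_analytic (deriv f)" unfolding real_analytic_def using loc by meson
qed

lemma periodic_bounded:
 fixes f :: "real => real"
 assumes d: "0 < d" and p: "\<And>x. f (x + d) = f x" and c: "continuous_on UNIV f"
 obtains B where "\<And>x. \<bar>f x\<bar> \<le> B"
proof -
 have "bounded (f ` {0..d})"
  by (intro compact_imp_bounded compact_continuous_image continuous_on_subset[OF c]) auto
 then have "\<exists>B. \<forall>x\<in>{0..d}. \<bar>f x\<bar> \<le> B" unfolding bounded_iff by auto
 then obtain B where B: "\<And>x. x \<in> {0..d} ==> \<bar>f x\<bar> \<le> B" by blast
 have pn: "f (x + real n * d) = f x" for x n
 proof (induction n)
  case (Suc n) then show ?case using p[of "x + real n * d"] by (simp add: algebra_simps)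
 qed simp
 have pz: "f (x + of_int z * d) = f x" for x z
 proof (cases "0 \<le> z")
  case True then show ?thesis using pn[of x "nat z"] by simp
 next
  case False then show ?thesis using pn[of "x + of_int z * d" "nat (- z)"] by (simp add: algebra_simps)
 qed
 have "\<bar>f x\<bar> \<le> B" for x
 proof -
  let ?z = "- \<lfloor>x / d\<rfloor>"
  have "0 \<le> x + of_int ?z * d" "x + of_int ?z * d \<le> d"
   using d floor_divide_lower[OF d, of x] floor_divide_upper[OF d, of x] by (auto simp: algebra_simps)
  then show ?thesis using B[of "x + of_int ?z * d"] pz[of x ?z] by simp
 qed
 then show ?thesis by (rule that)
qed

lemma deriv_period_real:
 fixes f :: "real => real"
 assumes "\<And>x. (f has_real_derivative f' x) (at x)" "\<And>x. f (x + d) = f x"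
 shows "f' (x + d) = f' x"
proof -
 have "(f has_real_derivative f' (x + d)) (at x)"
  using assms(1)[of "x + d"] DERIV_shift[of f "f' (x + d)" x d] assms(2) by simp
 then show ?thesis using assms(1)[of x] DERIV_unique by blast
qed

lemma real_analytic_Cb:
 assumes d: "0 < d"
 shows "real_analytic f ==> (\<And>x. f (x + d) = f x) ==> \<exists>B. Cb k B (\<lambda>x. of_real (f x))"
proof (induction k arbitrary: f)
 case 0
 note D = real_analytic_deriv(1)[OF 0(1)]
 have c: "continuous_on UNIV f" by (intro continuous_at_imp_continuous_on ballI DERIV_isCont[OF D])
 obtain B where "\<And>x. \<bar>f x\<bar> \<le> B" by (rule periodic_bounded[OF d 0(2) c]) blast+
 then show ?case using c by (auto intro!: exI[of _ B] continuous_intros)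
next
 case (Suc k)
 note D = real_analytic_deriv[OF Suc.prems(1)]
 have c: "continuous_on UNIV f" by (intro continuous_at_imp_continuous_on ballI DERIV_isCont[OF D(1)])
 obtain B1 where B1: "\<And>x. \<bar>f x\<bar> \<le> B1" by (rule periodic_bounded[OF d Suc.prems(2) c]) blast+
 obtain B2 where B2: "Cb k B2 (\<lambda>x. of_real (deriv f x))"
  using Suc.IH[OF D(2) deriv_period_real[OF D(1) Suc.prems(2)]] by blast
 have "Cb (Suc k) (max B1 B2) (\<lambda>x. of_real (f x))"
 proof (rule Cb_SucI)
  show "cmod (of_real (f x)) \<le> max B1 B2" for x using B1[of x] by simp
  show "((\<lambda>x. of_real (f x)) has_vector_derivative of_real (deriv f x)) (at x)" for x
   by (rule has_vector_derivative_of_real[OF D(1)])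
  show "Cb k (max B1 B2) (\<lambda>x. of_real (deriv f x))" by (rule Cb_mono[OF B2]) simp
 qed
 then show ?case by blast
qed

lemma Cb_rapid:
 assumes "0 < d" "Cb 5 B g" "\<And>x. g (x + d) = g x" shows "rapid (decK d 5 * B) (ccoef d g)"
 unfolding rapid_def using ccoef_decay_br[OF assms] by blast

subsection \<open>The convolution theorem\<close>

lemma ccoef_of_ee:
 assumes d: "0 < d" shows "ccoef d (\<lambda>x. g x * ee d k x) m = ccoef d g (m - k)"
proof -
 have "g x * ee d k x * ee d (- m) x = g x * ee d (- (m - k)) x" for x
  using ee_add[of d k "- m" x] by (simp add: mult.assoc)
 then show ?thesis by (simp only: ccoef_ee)
qed

lemma ccoef_one: assumes d: "0 < d" shows "ccoef d (\<lambda>x. 1) m = (if m = 0 then 1 else 0)"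
proof (cases "m = 0")
 case True then show ?thesis using d by (simp add: ccoef_ee scaleR_conv_of_real)
next
 case False
 have "ccoef d (\<lambda>x. 0) m = \<i> * of_real (2 * pi * of_int m / d) * ccoef d (\<lambda>x. 1) m"
  by (rule ccoef_deriv[OF d]) auto
 then show ?thesis using False d by (simp add: ccoef_ee)
qed

definition trigpoly :: "real => (real => complex) => bool" where
 "trigpoly d h \<longleftrightarrow> (\<exists>N c. finite N \<and> h = (\<lambda>x. \<Sum>k\<in>N. c k * ee d k x))"

lemma trigpoly_add: assumes "trigpoly d f" "trigpoly d g" shows "trigpoly d (\<lambda>x. f x + g x)"
proof -
 obtain N c M e where f: "finite N" "f = (\<lambda>x. \<Sum>k\<in>N. c k * ee d k x)" and g: "finite M" "g = (\<lambda>x. \<Sum>k\<in>M. e k * ee d k x)"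
  using assms unfolding trigpoly_def by blast
 let ?c = "\<lambda>k. (if k \<in> N then c k else 0) + (if k \<in> M then e k else 0)"
 have "f x + g x = (\<Sum>k\<in>N \<union> M. ?c k * ee d k x)" for x
 proof -
  have "(\<Sum>k\<in>N. c k * ee d k x) = (\<Sum>k\<in>N \<union> M. (if k \<in> N then c k else 0) * ee d k x)"
   using f(1) g(1) by (intro sum.mono_neutral_cong_left) auto
  moreover have "(\<Sum>k\<in>M. e k * ee d k x) = (\<Sum>k\<in>N \<union> M. (if k \<in> M then e k else 0) * ee d k x)"
   using f(1) g(1) by (intro sum.mono_neutral_cong_left) auto
  ultimately show ?thesis by (simp add: f(2) g(2) distrib_right sum.distrib)
 qed
 then show ?thesis unfolding trigpoly_def using f(1) g(1) by (intro exI[of _ "N \<union> M"] exI[of _ ?c]) auto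
qed

lemma trigpoly_ee: "trigpoly d (\<lambda>x. c * ee d k x)"
 unfolding trigpoly_def by (intro exI[of _ "{k}"] exI[of _ "\<lambda>_. c"]) auto

lemma trigpoly_sum: "finite I ==> (\<And>i. i \<in> I ==> trigpoly d (f i)) ==> trigpoly d (\<lambda>x. \<Sum>i\<in>I. f i x)"
proof (induction I rule: finite_induct)
 case empty then show ?case using trigpoly_ee[of d 0 0] by simp
qed (simp add: trigpoly_add)

lemma trigpoly_mult: assumes "trigpoly d f" "trigpoly d g" shows "trigpoly d (\<lambda>x. f x * g x)"
proof -
 obtain N c M e where f: "finite N" "f = (\<lambda>x. \<Sum>k\<in>N. c k * ee d k x)" and g: "finite M" "g = (\<lambda>x. \<Sum>k\<in>M. e k * ee d k x)"
  using assms unfolding trigpoly_def by blast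
 have "f x * g x = (\<Sum>k\<in>N. \<Sum>l\<in>M. (c k * e l) * ee d (k + l) x)" for x
  unfolding f(2) g(2) sum_product by (simp add: ee_add mult_ac)
 moreover have "trigpoly d (\<lambda>x. \<Sum>k\<in>N. \<Sum>l\<in>M. (c k * e l) * ee d (k + l) x)"
  by (intro trigpoly_sum f g trigpoly_ee)
 ultimately show ?thesis by simp
qed

text \<open>f is transplanted to the unit circle, where Stone-Weierstrass applies; a real polynomial
  in Re z and Im z restricted to the circle is a trigonometric polynomial.\<close>

lemma trigpoly_dense:
 fixes f :: "real => real"
 assumes d: "0 < d" and c: "continuous_on UNIV f" and p: "\<And>x. f (x + d) = f x" and e: "0 < e"
 obtains h where "trigpoly d h" "\<And>x. cmod (of_real (f x) - h x) < e"
proof -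
 define F where "F z = f (d / (2 * pi) * Im (Ln z))" for z
 \<comment> \<open>A second branch of the argument: \<open>F\<close> is visibly continuous off the
   negative axis, \<open>G\<close> off the positive one, and by periodicity of f they agree away
   from 0.\<close>
 define G where "G z = f (d / (2 * pi) * (Im (Ln (- z)) + pi))" for z
 have FG: "F z = G z" if "z \<noteq> 0" for z
 proof -
  have pm: "f (x - d) = f x" for x using p[of "x - d"] by simp
  have "Ln (- z) = Ln z + \<i> * of_real pi \<or> Ln (- z) = Ln z - \<i> * of_real pi" using Ln_minus[OF that] by (auto split: if_splits)
  then show ?thesis
  proof
   assume "Ln (- z) = Ln z + \<i> * of_real pi"
   then have "d / (2 * pi) * (Im (Ln (- z)) + pi) = d / (2 * pi) * Im (Ln z) + d" by (simp add: field_simps)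
   then show ?thesis by (simp only: F_def G_def p)
  next
   assume "Ln (- z) = Ln z - \<i> * of_real pi"
   then have "d / (2 * pi) * (Im (Ln (- z)) + pi) = d / (2 * pi) * Im (Ln z)" by simp
   then show ?thesis by (simp only: F_def G_def)
  qed
 qed
 have fc: "isCont f x" for x using c by (simp add: continuous_on_eq_continuous_at)
 have Fc: "isCont F z" if "z \<noteq> 0" for z
 proof (cases "z \<in> \<real>\<^sub>\<le>\<^sub>0")
  case False
  then show ?thesis unfolding F_def by (intro isCont_o2[OF _ fc] continuous_intros) auto
 next
  case True
  then have "- z \<notin> \<real>\<^sub>\<le>\<^sub>0" using that by (auto simp: complex_nonpos_Reals_iff complex_eq_iff)
  then have "isCont G z" unfolding G_def by (intro isCont_o2[OF _ fc] continuous_intros) auto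
  moreover have "\<forall>\<^sub>F z in nhds z. F z = G z"
   using t1_space_nhds[OF that] by eventually_elim (rule FG)
  ultimately show ?thesis using isCont_cong by blast
 qed
 have "continuous_on (sphere 0 1) F" by (intro continuous_at_imp_continuous_on ballI Fc) auto
 then obtain g where g: "real_polynomial_function g" "\<And>z. z \<in> sphere (0::complex) 1 ==> \<bar>F z - g z\<bar> < e"
  using Stone_Weierstrass_real_polynomial_function[of "sphere (0::complex) 1" F e] e by auto
 have "trigpoly d (\<lambda>x. of_real (g (ee d 1 x)))" using g(1)
 proof (induction rule: real_polynomial_function.induct)
  case (linear l)
  \<comment> \<open>A real linear functional on the plane is a combination of z and its conjugate,
    hence on the circle of \<open>ee d 1\<close> and \<open>ee d (- 1)\<close>.\<close>
  have lz: "complex_of_real (l z) = (of_real (l 1) / 2 - \<i> * of_real (l \<i>) / 2) * z + (of_real (l 1) / 2 + \<i> * of_real (l \<i>) / 2) * cnj z" for z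
  proof -
   have "l z = l (Re z *\<^sub>R 1 + Im z *\<^sub>R \<i>)" by (rule arg_cong[of _ _ l]) (simp add: complex_eq_iff)
   also have "\<dots> = Re z * l 1 + Im z * l \<i>"
    using linear by (simp add: linear_simps)
   finally show ?thesis by (simp add: complex_eq_iff field_simps)
  qed
  have cnj: "cnj (ee d 1 x) = ee d (- 1) x" for x by (simp add: ee_def exp_cnj)
  have "(\<lambda>x. complex_of_real (l (ee d 1 x))) = (\<lambda>x. (of_real (l 1) / 2 - \<i> * of_real (l \<i>) / 2) * ee d 1 x
    + (of_real (l 1) / 2 + \<i> * of_real (l \<i>) / 2) * ee d (- 1) x)"
   unfolding cnj[symmetric] by (rule ext) (rule lz)
  then show ?case using trigpoly_add[OF trigpoly_ee trigpoly_ee] by simp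
 next
  case (const c) then show ?case using trigpoly_ee[of d "of_real c" 0] by simp
 qed (simp_all add: trigpoly_add trigpoly_mult)
 moreover have "cmod (of_real (f x) - of_real (g (ee d 1 x))) < e" for x
 proof -
  have "f x = F (ee d 1 x)"
  proof -
   define y where "y = Im (Ln (ee d 1 x))"
   have "exp (Ln (ee d 1 x)) = exp (\<i> * of_real (2 * pi * x / d))" by (simp add: ee_def)
   then obtain n :: int where "Ln (ee d 1 x) = \<i> * of_real (2 * pi * x / d) + of_int (2 * n) * of_real pi * \<i>"
    unfolding exp_eq by auto
   then have "y = 2 * pi * x / d + 2 * of_int n * pi" by (simp add: y_def)
   then have *: "d / (2 * pi) * y = x + of_int n * d" using d by (simp add: field_simps)
   have pn: "f (x + real m * d) = f x" for x m
   proof (induction m)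
    case (Suc m) then show ?case using p[of "x + real m * d"] by (simp add: algebra_simps)
   qed simp
   have "f (x + of_int n * d) = f x"
   proof (cases "0 \<le> n")
    case True then show ?thesis using pn[of x "nat n"] by simp
   next
    case False then show ?thesis using pn[of "x + of_int n * d" "nat (- n)"] by (simp add: algebra_simps)
   qed
   then show ?thesis unfolding F_def using * by (simp add: y_def)
  qed
  then show ?thesis using g(2)[of "ee d 1 x"] by (simp flip: of_real_diff)
 qed
 ultimately show ?thesis by (rule that)
qed

lemma ccoef_diff:
 assumes "continuous_on {0..d} f" "continuous_on {0..d} g"
 shows "ccoef d (\<lambda>x. f x - g x) m = ccoef d f m - ccoef d g m"
 unfolding ccoef_ee left_diff_distrib
 by (subst integral_diff) (auto intro!: integrable_continuous_real continuous_intros assms simp: right_diff_distrib diff_divide_distrib)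

lemma ccoef_sum:
 assumes "finite N" "\<And>k. k \<in> N ==> continuous_on {0..d} (f k)"
 shows "ccoef d (\<lambda>x. \<Sum>k\<in>N. f k x) m = (\<Sum>k\<in>N. ccoef d (f k) m)"
 unfolding ccoef_ee sum_distrib_right
 by (subst integral_sum) (auto intro!: integrable_continuous_real continuous_intros assms simp: sum_distrib_left)

lemma ccoef_cmult: "ccoef d (\<lambda>x. c * f x) m = c * ccoef d f m"
 unfolding ccoef_ee mult.assoc integral_mult_right by (simp add: mult_ac)

text \<open>The formula is a finite identity when one factor is a trigonometric polynomial. Uniform
  approximation within e changes the left side by at most B e and the right side by at most K e, and
  e is arbitrary.\<close>

lemma ccoef_convolution:
 fixes f :: "real => real"
 assumes d: "0 < d" and c: "continuous_on UNIV f" and p: "\<And>x. f (x + d) = f x"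
  and r: "rapid C (ccoef d (\<lambda>x. of_real (f x)))"
 shows "ccoef d (\<lambda>x. of_real (f x) * of_real (f x)) k
   = infsum (\<lambda>m. ccoef d (\<lambda>x. of_real (f x)) (k - m) * ccoef d (\<lambda>x. of_real (f x)) m) UNIV"
proof -
 let ?f = "\<lambda>x. complex_of_real (f x)"
 let ?a = "ccoef d ?f"
 have fc: "continuous_on S ?f" for S by (intro continuous_intros continuous_on_subset[OF c]) auto
 obtain B where B: "\<And>x. \<bar>f x\<bar> \<le> B" by (rule periodic_bounded[OF d p c]) blast+
 have as: "(\<lambda>m. cmod (?a (k - m))) summable_on UNIV"
 proof (rule summable_on_comparison_test)
  show "(\<lambda>m. C * (1 / br (k - m) ^ 5)) summable_on UNIV" by (intro summable_on_cmult_right summable_br_shift) auto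
  show "cmod (?a (k - m)) \<le> C * (1 / br (k - m) ^ 5)" for m using rapidD[OF r, of "k - m"] by simp
 qed auto
 have sm: "(\<lambda>m. ?a (k - m) * z m) summable_on UNIV" "cmod (infsum (\<lambda>m. ?a (k - m) * z m) UNIV) \<le> infsum (\<lambda>m. cmod (?a (k - m))) UNIV * D"
  if z: "\<And>m. cmod (z m) \<le> D" for z D
 proof -
  have le: "norm (?a (k - m) * z m) \<le> cmod (?a (k - m)) * D" for m
   unfolding norm_mult by (intro mult_left_mono z) auto
  have s: "(\<lambda>m. norm (?a (k - m) * z m)) summable_on UNIV"
   by (rule summable_on_comparison_test[OF summable_on_cmult_left[OF as, of D]]) (use le in auto)
  then show "(\<lambda>m. ?a (k - m) * z m) summable_on UNIV" by (rule abs_summable_summable)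
  have "cmod (infsum (\<lambda>m. ?a (k - m) * z m) UNIV) \<le> infsum (\<lambda>m. norm (?a (k - m) * z m)) UNIV" by (rule norm_infsum_bound[OF s])
  also have "\<dots> \<le> infsum (\<lambda>m. cmod (?a (k - m)) * D) UNIV" by (rule infsum_mono[OF s summable_on_cmult_left[OF as] le])
  finally show "cmod (infsum (\<lambda>m. ?a (k - m) * z m) UNIV) \<le> infsum (\<lambda>m. cmod (?a (k - m))) UNIV * D"
   by (simp only: infsum_cmult_left')
 qed
 define K where "K = infsum (\<lambda>m. cmod (?a (k - m))) UNIV"
 have K0: "0 \<le> K" unfolding K_def by (rule infsum_nonneg) auto
 have B0: "0 \<le> B" using B[of 0] by linarith
 have near: "cmod (ccoef d (\<lambda>x. ?f x * ?f x) k - infsum (\<lambda>m. ?a (k - m) * ?a m) UNIV) \<le> (B + K) * e" if e: "0 < e" for e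
 proof -
  obtain h where h: "trigpoly d h" "\<And>x. cmod (?f x - h x) < e" by (rule trigpoly_dense[OF d c p e]) blast+
  obtain N q where N: "finite N" "h = (\<lambda>x. \<Sum>l\<in>N. q l * ee d l x)" using h(1) unfolding trigpoly_def by blast
  have hc: "continuous_on S h" for S unfolding N(2) by (intro continuous_intros)
  have hm: "ccoef d h m = (if m \<in> N then q m else 0)" for m
  proof -
   have "ccoef d h m = (\<Sum>l\<in>N. q l * ccoef d (\<lambda>x. 1 * ee d l x) m)"
    unfolding N(2) by (subst ccoef_sum[OF N(1)]) (auto intro!: continuous_intros simp: ccoef_cmult)
   also have "\<dots> = (\<Sum>l\<in>N. if m = l then q l else 0)" unfolding ccoef_of_ee[OF d] ccoef_one[OF d] by (intro sum.cong) auto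
   finally show ?thesis using N(1) by simp
  qed
  have "ccoef d (\<lambda>x. ?f x * h x) k = (\<Sum>l\<in>N. q l * ?a (k - l))"
  proof -
   have "(\<lambda>x. ?f x * h x) = (\<lambda>x. \<Sum>l\<in>N. q l * (?f x * ee d l x))" by (simp add: N(2) sum_distrib_left mult_ac)
   then show ?thesis
    by (simp only:) (subst ccoef_sum[OF N(1)]; auto intro!: continuous_intros fc simp: ccoef_cmult ccoef_of_ee[OF d])
  qed
  also have "\<dots> = infsum (\<lambda>m. ?a (k - m) * ccoef d h m) N" using N(1) by (simp add: hm mult.commute)
  also have "\<dots> = infsum (\<lambda>m. ?a (k - m) * ccoef d h m) UNIV" by (rule infsum_cong_neutral) (auto simp: hm)
  finally have 1: "ccoef d (\<lambda>x. ?f x * h x) k = infsum (\<lambda>m. ?a (k - m) * ccoef d h m) UNIV" .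
  have hd: "cmod (?a m - ccoef d h m) \<le> e" for m
   unfolding ccoef_diff[OF fc hc, symmetric]
   by (rule ccoef_bound[OF d]) (use h(2) in \<open>auto intro!: continuous_intros fc hc less_imp_le\<close>)
  have ab: "cmod (?a m) \<le> B" for m by (rule ccoef_bound[OF d _ fc]) (simp add: B)
  have hb: "cmod (ccoef d h m) \<le> B + e" for m using hd[of m] ab[of m] norm_triangle_ineq4[of "?a m" "?a m - ccoef d h m"] by simp
  have 2: "infsum (\<lambda>m. ?a (k - m) * ?a m) UNIV - infsum (\<lambda>m. ?a (k - m) * ccoef d h m) UNIV = infsum (\<lambda>m. ?a (k - m) * (?a m - ccoef d h m)) UNIV"
   using infsum_add[OF sm(1)[OF ab] sm(1)[of "\<lambda>m. - ccoef d h m" "B + e"]] hb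
   by (simp add: right_diff_distrib infsum_uminus)
  have 3: "cmod (infsum (\<lambda>m. ?a (k - m) * (?a m - ccoef d h m)) UNIV) \<le> K * e"
   unfolding K_def by (rule sm(2)[OF hd])
  have "ccoef d (\<lambda>x. ?f x * ?f x) k - ccoef d (\<lambda>x. ?f x * h x) k = ccoef d (\<lambda>x. ?f x * (?f x - h x)) k"
   unfolding right_diff_distrib by (rule ccoef_diff[symmetric]) (intro continuous_intros fc hc)+
  moreover have "cmod (ccoef d (\<lambda>x. ?f x * (?f x - h x)) k) \<le> B * e"
  proof (rule ccoef_bound[OF d])
   show "cmod (?f x * (?f x - h x)) \<le> B * e" for x
    unfolding norm_mult by (intro mult_mono) (use B[of x] h(2)[of x] B0 in auto)
  qed (intro continuous_intros fc hc)
  ultimately have 4: "cmod (ccoef d (\<lambda>x. ?f x * ?f x) k - ccoef d (\<lambda>x. ?f x * h x) k) \<le> B * e" by simp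
  have "ccoef d (\<lambda>x. ?f x * ?f x) k - infsum (\<lambda>m. ?a (k - m) * ?a m) UNIV
    = (ccoef d (\<lambda>x. ?f x * ?f x) k - ccoef d (\<lambda>x. ?f x * h x) k) - infsum (\<lambda>m. ?a (k - m) * (?a m - ccoef d h m)) UNIV"
   unfolding 1 2[symmetric] by simp
  then show ?thesis using 3 4 norm_triangle_ineq4 by (smt (verit) distrib_right)
 qed
 have "cmod (ccoef d (\<lambda>x. ?f x * ?f x) k - infsum (\<lambda>m. ?a (k - m) * ?a m) UNIV) \<le> 0"
 proof (rule field_le_epsilon)
  fix e :: real assume e: "0 < e"
  have "(B + K) * (e / (B + K + 1)) \<le> e"
   using e B0 K0 by (simp add: field_simps)
  then show "cmod (ccoef d (\<lambda>x. ?f x * ?f x) k - infsum (\<lambda>m. ?a (k - m) * ?a m) UNIV) \<le> 0 + e"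
   using near[of "e / (B + K + 1)"] e B0 K0 by (smt (verit) divide_pos_pos)
 qed
 then show ?thesis by simp
qed

section \<open>Uniformly smooth families of kernels\<close>

lemma Cb_cmult: "Cb k B f ==> cmod c * B \<le> B' ==> Cb k B' (\<lambda>x. c * f x)"
proof (induction k arbitrary: f)
 case 0
 have "cmod (c * f x) \<le> B'" for x
  using order_trans[OF mult_left_mono[OF Cb_bound[OF 0(1), of x] norm_ge_zero[of c]] 0(2)] by (simp add: norm_mult)
 then show ?case using Cb_continuous[OF 0(1)] by (auto intro!: continuous_intros)
next
 case (Suc k)
 then obtain f' where f': "\<And>x. (f has_vector_derivative f' x) (at x)" "Cb k B f'" by auto
 show ?case
 proof (rule Cb_SucI[where f' = "\<lambda>x. c * f' x"])
  show "cmod (c * f x) \<le> B'" for x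
   using order_trans[OF mult_left_mono[OF Cb_bound[OF Suc.prems(1), of x] norm_ge_zero[of c]] Suc.prems(2)] by (simp add: norm_mult)
  show "((\<lambda>x. c * f x) has_vector_derivative c * f' x) (at x)" for x by (rule has_vector_derivative_mult_right[OF f'(1)])
 qed (rule Suc.IH[OF f'(2) Suc.prems(2)])
qed

lemma has_vector_derivative_shift:
 fixes f :: "real => complex"
 shows "((\<lambda>x. f (x + a)) has_vector_derivative f') (at x) \<longleftrightarrow> (f has_vector_derivative f') (at (x + a))"
proof -
 have *: "((\<lambda>x. f (x + a)) has_vector_derivative f') (at x)" if "(f has_vector_derivative f') (at (x + a))" for f :: "real => complex" and a x
 proof -
  have "((f \<circ> (\<lambda>x. x + a)) has_vector_derivative 1 *\<^sub>R f') (at x)"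
   by (rule vector_diff_chain_at) (auto intro!: derivative_eq_intros that)
  then show ?thesis by (simp only: comp_def scaleR_one)
 qed
 show ?thesis using *[of f x a] *[of "\<lambda>x. f (x + a)" "x + a" "- a"] by auto
qed

lemma Cb_shift: "Cb k B f ==> Cb k B (\<lambda>x. f (x + a))"
proof (induction k arbitrary: f)
 case 0 then show ?case by (auto intro!: continuous_on_compose2[of UNIV f] continuous_intros)
next
 case (Suc k)
 then obtain f' where f': "\<And>x. (f has_vector_derivative f' x) (at x)" "Cb k B f'" by auto
 show ?case
  by (rule Cb_SucI[where f' = "\<lambda>x. f' (x + a)"])
   (use Cb_bound[OF Suc.prems] f' Suc.IH[OF f'(2)] in \<open>auto simp: has_vector_derivative_shift\<close>)
qed

lemma Cb_lowerD: "Cb (k + m) B f ==> Cb k B f"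
 by (induction m) (auto dest: Cb_lower simp del: Cb.simps)

text \<open>The bound is independent of s: the quotient is controlled by the derivative, and
  differentiation in x commutes with forming the quotient. One order of smoothness is spent.\<close>

lemma Cb_diff_quotient:
 assumes s: "s \<noteq> 0"
 shows "Cb (Suc k) B f ==> Cb k B (\<lambda>x. (f x - f (x - s)) / of_real s)"
proof (induction k arbitrary: f)
 case (0 f)
 then obtain f' where f': "\<And>x. (f has_vector_derivative f' x) (at x)" "Cb 0 B f'" by auto
 have "cmod (f x - f (x - s)) \<le> B * \<bar>x - (x - s)\<bar>" for x
  by (rule vector_derivative_bound[of UNIV]) (use f' Cb_bound[OF f'(2)] in auto)
 then have "cmod ((f x - f (x - s)) / of_real s) \<le> B" for x using s by (simp add: norm_divide pos_divide_le_eq)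
 moreover have "continuous_on UNIV f" by (rule Cb_continuous[OF 0])
 ultimately show ?case using s by (auto intro!: continuous_intros continuous_on_compose2[of UNIV f])
next
 case (Suc k f)
 then obtain f' where f': "\<And>x. (f has_vector_derivative f' x) (at x)" "Cb (Suc k) B f'" by (subst (asm) Cb.simps(2)) blast
 have "cmod (f x - f (x - s)) \<le> B * \<bar>x - (x - s)\<bar>" for x
  by (rule vector_derivative_bound[of UNIV]) (use f' Cb_bound[OF f'(2)] in auto)
 then have b: "cmod ((f x - f (x - s)) / of_real s) \<le> B" for x using s by (simp add: norm_divide pos_divide_le_eq)
 have "((\<lambda>x. f (x + (- s))) has_vector_derivative f' (x + (- s))) (at x)" for x
  unfolding has_vector_derivative_shift by (rule f'(1))
 then have "((\<lambda>x. (f x - f (x - s)) / of_real s) has_vector_derivative (f' x - f' (x - s)) / of_real s) (at x)" for x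
  by (intro has_vector_derivative_divide has_vector_derivative_diff f'(1)) simp
 then show ?case by (rule Cb_SucI[OF b _ Suc.IH[OF f'(2)]])
qed

text \<open>Taylor's formula to second order, again uniformly in s and at the price of two
  derivatives. Such quotients are what the singularity 1 / s of the gradient of the Green function
  leaves behind.\<close>

lemma Cb_second_quotient:
 assumes s: "s \<noteq> 0"
 shows "Cb (Suc (Suc k)) B f ==> (\<And>x. (f has_vector_derivative f' x) (at x)) ==>
  Cb k B (\<lambda>x. (f' x - (f x - f (x - s)) / of_real s) / of_real s)"
proof (induction k arbitrary: f f')
 have bd: "cmod ((f' x - (f x - f (x - s)) / of_real s) / of_real s) \<le> B"
  if "Cb (Suc 0) B f'" "\<And>x. (f has_vector_derivative f' x) (at x)" for f f' :: "real => complex" and x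
 proof -
  from that(1) obtain f'' where f'': "\<And>x. (f' has_vector_derivative f'' x) (at x)" "Cb 0 B f''" by auto
  define I where "I = {- \<bar>s\<bar>..\<bar>s\<bar>}"
  \<comment> \<open>Mean value inequality in t for f (x - t) + t f' x, whose derivative f' x - f' (x
    - t) is at most B |s|.\<close>
  have "cmod ((f (x - s) + of_real s * f' x) - (f (x - 0) + of_real 0 * f' x)) \<le> B * \<bar>s\<bar> * \<bar>s - 0\<bar>"
  proof (rule vector_derivative_bound[of I])
   fix t assume t: "t \<in> I"
   have "((f \<circ> (\<lambda>t. x - t)) has_vector_derivative (- 1) *\<^sub>R f' (x - t)) (at t)"
    by (rule vector_diff_chain_at) (auto intro!: derivative_eq_intros that(2))
   then have "((\<lambda>t. f (x - t)) has_vector_derivative - f' (x - t)) (at t)" by (simp add: comp_def)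
   moreover have "((\<lambda>t. of_real t * f' x) has_vector_derivative of_real 1 * f' x) (at t)"
    by (rule has_vector_derivative_mult_left[OF has_vector_derivative_of_real[OF DERIV_ident]])
   ultimately have "((\<lambda>t. f (x - t) + of_real t * f' x) has_vector_derivative - f' (x - t) + of_real 1 * f' x) (at t)"
    by (rule has_vector_derivative_add)
   then show "((\<lambda>t. f (x - t) + of_real t * f' x) has_vector_derivative f' x - f' (x - t)) (at t within I)"
    by (rule has_vector_derivative_at_within[THEN has_vector_derivative_eq_rhs]) simp
   have "cmod (f' x - f' (x - t)) \<le> B * \<bar>x - (x - t)\<bar>"
    by (rule vector_derivative_bound[of UNIV]) (use f'' Cb_bound[OF f''(2)] in auto)
   also have "\<dots> \<le> B * \<bar>s\<bar>" using t Cb_nonneg[OF f''(2)] by (intro mult_left_mono) (auto simp: I_def)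
   finally show "cmod (f' x - f' (x - t)) \<le> B * \<bar>s\<bar>" .
  qed (auto simp: I_def)
  then have le: "cmod (of_real s * f' x - (f x - f (x - s))) \<le> B * (\<bar>s\<bar> * \<bar>s\<bar>)" by (simp add: algebra_simps)
  have "(f' x - (f x - f (x - s)) / of_real s) / of_real s = (of_real s * f' x - (f x - f (x - s))) / (of_real s * of_real s)"
   using s by (simp add: field_simps)
  moreover have "0 < s * s" using s by (metis not_real_square_gt_zero)
  ultimately show ?thesis using le by (simp add: norm_divide norm_mult pos_divide_le_eq)
 qed
 {
  case (0 f f')
  have f': "Cb (Suc 0) B f'" by (rule Cb_deriv[OF 0])
  have "continuous_on UNIV f" "continuous_on UNIV f'" using Cb_continuous[OF 0(1)] Cb_continuous[OF f'] by auto
  then show ?case using s bd[OF f' 0(2)]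
   by (auto intro!: continuous_intros continuous_on_compose2[of UNIV f])
 next
  case (Suc k f f')
  have f': "Cb (Suc (Suc k)) B f'" by (rule Cb_deriv[OF Suc.prems])
  then obtain f'' where f'': "\<And>x. (f' has_vector_derivative f'' x) (at x)" by (subst (asm) Cb.simps(2)) blast
  have f1: "Cb (Suc 0) B f'" by (rule Cb_lowerD[of _ "Suc k"]) (use f' in simp)
  have "((\<lambda>x. f (x + (- s))) has_vector_derivative f' (x + (- s))) (at x)" for x
   unfolding has_vector_derivative_shift by (rule Suc.prems(2))
  then have "((\<lambda>x. (f' x - (f x - f (x - s)) / of_real s) / of_real s) has_vector_derivative
    (f'' x - (f' x - f' (x - s)) / of_real s) / of_real s) (at x)" for x
   by (intro has_vector_derivative_divide has_vector_derivative_diff Suc.prems(2) f'') simp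
  then show ?case by (rule Cb_SucI[OF bd[OF f1 Suc.prems(2)] _ Suc.IH[OF f' f'']])
 }
qed

subsection \<open>Uniform families\<close>

text \<open>Here e is the amplitude of the interface and s = x - y the separation, while smoothness
  is in x. The order p in e, uniform in s, becomes the smallness of the perturbation matrix.\<close>

definition unif :: "nat => nat => real set => (real => real => real => complex) => bool" where
 "unif p k J \<Phi> \<longleftrightarrow> (\<exists>B. \<forall>e s. 0 < e \<and> e \<le> 1 \<and> s \<in> J \<longrightarrow> Cb k (B * e ^ p) (\<Phi> e s))"

lemma unifI: "(\<And>e s. 0 < e ==> e \<le> 1 ==> s \<in> J ==> Cb k (B * e ^ p) (\<Phi> e s)) ==> unif p k J \<Phi>"
 unfolding unif_def by blast

lemma unifE:
 assumes "unif p k J \<Phi>"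
 obtains B where "0 \<le> B" "\<And>e s. 0 < e ==> e \<le> 1 ==> s \<in> J ==> Cb k (B * e ^ p) (\<Phi> e s)"
proof -
 obtain B where B: "\<And>e s. 0 < e ==> e \<le> 1 ==> s \<in> J ==> Cb k (B * e ^ p) (\<Phi> e s)"
  using assms unfolding unif_def by blast
 show ?thesis
 proof (rule that[of "\<bar>B\<bar>"])
  fix e s assume *: "0 < e" "e \<le> (1::real)" "s \<in> J"
  show "Cb k (\<bar>B\<bar> * e ^ p) (\<Phi> e s)"
   by (rule Cb_mono[OF B[OF *]]) (use * in \<open>auto intro: mult_right_mono\<close>)
 qed simp
qed

lemma unif_add: assumes "unif p k J \<Phi>" "unif p k J \<Psi>" shows "unif p k J (\<lambda>e s x. \<Phi> e s x + \<Psi> e s x)"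
proof -
 obtain A where A: "\<And>e s. 0 < e ==> e \<le> 1 ==> s \<in> J ==> Cb k (A * e ^ p) (\<Phi> e s)" by (rule unifE[OF assms(1)]) (rule that)
 obtain B where B: "\<And>e s. 0 < e ==> e \<le> 1 ==> s \<in> J ==> Cb k (B * e ^ p) (\<Psi> e s)" by (rule unifE[OF assms(2)]) (rule that)
 show ?thesis by (rule unifI[of _ _ "A + B"]) (simp add: distrib_right Cb_add A B)
qed

lemma unif_mult: assumes "unif p k J \<Phi>" "unif q k J \<Psi>" shows "unif (p + q) k J (\<lambda>e s x. \<Phi> e s x * \<Psi> e s x)"
proof -
 obtain A where A: "\<And>e s. 0 < e ==> e \<le> 1 ==> s \<in> J ==> Cb k (A * e ^ p) (\<Phi> e s)" by (rule unifE[OF assms(1)]) (rule that)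
 obtain B where B: "\<And>e s. 0 < e ==> e \<le> 1 ==> s \<in> J ==> Cb k (B * e ^ q) (\<Psi> e s)" by (rule unifE[OF assms(2)]) (rule that)
 show ?thesis
 proof (rule unifI[of _ _ "2 ^ k * A * B"])
  fix e s assume *: "0 < e" "e \<le> (1::real)" "s \<in> J"
  show "Cb k (2 ^ k * A * B * e ^ (p + q)) (\<lambda>x. \<Phi> e s x * \<Psi> e s x)"
   using Cb_mult[OF A[OF *] B[OF *]] by (simp add: power_add mult_ac)
 qed
qed

lemma unif_weaken: assumes "unif p k J \<Phi>" "q \<le> p" shows "unif q k J \<Phi>"
proof -
 obtain B where B: "0 \<le> B" "\<And>e s. 0 < e ==> e \<le> 1 ==> s \<in> J ==> Cb k (B * e ^ p) (\<Phi> e s)" by (rule unifE[OF assms(1)]) (rule that)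
 show ?thesis
 proof (rule unifI[of _ _ B])
  fix e s assume *: "0 < e" "e \<le> (1::real)" "s \<in> J"
  show "Cb k (B * e ^ q) (\<Phi> e s)"
   by (rule Cb_mono[OF B(2)[OF *]]) (use * B(1) assms(2) in \<open>intro mult_left_mono power_decreasing; simp\<close>)
 qed
qed

lemma unif_lower: "unif p (Suc k) J \<Phi> ==> unif p k J \<Phi>"
 unfolding unif_def by (meson Cb_lower)

lemma unif_const:
 assumes "\<And>e s. 0 < e ==> e \<le> 1 ==> s \<in> J ==> cmod (c e s) \<le> B * e ^ p" shows "unif p k J (\<lambda>e s x. c e s)"
 by (rule unifI[of _ _ B]) (rule Cb_const, rule assms)

lemma unif_cong:
 assumes "unif p k J \<Phi>" "\<And>e s x. 0 < e ==> e \<le> 1 ==> s \<in> J ==> \<Phi> e s x = \<Psi> e s x" shows "unif p k J \<Psi>"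
proof -
 obtain B where B: "\<And>e s. 0 < e ==> e \<le> 1 ==> s \<in> J ==> Cb k (B * e ^ p) (\<Phi> e s)" by (rule unifE[OF assms(1)]) (rule that)
 show ?thesis
 proof (rule unifI[of _ _ B])
  fix e s assume *: "0 < e" "e \<le> (1::real)" "s \<in> J"
  have "\<Phi> e s = \<Psi> e s" using assms(2)[OF *] by blast
  then show "Cb k (B * e ^ p) (\<Psi> e s)" using B[OF *] by simp
 qed
qed

lemma unif_SucI:
 assumes b: "\<And>e s x. 0 < e ==> e \<le> 1 ==> s \<in> J ==> cmod (\<Phi> e s x) \<le> A * e ^ p"
  and d: "\<And>e s x. 0 < e ==> e \<le> 1 ==> s \<in> J ==> (\<Phi> e s has_vector_derivative \<Phi>' e s x) (at x)"
  and o: "unif p k J \<Phi>'"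
 shows "unif p (Suc k) J \<Phi>"
proof -
 obtain B where B: "\<And>e s. 0 < e ==> e \<le> 1 ==> s \<in> J ==> Cb k (B * e ^ p) (\<Phi>' e s)" by (rule unifE[OF o]) (rule that)
 show ?thesis
 proof (rule unifI[of _ _ "max A B"])
  fix e s assume *: "0 < e" "e \<le> (1::real)" "s \<in> J"
  have le: "A * e ^ p \<le> max A B * e ^ p" "B * e ^ p \<le> max A B * e ^ p" using * by (intro mult_right_mono; simp)+
  show "Cb (Suc k) (max A B * e ^ p) (\<Phi> e s)"
   by (rule Cb_SucI[OF order_trans[OF b[OF *] le(1)] d[OF *] Cb_mono[OF B[OF *] le(2)]])
 qed
qed

lemma unif_zeroI:
 assumes b: "\<And>e s x. 0 < e ==> e \<le> 1 ==> s \<in> J ==> cmod (\<Phi> e s x) \<le> A * e ^ p"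
  and d: "\<And>e s x. 0 < e ==> e \<le> 1 ==> s \<in> J ==> (\<Phi> e s has_vector_derivative \<Phi>' e s x) (at x)"
 shows "unif p 0 J \<Phi>"
 by (rule unifI[of _ _ A]) (use b d in \<open>auto intro!: continuous_at_imp_continuous_on has_vector_derivative_continuous\<close>)

lemma unif_bound:
 assumes "unif p k J \<Phi>"
 obtains B where "0 \<le> B" "\<And>e s x. 0 < e ==> e \<le> 1 ==> s \<in> J ==> cmod (\<Phi> e s x) \<le> B * e ^ p"
 by (rule unifE[OF assms]) (use Cb_bound that in blast)

section \<open>Kernels of the layer potentials\<close>

locale smooth_periodic =
 fixes d :: real and f f' :: "real => real"
 assumes d: "0 < d" and period: "\<And>x. f (x + d) = f x"
  and f_deriv: "\<And>x. (f has_real_derivative f' x) (at x)"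
  and smooth: "\<And>k. \<exists>B. Cb k B (\<lambda>x. of_real (f x))"
begin

text \<open>One period centred at the singularity, with s = 0 removed. Since |s| <= d / 2, the
  remaining lattice translates stay at distance at least d / 2.\<close>

definition J :: "real set" where "J = {s. s \<noteq> 0 \<and> \<bar>s\<bar> \<le> d / 2}"

lemma J_iff [simp]: "s \<in> J \<longleftrightarrow> s \<noteq> 0 \<and> \<bar>s\<bar> \<le> d / 2"
 by (simp add: J_def)

definition dq :: "(real => real) => real => real => real" where
 "dq g s x = (g x - g (x - s)) / s"

lemma f_vderiv: "((\<lambda>x. complex_of_real (f x)) has_vector_derivative of_real (f' x)) (at x)"
 by (rule has_vector_derivative_of_real[OF f_deriv])

lemma smooth': "\<exists>B. Cb k B (\<lambda>x. of_real (f' x))"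
 using smooth[of "Suc k"] Cb_deriv[OF _ f_vderiv] by blast

lemma unif_of_Cb: assumes "\<And>s. s \<in> J ==> Cb k B (\<Phi> s)" shows "unif 0 k J (\<lambda>e s x. \<Phi> s x)"
 by (rule unifI[of _ _ B]) (use assms in simp)

lemma unif_f': "unif 0 k J (\<lambda>e s x. of_real (f' x))" and unif_f'_shift: "unif 0 k J (\<lambda>e s x. of_real (f' (x - s)))"
proof -
 obtain B where B: "Cb k B (\<lambda>x. of_real (f' x))" using smooth' by blast
 show "unif 0 k J (\<lambda>e s x. of_real (f' x))" by (rule unif_of_Cb[OF B])
 have "Cb k B (\<lambda>x. of_real (f' (x - s)))" for s using Cb_shift[OF B, of "- s"] by simp
 then show "unif 0 k J (\<lambda>e s x. of_real (f' (x - s)))" by (rule unif_of_Cb)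
qed

lemma unif_dq: "unif 0 k J (\<lambda>e s x. of_real (dq f s x))" and unif_dq': "unif 0 k J (\<lambda>e s x. of_real (dq f' s x))"
proof -
 obtain B where B: "Cb (Suc k) B (\<lambda>x. of_real (f x))" using smooth by blast
 have "Cb k B (\<lambda>x. of_real (dq f s x))" if "s \<in> J" for s
  using Cb_diff_quotient[OF _ B, of s] that by (simp add: dq_def)
 then show "unif 0 k J (\<lambda>e s x. of_real (dq f s x))" by (rule unif_of_Cb)
 obtain B' where B': "Cb (Suc k) B' (\<lambda>x. of_real (f' x))" using smooth' by blast
 have "Cb k B' (\<lambda>x. of_real (dq f' s x))" if "s \<in> J" for s
  using Cb_diff_quotient[OF _ B', of s] that by (simp add: dq_def)
 then show "unif 0 k J (\<lambda>e s x. of_real (dq f' s x))" by (rule unif_of_Cb)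
qed

lemma unif_dq2: "unif 0 k J (\<lambda>e s x. of_real ((f' x - dq f s x) / s))"
 and unif_dq2': "unif 0 k J (\<lambda>e s x. of_real ((dq f s x - f' (x - s)) / s))"
proof -
 obtain B where B: "Cb (Suc (Suc k)) B (\<lambda>x. of_real (f x))" using smooth by blast
 have *: "Cb k B (\<lambda>x. of_real ((f' x - dq f s x) / s))" if "s \<noteq> 0" for s
  using Cb_second_quotient[OF that B f_vderiv] by (simp add: dq_def)
 then show "unif 0 k J (\<lambda>e s x. of_real ((f' x - dq f s x) / s))" by (intro unif_of_Cb) auto
 have "Cb k B (\<lambda>x. of_real ((dq f s x - f' (x - s)) / s))" if "s \<noteq> 0" for s
 proof -
  have "(f' (x - s) - dq f (- s) (x - s)) / (- s) = (dq f s x - f' (x - s)) / s" for x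
   using that by (simp add: dq_def field_simps)
  then show ?thesis using Cb_shift[OF *[of "- s"], of "- s"] that by simp
 qed
 then show "unif 0 k J (\<lambda>e s x. of_real ((dq f s x - f' (x - s)) / s))" by (intro unif_of_Cb) auto
qed

definition dqK :: real where "dqK = (SOME B. 0 \<le> B \<and> (\<forall>s x. s \<in> J \<longrightarrow> \<bar>dq f s x\<bar> \<le> B))"

lemma dqK: "0 \<le> dqK" "s \<in> J ==> \<bar>dq f s x\<bar> \<le> dqK"
proof -
 have "\<exists>B. 0 \<le> B \<and> (\<forall>s x. s \<in> J \<longrightarrow> \<bar>dq f s x\<bar> \<le> B)"
 proof (rule unif_bound[OF unif_dq[of 0]])
  fix B assume B: "0 \<le> B" "\<And>e s x. 0 < e ==> e \<le> 1 ==> s \<in> J ==> cmod (complex_of_real (dq f s x)) \<le> B * e ^ 0"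
  show ?thesis using B(1) B(2)[of 1] by (intro exI[of _ B]) auto
 qed
 from someI_ex[OF this] show "0 \<le> dqK" "s \<in> J ==> \<bar>dq f s x\<bar> \<le> dqK" unfolding dqK_def by blast+
qed

text \<open>Square of the slope of the chord between the two boundary points; their squared distance
  is s^2 (1 + tt) by \<open>radius\<close>.\<close>

definition tt :: "real => real => real => real" where "tt e s x = e^2 * (dq f s x)^2"
definition tt' :: "real => real => real => real" where "tt' e s x = e^2 * (2 * dq f s x * dq f' s x)"

lemma tt_nonneg: "0 \<le> tt e s x" by (simp add: tt_def)

lemma tt_le: "s \<in> J ==> tt e s x \<le> e^2 * dqK^2"
 unfolding tt_def using dqK(2)[of s x] dqK(1) by (intro mult_left_mono abs_le_square_iff[THEN iffD1]) auto

lemma dq_deriv: assumes "s \<noteq> 0" shows "((\<lambda>x. dq f s x) has_real_derivative dq f' s x) (at x)"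
proof -
 have "((\<lambda>x. f (x - s)) has_real_derivative f' (x - s)) (at x)"
  using DERIV_shift[of f "f' (x - s)" x "- s"] f_deriv[of "x - s"] by simp
 then show ?thesis unfolding dq_def by (intro DERIV_cdivide DERIV_diff f_deriv)
qed

lemma tt_deriv: assumes "s \<noteq> 0" shows "((\<lambda>x. tt e s x) has_real_derivative tt' e s x) (at x)"
 unfolding tt_def tt'_def by (auto intro!: derivative_eq_intros dq_deriv[OF assms] simp: power2_eq_square)

lemma unif_eps: "unif p k J (\<lambda>e s x. of_real (c * e ^ p))"
 by (rule unif_const[of _ _ "\<bar>c\<bar>"]) (simp add: norm_mult norm_power)

lemma unif_tt': "unif 2 k J (\<lambda>e s x. of_real (tt' e s x))"
 using unif_mult[OF unif_eps[of 2 k 2] unif_mult[OF unif_dq unif_dq']] by (simp add: tt'_def mult_ac)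

end

text \<open>In the relative variable t the derivative of \<open>VV\<close> is VP / (2 (1 + t)),
  bounded however small c is, although \<open>VV\<close> itself behaves like - ln c. This is the
  mechanism behind the estimates that are uniform in s.\<close>

lemma VV_scale_deriv:
 assumes c: "0 < c" and t: "- 1 < t"
 shows "((\<lambda>t. VV (c * sqrt (1 + t))) has_vector_derivative VP (c * sqrt (1 + t)) * of_real (1 / (2 * (1 + t)))) (at t)"
  and "((\<lambda>t. VP (c * sqrt (1 + t))) has_vector_derivative - of_real (c^2 / 2) * VV (c * sqrt (1 + t))) (at t)"
proof -
 let ?q = "sqrt (1 + t)"
 have q: "0 < ?q" "?q * ?q = 1 + t" using t by auto
 have D: "((\<lambda>t. c * sqrt (1 + t)) has_vector_derivative c / (2 * ?q)) (at t)"
  unfolding has_real_derivative_iff_has_vector_derivative[symmetric]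
  using t by (auto intro!: derivative_eq_intros simp: divide_simps)
 have cq: "0 < c * ?q" using c q by simp
 have "((VV \<circ> (\<lambda>t. c * sqrt (1 + t))) has_vector_derivative (c / (2 * ?q)) *\<^sub>R (VP (c * ?q) / of_real (c * ?q))) (at t)"
  by (rule vector_diff_chain_at[OF D VV_deriv[OF cq]])
 moreover have "(c / (2 * ?q)) *\<^sub>R (VP (c * ?q) / of_real (c * ?q)) = VP (c * ?q) * of_real (1 / (2 * (1 + t)))"
 proof -
  have "(c / (2 * ?q)) / (c * ?q) = 1 / (2 * (1 + t))"
  proof -
   have "(c / (2 * y)) / (c * y) = 1 / (2 * z)" if "0 < y" "y * y = z" for y z
    using c that by (auto simp: field_simps)
   then show ?thesis using q by blast
  qed
  moreover have "x *\<^sub>R (z / of_real y) = z * of_real (x / y)" for x y and z :: complex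
   by (simp add: scaleR_conv_of_real)
  ultimately show ?thesis by (simp only:)
 qed
 ultimately show "((\<lambda>t. VV (c * sqrt (1 + t))) has_vector_derivative VP (c * sqrt (1 + t)) * of_real (1 / (2 * (1 + t)))) (at t)"
  by (simp only: comp_def)
 have "((VP \<circ> (\<lambda>t. c * sqrt (1 + t))) has_vector_derivative (c / (2 * ?q)) *\<^sub>R (- of_real (c * ?q) * VV (c * ?q))) (at t)"
  by (rule vector_diff_chain_at[OF D VP_deriv[OF cq]])
 moreover have "(c / (2 * ?q)) *\<^sub>R (- of_real (c * ?q) * VV (c * ?q)) = - of_real (c^2 / 2) * VV (c * ?q)"
 proof -
  have "(c / (2 * ?q)) * (c * ?q) = c^2 / 2" using q(1) by (simp add: power2_eq_square)
  then have "complex_of_real ((c / (2 * ?q)) * (c * ?q)) = of_real (c^2 / 2)" by (rule arg_cong)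
  then show ?thesis by (simp only: scaleR_conv_of_real mult_minus_right mult_minus_left of_real_mult mult.assoc[symmetric])
 qed
 ultimately show "((\<lambda>t. VP (c * sqrt (1 + t))) has_vector_derivative - of_real (c^2 / 2) * VV (c * sqrt (1 + t))) (at t)"
  by (simp only: comp_def)
qed

section \<open>The singular part of the kernel along the interface\<close>

locale kernel = smooth_periodic +
 fixes k :: real
 assumes k: "0 < k"
begin

definition cs :: "real => real" where "cs s = k * \<bar>s\<bar>"

text \<open>\<open>pf\<close>, \<open>ww\<close> and \<open>rf\<close> form a family closed under
  differentiation in x, up to the bounded factors \<open>tt'\<close> and \<open>cs\<close>
  (\<open>sing_derivs\<close>). The factor \<open>cs\<close> in \<open>ww\<close> tames the
  logarithm. \<open>vf\<close> and \<open>uf\<close> are differences from the flat interface, the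
  latter divided by \<open>cs\<close> to pay for the 1 / s of a gradient.\<close>

definition pf :: "real => real => real => complex" where "pf e s x = VP (cs s * sqrt (1 + tt e s x))"
definition ww :: "real => real => real => complex" where "ww e s x = of_real (cs s) * VV (cs s * sqrt (1 + tt e s x))"
definition rf :: "real => real => real => complex" where "rf e s x = of_real (1 / (1 + tt e s x))"
definition vf :: "real => real => real => complex" where "vf e s x = VV (cs s * sqrt (1 + tt e s x)) - VV (cs s)"
definition uf :: "real => real => real => complex" where
 "uf e s x = (VP (cs s * sqrt (1 + tt e s x)) - VP (cs s)) / of_real (cs s)"

lemma cs_pos: "s \<in> J ==> 0 < cs s" using k by (simp add: cs_def)
lemma cs_le: "s \<in> J ==> cs s \<le> k * (d / 2)" using k by (simp add: cs_def)

lemma sing_bounds: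
 obtains C where "0 \<le> C"
  "\<And>s t. s \<in> J ==> 0 \<le> t ==> t \<le> dqK^2 ==> cmod (VP (cs s * sqrt (1 + t))) \<le> C"
  "\<And>s t. s \<in> J ==> 0 \<le> t ==> t \<le> dqK^2 ==> cs s * cmod (VV (cs s * sqrt (1 + t))) \<le> C"
proof -
 let ?R = "k * (d / 2) * sqrt (1 + dqK^2)"
 have R: "0 < ?R" using k d by (intro mult_pos_pos) (auto simp: add_pos_nonneg)
 obtain C where C: "0 \<le> C" "\<And>x. 0 < x ==> x \<le> ?R ==> cmod (VP x) \<le> C" "\<And>x. 0 < x ==> x \<le> ?R ==> x * cmod (VV x) \<le> C"
  by (rule VV_bound[OF R]) (rule that)
 have X: "0 < cs s * sqrt (1 + t)" "cs s * sqrt (1 + t) \<le> ?R" "cs s \<le> cs s * sqrt (1 + t)"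
  if s: "s \<in> J" and t: "0 \<le> t" "t \<le> dqK^2" for s t
 proof -
  show "0 < cs s * sqrt (1 + t)" using cs_pos[OF s] t by simp
  show "cs s * sqrt (1 + t) \<le> ?R"
   by (intro mult_mono cs_le[OF s]) (use t k d in auto)
  have "1 \<le> sqrt (1 + t)" using t by simp
  then show "cs s \<le> cs s * sqrt (1 + t)" using cs_pos[OF s] by simp
 qed
 show ?thesis
 proof (rule that[OF C(1)])
  fix s t assume *: "s \<in> J" "0 \<le> t" "t \<le> dqK^2"
  show "cmod (VP (cs s * sqrt (1 + t))) \<le> C" by (rule C(2)[OF X(1,2)[OF *]])
  have "cs s * cmod (VV (cs s * sqrt (1 + t))) \<le> cs s * sqrt (1 + t) * cmod (VV (cs s * sqrt (1 + t)))"
   by (intro mult_right_mono X(3)[OF *]) auto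
  also have "\<dots> \<le> C" by (rule C(3)[OF X(1,2)[OF *]])
  finally show "cs s * cmod (VV (cs s * sqrt (1 + t))) \<le> C" .
 qed
qed

lemma tt_le1: "s \<in> J ==> 0 < e ==> e \<le> 1 ==> tt e s x \<le> dqK^2"
 using tt_le[of s e x] mult_right_mono[of "e^2" 1 "dqK^2"] power_le_one[of e 2] by simp

lemma sing_derivs:
 assumes s: "s \<in> J"
 shows "(pf e s has_vector_derivative - of_real (cs s / 2) * (of_real (tt' e s x) * ww e s x)) (at x)"
  and "(ww e s has_vector_derivative of_real (cs s / 2) * (of_real (tt' e s x) * (rf e s x * pf e s x))) (at x)"
  and "(rf e s has_vector_derivative - (of_real (tt' e s x) * (rf e s x * rf e s x))) (at x)"
  and "(vf e s has_vector_derivative (1 / 2) * (of_real (tt' e s x) * (rf e s x * pf e s x))) (at x)"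
  and "(uf e s has_vector_derivative - (1 / 2) * (of_real (tt' e s x) * ww e s x)) (at x)"
proof -
 let ?t = "tt e s x" and ?t' = "tt' e s x" and ?c = "cs s"
 have c: "0 < ?c" by (rule cs_pos[OF s])
 have c0: "complex_of_real ?c \<noteq> 0" using c by simp
 have t: "- 1 < ?t" using tt_nonneg[of e s x] by linarith
 have s0: "s \<noteq> 0" using s by simp
 have D: "(tt e s has_vector_derivative ?t') (at x)"
  unfolding has_real_derivative_iff_has_vector_derivative[symmetric] by (rule tt_deriv[OF s0])
 note V = vector_diff_chain_at[OF D VV_scale_deriv(1)[OF c t], unfolded comp_def]
 note P = vector_diff_chain_at[OF D VV_scale_deriv(2)[OF c t], unfolded comp_def]
 show "(pf e s has_vector_derivative - of_real (?c / 2) * (of_real ?t' * ww e s x)) (at x)"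
  unfolding pf_def ww_def
  by (rule P[THEN has_vector_derivative_eq_rhs]) (simp add: scaleR_conv_of_real power2_eq_square)
 show "(ww e s has_vector_derivative of_real (?c / 2) * (of_real ?t' * (rf e s x * pf e s x))) (at x)"
  unfolding ww_def
  by (rule has_vector_derivative_mult_right[OF V, THEN has_vector_derivative_eq_rhs])
   (simp add: pf_def rf_def scaleR_conv_of_real mult_ac)
 have "((\<lambda>x. 1 / (1 + tt e s x)) has_real_derivative - (?t' * (1 / (1 + ?t) * (1 / (1 + ?t))))) (at x)"
  using t by (auto intro!: derivative_eq_intros tt_deriv[OF s0])
 from has_vector_derivative_of_real[OF this, where 'a = complex]
 show "(rf e s has_vector_derivative - (of_real ?t' * (rf e s x * rf e s x))) (at x)"
  unfolding rf_def by simp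
 show "(vf e s has_vector_derivative (1 / 2) * (of_real ?t' * (rf e s x * pf e s x))) (at x)"
  unfolding vf_def
  by (rule has_vector_derivative_diff[OF V has_vector_derivative_const, THEN has_vector_derivative_eq_rhs])
   (simp add: pf_def rf_def scaleR_conv_of_real mult_ac)
 show "(uf e s has_vector_derivative - (1 / 2) * (of_real ?t' * ww e s x)) (at x)"
  unfolding uf_def
  by (rule has_vector_derivative_divide[OF has_vector_derivative_diff[OF P has_vector_derivative_const], THEN has_vector_derivative_eq_rhs])
   (use c0 in \<open>simp add: ww_def scaleR_conv_of_real power2_eq_square\<close>)
qed

lemma unif_cs: "unif 0 K J (\<lambda>e s x. of_real (c * cs s))"
proof (rule unif_const[of _ _ "\<bar>c\<bar> * (k * (d / 2))"])
 fix e s :: real assume "s \<in> J"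
 then show "cmod (of_real (c * cs s)) \<le> \<bar>c\<bar> * (k * (d / 2)) * e ^ 0"
  using cs_pos[of s] mult_left_mono[OF cs_le[of s], of "\<bar>c\<bar>"] by (simp only: norm_of_real abs_mult) simp
qed

lemma unif_minus: "unif p K J \<Phi> ==> unif p K J (\<lambda>e s x. - \<Phi> e s x)"
 using unif_mult[OF unif_const[of J "\<lambda>_ _. - 1" 1 0 K], of p \<Phi>] by simp

lemma unif_cmult: "unif p K J \<Phi> ==> unif p K J (\<lambda>e s x. c * \<Phi> e s x)"
 using unif_mult[OF unif_const[of J "\<lambda>_ _. c" "cmod c" 0 K], of p \<Phi>] by simp

text \<open>The derivatives of the three functions refer to one another, so the order of smoothness
  is raised for all of them simultaneously.\<close>

lemma unif_sing: "unif 0 K J pf \<and> unif 0 K J ww \<and> unif 0 K J rf"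
proof (rule sing_bounds)
 fix C assume C: "0 \<le> C"
  "\<And>s t. s \<in> J ==> 0 \<le> t ==> t \<le> dqK^2 ==> cmod (VP (cs s * sqrt (1 + t))) \<le> C"
  "\<And>s t. s \<in> J ==> 0 \<le> t ==> t \<le> dqK^2 ==> cs s * cmod (VV (cs s * sqrt (1 + t))) \<le> C"
 have p: "cmod (pf e s x) \<le> C * e ^ 0" if "0 < e" "e \<le> 1" "s \<in> J" for e s x
  using C(2)[OF that(3) tt_nonneg tt_le1[OF that(3,1,2)]] by (simp add: pf_def)
 have w: "cmod (ww e s x) \<le> C * e ^ 0" if "0 < e" "e \<le> 1" "s \<in> J" for e s x
  using C(3)[OF that(3) tt_nonneg tt_le1[OF that(3,1,2)]] cs_pos[OF that(3)] by (simp add: ww_def norm_mult)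
 have r: "cmod (rf e s x) \<le> 1 * e ^ 0" if "0 < e" "e \<le> 1" "s \<in> J" for e s x
  unfolding rf_def norm_of_real using tt_nonneg[of e s x] by (simp add: abs_of_nonneg)
 show ?thesis
 proof (induction K)
  case 0
  show ?case
   by (intro conjI; rule unif_zeroI)
    (rule p w r sing_derivs; assumption)+
 next
  case (Suc K)
  note t = unif_weaken[OF unif_tt', of 0 K, simplified]
  have o: "unif 0 K J (\<lambda>e s x. - of_real (cs s / 2) * (of_real (tt' e s x) * ww e s x))"
   "unif 0 K J (\<lambda>e s x. of_real (cs s / 2) * (of_real (tt' e s x) * (rf e s x * pf e s x)))"
   "unif 0 K J (\<lambda>e s x. - (of_real (tt' e s x) * (rf e s x * rf e s x)))"
   using unif_mult[OF unif_cs[of K "- 1 / 2"] unif_mult[OF t unif_weaken[of 0 K J ww 0]]]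
    unif_mult[OF unif_cs[of K "1 / 2"] unif_mult[OF t unif_mult[of 0 K J rf 0 pf]]]
    unif_minus[OF unif_mult[OF t unif_mult[of 0 K J rf 0 rf]]] Suc.IH
   by simp_all
  show ?case
   by (intro conjI; rule unif_SucI, rule p w r, assumption+, rule sing_derivs, assumption, rule o)
 qed
qed

lemma unif_pf: "unif 0 K J pf" and unif_ww: "unif 0 K J ww" and unif_rf: "unif 0 K J rf"
 using unif_sing by blast+

text \<open>Order 2 because \<open>tt\<close> is at most e^2 dqK^2: the bound on the functions
  themselves integrates the derivative in t from the flat value t = 0, and each x-derivative carries
  the factor \<open>tt'\<close>.\<close>

lemma unif_vf: "unif 2 K J vf" and unif_uf: "unif 2 K J uf"
proof -
 obtain C where C: "0 \<le> C"
  "\<And>s t. s \<in> J ==> 0 \<le> t ==> t \<le> dqK^2 ==> cmod (VP (cs s * sqrt (1 + t))) \<le> C"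
  "\<And>s t. s \<in> J ==> 0 \<le> t ==> t \<le> dqK^2 ==> cs s * cmod (VV (cs s * sqrt (1 + t))) \<le> C" by (rule sing_bounds) (rule that)
 have bd: "cmod (vf e s x) \<le> (C * dqK^2) * e ^ 2 \<and> cmod (uf e s x) \<le> (C * dqK^2) * e ^ 2" if e: "0 < e" "e \<le> 1" and s: "s \<in> J" for e s x
 proof -
  let ?t = "tt e s x" and ?c = "cs s"
  have c: "0 < ?c" by (rule cs_pos[OF s])
  have T: "t \<le> dqK^2" if "t \<in> {0..?t}" for t using tt_le1[OF s e, of x] that by simp
  have "cmod (VV (?c * sqrt (1 + ?t)) - VV (?c * sqrt (1 + 0))) \<le> C * \<bar>?t - 0\<bar>"
  proof (rule vector_derivative_bound[of "{0..?t}"])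
   fix t assume t: "t \<in> {0..?t}"
   show "((\<lambda>t. VV (?c * sqrt (1 + t))) has_vector_derivative VP (?c * sqrt (1 + t)) * of_real (1 / (2 * (1 + t)))) (at t within {0..?t})"
    by (rule has_vector_derivative_at_within[OF VV_scale_deriv(1)[OF c]]) (use t in simp)
   have "\<bar>1 / (2 * (1 + t))\<bar> \<le> 1" using t by simp
   then have "cmod (VP (?c * sqrt (1 + t)) * of_real (1 / (2 * (1 + t)))) \<le> C * 1"
    unfolding norm_mult norm_of_real using t C(1) by (intro mult_mono C(2)[OF s _ T[OF t]]) auto
   then show "cmod (VP (?c * sqrt (1 + t)) * of_real (1 / (2 * (1 + t)))) \<le> C" by simp
  qed (use tt_nonneg[of e s x] in auto)
  then have 1: "cmod (vf e s x) \<le> C * ?t" using tt_nonneg[of e s x] by (simp add: vf_def)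
  have "cmod (VP (?c * sqrt (1 + ?t)) / of_real ?c - VP (?c * sqrt (1 + 0)) / of_real ?c) \<le> C * \<bar>?t - 0\<bar>"
  proof (rule vector_derivative_bound[of "{0..?t}"])
   fix t assume t: "t \<in> {0..?t}"
   show "((\<lambda>t. VP (?c * sqrt (1 + t)) / of_real ?c) has_vector_derivative (- of_real (?c^2 / 2) * VV (?c * sqrt (1 + t))) / of_real ?c) (at t within {0..?t})"
    by (rule has_vector_derivative_at_within[OF has_vector_derivative_divide[OF VV_scale_deriv(2)[OF c]]]) (use t in simp)
   have "(- of_real (?c^2 / 2) * VV (?c * sqrt (1 + t))) / of_real ?c = - (of_real ?c * VV (?c * sqrt (1 + t)) / 2)"
    using c by (simp add: power2_eq_square)
   then have "cmod ((- of_real (?c^2 / 2) * VV (?c * sqrt (1 + t))) / of_real ?c) = ?c * cmod (VV (?c * sqrt (1 + t))) / 2"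
    using c by (simp only: norm_minus_cancel norm_divide norm_mult norm_of_real) simp
   also have "\<dots> \<le> C" using C(3)[OF s _ T[OF t]] t C(1) by simp
   finally show "cmod ((- of_real (?c^2 / 2) * VV (?c * sqrt (1 + t))) / of_real ?c) \<le> C" .
  qed (use tt_nonneg[of e s x] in auto)
  then have 2: "cmod (uf e s x) \<le> C * ?t" using tt_nonneg[of e s x] by (simp add: uf_def diff_divide_distrib)
  have "C * ?t \<le> C * (e^2 * dqK^2)" using tt_le[OF s] C(1) by (intro mult_left_mono) auto
  then show ?thesis using 1 2 by (simp add: mult_ac)
 qed
 have o: "unif 2 K J (\<lambda>e s x. (1 / 2) * (of_real (tt' e s x) * (rf e s x * pf e s x)))"
  "unif 2 K J (\<lambda>e s x. - (1 / 2) * (of_real (tt' e s x) * ww e s x))"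
  using unif_cmult[OF unif_mult[OF unif_tt' unif_mult[OF unif_rf unif_pf]], of K "1/2"]
   unif_cmult[OF unif_mult[OF unif_tt' unif_ww], of K "- (1/2)"] by simp_all
 show "unif 2 K J vf" by (rule unif_lower, rule unif_SucI[where A = "C * dqK^2"], rule bd[THEN conjunct1], assumption+, rule sing_derivs(4), assumption, rule o)
 show "unif 2 K J uf" by (rule unif_lower, rule unif_SucI[where A = "C * dqK^2"], rule bd[THEN conjunct2], assumption+, rule sing_derivs(5), assumption, rule o)
qed

end

section \<open>The lattice remainder along the interface\<close>

lemma Jc_chain:
 assumes h: "hb a h" and \<delta>: "0 < \<delta>" and X: "\<And>t. t \<in> {t0 - \<delta><..<t0 + \<delta>} ==> (X has_real_derivative X' t) (at t)"
  and Y: "\<And>t. t \<in> {t0 - \<delta><..<t0 + \<delta>} ==> (Y has_real_derivative Y' t) (at t)"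
  and x0: "- a < x0" "\<And>t. t \<in> {t0 - \<delta><..<t0 + \<delta>} ==> x0 \<le> X t"
  and bd: "\<And>t. t \<in> {t0 - \<delta><..<t0 + \<delta>} ==> \<bar>X' t\<bar> \<le> L" "\<And>t. t \<in> {t0 - \<delta><..<t0 + \<delta>} ==> \<bar>Y' t\<bar> \<le> L"
   "\<And>t. t \<in> {t0 - \<delta><..<t0 + \<delta>} ==> \<bar>Y t\<bar> \<le> L"
 shows "((\<lambda>t. Jc h (X t) (Y t)) has_vector_derivative
   of_real (X' t0) * Jc (ig h) (X t0) (Y t0) - of_real (Y' t0) * Js (xm h) (X t0) (Y t0)) (at t0)"
proof -
 have t0: "t0 \<in> {t0 - \<delta><..<t0 + \<delta>}" using \<delta> by simp
 have hg: "hb a (ig h)" using hb_cmult[OF hb_ggm[OF h], of \<i>] by (simp add: mult.assoc)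
 have hx: "hb a (xm h)" by (rule hb_xim[OF h])
 have ax: "- a < X t0" using x0(1) x0(2)[OF t0] by linarith
 have D: "((\<lambda>t. Jc h (X t) (Y t)) has_vector_derivative
  (LINT v|Mv. of_real (X' t0) * ((\<i> * gg v * h v) * ew v (X t0) * cx v (Y t0))
      - of_real (Y' t0) * ((xi v * h v) * ew v (X t0) * sx v (Y t0)))) (at t0)"
  by (rule Jc_curve_deriv(1)[OF h X Y x0 bd t0])
 show ?thesis
  using D by (rule has_vector_derivative_eq_rhs)
   (subst Bochner_Integration.integral_diff; (intro integrable_mult_right wave_integrable[OF hg ax] wave_integrable[OF hx ax])?; simp add: Jc_def Js_def)
qed

context kernel
begin

definition fK :: real where "fK = (SOME B. (\<forall>x. \<bar>f x\<bar> \<le> B) \<and> (\<forall>x. \<bar>f' x\<bar> \<le> B))"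

lemma fK: "\<bar>f x\<bar> \<le> fK" "\<bar>f' x\<bar> \<le> fK"
proof -
 obtain A B where AB: "Cb 0 A (\<lambda>x. of_real (f x))" "Cb 0 B (\<lambda>x. of_real (f' x))" using smooth smooth' by blast
 have "\<bar>f x\<bar> \<le> A" "\<bar>f' x\<bar> \<le> B" for x using Cb_bound[OF AB(1), of x] Cb_bound[OF AB(2), of x] by simp_all
 then have "(\<forall>x. \<bar>f x\<bar> \<le> max A B) \<and> (\<forall>x. \<bar>f' x\<bar> \<le> max A B)" by (metis max.coboundedI1 max.coboundedI2)
 then have "\<exists>B. (\<forall>x. \<bar>f x\<bar> \<le> B) \<and> (\<forall>x. \<bar>f' x\<bar> \<le> B)" by blast
 from someI_ex[OF this] show "\<bar>f x\<bar> \<le> fK" "\<bar>f' x\<bar> \<le> fK" unfolding fK_def by blast+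
qed

lemma fK_nonneg: "0 \<le> fK" using fK(1)[of 0] by linarith

definition yf :: "real => real => real => real" where "yf e s x = e * (f x - f (x - s))"

lemma yf_le: assumes "0 < e" shows "\<bar>yf e s x\<bar> \<le> 2 * fK * e"
proof -
 have "\<bar>f x - f (x - s)\<bar> \<le> 2 * fK" using fK(1)[of x] fK(1)[of "x - s"] by linarith
 then show ?thesis using assms by (simp add: yf_def abs_mult mult.commute mult_right_mono)
qed

lemma yf_le1: assumes "0 < e" "e \<le> 1" shows "\<bar>k * yf e s x\<bar> \<le> k * (2 * fK)"
proof -
 have "2 * fK * e \<le> 2 * fK * 1" using assms fK_nonneg by (intro mult_left_mono) auto
 then have "\<bar>yf e s x\<bar> \<le> 2 * fK" using yf_le[OF assms(1), of s x] by linarith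
 then show ?thesis using k by (simp add: abs_mult)
qed

lemma yf_deriv: "((\<lambda>x. k * yf e s x) has_real_derivative k * (e * (f' x - f' (x - s)))) (at x)"
proof -
 have "((\<lambda>x. f (x - s)) has_real_derivative f' (x - s)) (at x)"
  using DERIV_shift[of f "f' (x - s)" x "- s"] f_deriv[of "x - s"] by simp
 then show ?thesis unfolding yf_def by (intro DERIV_cmult DERIV_diff f_deriv)
qed

lemma unif_yf': "unif 1 K J (\<lambda>e s x. of_real (k * (e * (f' x - f' (x - s)))))"
 using unif_mult[OF unif_eps[of 1 K k] unif_add[OF unif_f' unif_minus[OF unif_f'_shift]]]
 by (simp add: mult_ac)

text \<open>The sign sigma is 1 for the right half of the lattice sum and - 1 for the reflected left
  half.\<close>

definition jcf :: "real => (real => complex) => real => real => real => complex" where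
 "jcf \<sigma> h e s x = Jc h (k * (\<sigma> * s)) (k * yf e s x)"
definition jsf :: "real => (real => complex) => real => real => real => complex" where
 "jsf \<sigma> h e s x = Js h (k * (\<sigma> * s)) (k * yf e s x)"

context
 fixes \<sigma> :: real assumes \<sigma>: "\<bar>\<sigma>\<bar> = 1"
begin

lemma arg_ge: "s \<in> J ==> - (k * d / 2) \<le> k * (\<sigma> * s)"
proof -
 assume "s \<in> J"
 then have "\<bar>\<sigma> * s\<bar> \<le> d / 2" using \<sigma> by (simp add: abs_mult)
 then have "- (d / 2) \<le> \<sigma> * s" by linarith
 then show ?thesis using mult_left_mono[of "- (d / 2)" "\<sigma> * s" k] k by simp
qed

lemma arg_gt: "s \<in> J ==> - (k * d) < k * (\<sigma> * s)"
 using arg_ge[of s] mult_pos_pos[OF k d] by linarith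

lemma j_derivs:
 assumes h: "hb (k * d) h" and s: "s \<in> J"
 shows "(jcf \<sigma> h e s has_vector_derivative of_real (k * (e * (f' x - f' (x - s)))) * (- jsf \<sigma> (xm h) e s x)) (at x)"
  and "(jsf \<sigma> h e s has_vector_derivative of_real (k * (e * (f' x - f' (x - s)))) * jcf \<sigma> (xm h) e s x) (at x)"
proof -
 have D: "((\<lambda>x. k * yf e s x) has_vector_derivative k * (e * (f' x - f' (x - s)))) (at x)"
  using yf_deriv by (simp only: has_real_derivative_iff_has_vector_derivative)
 note * = J_partial_derivs[OF h arg_gt[OF s]]
 show "(jcf \<sigma> h e s has_vector_derivative of_real (k * (e * (f' x - f' (x - s)))) * (- jsf \<sigma> (xm h) e s x)) (at x)"
  using vector_diff_chain_at[OF D *(3)] unfolding comp_def jcf_def jsf_def scaleR_conv_of_real .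
 show "(jsf \<sigma> h e s has_vector_derivative of_real (k * (e * (f' x - f' (x - s)))) * jcf \<sigma> (xm h) e s x) (at x)"
  using vector_diff_chain_at[OF D *(4)] unfolding comp_def jcf_def jsf_def scaleR_conv_of_real .
qed

lemma j_bounds:
 assumes h: "hb (k * d) h"
 obtains C where "0 \<le> C" "\<And>s y. s \<in> J ==> \<bar>y\<bar> \<le> k * (2 * fK) ==> cmod (Jc h (k * (\<sigma> * s)) y) \<le> C"
  "\<And>s y. s \<in> J ==> \<bar>y\<bar> \<le> k * (2 * fK) ==> cmod (Js h (k * (\<sigma> * s)) y) \<le> C"
proof -
 have kd: "- (k * d) < - (k * d / 2)" using mult_pos_pos[OF k d] by linarith
 obtain B where B: "0 \<le> B" "\<And>x y. - (k * d / 2) \<le> x ==> cmod (Jc h x y) \<le> B * exp \<bar>y\<bar>" "\<And>x y. - (k * d / 2) \<le> x ==> cmod (Js h x y) \<le> B * exp \<bar>y\<bar>"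
  by (rule J_bounded[OF h kd]) (rule that)
 show ?thesis
 proof (rule that[of "B * exp (k * (2 * fK))"])
  show "0 \<le> B * exp (k * (2 * fK))" using B by simp
  fix s y assume *: "s \<in> J" "\<bar>y\<bar> \<le> k * (2 * fK)"
  have "B * exp \<bar>y\<bar> \<le> B * exp (k * (2 * fK))" using * B by (intro mult_left_mono) auto
  then show "cmod (Jc h (k * (\<sigma> * s)) y) \<le> B * exp (k * (2 * fK))" "cmod (Js h (k * (\<sigma> * s)) y) \<le> B * exp (k * (2 * fK))"
   using B(2,3)[OF arg_ge[OF *(1)], of y] by linarith+
 qed
qed

text \<open>Each x-derivative multiplies the amplitude by \<open>xi\<close> and exchanges cosine and
  sine, so the induction runs over all amplitudes and over both integrals together.\<close>

lemma unif_j: "hb (k * d) h ==> unif 0 K J (jcf \<sigma> h) \<and> unif 0 K J (jsf \<sigma> h)"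
proof (induction K arbitrary: h)
 case (0 h)
 obtain C where C: "\<And>s y. s \<in> J ==> \<bar>y\<bar> \<le> k * (2 * fK) ==> cmod (Jc h (k * (\<sigma> * s)) y) \<le> C"
  "\<And>s y. s \<in> J ==> \<bar>y\<bar> \<le> k * (2 * fK) ==> cmod (Js h (k * (\<sigma> * s)) y) \<le> C" by (rule j_bounds[OF 0]) (rule that)
 have b: "cmod (jcf \<sigma> h e s x) \<le> C * e ^ 0" "cmod (jsf \<sigma> h e s x) \<le> C * e ^ 0" if "0 < e" "e \<le> 1" "s \<in> J" for e s x
  using C(1,2)[OF that(3) yf_le1[OF that(1,2)]] by (simp_all add: jcf_def jsf_def)
 show ?case
  by (intro conjI; rule unif_zeroI, rule b, assumption+, rule j_derivs[OF 0], assumption)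
next
 case (Suc K h)
 obtain C where C: "\<And>s y. s \<in> J ==> \<bar>y\<bar> \<le> k * (2 * fK) ==> cmod (Jc h (k * (\<sigma> * s)) y) \<le> C"
  "\<And>s y. s \<in> J ==> \<bar>y\<bar> \<le> k * (2 * fK) ==> cmod (Js h (k * (\<sigma> * s)) y) \<le> C" by (rule j_bounds[OF Suc.prems]) (rule that)
 have b: "cmod (jcf \<sigma> h e s x) \<le> C * e ^ 0" "cmod (jsf \<sigma> h e s x) \<le> C * e ^ 0" if "0 < e" "e \<le> 1" "s \<in> J" for e s x
  using C(1,2)[OF that(3) yf_le1[OF that(1,2)]] by (simp_all add: jcf_def jsf_def)
 note IH = Suc.IH[OF hb_xim[OF Suc.prems]]
 note y = unif_weaken[OF unif_yf', of 0 K, simplified]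
 have o: "unif 0 K J (\<lambda>e s x. of_real (k * (e * (f' x - f' (x - s)))) * (- jsf \<sigma> (xm h) e s x))"
  "unif 0 K J (\<lambda>e s x. of_real (k * (e * (f' x - f' (x - s)))) * jcf \<sigma> (xm h) e s x)"
  using unif_mult[OF unif_weaken[OF unif_yf', of 0 K] unif_minus[OF IH[THEN conjunct2]]] unif_mult[OF unif_weaken[OF unif_yf', of 0 K] IH[THEN conjunct1]]
  by simp_all
 show ?case
  by (intro conjI; rule unif_SucI, rule b, assumption+, rule j_derivs[OF Suc.prems], assumption, rule o)
qed

lemma unif_jcf: "hb (k * d) h ==> unif 0 K J (jcf \<sigma> h)" using unif_j by blast

text \<open>Both expressions vanish at y = 0, and y is of size e; the mean value inequality in y
  gives the order 1.\<close>

lemma unif_j_small: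
 assumes h: "hb (k * d) h"
 shows "unif 1 K J (jsf \<sigma> h)" "unif 1 K J (\<lambda>e s x. jcf \<sigma> h e s x - Jc h (k * (\<sigma> * s)) 0)"
proof -
 note hx = hb_xim[OF h]
 obtain C where C: "0 \<le> C" "\<And>s y. s \<in> J ==> \<bar>y\<bar> \<le> k * (2 * fK) ==> cmod (Jc (xm h) (k * (\<sigma> * s)) y) \<le> C"
  "\<And>s y. s \<in> J ==> \<bar>y\<bar> \<le> k * (2 * fK) ==> cmod (Js (xm h) (k * (\<sigma> * s)) y) \<le> C" by (rule j_bounds[OF hx]) (rule that)
 let ?I = "{- (k * (2 * fK))..k * (2 * fK)}"
 have b: "cmod (jsf \<sigma> h e s x) \<le> (C * (k * (2 * fK))) * e ^ 1 \<and> cmod (jcf \<sigma> h e s x - Jc h (k * (\<sigma> * s)) 0) \<le> (C * (k * (2 * fK))) * e ^ 1"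
  if e: "0 < e" "e \<le> 1" and s: "s \<in> J" for e s x
 proof -
  let ?y = "k * yf e s x"
  note D = J_partial_derivs[OF h arg_gt[OF s]]
  have y: "?y \<in> ?I" using yf_le1[OF e, of s x] by (simp add: abs_le_iff)
  have o: "0 \<in> ?I" using fK_nonneg k by simp
  have 1: "cmod (Js h (k * (\<sigma> * s)) ?y - Js h (k * (\<sigma> * s)) 0) \<le> C * \<bar>?y - 0\<bar>"
   by (rule vector_derivative_bound[of ?I, OF _ has_vector_derivative_at_within[OF D(4)] C(2)[OF s] y o]) auto
  have 2: "cmod (Jc h (k * (\<sigma> * s)) ?y - Jc h (k * (\<sigma> * s)) 0) \<le> C * \<bar>?y - 0\<bar>"
   by (rule vector_derivative_bound[of ?I, OF _ has_vector_derivative_at_within[OF D(3)] _ y o]) (use C(3)[OF s] in auto)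
  have "\<bar>?y\<bar> \<le> k * (2 * fK * e)" using yf_le[OF e(1), of s x] k by (simp add: abs_mult)
  from mult_left_mono[OF this C(1)] have "C * \<bar>?y - 0\<bar> \<le> C * (k * (2 * fK)) * e ^ 1" by (simp add: mult_ac)
  moreover have "Js h (k * (\<sigma> * s)) 0 = 0" by (simp add: Js_def)
  ultimately show ?thesis using 1 2 by (simp add: jcf_def jsf_def)
 qed
 have o: "unif 1 K J (\<lambda>e s x. of_real (k * (e * (f' x - f' (x - s)))) * jcf \<sigma> (xm h) e s x)"
  "unif 1 K J (\<lambda>e s x. of_real (k * (e * (f' x - f' (x - s)))) * (- jsf \<sigma> (xm h) e s x))"
  using unif_mult[OF unif_yf' unif_j[OF hx, THEN conjunct1]] unif_mult[OF unif_yf' unif_minus[OF unif_j[OF hx, THEN conjunct2]]] by simp_all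
 show "unif 1 K J (jsf \<sigma> h)"
  by (rule unif_lower, rule unif_SucI, rule b[THEN conjunct1], assumption+, rule j_derivs[OF h], assumption, rule o)
 have D: "((\<lambda>x. jcf \<sigma> h e s x - Jc h (k * (\<sigma> * s)) 0) has_vector_derivative of_real (k * (e * (f' x - f' (x - s)))) * (- jsf \<sigma> (xm h) e s x)) (at x)"
  if "s \<in> J" for e s x
  using has_vector_derivative_diff[OF j_derivs(1)[OF h that] has_vector_derivative_const] by simp
 show "unif 1 K J (\<lambda>e s x. jcf \<sigma> h e s x - Jc h (k * (\<sigma> * s)) 0)"
  by (rule unif_lower, rule unif_SucI, rule b[THEN conjunct2], assumption+, rule D, assumption, rule o)
qed

end

end

section \<open>Kernels of the layer potentials and their flat parts\<close>

locale green_kernel = kernel +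
 fixes \<alpha> :: real
 assumes not_wood: "\<not> wood d \<alpha> k"
begin

abbreviation "h1 \<equiv> hf d k \<alpha>"
abbreviation "h2 \<equiv> hf d k (- \<alpha>)"
abbreviation "G \<equiv> green_q d \<alpha> k"

lemma hb_h: "hb (k * d) h1" "hb (k * d) h2"
 using nonres_of_not_wood[OF d k not_wood] by (auto intro: hb_hf)

lemma hb_gh: "hb (k * d) (ig h1)" "hb (k * d) (ig h2)"
 using hb_cmult[OF hb_ggm[OF hb_h(1)], of \<i>] hb_cmult[OF hb_ggm[OF hb_h(2)], of \<i>] by (simp_all add: mult.assoc)

text \<open>With \<open>g2\<close>, the partial derivatives of the quasi-periodic Green function in
  closed form: the radial singular part through \<open>VP\<close>, the lattice remainder through the
  amplitudes \<open>ig\<close> and \<open>xm\<close>.\<close>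

definition g1 :: "real => real => complex" where
 "g1 x y = (VP (k * sqrt (x^2 + y^2)) / of_real (x^2 + y^2) * of_real x
   + of_real k * (Jc (ig h1) (k * x) (k * y) - Jc (ig h2) (k * (- x)) (k * y))) / of_real (2 * pi)"

definition g2 :: "real => real => complex" where
 "g2 x y = (VP (k * sqrt (x^2 + y^2)) / of_real (x^2 + y^2) * of_real y
   - of_real k * (Js (xm h1) (k * x) (k * y) + Js (xm h2) (k * (- x)) (k * y))) / of_real (2 * pi)"

lemma green_q_curve:
 assumes \<delta>: "0 < \<delta>" and X: "\<And>t. t \<in> {t0 - \<delta><..<t0 + \<delta>} ==> (X has_real_derivative X' t) (at t)"
  and Y: "\<And>t. t \<in> {t0 - \<delta><..<t0 + \<delta>} ==> (Y has_real_derivative Y' t) (at t)"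
  and x0: "D < d" "\<And>t. t \<in> {t0 - \<delta><..<t0 + \<delta>} ==> X t \<noteq> 0 \<and> \<bar>X t\<bar> \<le> D"
  and bd: "\<And>t. t \<in> {t0 - \<delta><..<t0 + \<delta>} ==> \<bar>X' t\<bar> \<le> L" "\<And>t. t \<in> {t0 - \<delta><..<t0 + \<delta>} ==> \<bar>Y' t\<bar> \<le> L"
   "\<And>t. t \<in> {t0 - \<delta><..<t0 + \<delta>} ==> \<bar>Y t\<bar> \<le> L"
 shows "((\<lambda>t. G (X t) (Y t)) has_vector_derivative of_real (X' t0) * g1 (X t0) (Y t0) + of_real (Y' t0) * g2 (X t0) (Y t0)) (at t0)"
proof -
 let ?I = "{t0 - \<delta><..<t0 + \<delta>}"
 have t0: "t0 \<in> ?I" using \<delta> by simp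
 let ?x = "X t0" and ?y = "Y t0"
 have x: "?x \<noteq> 0" using x0(2)[OF t0] by simp
 have r2: "0 < ?x^2 + ?y^2" using x by (simp add: sum_power2_gt_zero_iff)
 let ?r = "sqrt (?x^2 + ?y^2)"
 have r: "0 < ?r" "?r * ?r = ?x^2 + ?y^2" using r2 by simp_all
 have kr: "0 < k * ?r" using k r by simp
 have DR: "((\<lambda>t. k * sqrt ((X t)^2 + (Y t)^2)) has_vector_derivative k * ((?x * X' t0 + ?y * Y' t0) / ?r)) (at t0)"
 proof -
  have "((\<lambda>t. (X t)^2 + (Y t)^2) has_real_derivative (2 * (?x * X' t0) + 2 * (?y * Y' t0))) (at t0)"
   by (auto intro!: derivative_eq_intros X[OF t0] Y[OF t0])
  from DERIV_cmult[OF DERIV_chain2[OF DERIV_real_sqrt[OF r2] this], of k]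
  have "((\<lambda>t. k * sqrt ((X t)^2 + (Y t)^2)) has_real_derivative k * ((?x * X' t0 + ?y * Y' t0) / ?r)) (at t0)"
  proof (rule DERIV_cong)
   have "k * (inverse z / 2 * (2 * a + 2 * b)) = k * ((a + b) / z)" for a b z
    by (cases "z = 0") (simp_all add: field_simps)
   then show "k * (inverse ?r / 2 * (2 * (?x * X' t0) + 2 * (?y * Y' t0))) = k * ((?x * X' t0 + ?y * Y' t0) / ?r)" .
  qed
  then show ?thesis by (simp only: has_real_derivative_iff_has_vector_derivative)
 qed
 have "((VV \<circ> (\<lambda>t. k * sqrt ((X t)^2 + (Y t)^2))) has_vector_derivative (k * ((?x * X' t0 + ?y * Y' t0) / ?r)) *\<^sub>R (VP (k * ?r) / of_real (k * ?r))) (at t0)"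
  by (rule vector_diff_chain_at[OF DR VV_deriv[OF kr]])
 moreover have "(k * ((?x * X' t0 + ?y * Y' t0) / ?r)) *\<^sub>R (VP (k * ?r) / of_real (k * ?r))
   = VP (k * ?r) / of_real (?x^2 + ?y^2) * of_real (?x * X' t0 + ?y * Y' t0)"
 proof -
  have "(k * (z / u)) / (k * u) = z / (u * u)" for z u using k by simp
  from this[of _ ?r] have "(k * (z / ?r)) / (k * ?r) = z / (?x^2 + ?y^2)" for z unfolding r(2) .
  moreover have "u *\<^sub>R (z / of_real v) = z * of_real (u / v)" for u v and z :: complex
   by (simp add: scaleR_conv_of_real)
  moreover have "z / of_real v * of_real u = z * of_real (u / v)" for u v and z :: complex by simp
  ultimately show ?thesis by (simp only:)
 qed
 ultimately have S: "((\<lambda>t. VV (k * sqrt ((X t)^2 + (Y t)^2))) has_vector_derivative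
   VP (k * ?r) / of_real (?x^2 + ?y^2) * of_real (?x * X' t0 + ?y * Y' t0)) (at t0)"
  by (simp only: comp_def)
 have kD: "- (k * d) < - (k * D)" using x0(1) k by simp
 have kb: "\<bar>k * z\<bar> \<le> k * L" "\<bar>k * (- z)\<bar> \<le> k * L" if "\<bar>z\<bar> \<le> L" for z using that k by (simp_all add: abs_mult)
 have kx: "- (k * D) \<le> k * X t" "- (k * D) \<le> k * (- X t)" if "t \<in> ?I" for t
  using x0(2)[OF that] k mult_left_mono[of "- D" "X t" k] mult_left_mono[of "- D" "- X t" k] by auto
 have R1: "((\<lambda>t. Jc h1 (k * X t) (k * Y t)) has_vector_derivative
   of_real (k * X' t0) * Jc (ig h1) (k * ?x) (k * ?y) - of_real (k * Y' t0) * Js (xm h1) (k * ?x) (k * ?y)) (at t0)"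
  by (rule Jc_chain[OF hb_h(1) \<delta> _ _ kD kx(1), where X' = "\<lambda>t. k * X' t" and Y' = "\<lambda>t. k * Y' t" and L = "k * L"])
   (auto intro!: DERIV_cmult X Y kb bd)
 have R2: "((\<lambda>t. Jc h2 (k * (- X t)) (k * Y t)) has_vector_derivative
   of_real (k * (- X' t0)) * Jc (ig h2) (k * (- ?x)) (k * ?y) - of_real (k * Y' t0) * Js (xm h2) (k * (- ?x)) (k * ?y)) (at t0)"
  by (rule Jc_chain[OF hb_h(2) \<delta> _ _ kD kx(2), where X' = "\<lambda>t. k * (- X' t)" and Y' = "\<lambda>t. k * Y' t" and L = "k * L"])
   (auto intro!: DERIV_cmult DERIV_minus X Y kb bd simp del: mult_minus_right)
 let ?F = "\<lambda>t. (VV (k * sqrt ((X t)^2 + (Y t)^2)) + (Jc h1 (k * X t) (k * Y t) + Jc h2 (k * (- X t)) (k * Y t))) / of_real (2 * pi)"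
 have "(?F has_vector_derivative of_real (X' t0) * g1 ?x ?y + of_real (Y' t0) * g2 ?x ?y) (at t0)"
  by (rule has_vector_derivative_divide[OF has_vector_derivative_add[OF S has_vector_derivative_add[OF R1 R2]], THEN has_vector_derivative_eq_rhs])
   (simp add: g1_def g2_def add_divide_distrib diff_divide_distrib algebra_simps)
 moreover have "G (X t) (Y t) = ?F t" if "t \<in> ?I" for t
 proof -
  have Xt: "X t \<noteq> 0 \<or> Y t \<noteq> 0" "\<bar>X t\<bar> < d" using x0(2)[OF that] x0(1) by auto
  show ?thesis unfolding green_q_eq[OF d k not_wood Xt(2)] green_VV[OF Xt(1) k] Rq_def by (simp add: add_divide_distrib)
 qed
 ultimately show ?thesis using t0
  by (elim has_vector_derivative_transform_within_open[of ?F _ t0 ?I]) auto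
qed

lemma green_q_deriv_line:
 assumes s: "s \<noteq> 0" "\<bar>s\<bar> < d" and Y: "\<And>t. (Y has_real_derivative Y' t) (at t)"
  and bd: "\<And>t. \<bar>Y' t\<bar> \<le> L" "\<And>t. \<bar>Y t\<bar> \<le> L"
 shows "((\<lambda>t. G t (Y t)) has_vector_derivative g1 s (Y s) + of_real (Y' s) * g2 s (Y s)) (at s)"
proof -
 define \<delta> where "\<delta> = min \<bar>s\<bar> (d - \<bar>s\<bar>) / 2"
 have \<delta>: "0 < \<delta>" "\<delta> < \<bar>s\<bar>" "\<bar>s\<bar> + \<delta> < d" using s by (auto simp: \<delta>_def min_def field_simps)
 have "((\<lambda>t. G ((\<lambda>t. t) t) (Y t)) has_vector_derivative of_real ((\<lambda>_. 1) s) * g1 ((\<lambda>t. t) s) (Y s) + of_real (Y' s) * g2 ((\<lambda>t. t) s) (Y s)) (at s)"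
  by (rule green_q_curve[OF \<delta>(1), where X = "\<lambda>t. t" and D = "\<bar>s\<bar> + \<delta>" and L = "max 1 L"])
   (use \<delta> Y bd in \<open>auto intro!: derivative_eq_intros simp: le_max_iff_disj abs_if split: if_splits\<close>)
 then show ?thesis by simp
qed

lemma green_q_d1: assumes s: "s \<noteq> 0" "\<bar>s\<bar> < d" shows "((\<lambda>t. G t y) has_vector_derivative g1 s y) (at s)"
 using green_q_deriv_line[OF s, of "\<lambda>_. y" "\<lambda>_. 0" "\<bar>y\<bar>"] by simp

lemma green_q_d2: assumes s: "s \<noteq> 0" "\<bar>s\<bar> < d" shows "((\<lambda>t. G s t) has_vector_derivative g2 s y) (at y)"
proof -
 have "((\<lambda>t. G ((\<lambda>_. s) t) ((\<lambda>t. t) t)) has_vector_derivative of_real ((\<lambda>_. 0) y) * g1 ((\<lambda>_. s) y) ((\<lambda>t. t) y) + of_real ((\<lambda>_. 1) y) * g2 ((\<lambda>_. s) y) ((\<lambda>t. t) y)) (at y)"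
  by (rule green_q_curve[of 1, where D = "\<bar>s\<bar>" and L = "max 1 (\<bar>y\<bar> + 1)"])
   (use s in \<open>auto intro!: derivative_eq_intros simp: le_max_iff_disj\<close>)
 then show ?thesis by simp
qed

text \<open>\<open>KD\<close> is the single layer kernel minus its flat version and
  \<open>KDs\<close> its derivative in s with x fixed, which moves the source point along the
  interface. \<open>KK\<close> is the normal derivative kernel; it vanishes on a flat interface, so
  nothing is subtracted.\<close>

definition KD :: "real => real => real => complex" where
 "KD e s x = G s (yf e s x) - G s 0"
definition KDs :: "real => real => real => complex" where
 "KDs e s x = g1 s (yf e s x) + of_real (e * f' (x - s)) * g2 s (yf e s x) - g1 s 0"
definition KK :: "real => real => real => complex" where
 "KK e s x = of_real (e * f' x) * g1 s (yf e s x) - g2 s (yf e s x)"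

lemma yf_dq: "s \<in> J ==> yf e s x = e * (s * dq f s x)"
 by (simp add: yf_def dq_def)

lemma radius: assumes "s \<in> J" shows "s^2 + (yf e s x)^2 = s^2 * (1 + tt e s x)" "k * sqrt (s^2 + (yf e s x)^2) = cs s * sqrt (1 + tt e s x)"
proof -
 show *: "s^2 + (yf e s x)^2 = s^2 * (1 + tt e s x)"
  by (simp add: yf_dq[OF assms] tt_def power_mult_distrib algebra_simps)
 show "k * sqrt (s^2 + (yf e s x)^2) = cs s * sqrt (1 + tt e s x)"
  unfolding * by (simp add: cs_def real_sqrt_mult)
qed

lemma unif_div: "unif p K J \<Phi> ==> unif p K J (\<lambda>e s x. \<Phi> e s x / c)"
 using unif_cmult[of p K \<Phi> "1 / c"] by simp

lemma KD_eq:
 assumes s: "s \<in> J"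
 shows "KD e s x = (vf e s x + ((jcf 1 h1 e s x - Jc h1 (k * (1 * s)) 0) + (jcf (- 1) h2 e s x - Jc h2 (k * (- 1 * s)) 0))) / of_real (2 * pi)"
proof -
 have sd: "\<bar>s\<bar> < d" "s \<noteq> 0" using s d by auto
 have "G s y = (VV (k * sqrt (s^2 + y^2)) + (Jc h1 (k * s) (k * y) + Jc h2 (k * (- s)) (k * y))) / of_real (2 * pi)" for y
  using green_q_eq[OF d k not_wood sd(1)] green_VV[of s y k] k sd(2) by (simp add: Rq_def add_divide_distrib)
 note e = this[of "yf e s x"] this[of 0]
 have z: "k * sqrt (s^2 + 0^2) = cs s" by (simp add: cs_def)
 show ?thesis unfolding KD_def e radius(2)[OF s] z
  by (simp add: vf_def jcf_def diff_divide_distrib add_divide_distrib)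
qed

lemma unif_KD: "unif 1 K J KD"
proof -
 have "unif 1 K J (\<lambda>e s x. (vf e s x + ((jcf 1 h1 e s x - Jc h1 (k * (1 * s)) 0) + (jcf (- 1) h2 e s x - Jc h2 (k * (- 1 * s)) 0))) / of_real (2 * pi))"
  by (intro unif_div unif_add unif_weaken[OF unif_vf] unif_j_small hb_h) auto
 then show ?thesis by (rule unif_cong) (rule KD_eq[symmetric])
qed

lemma unif_epsf: "unif 1 K J (\<lambda>e s x. of_real (e * f' x))" "unif 1 K J (\<lambda>e s x. of_real (e * f' (x - s)))"
 using unif_mult[OF unif_eps[of 1 K 1] unif_f'] unif_mult[OF unif_eps[of 1 K 1] unif_f'_shift] by simp_all

lemma g_eq:
 assumes s: "s \<in> J"
 shows "g1 s (yf e s x) = (pf e s x * rf e s x / of_real s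
   + of_real k * (jcf 1 (ig h1) e s x - jcf (- 1) (ig h2) e s x)) / of_real (2 * pi)"
  and "g2 s (yf e s x) = (pf e s x * rf e s x * of_real (e * dq f s x) / of_real s
   - of_real k * (jsf 1 (xm h1) e s x + jsf (- 1) (xm h2) e s x)) / of_real (2 * pi)"
  and "g1 s 0 = (VP (cs s) / of_real s
   + of_real k * (Jc (ig h1) (k * (1 * s)) 0 - Jc (ig h2) (k * (- 1 * s)) 0)) / of_real (2 * pi)"
proof -
 have s0: "complex_of_real s \<noteq> 0" using s by simp
 note rad = radius(2)[OF s, of e x, unfolded radius(1)[OF s]]
 have z: "k * sqrt (s^2 + 0^2) = cs s" by (simp add: cs_def)
 have a: "p / of_real (s^2 * (1 + t)) * of_real s = p * of_real (1 / (1 + t)) / of_real s"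
  "p / of_real (s^2 * (1 + t)) * of_real (e * (s * q)) = p * of_real (1 / (1 + t)) * of_real (e * q) / of_real s" for p :: complex and t q
  using s0 by (simp_all add: power2_eq_square)
 show "g1 s (yf e s x) = (pf e s x * rf e s x / of_real s
   + of_real k * (jcf 1 (ig h1) e s x - jcf (- 1) (ig h2) e s x)) / of_real (2 * pi)"
  unfolding g1_def radius(1)[OF s] rad a pf_def rf_def jcf_def by simp
 show "g2 s (yf e s x) = (pf e s x * rf e s x * of_real (e * dq f s x) / of_real s
   - of_real k * (jsf 1 (xm h1) e s x + jsf (- 1) (xm h2) e s x)) / of_real (2 * pi)"
  unfolding g2_def radius(1)[OF s] rad a(2)[of _ _ "dq f s x", folded yf_dq[OF s]] pf_def rf_def jsf_def by simp
 show "g1 s 0 = (VP (cs s) / of_real s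
   + of_real k * (Jc (ig h1) (k * (1 * s)) 0 - Jc (ig h2) (k * (- 1 * s)) 0)) / of_real (2 * pi)"
  unfolding g1_def z using s0 by (simp add: power2_eq_square)
qed

text \<open>The 1 / s singularities of the two gradient terms combine to (f' x - dq f s x) / s,
  which the second derivative of the profile controls; all terms are then of order e.\<close>

lemma KK_eq:
 assumes s: "s \<in> J"
 shows "KK e s x = (of_real (1 * e ^ 1) * ((pf e s x * rf e s x) * of_real ((f' x - dq f s x) / s))
   + (of_real (e * f' x) * (of_real k * (jcf 1 (ig h1) e s x + - jcf (- 1) (ig h2) e s x))
   + of_real k * (jsf 1 (xm h1) e s x + jsf (- 1) (xm h2) e s x))) / of_real (2 * pi)"
proof -
 have s0: "complex_of_real s \<noteq> 0" using s by simp
 have alg: "e * \<phi> * ((pr / z + A) / c) - (pr * (e * q) / z - B) / c = (e * (pr * ((\<phi> - q) / z)) + (e * \<phi> * A + B)) / c"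
  for e \<phi> pr z A B q c :: complex
  by (simp add: divide_inverse algebra_simps)
 show ?thesis unfolding KK_def g_eq(1,2)[OF s]
  using alg[of "of_real e" "of_real (f' x)" "pf e s x * rf e s x"] by simp
qed

lemma unif_KK: "unif 1 K J KK"
proof (rule unif_cong[OF _ KK_eq[symmetric]], (intro unif_div unif_add)[1])
 show "unif 1 K J (\<lambda>e s x. of_real (1 * e ^ 1) * ((pf e s x * rf e s x) * of_real ((f' x - dq f s x) / s)))"
  using unif_mult[OF unif_eps[of 1 K 1] unif_mult[OF unif_mult[OF unif_pf unif_rf] unif_dq2]] by simp
 have "unif 0 K J (\<lambda>e s x. of_real k * (jcf 1 (ig h1) e s x + - jcf (- 1) (ig h2) e s x))"
  by (intro unif_cmult unif_add unif_minus unif_jcf hb_gh) auto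
 from unif_mult[OF unif_epsf(1) this]
 show "unif 1 K J (\<lambda>e s x. of_real (e * f' x) * (of_real k * (jcf 1 (ig h1) e s x + - jcf (- 1) (ig h2) e s x)))"
  by simp
 show "unif 1 K J (\<lambda>e s x. of_real k * (jsf 1 (xm h1) e s x + jsf (- 1) (xm h2) e s x))"
  by (intro unif_cmult unif_add unif_j_small hb_xim hb_h) auto
qed

text \<open>As for \<open>KK\<close>, the tangential combination of the gradient leaves a
  second-order quotient. The leftover difference of \<open>VP\<close> values over s is
  \<open>uf\<close> up to a bounded factor; this is where the subtraction of the flat kernel is
  needed.\<close>

lemma KDs_eq:
 assumes s: "s \<in> J"
 shows "KDs e s x = ((of_real (- 1 * e ^ 2) * ((pf e s x * rf e s x) * (of_real (dq f s x) * of_real ((dq f s x - f' (x - s)) / s)))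
    + of_real (k * sgn s) * uf e s x)
   + (of_real k * ((jcf 1 (ig h1) e s x - Jc (ig h1) (k * (1 * s)) 0)
     + - (jcf (- 1) (ig h2) e s x - Jc (ig h2) (k * (- 1 * s)) 0))
   + - (of_real (e * f' (x - s)) * (of_real k * (jsf 1 (xm h1) e s x + jsf (- 1) (xm h2) e s x))))) / of_real (2 * pi)"
proof -
 have s0: "complex_of_real s \<noteq> 0" using s by simp
 have T0: "1 + tt e s x \<noteq> 0" using tt_nonneg[of e s x] by linarith
 have r: "rf e s x = 1 / (1 + of_real e ^ 2 * of_real (dq f s x) ^ 2)" "1 + complex_of_real e ^ 2 * of_real (dq f s x) ^ 2 \<noteq> 0"
  using arg_cong[of _ _ complex_of_real, OF tt_def[of e s x]] T0 of_real_eq_iff[of "1 + tt e s x" 0, where 'a = complex] by (simp_all add: rf_def)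
 \<comment> \<open>\<open>cs s\<close> is k |s|, so the sign converts the division by
   \<open>cs\<close> into one by s.\<close>
 have u: "of_real (k * sgn s) * uf e s x = (pf e s x - VP (cs s)) / of_real s"
 proof -
  have e: "k * sgn s / cs s = 1 / s" using s k by (simp add: cs_def sgn_if field_simps)
  have "of_real (k * sgn s) * uf e s x = (pf e s x - VP (cs s)) * of_real (k * sgn s / cs s)"
   by (simp add: uf_def pf_def)
  then show ?thesis unfolding e by simp
 qed
 have alg0: "p * (1 / (1 + e^2 * q^2)) / z + e * \<phi> * (p * (1 / (1 + e^2 * q^2)) * (e * q) / z) - p0 / z
   = (- (e^2)) * (p * (1 / (1 + e^2 * q^2)) * (q * ((q - \<phi>) / z))) + (p - p0) / z"
  if z: "z \<noteq> 0" and T: "1 + e^2 * q^2 \<noteq> 0" for e \<phi> p p0 z q :: complex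
 proof -
  define T where "T = 1 + e^2 * q^2"
  have T: "T \<noteq> 0" using that by (simp add: T_def)
  have "p * (1 / T) / z + e * \<phi> * (p * (1 / T) * (e * q) / z) - p0 / z
   - ((- (e^2)) * (p * (1 / T) * (q * ((q - \<phi>) / z))) + (p - p0) / z) = p * ((1 + e^2 * q^2) - T) / (T * z)"
   using z T by (simp add: field_simps power2_eq_square)
  also have "\<dots> = 0" by (simp add: T_def)
  finally show ?thesis unfolding T_def by simp
 qed
 have alg: "(S1 + A) / c + e * ((S2 - B) / c) - (S0 + A0) / c = (W + ((A - A0) + - (e * B))) / c" if "S1 + e * S2 - S0 = W" for S1 S2 S0 W A B A0 c e :: complex
  unfolding that[symmetric] by (simp add: algebra_simps add_divide_distrib diff_divide_distrib)
 have m: "pf e s x * rf e s x / of_real s + of_real (e * f' (x - s)) * (pf e s x * rf e s x * of_real (e * dq f s x) / of_real s) - VP (cs s) / of_real s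
   = of_real (- 1 * e ^ 2) * ((pf e s x * rf e s x) * (of_real (dq f s x) * of_real ((dq f s x - f' (x - s)) / s))) + of_real (k * sgn s) * uf e s x"
  unfolding u r(1) using alg0[OF s0 r(2), of "pf e s x" "of_real (f' (x - s))" "VP (cs s)"] by simp
 show ?thesis unfolding KDs_def g_eq[OF s] alg[OF m] by (simp add: algebra_simps)
qed

lemma unif_KDs: "unif 1 K J KDs"
proof (rule unif_cong[OF _ KDs_eq[symmetric]], (intro unif_div unif_add unif_minus)[1])
 have "unif 2 K J (\<lambda>e s x. of_real (- 1 * e ^ 2) * ((pf e s x * rf e s x) * (of_real (dq f s x) * of_real ((dq f s x - f' (x - s)) / s))))"
  using unif_mult[OF unif_eps[of 2 K "- 1"] unif_mult[OF unif_mult[OF unif_pf unif_rf] unif_mult[OF unif_dq unif_dq2']]] by simp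
 then show "unif 1 K J (\<lambda>e s x. of_real (- 1 * e ^ 2) * ((pf e s x * rf e s x) * (of_real (dq f s x) * of_real ((dq f s x - f' (x - s)) / s))))"
  by (rule unif_weaken) simp
 have "unif 0 K J (\<lambda>e s x. of_real (k * sgn s))"
  by (rule unif_const[of _ _ k]) (use k in \<open>simp add: norm_mult abs_sgn_eq\<close>)
 from unif_mult[OF this unif_weaken[OF unif_uf, of 1]]
 show "unif 1 K J (\<lambda>e s x. of_real (k * sgn s) * uf e s x)" by simp
 show "unif 1 K J (\<lambda>e s x. of_real k * ((jcf 1 (ig h1) e s x - Jc (ig h1) (k * (1 * s)) 0)
    + - (jcf (- 1) (ig h2) e s x - Jc (ig h2) (k * (- 1 * s)) 0)))"
  by (intro unif_cmult unif_add unif_minus unif_j_small hb_gh) auto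
 have "unif 1 K J (\<lambda>e s x. of_real k * (jsf 1 (xm h1) e s x + jsf (- 1) (xm h2) e s x))"
  by (intro unif_cmult unif_add unif_j_small hb_xim hb_h) auto
 from unif_mult[OF unif_epsf(2) unif_weaken[OF this, of 0]]
 show "unif 1 K J (\<lambda>e s x. of_real (e * f' (x - s)) * (of_real k * (jsf 1 (xm h1) e s x + jsf (- 1) (xm h2) e s x)))"
  by simp
qed

end

section \<open>Fourier matrices of the layer potentials\<close>

text \<open>One derivative is lost: continuity of the highest derivative of the integral is obtained
  by differentiating once more under the integral.\<close>

lemma integral_Cb:
 fixes g :: "real => real => complex"
 assumes "integrable M (\<lambda>s. 1 :: real)"
 shows "(\<And>s. s \<in> space M ==> Cb (Suc k) B (g s)) ==> (\<And>x. integrable M (\<lambda>s. g s x)) ==>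
   Cb k (B * (LINT s|M. 1)) (\<lambda>x. LINT s|M. g s x)"
proof (induction k arbitrary: g)
 have const: "integrable M (\<lambda>s. B)" "(LINT s|M. B) = B * (LINT s|M. 1)"
  using integrable_mult_right[OF assms, of B] integral_mult_right_zero[of M B "\<lambda>_. 1"] by simp_all
 have bd: "cmod (LINT s|M. g s x) \<le> B * (LINT s|M. 1)"
  if "\<And>s. s \<in> space M ==> cmod (g s x) \<le> B" "integrable M (\<lambda>s. g s x)" for g :: "real => real => complex" and x
  unfolding const(2)[symmetric]
  by (rule Bochner_Integration.integral_norm_bound_integral[OF that(2) const(1)]) (use that(1) in auto)
 have der: "\<exists>g'. (\<forall>s\<in>space M. Cb k B (g' s)) \<and> (\<forall>x. integrable M (\<lambda>s. g' s x)) \<and>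
   (\<forall>x. ((\<lambda>x. LINT s|M. g s x) has_vector_derivative (LINT s|M. g' s x)) (at x))"
  if g: "\<And>s. s \<in> space M ==> Cb (Suc k) B (g s)" and i: "\<And>x. integrable M (\<lambda>s. g s x)" for g :: "real => real => complex" and k
 proof -
  have "\<forall>s\<in>space M. \<exists>g'. (\<forall>x. (g s has_vector_derivative g' x) (at x)) \<and> Cb k B g'" using g by auto
  then obtain g' where g': "\<And>s x. s \<in> space M ==> (g s has_vector_derivative g' s x) (at x)" "\<And>s. s \<in> space M ==> Cb k B (g' s)"
   by metis
  have *: "integrable M (\<lambda>s. g' s x)" "((\<lambda>x. LINT s|M. g s x) has_vector_derivative (LINT s|M. g' s x)) (at x)" for x
  proof -
   have x: "x \<in> {x - 1<..<x + 1}" by simp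
   show "integrable M (\<lambda>s. g' s x)"
    by (rule has_vector_derivative_lebesgue(1)[where f = "\<lambda>x s. g s x" and f' = "\<lambda>x s. g' s x" and w = "\<lambda>_. B", OF i _ _ const(1) x])
     (use g' Cb_bound in blast)+
   show "((\<lambda>x. LINT s|M. g s x) has_vector_derivative (LINT s|M. g' s x)) (at x)"
    by (rule has_vector_derivative_lebesgue(2)[where f = "\<lambda>x s. g s x" and f' = "\<lambda>x s. g' s x" and w = "\<lambda>_. B", OF i _ _ const(1) x])
     (use g' Cb_bound in blast)+
  qed
  show ?thesis using g'(2) * by blast
 qed
 {
  case (0 g)
  from der[OF 0] obtain g' where "\<And>x. ((\<lambda>x. LINT s|M. g s x) has_vector_derivative (LINT s|M. g' s x)) (at x)" by blast
  then have "continuous_on UNIV (\<lambda>x. LINT s|M. g s x)"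
   by (auto intro!: continuous_at_imp_continuous_on has_vector_derivative_continuous)
  moreover have "cmod (LINT s|M. g s x) \<le> B * (LINT s|M. 1)" for x
   by (rule bd[OF Cb_bound[OF 0(1)] 0(2)])
  ultimately show ?case by (simp only: Cb.simps) blast
 next
  case (Suc k g)
  from der[OF Suc.prems] obtain g' where g': "\<And>s. s \<in> space M ==> Cb (Suc k) B (g' s)" "\<And>x. integrable M (\<lambda>s. g' s x)"
   "\<And>x. ((\<lambda>x. LINT s|M. g s x) has_vector_derivative (LINT s|M. g' s x)) (at x)" by blast
  have b: "cmod (LINT s|M. g s x) \<le> B * (LINT s|M. 1)" for x
   by (rule bd[OF Cb_bound[OF Suc.prems(1)] Suc.prems(2)])
  show ?case by (rule Cb_SucI[OF b g'(3) Suc.IH[OF g'(1,2)]])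
 }
qed

text \<open>Periodicity is available only where the closed forms of the kernel hold, between - d and
  d. The floor builds a fully periodic function from the values between - d and 0, so that the
  period can be moved.\<close>

lemma has_integral_window:
 fixes f :: "real => complex"
 assumes d: "0 < d" and f: "(f has_integral I) {- (d / 2)..d / 2}" and p: "\<And>s. - d < s ==> s < 0 ==> f (s + d) = f s"
  and b: "- d \<le> b" "b \<le> 0"
 shows "(f has_integral I) {b..b + d}"
proof -
 define g where "g s = f (s - d * of_int \<lfloor>s / d\<rfloor> - d)" for s
 have gp: "g (s + d) = g s" for s
 proof -
  have "(s + d) / d = s / d + 1" using d by (simp add: field_simps)
  then show ?thesis by (simp add: g_def algebra_simps)
 qed
 have gf: "g s = f s" if "s \<in> {- d..d} - {- d, 0, d}" for s
 proof (cases "s < 0")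
  case True
  then have "\<lfloor>s / d\<rfloor> = - 1" using that d by (intro floor_unique) (auto simp: field_simps)
  then show ?thesis by (simp add: g_def)
 next
  case False
  then have "\<lfloor>s / d\<rfloor> = 0" using that d by (intro floor_unique) (auto simp: field_simps)
  then show ?thesis using p[of "s - d"] False that by (simp add: g_def)
 qed
 have "(g has_integral I) {- (d / 2)..- (d / 2) + d}"
  by (rule has_integral_spike_finite[of "{- d, 0, d}", OF _ gf]) (use f d in auto)
 then have "(g has_integral I) {b..b + d}" by (rule has_integral_period[where f = g, OF _ gp]) (use b d in \<open>auto simp: abs_if\<close>)
 then show ?thesis by (rule has_integral_spike_finite[of "{- d, 0, d}", rotated 2]) (use gf b in auto)
qed

section \<open>Integration over the punctured period\<close>

context green_kernel
begin

definition U :: "real set" where "U = {- (d / 2)<..<d / 2} - {0}"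

lemma U_J: "s \<in> U ==> s \<in> J" by (auto simp: U_def)

abbreviation "MU \<equiv> restrict_space lborel U"

lemma U_sets [simp]: "U \<in> sets borel" by (simp add: U_def)

lemma space_MU [simp]: "space MU = U" by (simp add: space_restrict_space)

lemma const_MU: "integrable MU (\<lambda>s. c :: real)"
proof -
 have "set_integrable lborel {- (d / 2)..d / 2} (\<lambda>s. c)" by (intro borel_integrable_atLeastAtMost' continuous_intros)
 then have "set_integrable lborel U (\<lambda>s. c)" by (rule set_integrable_subset) (auto simp: U_def)
 then show ?thesis by (subst integrable_restrict_space) (auto simp: set_integrable_def)
qed

definition mU :: real where "mU = (LINT s|MU. 1)"

lemma mU_nonneg: "0 \<le> mU" unfolding mU_def by (rule integral_nonneg_AE) auto

lemma integrable_MU: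
 fixes g :: "real => complex"
 assumes "continuous_on U g" "\<And>s. s \<in> U ==> cmod (g s) \<le> B" shows "integrable MU g"
proof (rule Bochner_Integration.integrable_bound[OF const_MU[of B]])
 show "g \<in> borel_measurable MU"
  using borel_measurable_continuous_on_restrict[OF assms(1)] by (simp cong: measurable_cong_sets add: sets_restrict_space)
 show "AE s in MU. norm (g s) \<le> norm B" by (rule AE_I2) (use assms(2) in \<open>force intro: order_trans\<close>)
qed

lemma MU_has_integral:
 fixes g :: "real => complex"
 assumes "integrable MU g" shows "(g has_integral (LINT s|MU. g s)) {- (d / 2)..d / 2}"
proof -
 have s: "set_integrable lborel U g"
  using assms by (subst (asm) integrable_restrict_space) (auto simp: set_integrable_def)
 have "(LINT s|MU. g s) = (LINT s:U|lborel. g s)"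
  unfolding set_lebesgue_integral_def by (subst integral_restrict_space) auto
 then have "(g has_integral (LINT s|MU. g s)) U"
  using set_borel_integral_eq_integral[OF s] by (simp add: has_integral_iff)
 moreover have "{x \<in> U - {- (d / 2)..d / 2}. g x \<noteq> 0} \<subseteq> {}" by (auto simp: U_def)
 then have "negligible {x \<in> U - {- (d / 2)..d / 2}. g x \<noteq> 0}" by (rule negligible_subset[rotated]) simp
 moreover have "{x \<in> {- (d / 2)..d / 2} - U. g x \<noteq> 0} \<subseteq> {- (d / 2), 0, d / 2}" by (auto simp: U_def)
 then have "negligible {x \<in> {- (d / 2)..d / 2} - U. g x \<noteq> 0}" by (rule negligible_subset[rotated]) simp
 ultimately show ?thesis using has_integral_spike_set_eq by blast
qed

definition ex :: "int => real => complex" where "ex j s = exp (\<i> * of_real (alpha_n d \<alpha> j * s))"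

lemma norm_ex [simp]: "cmod (ex j s) = 1" by (simp add: ex_def)

lemma ex_add: "ex j (s + t) = ex j s * ex j t"
 by (simp add: ex_def algebra_simps flip: exp_add)

lemma ex_deriv: "((\<lambda>s. ex j (- s)) has_vector_derivative - (\<i> * of_real (alpha_n d \<alpha> j)) * ex j (- s)) (at s)"
proof -
 have "((\<lambda>s. complex_of_real (alpha_n d \<alpha> j * (- s))) has_vector_derivative of_real (- alpha_n d \<alpha> j)) (at s)"
  by (rule has_vector_derivative_of_real) (auto intro!: derivative_eq_intros)
 moreover have "((\<lambda>z. exp (\<i> * z)) has_field_derivative \<i> * ex j (- s)) (at (complex_of_real (alpha_n d \<alpha> j * (- s))))"
  unfolding ex_def by (auto intro!: derivative_eq_intros)
 ultimately have "(((\<lambda>z. exp (\<i> * z)) \<circ> (\<lambda>s. complex_of_real (alpha_n d \<alpha> j * (- s)))) has_vector_derivative of_real (- alpha_n d \<alpha> j) * (\<i> * ex j (- s))) (at s)"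
  by (rule field_vector_diff_chain_at)
 then have "((\<lambda>s. ex j (- s)) has_vector_derivative of_real (- alpha_n d \<alpha> j) * (\<i> * ex j (- s))) (at s)"
  by (simp only: comp_def ex_def)
 then show ?thesis by (rule has_vector_derivative_eq_rhs) simp
qed

lemma ex_cont: "continuous_on S (\<lambda>s. ex j (- s))"
 by (intro continuous_at_imp_continuous_on ballI has_vector_derivative_continuous[OF ex_deriv])

lemma ex_d: "(qd \<alpha> d) * ex j (- d) = 1"
proof -
 have "\<alpha> * d + alpha_n d \<alpha> j * (- d) = - (2 * pi * of_int j)" using d by (simp add: alpha_n_def field_simps)
 then have "(qd \<alpha> d) * ex j (- d) = exp (\<i> * of_real (- (2 * pi * of_int j)))"
  unfolding ex_def exp_add[symmetric] distrib_left[symmetric] of_real_add[symmetric] by simp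
 also have "\<dots> = 1" using exp_integer_2pi[of "of_int (- j)"] by (simp add: mult_ac)
 finally show ?thesis .
qed

lemma ex_shift: "(qd \<alpha> d) * z * ex j (- (s + d)) = z * ex j (- s)"
proof -
 have "ex j (- (s + d)) = ex j (- s) * ex j (- d)" using ex_add[of j "- s" "- d"] by simp
 then have "(qd \<alpha> d) * z * ex j (- (s + d)) = ((qd \<alpha> d) * ex j (- d)) * (z * ex j (- s))"
  by (simp only: mult_ac)
 then show ?thesis unfolding ex_d by simp
qed

text \<open>The layer potential of exp (i alpha_j x) is this exponential times an x-dependent
  symbol. \<open>Phi\<close> is that symbol, for the single layer without its flat part, and its
  Fourier coefficients at n - j are matrix entries.\<close>

definition Phi :: "(real => real => real => complex) => real => int => real => complex" where
 "Phi K e j x = (LINT s|MU. K e s x * ex j (- s))"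

lemma Phi_props:
 assumes u: "unif 1 (Suc m) J \<K>" and c: "\<And>e x. 0 < e ==> continuous_on U (\<lambda>s. \<K> e s x)"
 obtains B where "0 \<le> B" "\<And>e j. 0 < e ==> e \<le> 1 ==> Cb m (B * e) (Phi \<K> e j)"
  "\<And>e j x. 0 < e ==> e \<le> 1 ==> ((\<lambda>s. \<K> e s x * ex j (- s)) has_integral Phi \<K> e j x) {- (d / 2)..d / 2}"
proof -
 obtain B where B: "0 \<le> B" "\<And>e s. 0 < e ==> e \<le> 1 ==> s \<in> J ==> Cb (Suc m) (B * e ^ 1) (\<K> e s)"
  by (rule unifE[OF u]) (rule that)
 have b: "Cb (Suc m) (B * e) (\<lambda>x. \<K> e s x * ex j (- s))" if "0 < e" "e \<le> 1" "s \<in> U" for e s j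
  using Cb_cmult[OF B(2)[OF that(1,2) U_J[OF that(3)]], of "ex j (- s)" "B * e"] by (simp add: mult.commute)
 have i: "integrable MU (\<lambda>s. \<K> e s x * ex j (- s))" if "0 < e" "e \<le> 1" for e x j
  by (rule integrable_MU[OF continuous_on_mult[OF c[OF that(1)] ex_cont] Cb_bound[OF b[OF that]]])
 show ?thesis
 proof (rule that[of "B * mU"])
  show "0 \<le> B * mU" using B(1) mU_nonneg by simp
  fix e :: real and j assume e: "0 < e" "e \<le> 1"
  have "Cb m (B * e * mU) (\<lambda>x. LINT s|MU. \<K> e s x * ex j (- s))"
   unfolding mU_def by (rule integral_Cb[OF const_MU]) (use b[OF e] i[OF e] in simp_all)
  then show "Cb m (B * mU * e) (Phi \<K> e j)" unfolding Phi_def[abs_def] by (simp only: mult_ac)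
  show "((\<lambda>s. \<K> e s x * ex j (- s)) has_integral Phi \<K> e j x) {- (d / 2)..d / 2}" for x
   unfolding Phi_def by (rule MU_has_integral[OF i[OF e]])
 qed
qed

subsection \<open>Continuity of the kernels\<close>

lemma yf_deriv_s: "((\<lambda>s. k * yf e s x) has_real_derivative k * (e * f' (x - s))) (at s)"
proof -
 have "((\<lambda>s. f (x - s)) has_real_derivative f' (x - s) * (0 - 1)) (at s)"
  by (rule DERIV_chain2[OF f_deriv]) (intro derivative_intros)
 then have "((\<lambda>s. k * (e * (f x - f (x - s)))) has_real_derivative k * (e * (0 - f' (x - s) * (0 - 1)))) (at s)"
  by (intro DERIV_cmult DERIV_diff DERIV_const)
 then show ?thesis by (simp add: yf_def)
qed

lemma yf_cont': "isCont (\<lambda>s. yf e s x) s"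
 using DERIV_isCont[OF DERIV_cdivide[OF yf_deriv_s[of e x s], of k]] k by simp

lemma j_cont:
 assumes h: "hb (k * d) h" and \<sigma>: "\<bar>\<sigma>\<bar> = 1" and s: "\<bar>s\<bar> < d" and e: "0 < e"
 shows "isCont (\<lambda>s. Jc h (k * (\<sigma> * s)) (k * yf e s x)) s" "isCont (\<lambda>s. Js h (k * (\<sigma> * s)) (k * yf e s x)) s"
proof -
 define \<delta> where "\<delta> = (d - \<bar>s\<bar>) / 2"
 have \<delta>: "0 < \<delta>" "\<bar>s\<bar> + \<delta> < d" using s by (auto simp: \<delta>_def field_simps)
 let ?I = "{s - \<delta><..<s + \<delta>}"
 let ?L = "k + (k * (e * fK) + k * (2 * fK * e))"
 have L: "0 \<le> k * (e * fK)" "0 \<le> k * (2 * fK * e)" using k e fK_nonneg by simp_all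
 have X: "((\<lambda>s. k * (\<sigma> * s)) has_real_derivative k * \<sigma>) (at t)" for t by (auto intro!: derivative_eq_intros)
 have x0: "- (k * d) < - (k * (\<bar>s\<bar> + \<delta>))" using \<delta> k by simp
 have xl: "- (k * (\<bar>s\<bar> + \<delta>)) \<le> k * (\<sigma> * t)" if "t \<in> ?I" for t
 proof -
  have "\<bar>\<sigma> * t\<bar> \<le> \<bar>s\<bar> + \<delta>" using that \<sigma> by (auto simp: abs_mult abs_if split: if_splits)
  then have "- (\<bar>s\<bar> + \<delta>) \<le> \<sigma> * t" by linarith
  then show ?thesis using mult_left_mono[of "- (\<bar>s\<bar> + \<delta>)" "\<sigma> * t" k] k by (simp only: mult_minus_right)
 qed
 have b1: "\<bar>k * \<sigma>\<bar> \<le> ?L" using k \<sigma> L by (simp add: abs_mult)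
 have b2: "\<bar>k * (e * f' (x - t))\<bar> \<le> ?L" for t
 proof -
  have "\<bar>k * (e * f' (x - t))\<bar> \<le> k * (e * fK)" using k e fK(2)[of "x - t"] by (simp add: abs_mult)
  then show ?thesis using k L by linarith
 qed
 have b3: "\<bar>k * yf e t x\<bar> \<le> ?L" for t
 proof -
  have "\<bar>k * yf e t x\<bar> \<le> k * (2 * fK * e)" using k yf_le[OF e, of t x] by (simp add: abs_mult)
  then show ?thesis using k L by linarith
 qed
 have t: "s \<in> ?I" using \<delta> by simp
 show "isCont (\<lambda>s. Jc h (k * (\<sigma> * s)) (k * yf e s x)) s"
  by (rule has_vector_derivative_continuous[OF Jc_curve_deriv(1)[where X = "\<lambda>s. k * (\<sigma> * s)" and X' = "\<lambda>_. k * \<sigma>"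
    and Y = "\<lambda>s. k * yf e s x" and Y' = "\<lambda>s. k * (e * f' (x - s))", OF h X yf_deriv_s x0 xl b1 b2 b3 t]])
 show "isCont (\<lambda>s. Js h (k * (\<sigma> * s)) (k * yf e s x)) s"
  by (rule has_vector_derivative_continuous[OF Jc_curve_deriv(2)[where X = "\<lambda>s. k * (\<sigma> * s)" and X' = "\<lambda>_. k * \<sigma>"
    and Y = "\<lambda>s. k * yf e s x" and Y' = "\<lambda>s. k * (e * f' (x - s))", OF h X yf_deriv_s x0 xl b1 b2 b3 t]])
qed

lemma j_cont0:
 assumes h: "hb (k * d) h" and \<sigma>: "\<bar>\<sigma>\<bar> = 1" and s: "\<bar>s\<bar> < d"
 shows "isCont (\<lambda>s. Jc h (k * (\<sigma> * s)) 0) s"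
proof -
 have "\<bar>\<sigma> * s\<bar> < d" using \<sigma> s by (simp add: abs_mult)
 then have "- d < \<sigma> * s" by linarith
 then have ax: "- (k * d) < k * (\<sigma> * s)" using mult_strict_left_mono[of "- d" "\<sigma> * s" k] k by simp
 have "isCont (\<lambda>x. Jc h x 0) (k * (\<sigma> * s))"
  by (rule has_vector_derivative_continuous[OF J_partial_derivs(1)[OF h ax]])
 moreover have "isCont (\<lambda>s. k * (\<sigma> * s)) s" by (intro continuous_intros)
 ultimately show ?thesis by (rule isCont_o2[of s "\<lambda>s. k * (\<sigma> * s)" "\<lambda>x. Jc h x 0", rotated])
qed

lemma VP_cont: "0 < x ==> isCont VP x"
 by (rule has_vector_derivative_continuous[OF VP_deriv])

lemma VP_comp_cont: assumes "isCont h s" "0 < h s" shows "isCont (\<lambda>s::real. VP (h s)) s"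
 by (rule isCont_o2[of s h VP, OF assms(1) VP_cont[OF assms(2)]])

lemma VP_r_cont:
 assumes "s \<noteq> 0"
 shows "isCont (\<lambda>s. VP (k * sqrt (s^2 + (yf e s x)^2)) / of_real (s^2 + (yf e s x)^2)) s"
proof -
 have p: "0 < s^2 + (yf e s x)^2" using assms by (simp add: sum_power2_gt_zero_iff)
 then have n: "complex_of_real (s^2 + (yf e s x)^2) \<noteq> 0" using of_real_eq_0_iff by (metis less_irrefl)
 have kp: "0 < k * sqrt (s^2 + (yf e s x)^2)" using p k by simp
 show ?thesis
  by (rule isCont_divide[where g = "\<lambda>s. complex_of_real (s^2 + (yf e s x)^2)", OF VP_comp_cont[where h = "\<lambda>s. k * sqrt (s^2 + (yf e s x)^2)", OF _ kp] _ n])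
   (intro continuous_intros yf_cont')+
qed

lemma g_cont:
 assumes s: "s \<noteq> 0" "\<bar>s\<bar> < d" and e: "0 < e"
 shows "isCont (\<lambda>s. g1 s (yf e s x)) s" "isCont (\<lambda>s. g2 s (yf e s x)) s" "isCont (\<lambda>s. g1 s 0) s"
proof -
 have j: "isCont (\<lambda>s. Jc h (k * s) (k * yf e s x)) s" "isCont (\<lambda>s. Js h (k * s) (k * yf e s x)) s"
  "isCont (\<lambda>s. Jc h (k * (- s)) (k * yf e s x)) s" "isCont (\<lambda>s. Js h (k * (- s)) (k * yf e s x)) s"
  "isCont (\<lambda>s. Jc h (k * s) (k * 0)) s" "isCont (\<lambda>s. Jc h (k * (- s)) (k * 0)) s" if h: "hb (k * d) h" for h
  using j_cont[OF h _ s(2) e, of 1] j_cont[OF h _ s(2) e, of "- 1"] j_cont0[OF h _ s(2), of 1] j_cont0[OF h _ s(2), of "- 1"]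
  by simp_all
 have c: "isCont (\<lambda>s. c) s" for c :: complex by (rule continuous_const)
 have i: "isCont (\<lambda>s. complex_of_real s) s" by (intro continuous_intros)
 have y: "isCont (\<lambda>s. complex_of_real (yf e s x)) s" by (intro continuous_of_real yf_cont')
 have pi0: "complex_of_real (2 * pi) \<noteq> 0" by simp
 show "isCont (\<lambda>s. g1 s (yf e s x)) s" unfolding g1_def
  by (rule isCont_divide[OF isCont_add[OF isCont_mult[OF VP_r_cont[OF s(1)] i] isCont_mult[OF c isCont_diff[OF j(1)[OF hb_gh(1)] j(3)[OF hb_gh(2)]]]] c pi0])
 show "isCont (\<lambda>s. g2 s (yf e s x)) s" unfolding g2_def
  by (rule isCont_divide[OF isCont_diff[OF isCont_mult[OF VP_r_cont[OF s(1)] y] isCont_mult[OF c isCont_add[OF j(2)[OF hb_xim[OF hb_h(1)]] j(4)[OF hb_xim[OF hb_h(2)]]]]] c pi0])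
 have kp: "0 < k * sqrt (s^2 + 0^2)" using s k by simp
 have VPr: "isCont (\<lambda>s. VP (k * sqrt (s^2 + 0^2)) / of_real (s^2 + 0^2)) s"
  by (rule isCont_divide[OF VP_comp_cont[where h = "\<lambda>s. k * sqrt (s^2 + 0^2)", OF _ kp]])
   ((intro continuous_intros)+, use s in simp)
 show "isCont (\<lambda>s. g1 s 0) s" unfolding g1_def
  by (rule isCont_divide[OF isCont_add[OF isCont_mult[OF VPr i] isCont_mult[OF c isCont_diff[OF j(5)[OF hb_gh(1)] j(6)[OF hb_gh(2)]]]] c pi0])
qed

lemma f'_cont: "isCont f' x"
proof -
 obtain B where "Cb 0 B (\<lambda>x. of_real (f' x))" using smooth' by blast
 then have "continuous_on UNIV (\<lambda>x. Re (of_real (f' x)))" by (intro continuous_on_Re) simp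
 then show ?thesis by (simp add: continuous_on_eq_continuous_at)
qed

lemma U_D: "s \<in> U ==> s \<noteq> 0 \<and> \<bar>s\<bar> < d" using d by (auto simp: U_def abs_if)

lemma KK_cont: "0 < e ==> continuous_on U (\<lambda>s. KK e s x)"
 unfolding KK_def using g_cont U_D
 by (intro continuous_at_imp_continuous_on ballI continuous_intros) blast+

lemma KDs_cont: "0 < e ==> continuous_on U (\<lambda>s. KDs e s x)"
 unfolding KDs_def using g_cont U_D
 by (intro continuous_at_imp_continuous_on ballI continuous_intros isCont_o2[where g = f', OF _ f'_cont]) blast+

lemma KD_deriv:
 assumes s: "s \<noteq> 0" "\<bar>s\<bar> < d" and e: "0 < e"
 shows "((\<lambda>s. KD e s x) has_vector_derivative KDs e s x) (at s)"
proof -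
 have Y: "((\<lambda>s. yf e s x) has_real_derivative e * f' (x - s)) (at s)" for s
  using DERIV_cdivide[OF yf_deriv_s[of e x s], of k] k by simp
 have "\<bar>e * f' (x - t)\<bar> \<le> e * fK + 2 * fK * e" for t
 proof -
  have "\<bar>e * f' (x - t)\<bar> \<le> e * fK" using fK(2)[of "x - t"] e by (simp add: abs_mult)
  then show ?thesis using mult_nonneg_nonneg[OF fK_nonneg less_imp_le[OF e]] by linarith
 qed
 moreover have "\<bar>yf e t x\<bar> \<le> e * fK + 2 * fK * e" for t
  using yf_le[OF e, of t x] mult_nonneg_nonneg[OF less_imp_le[OF e] fK_nonneg] by linarith
 ultimately have "((\<lambda>s. G s (yf e s x)) has_vector_derivative g1 s (yf e s x) + of_real (e * f' (x - s)) * g2 s (yf e s x)) (at s)"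
  by (rule green_q_deriv_line[OF s Y])
 from has_vector_derivative_diff[OF this green_q_d1[OF s, of 0]]
 show ?thesis unfolding KD_def KDs_def .
qed

lemma KD_cont: "0 < e ==> continuous_on U (\<lambda>s. KD e s x)"
 using KD_deriv U_D by (auto intro!: continuous_at_imp_continuous_on has_vector_derivative_continuous)

text \<open>The curved and the flat kernel have the same logarithm ln |s|, which cancels and leaves
  a multiple of ln sqrt (1 + e^2 (f' x)^2). The limit is needed to integrate by parts across s =
  0.\<close>

lemma KD_lim:
 assumes e: "0 < e"
 obtains D0 where "((\<lambda>s. KD e s x) \<longlongrightarrow> D0) (at 0)"
proof -
 let ?L = "of_real (ln 2 - euler_mascheroni) + \<i> * of_real (pi / 2) :: complex"
 have "((\<lambda>h. (f (x + h) - f x) / h) \<longlongrightarrow> f' x) (at 0)" using f_deriv[of x] by (simp add: DERIV_def)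
 moreover have "filterlim (\<lambda>s::real. - s) (at 0) (at 0)"
  by (rule filterlim_atI) (auto intro!: tendsto_eq_intros simp: eventually_at_filter)
 ultimately have "((\<lambda>s. (f (x + - s) - f x) / (- s)) \<longlongrightarrow> f' x) (at 0)" by (rule filterlim_compose)
 moreover have "(f (x + - s) - f x) / (- s) = dq f s x" for s by (cases "s = 0") (auto simp: dq_def field_simps)
 ultimately have q: "((\<lambda>s. dq f s x) \<longlongrightarrow> f' x) (at 0)" by simp
 have t: "((\<lambda>s. sqrt (1 + tt e s x)) \<longlongrightarrow> sqrt (1 + e^2 * (f' x)^2)) (at 0)"
  unfolding tt_def by (intro tendsto_intros q)
 have sp: "1 \<le> sqrt (1 + tt e s x)" for s using tt_nonneg[of e s x] by simp
 have c: "(cs \<longlongrightarrow> 0) (at 0)" unfolding cs_def[abs_def] by (auto intro!: tendsto_eq_intros)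
 have cr: "filterlim cs (at_right 0) (at 0)"
  unfolding filterlim_at using c k by (auto simp: eventually_at_filter cs_def)
 have ct: "((\<lambda>s. cs s * sqrt (1 + tt e s x)) \<longlongrightarrow> 0) (at 0)" using tendsto_mult[OF c t] by simp
 have ctr: "filterlim (\<lambda>s. cs s * sqrt (1 + tt e s x)) (at_right 0) (at 0)"
  unfolding filterlim_at
 proof (intro conjI ct)
  show "\<forall>\<^sub>F s in at 0. cs s * sqrt (1 + tt e s x) \<in> {0<..} \<and> cs s * sqrt (1 + tt e s x) \<noteq> 0"
   unfolding eventually_at_filter
  proof (intro always_eventually allI impI)
   fix s :: real assume "s \<noteq> 0"
   then have "0 < cs s * sqrt (1 + tt e s x)" using k sp[of s] by (intro mult_pos_pos) (auto simp: cs_def)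
   then show "cs s * sqrt (1 + tt e s x) \<in> {0<..} \<and> cs s * sqrt (1 + tt e s x) \<noteq> 0"
    by (metis greaterThan_iff less_irrefl)
  qed
 qed
 \<comment> \<open>Adding the logarithm makes W converge at 0; in the difference of its two values
   below, ln (cs s) cancels and only the logarithm of the bounded factor remains.\<close>
 define W where "W z = VV z + of_real (ln z)" for z
 have W: "(W \<longlongrightarrow> ?L) (at_right 0)" unfolding W_def by (rule VV_at_0)
 have "((\<lambda>s. W (cs s * sqrt (1 + tt e s x)) - W (cs s) - of_real (ln (sqrt (1 + tt e s x)))) \<longlongrightarrow> ?L - ?L - of_real (ln (sqrt (1 + e^2 * (f' x)^2)))) (at 0)"
 proof (intro tendsto_diff filterlim_compose[OF W ctr] filterlim_compose[OF W cr] tendsto_of_real tendsto_ln t)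
  have "0 < 1 + e^2 * (f' x)^2" by (simp add: add_pos_nonneg)
  then show "sqrt (1 + e^2 * (f' x)^2) \<noteq> 0" by simp
 qed
 moreover have "\<forall>\<^sub>F s in at 0. W (cs s * sqrt (1 + tt e s x)) - W (cs s) - of_real (ln (sqrt (1 + tt e s x))) = vf e s x"
  unfolding eventually_at_filter
 proof (intro always_eventually allI impI)
  fix s :: real assume "s \<noteq> 0"
  then have "0 < cs s" using k by (simp add: cs_def)
  then have "ln (cs s * sqrt (1 + tt e s x)) = ln (cs s) + ln (sqrt (1 + tt e s x))" using sp[of s] by (intro ln_mult_pos) auto
  then show "W (cs s * sqrt (1 + tt e s x)) - W (cs s) - of_real (ln (sqrt (1 + tt e s x))) = vf e s x"
   by (simp add: W_def vf_def)
 qed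
 ultimately have v: "((\<lambda>s. vf e s x) \<longlongrightarrow> ?L - ?L - of_real (ln (sqrt (1 + e^2 * (f' x)^2)))) (at 0)"
  by (rule Lim_transform_eventually)
 have j: "((\<lambda>s. jcf \<sigma> h e s x - Jc h (k * (\<sigma> * s)) 0) \<longlongrightarrow> Jc h (k * (\<sigma> * 0)) (k * yf e 0 x) - Jc h (k * (\<sigma> * 0)) 0) (at 0)"
  if "hb (k * d) h" "\<bar>\<sigma>\<bar> = 1" for h \<sigma>
  using j_cont(1)[OF that _ e, of 0 x] j_cont0[OF that, of 0] d unfolding isCont_def jcf_def by (intro tendsto_diff) auto
 have j1: "((\<lambda>s. jcf 1 h1 e s x - Jc h1 (k * (1 * s)) 0) \<longlongrightarrow> Jc h1 (k * (1 * 0)) (k * yf e 0 x) - Jc h1 (k * (1 * 0)) 0) (at 0)"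
  by (rule j[OF hb_h(1)]) simp
 have j2: "((\<lambda>s. jcf (- 1) h2 e s x - Jc h2 (k * (- 1 * s)) 0) \<longlongrightarrow> Jc h2 (k * (- 1 * 0)) (k * yf e 0 x) - Jc h2 (k * (- 1 * 0)) 0) (at 0)"
  by (rule j[OF hb_h(2)]) simp
 note all = tendsto_divide[OF tendsto_add[OF v tendsto_add[OF j1 j2]] tendsto_const[of "complex_of_real (2 * pi)"]]
 have ev: "\<forall>\<^sub>F s in at 0. (vf e s x + ((jcf 1 h1 e s x - Jc h1 (k * (1 * s)) 0) + (jcf (- 1) h2 e s x - Jc h2 (k * (- 1 * s)) 0))) / of_real (2 * pi) = KD e s x"
 proof -
  have "\<forall>\<^sub>F s in at (0::real). s \<in> J"
   unfolding eventually_at using d by (intro exI[of _ "d / 2"]) (auto simp: dist_real_def)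
  then show ?thesis by eventually_elim (rule KD_eq[symmetric])
 qed
 show ?thesis by (rule that, rule Lim_transform_eventually[OF all ev]) simp
qed

lemma yf_period: "yf e (s + d) x = yf e s x"
 using period[of "x - (s + d)"] by (simp add: yf_def)

lemma KD_shift: "KD e (s + d) x = (qd \<alpha> d) * KD e s x"
 unfolding KD_def yf_period green_q_qp[OF d k not_wood] by (simp add: right_diff_distrib)

text \<open>Quasi-periodicity cancels the boundary terms at - d / 2 and d / 2, and the continuous
  extension at s = 0 leaves no jump. The factor alpha_j gained is the one order of smoothing of the
  single layer.\<close>

lemma KD_by_parts:
 assumes e: "0 < e" and 1: "((\<lambda>s. KD e s x * ex j (- s)) has_integral I1) {- (d / 2)..d / 2}"
  and 2: "((\<lambda>s. KDs e s x * ex j (- s)) has_integral I2) {- (d / 2)..d / 2}"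
 shows "\<i> * of_real (alpha_n d \<alpha> j) * I1 = I2"
proof -
 obtain D0 where D0: "((\<lambda>s. KD e s x) \<longlongrightarrow> D0) (at 0)" by (rule KD_lim[OF e])
 define D where "D s = (if s = 0 then D0 else KD e s x)" for s
 let ?a = "\<i> * of_real (alpha_n d \<alpha> j)"
 have DD: "(D has_vector_derivative KDs e s x) (at s)" if "s \<noteq> 0" "\<bar>s\<bar> < d" for s
  using KD_deriv[OF that e]
  by (rule has_vector_derivative_transform_within_open[of _ _ _ "- {0}"]) (use that in \<open>auto simp: D_def\<close>)
 have D0': "isCont D 0"
  unfolding isCont_def using D0 by (simp add: D_def cong: LIM_cong)
 have Dc: "isCont D s" if "\<bar>s\<bar> < d" for s
  using D0' has_vector_derivative_continuous[OF DD[OF _ that]] by (cases "s = 0") auto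
 have "((\<lambda>s. KDs e s x * ex j (- s) - ?a * (KD e s x * ex j (- s))) has_integral
   (D (d / 2) * ex j (- (d / 2)) - D (- (d / 2)) * ex j (- (- (d / 2))))) {- (d / 2)..d / 2}"
 proof (rule fundamental_theorem_of_calculus_interior_strong[of "{0}" "- (d / 2)" "d / 2" "\<lambda>s. D s * ex j (- s)"])
  fix s assume s: "s \<in> {- (d / 2)<..<d / 2} - {0}"
  then have s': "s \<noteq> 0" "\<bar>s\<bar> < d" using d by auto
  show "((\<lambda>s. D s * ex j (- s)) has_vector_derivative KDs e s x * ex j (- s) - ?a * (KD e s x * ex j (- s))) (at s)"
   using has_vector_derivative_mult[OF DD[OF s'] ex_deriv[of j s]]
   by (rule has_vector_derivative_eq_rhs) (use s' in \<open>simp add: D_def algebra_simps\<close>)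
 next
  show "continuous_on {- (d / 2)..d / 2} (\<lambda>s. D s * ex j (- s))"
   by (intro continuous_on_mult ex_cont continuous_at_imp_continuous_on ballI Dc) (use d in auto)
 qed (use d in auto)
 moreover have "D (d / 2) * ex j (- (d / 2)) - D (- (d / 2)) * ex j (- (- (d / 2))) = 0"
 proof -
  have h: "- (d / 2) + d = d / 2" by simp
  show ?thesis using KD_shift[of e "- (d / 2)" x] ex_shift[of "KD e (- (d / 2)) x" j "- (d / 2)"] d unfolding h by (simp add: D_def)
 qed
 ultimately have "((\<lambda>s. KDs e s x * ex j (- s) - ?a * (KD e s x * ex j (- s))) has_integral 0) {- (d / 2)..d / 2}" by simp
 moreover have "((\<lambda>s. KDs e s x * ex j (- s) - ?a * (KD e s x * ex j (- s))) has_integral (I2 - ?a * I1)) {- (d / 2)..d / 2}"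
  by (intro has_integral_diff has_integral_mult_right 1 2)
 ultimately have "I2 - ?a * I1 = 0" using has_integral_unique by blast
 then show ?thesis by simp
qed

end

subsection \<open>Layer potentials of exponentials\<close>

context green_kernel
begin

lemma g_shift:
 assumes s: "- d < s" "s < 0"
 shows "g1 (s + d) y = (qd \<alpha> d) * g1 s y" "g2 (s + d) y = (qd \<alpha> d) * g2 s y"
proof -
 have s1: "s \<noteq> 0" "\<bar>s\<bar> < d" and s2: "s + d \<noteq> 0" "\<bar>s + d\<bar> < d" using s by auto
 have "((\<lambda>t. G (t + d) y) has_vector_derivative g1 (s + d) y) (at s)"
  unfolding has_vector_derivative_shift[of "\<lambda>t. G t y"] by (rule green_q_d1[OF s2])
 moreover have "((\<lambda>t. G (t + d) y) has_vector_derivative (qd \<alpha> d) * g1 s y) (at s)"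
  unfolding green_q_qp[OF d k not_wood] by (rule has_vector_derivative_mult_right[OF green_q_d1[OF s1]])
 ultimately show "g1 (s + d) y = (qd \<alpha> d) * g1 s y" by (rule vector_derivative_unique_at)
 have "((\<lambda>t. G (s + d) t) has_vector_derivative (qd \<alpha> d) * g2 s y) (at y)"
  unfolding green_q_qp[OF d k not_wood] by (rule has_vector_derivative_mult_right[OF green_q_d2[OF s1]])
 with green_q_d2[OF s2] show "g2 (s + d) y = (qd \<alpha> d) * g2 s y" by (rule vector_derivative_unique_at)
qed

lemma green_coef_centered:
 "((\<lambda>s. G s 0 * ex j (- s)) has_integral \<i> / (2 * beta0 d \<alpha> k j)) {- (d / 2)..d / 2}"
proof -
 have e: "exp (- \<i> * of_real (alpha_n d \<alpha> j * s)) = ex j (- s)" for s by (simp add: ex_def)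
 have i: "((\<lambda>s. G s 0 * ex j (- s)) has_integral \<i> / (2 * beta0 d \<alpha> k j)) {0..0 + d}"
  using green_q_coef[OF d k not_wood, of j] unfolding e by simp
 have p: "G (s + d) 0 * ex j (- (s + d)) = G s 0 * ex j (- s)" for s
  unfolding green_q_qp[OF d k not_wood] by (rule ex_shift)
 have "((\<lambda>s. G s 0 * ex j (- s)) has_integral \<i> / (2 * beta0 d \<alpha> k j)) {- (d / 2)..- (d / 2) + d}"
  by (rule has_integral_period[where f = "\<lambda>s. G s 0 * ex j (- s)", OF i p]) (use d in simp)
 then show ?thesis by simp
qed

text \<open>Substituting s = x - y turns the integral over y in {0..d} into one over {x - d..x},
  which \<open>has_integral_window\<close> relates to the centred period.\<close>

lemma convolution_substitution:
 assumes H: "(H has_integral I) {- (d / 2)..d / 2}" and p: "\<And>s. - d < s ==> s < 0 ==> H (s + d) = H s"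
  and x: "0 \<le> x" "x \<le> d"
 shows "((\<lambda>y. ex j x * H (x - y)) has_integral ex j x * I) {0..d}"
proof -
 have "(H has_integral I) {x - d..x - d + d}" by (rule has_integral_window[OF d H p]) (use x in auto)
 then have "((\<lambda>s. H (- s)) has_integral I) {- x..- (x - d)}" by (subst has_integral_reflect_real) simp_all
 from has_integral_affinity[OF this[unfolded cbox_interval[symmetric]], of 1 "- x"]
 have "((\<lambda>y. H (x - y)) has_integral I) {0..d}" by (simp add: algebra_simps)
 then show ?thesis by (rule has_integral_mult_right)
qed

lemma ex_split: "ex j x * ex j (- (x - y)) = ex j y"
 using ex_add[of j x "- (x - y)"] by simp

lemma yf_xy: "yf e (x - y) x = e * f x - e * f y"
 by (simp add: yf_def right_diff_distrib)

lemma single_layer_ex: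
 assumes P: "((\<lambda>s. KD e s x * ex j (- s)) has_integral P) {- (d / 2)..d / 2}" and x: "0 \<le> x" "x \<le> d"
 shows "((\<lambda>y. G (x - y) (e * f x - e * f y) * ex j y) has_integral ex j x * (P + \<i> / (2 * beta0 d \<alpha> k j))) {0..d}"
proof -
 define H where "H s = G s (yf e s x) * ex j (- s)" for s
 have "H s = KD e s x * ex j (- s) + G s 0 * ex j (- s)" for s by (simp add: H_def KD_def algebra_simps)
 then have "(H has_integral (P + \<i> / (2 * beta0 d \<alpha> k j))) {- (d / 2)..d / 2}"
  using has_integral_add[OF P green_coef_centered[of j]] by presburger
 moreover have "H (s + d) = H s" for s
  unfolding H_def yf_period green_q_qp[OF d k not_wood] by (rule ex_shift)
 ultimately have "((\<lambda>y. ex j x * H (x - y)) has_integral ex j x * (P + \<i> / (2 * beta0 d \<alpha> k j))) {0..d}"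
  by (intro convolution_substitution x) auto
 moreover have "ex j x * H (x - y) = G (x - y) (e * f x - e * f y) * ex j y" for y
  unfolding H_def yf_xy ex_split[of j x y, symmetric] by (simp only: mult_ac)
 ultimately show ?thesis by simp
qed

lemma adj_double_layer_ex:
 assumes P: "((\<lambda>s. KK e s x * ex j (- s)) has_integral P) {- (d / 2)..d / 2}" and x: "0 \<le> x" "x \<le> d"
 shows "((\<lambda>y. (of_real (e * f' x) * green_q_d1 d \<alpha> k (x - y) (e * f x - e * f y)
   - green_q_d2 d \<alpha> k (x - y) (e * f x - e * f y)) * ex j y) has_integral ex j x * P) {0..d}"
proof -
 define H where "H s = (of_real (e * f' x) * green_q_d1 d \<alpha> k s (yf e s x) - green_q_d2 d \<alpha> k s (yf e s x)) * ex j (- s)" for s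
 have g: "green_q_d1 d \<alpha> k s y = g1 s y" "green_q_d2 d \<alpha> k s y = g2 s y" if "s \<noteq> 0" "\<bar>s\<bar> < d" for s y
  unfolding green_q_d1_def green_q_d2_def using green_q_d1[OF that] green_q_d2[OF that] by (simp_all add: vector_derivative_at)
 \<comment> \<open>At s = 0 the partial derivatives are \<open>vector_derivative\<close> terms
   without a known value; a single point does not affect the integral.\<close>
 have "(H has_integral P) {- (d / 2)..d / 2}"
  by (rule has_integral_spike_finite[of "{0}", OF _ _ P]) (use d in \<open>auto simp: H_def KK_def g\<close>)
 moreover have "H (s + d) = H s" if "- d < s" "s < 0" for s
 proof -
  have gs: "green_q_d1 d \<alpha> k (s + d) y = (qd \<alpha> d) * green_q_d1 d \<alpha> k s y"
   "green_q_d2 d \<alpha> k (s + d) y = (qd \<alpha> d) * green_q_d2 d \<alpha> k s y" for y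
   using g[of s y] g[of "s + d" y] g_shift[OF that, of y] that by simp_all
  let ?z = "of_real (e * f' x) * green_q_d1 d \<alpha> k s (yf e s x) - green_q_d2 d \<alpha> k s (yf e s x)"
  have "H (s + d) = (qd \<alpha> d) * ?z * ex j (- (s + d))"
   unfolding H_def yf_period gs by (simp add: algebra_simps)
  then show ?thesis unfolding ex_shift by (simp add: H_def)
 qed
 ultimately have "((\<lambda>y. ex j x * H (x - y)) has_integral ex j x * P) {0..d}"
  by (intro convolution_substitution x) auto
 moreover have "ex j x * H (x - y) = (of_real (e * f' x) * green_q_d1 d \<alpha> k (x - y) (e * f x - e * f y)
   - green_q_d2 d \<alpha> k (x - y) (e * f x - e * f y)) * ex j y" for y
  unfolding H_def yf_xy ex_split[of j x y, symmetric] by (simp only: mult_ac)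
 ultimately show ?thesis by simp
qed

lemma qp_fun_finite:
 assumes "finite {n. c n \<noteq> 0}" shows "qp_fun d \<alpha> c y = (\<Sum>j | c j \<noteq> 0. c j * ex j y)"
proof -
 have "qp_fun d \<alpha> c y = infsum (\<lambda>n. c n * ex n y) {n. c n \<noteq> 0}"
  unfolding qp_fun_def ex_def by (rule infsum_cong_neutral) auto
 then show ?thesis using assms by simp
qed

lemma integral_qp_fun:
 assumes c: "finite {n. c n \<noteq> 0}" and i: "\<And>j. ((\<lambda>y. g y * ex j y) has_integral ex j x * \<Psi> j) {0..d}"
 shows "integral {0..d} (\<lambda>y. g y * qp_fun d \<alpha> c y) = (\<Sum>j | c j \<noteq> 0. c j * (ex j x * \<Psi> j))"
proof (rule integral_unique)
 have "((\<lambda>y. \<Sum>j | c j \<noteq> 0. c j * (g y * ex j y)) has_integral (\<Sum>j | c j \<noteq> 0. c j * (ex j x * \<Psi> j))) {0..d}"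
  by (intro has_integral_sum c has_integral_mult_right i)
 then show "((\<lambda>y. g y * qp_fun d \<alpha> c y) has_integral (\<Sum>j | c j \<noteq> 0. c j * (ex j x * \<Psi> j))) {0..d}"
  by (simp add: qp_fun_finite[OF c] sum_distrib_left mult_ac)
qed

text \<open>The product of \<open>ex j\<close> with the n-th test exponential depends on n - j only,
  since alpha cancels; quasi-periodic coefficients become ordinary Fourier coefficients of the
  symbols.\<close>

lemma qp_coef_sum:
 assumes c: "finite {n. c n \<noteq> 0}" and \<Psi>: "\<And>j. continuous_on {0..d} (\<Psi> j)"
  and g: "\<And>x. 0 \<le> x ==> x \<le> d ==> g x = (\<Sum>j | c j \<noteq> 0. c j * (ex j x * \<Psi> j x))"
 shows "qp_coef d \<alpha> g n = (\<Sum>j | c j \<noteq> 0. ccoef d (\<Psi> j) (n - j) * c j)"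
proof -
 have e: "ex j x * exp (- \<i> * of_real (alpha_n d \<alpha> n * x)) = exp (- \<i> * of_real (2 * pi * of_int (n - j) * x / d))" for j x
 proof -
  have "alpha_n d \<alpha> j * x - alpha_n d \<alpha> n * x = - (2 * pi * of_int (n - j) * x / d)"
   using d by (simp add: alpha_n_def field_simps)
  then have "\<i> * of_real (alpha_n d \<alpha> j * x) + - \<i> * of_real (alpha_n d \<alpha> n * x) = - \<i> * of_real (2 * pi * of_int (n - j) * x / d)"
   by (metis (no_types, opaque_lifting) mult_minus_left mult_minus_right of_real_diff of_real_minus right_diff_distrib uminus_add_conv_diff add.commute)
  then show ?thesis unfolding ex_def exp_add[symmetric] by simp
 qed
 \<comment> \<open>The exponential is kept inside the function and coefficient 0 is taken, because
   \<open>ccoef_sum\<close> needs one index for all summands while n - j varies.\<close>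
 have s: "ccoef d (\<lambda>x. \<Sum>j | c j \<noteq> 0. c j * (\<Psi> j x * exp (- \<i> * of_real (2 * pi * of_int (n - j) * x / d)))) 0
   = (\<Sum>j | c j \<noteq> 0. c j * ccoef d (\<lambda>x. \<Psi> j x * exp (- \<i> * of_real (2 * pi * of_int (n - j) * x / d))) 0)"
  by (subst ccoef_sum[OF c]) (auto intro!: continuous_intros \<Psi> simp: ccoef_cmult d less_imp_neq[OF d, symmetric])
 have "integral {0..d} (\<lambda>x. g x * exp (- \<i> * of_real (alpha_n d \<alpha> n * x)))
  = integral {0..d} (\<lambda>x. \<Sum>j | c j \<noteq> 0. c j * (\<Psi> j x * exp (- \<i> * of_real (2 * pi * of_int (n - j) * x / d))))"
 proof (rule integral_cong)
  fix x assume "x \<in> {0..d}"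
  then have "g x * exp (- \<i> * of_real (alpha_n d \<alpha> n * x)) = (\<Sum>j | c j \<noteq> 0. c j * (\<Psi> j x * (ex j x * exp (- \<i> * of_real (alpha_n d \<alpha> n * x)))))"
   by (simp add: g sum_distrib_left mult_ac)
  then show "g x * exp (- \<i> * of_real (alpha_n d \<alpha> n * x)) = (\<Sum>j | c j \<noteq> 0. c j * (\<Psi> j x * exp (- \<i> * of_real (2 * pi * of_int (n - j) * x / d))))"
   unfolding e .
 qed
 then have "qp_coef d \<alpha> g n = ccoef d (\<lambda>x. \<Sum>j | c j \<noteq> 0. c j * (\<Psi> j x * exp (- \<i> * of_real (2 * pi * of_int (n - j) * x / d)))) 0"
  by (simp add: qp_coef_def ccoef_def)
 then show ?thesis unfolding s by (simp add: ccoef_def mult.commute)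
qed

lemma KK_period: "KK e s (x + d) = KK e s x" and KD_period: "KD e s (x + d) = KD e s x" and KDs_period: "KDs e s (x + d) = KDs e s x"
proof -
 have p: "f' (x + d) = f' x" for x by (rule deriv_period_real[OF f_deriv period])
 have y: "yf e s (x + d) = yf e s x" using period[of x] period[of "x - s"] by (simp add: yf_def algebra_simps)
 show "KK e s (x + d) = KK e s x" "KD e s (x + d) = KD e s x" by (simp_all add: KK_def KD_def y p)
 have "f' (x + d - s) = f' (x - s)" using p[of "x - s"] by (simp add: algebra_simps)
 then show "KDs e s (x + d) = KDs e s x" by (simp add: KDs_def y)
qed

text \<open>Three derivatives suffice for \<open>KM\<close>. \<open>DM\<close> gets four:
  integration by parts provides the weight at column j, and \<open>jw_le\<close> spends one power of
  \<open>br\<close> to move it to row n. The diagonal term is the flat single layer.\<close>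

lemma layer_matrices:
 obtains B where "0 \<le> B" "\<And>e. 0 < e ==> e \<le> 1 ==> \<exists>KM DM. mdec (B * e) KM \<and> mdec (B * e) (\<lambda>n j. of_real (jw d \<alpha> n) * DM n j) \<and>
   (\<forall>c n. finite {n. c n \<noteq> 0} \<longrightarrow> qp_coef d \<alpha> (adj_double_layer d \<alpha> k (\<lambda>x. e * f x) c) n = (\<Sum>j | c j \<noteq> 0. KM n j * c j)) \<and>
   (\<forall>c n. finite {n. c n \<noteq> 0} \<longrightarrow> qp_coef d \<alpha> (single_layer d \<alpha> k (\<lambda>x. e * f x) c) n
     = (\<Sum>j | c j \<noteq> 0. (DM n j + (if n = j then \<i> / (2 * beta0 d \<alpha> k j) else 0)) * c j))"
proof -
 obtain B1 where B1: "0 \<le> B1" "\<And>e j. 0 < e ==> e \<le> 1 ==> Cb 3 (B1 * e) (Phi KK e j)"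
  "\<And>e j x. 0 < e ==> e \<le> 1 ==> ((\<lambda>s. KK e s x * ex j (- s)) has_integral Phi KK e j x) {- (d / 2)..d / 2}"
  by (rule Phi_props[OF unif_KK KK_cont]) (assumption, rule that)
 obtain B2 where B2: "0 \<le> B2" "\<And>e j. 0 < e ==> e \<le> 1 ==> Cb 4 (B2 * e) (Phi KD e j)"
  "\<And>e j x. 0 < e ==> e \<le> 1 ==> ((\<lambda>s. KD e s x * ex j (- s)) has_integral Phi KD e j x) {- (d / 2)..d / 2}"
  by (rule Phi_props[OF unif_KD KD_cont]) (assumption, rule that)
 obtain B3 where B3: "0 \<le> B3" "\<And>e j. 0 < e ==> e \<le> 1 ==> Cb 4 (B3 * e) (Phi KDs e j)"
  "\<And>e j x. 0 < e ==> e \<le> 1 ==> ((\<lambda>s. KDs e s x * ex j (- s)) has_integral Phi KDs e j x) {- (d / 2)..d / 2}"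
  by (rule Phi_props[OF unif_KDs KDs_cont]) (assumption, rule that)
 have per: "Phi KK e j (x + d) = Phi KK e j x" "Phi KD e j (x + d) = Phi KD e j x" "Phi KDs e j (x + d) = Phi KDs e j x" for e j x
  by (simp_all add: Phi_def KK_period KD_period KDs_period)
 define B where "B = decK d 3 * B1 + jwK d * (decK d 4 * B2 + decK d 4 * B3)"
 have K0: "0 \<le> decK d 3" "0 \<le> decK d 4" "0 \<le> jwK d" using decK_nonneg[OF d] jwK_ge1[of d] by auto
 show ?thesis
 proof (rule that[of B])
  show "0 \<le> B" using K0 B1(1) B2(1) B3(1) by (simp add: B_def)
  fix e :: real assume e: "0 < e" "e \<le> 1"
  define KM DM where "KM n j = ccoef d (Phi KK e j) (n - j)" and "DM n j = ccoef d (Phi KD e j) (n - j)" for n j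
  have KMd: "mdec (B * e) KM" unfolding mdec_def
  proof (intro allI)
   fix n j
   have "cmod (KM n j) \<le> decK d 3 * (B1 * e) / br (n - j) ^ 3"
    unfolding KM_def by (rule ccoef_decay_br[OF d B1(2)[OF e] per(1)])
   also have "\<dots> \<le> B * e / br (n - j) ^ 3"
    using K0 B1(1) B2(1) B3(1) e by (intro divide_right_mono) (auto simp: B_def distrib_right mult.assoc)
   finally show "cmod (KM n j) \<le> B * e / br (n - j) ^ 3" .
  qed
  have DMd: "mdec (B * e) (\<lambda>n j. of_real (jw d \<alpha> n) * DM n j)" unfolding mdec_def
  proof (intro allI)
   fix n j
   let ?b = "br (n - j)" and ?a = "alpha_n d \<alpha> j" and ?D = "cmod (DM n j)"
   have 1: "?D \<le> decK d 4 * (B2 * e) / ?b ^ 4"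
    unfolding DM_def by (rule ccoef_decay_br[OF d B2(2)[OF e] per(2)])
   have "(\<lambda>x. \<i> * of_real ?a * Phi KD e j x) = Phi KDs e j"
    using KD_by_parts[OF e(1) B2(3)[OF e] B3(3)[OF e]] by blast
   then have "\<i> * of_real ?a * DM n j = ccoef d (Phi KDs e j) (n - j)"
    unfolding DM_def ccoef_cmult[symmetric] by simp
   then have "cmod (\<i> * of_real ?a * DM n j) \<le> decK d 4 * (B3 * e) / ?b ^ 4"
    using ccoef_decay_br[OF d B3(2)[OF e] per(3), of j "n - j"] by simp
   then have 2: "\<bar>?a\<bar> * ?D \<le> decK d 4 * (B3 * e) / ?b ^ 4" by (simp add: norm_mult)
   have "jw d \<alpha> j \<le> 1 + \<bar>?a\<bar>" unfolding jw_def by (rule real_le_lsqrt) (auto simp: power2_eq_square algebra_simps)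
   then have "jw d \<alpha> j * ?D \<le> (1 + \<bar>?a\<bar>) * ?D" by (rule mult_right_mono) simp
   also have "\<dots> = ?D + \<bar>?a\<bar> * ?D" by (simp add: distrib_right)
   also have "\<dots> \<le> (decK d 4 * B2 + decK d 4 * B3) * e / ?b ^ 4"
    using add_mono[OF 1 2] by (simp add: distrib_right add_divide_distrib mult.assoc)
   finally have 3: "jw d \<alpha> j * ?D \<le> (decK d 4 * B2 + decK d 4 * B3) * e / ?b ^ 4" .
   have "jw d \<alpha> n * ?D \<le> (jwK d * jw d \<alpha> j * br (j - n)) * ?D" by (intro mult_right_mono jw_le) auto
   also have "\<dots> = jwK d * ?b * (jw d \<alpha> j * ?D)" by (simp add: br_diff_commute[of j n] mult_ac)
   also have "\<dots> \<le> jwK d * ?b * ((decK d 4 * B2 + decK d 4 * B3) * e / ?b ^ 4)"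
    using K0 by (intro mult_left_mono 3) auto
   also have "\<dots> = jwK d * (decK d 4 * B2 + decK d 4 * B3) * e / ?b ^ 3"
   proof -
    have "?b ^ 4 = ?b * ?b ^ 3" by (simp add: eval_nat_numeral)
    then show ?thesis by simp
   qed
   also have "\<dots> \<le> B * e / ?b ^ 3"
    using K0 B1(1) e by (intro divide_right_mono) (auto simp: B_def distrib_right)
   finally show "cmod (of_real (jw d \<alpha> n) * DM n j) \<le> B * e / ?b ^ 3"
    using jw_pos[of d \<alpha> n] by (simp add: norm_mult)
  qed
  have contK: "continuous_on S (Phi KK e j)" and contD: "continuous_on S (Phi KD e j)" for S j
   using Cb_continuous[OF B1(2)[OF e]] Cb_continuous[OF B2(2)[OF e]] by blast+
  have coefK: "qp_coef d \<alpha> (adj_double_layer d \<alpha> k (\<lambda>x. e * f x) c) n = (\<Sum>j | c j \<noteq> 0. KM n j * c j)"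
   if c: "finite {n. c n \<noteq> 0}" for c n
   unfolding KM_def
  proof (rule qp_coef_sum[OF c contK])
   fix x assume x: "0 \<le> x" "x \<le> d"
   have dv: "deriv (\<lambda>x. e * f x) x = e * f' x" by (rule DERIV_imp_deriv[OF DERIV_cmult[OF f_deriv]])
   show "adj_double_layer d \<alpha> k (\<lambda>x. e * f x) c x = (\<Sum>j | c j \<noteq> 0. c j * (ex j x * Phi KK e j x))"
    unfolding adj_double_layer_def dv
    by (rule integral_qp_fun[OF c adj_double_layer_ex[OF B1(3)[OF e] x]])
  qed
  have coefS: "qp_coef d \<alpha> (single_layer d \<alpha> k (\<lambda>x. e * f x) c) n
     = (\<Sum>j | c j \<noteq> 0. (DM n j + (if n = j then \<i> / (2 * beta0 d \<alpha> k j) else 0)) * c j)"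
   if c: "finite {n. c n \<noteq> 0}" for c n
  proof -
   let ?\<Psi> = "\<lambda>j x. Phi KD e j x - - (\<i> / (2 * beta0 d \<alpha> k j)) * 1"
   have "qp_coef d \<alpha> (single_layer d \<alpha> k (\<lambda>x. e * f x) c) n = (\<Sum>j | c j \<noteq> 0. ccoef d (?\<Psi> j) (n - j) * c j)"
   proof (rule qp_coef_sum[OF c])
    show "continuous_on {0..d} (?\<Psi> j)" for j by (intro continuous_intros contD)
    fix x assume x: "0 \<le> x" "x \<le> d"
    show "single_layer d \<alpha> k (\<lambda>x. e * f x) c x = (\<Sum>j | c j \<noteq> 0. c j * (ex j x * ?\<Psi> j x))"
     unfolding single_layer_def
     by (rule integral_qp_fun[OF c]) (use single_layer_ex[OF B2(3)[OF e] x] in simp)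
   qed
   moreover have "ccoef d (?\<Psi> j) (n - j) = DM n j + (if n = j then \<i> / (2 * beta0 d \<alpha> k j) else 0)" for j
    by (subst ccoef_diff) (auto intro!: continuous_intros contD simp: ccoef_cmult[of d "- (\<i> / (2 * beta0 d \<alpha> k j))" "\<lambda>x. 1", simplified] ccoef_one[OF d] DM_def)
   ultimately show ?thesis by simp
  qed
  show "\<exists>KM DM. mdec (B * e) KM \<and> mdec (B * e) (\<lambda>n j. of_real (jw d \<alpha> n) * DM n j) \<and>
   (\<forall>c n. finite {n. c n \<noteq> 0} \<longrightarrow> qp_coef d \<alpha> (adj_double_layer d \<alpha> k (\<lambda>x. e * f x) c) n = (\<Sum>j | c j \<noteq> 0. KM n j * c j)) \<and>
   (\<forall>c n. finite {n. c n \<noteq> 0} \<longrightarrow> qp_coef d \<alpha> (single_layer d \<alpha> k (\<lambda>x. e * f x) c) n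
     = (\<Sum>j | c j \<noteq> 0. (DM n j + (if n = j then \<i> / (2 * beta0 d \<alpha> k j) else 0)) * c j))"
   using KMd DMd coefK coefS by blast
 qed
qed

end

section \<open>Invertibility\<close>

lemma mdec_sum:
 assumes "finite I" "\<And>l. l \<in> I ==> mdec (C l) (x l)"
 shows "mdec (\<Sum>l\<in>I. C l) (\<lambda>n j. \<Sum>l\<in>I. x l n j)"
 using assms by (induction I rule: finite_induct) (auto simp: mdec_def[of 0] intro: mdec_add)

lemma mmul_diagm_left: "mmul (diagm a) x n j = a n * x n j"
proof -
 have "mmul (diagm a) x n j = infsum (\<lambda>k. diagm a n k * x k j) {n}"
  unfolding mmul_def by (rule infsum_cong_neutral) (auto simp: diagm_def)
 then show ?thesis by (simp add: diagm_def)
qed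

lemma mapp_finite_combination:
 assumes "mdec A z" "mdec B t" "finite F"
 shows "mapp z (\<lambda>k. \<Sum>j\<in>F. t k j * c j) n = (\<Sum>j\<in>F. mmul z t n j * c j)"
proof -
 have "(\<lambda>k. z n k * t k j) summable_on UNIV" for j
  by (rule mapp_summable[OF assms(1) mdec_col_adm[OF assms(2)]])
 then have s: "(\<lambda>k. z n k * t k j * c j) summable_on UNIV" for j by (intro summable_on_cmult_left)
 have "mapp z (\<lambda>k. \<Sum>j\<in>F. t k j * c j) n = infsum (\<lambda>k. \<Sum>j\<in>F. z n k * t k j * c j) UNIV"
  by (simp add: mapp_def sum_distrib_left mult.assoc)
 also have "\<dots> = (\<Sum>j\<in>F. infsum (\<lambda>k. z n k * t k j * c j) UNIV)"
  by (rule infsum_finite_sum(2)[OF assms(3) s])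
 finally show ?thesis by (simp add: mmul_def infsum_cmult_left')
qed

text \<open>For a fixed finite combination the distance to each column j is compared with the
  distance to 0. The constant depends on the support, which is harmless since it only serves
  convergence.\<close>

lemma finite_combination_decay:
 assumes "mdec B t" "finite F"
 obtains D where "\<And>n. cmod (\<Sum>j\<in>F. t n j * c j) \<le> D / br (n - 0) ^ 3"
proof (rule that)
 fix n
 have "cmod (\<Sum>j\<in>F. t n j * c j) \<le> (\<Sum>j\<in>F. B * br j ^ 3 * cmod (c j) / br n ^ 3)"
 proof (rule sum_norm_le)
  fix j
  have "br n \<le> br j * br (n - j)" using br_mult[of j "n - j"] by simp
  then have "br n ^ 3 \<le> (br j * br (n - j)) ^ 3" by (intro power_mono) auto
  then have "1 / br (n - j) ^ 3 \<le> br j ^ 3 / br n ^ 3" by (simp add: field_simps)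
  then have "B * (1 / br (n - j) ^ 3) \<le> B * (br j ^ 3 / br n ^ 3)" by (intro mult_left_mono mdec_nonneg[OF assms(1)])
  then have "cmod (t n j) \<le> B * br j ^ 3 / br n ^ 3" using mdecD[OF assms(1), of n j] by simp
  then show "norm (t n j * c j) \<le> B * br j ^ 3 * cmod (c j) / br n ^ 3"
   unfolding norm_mult using mult_right_mono[of "cmod (t n j)" "B * br j ^ 3 / br n ^ 3" "cmod (c j)"] by simp
 qed
 also have "\<dots> = (\<Sum>j\<in>F. B * br j ^ 3 * cmod (c j)) / br (n - 0) ^ 3" by (simp add: sum_divide_distrib)
 finally show "cmod (\<Sum>j\<in>F. t n j * c j) \<le> (\<Sum>j\<in>F. B * br j ^ 3 * cmod (c j)) / br (n - 0) ^ 3" .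
qed

section \<open>The flat symbol and the coefficients of the profile\<close>

lemma beta0_dir:
 assumes "\<not> wood d \<alpha> k"
 shows "(Re (beta0 d \<alpha> k n) > 0 \<and> Im (beta0 d \<alpha> k n) = 0) \<or> (Re (beta0 d \<alpha> k n) = 0 \<and> Im (beta0 d \<alpha> k n) > 0)"
proof -
 let ?x = "k^2 - (alpha_n d \<alpha> n)^2"
 have "?x \<noteq> 0" using assms by (auto simp: wood_def)
 then consider "0 < ?x" | "?x < 0" by linarith
 then show ?thesis
 proof cases
  case 1
  then have "beta0 d \<alpha> k n = of_real (sqrt ?x)" unfolding beta0_def by (subst of_real_sqrt) auto
  then show ?thesis using 1 by simp
 next
  case 2
  then have "beta0 d \<alpha> k n = \<i> * of_real (sqrt (- ?x))" unfolding beta0_def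
   by (subst csqrt_of_real_nonpos) (auto simp: abs_if)
  then show ?thesis using 2 by simp
 qed
qed

lemma finite_alpha_small: assumes "0 < d" shows "finite {n. (alpha_n d \<alpha> n)^2 \<le> R}"
proof (cases "0 \<le> R")
 case True
 let ?q = "2 * pi / d"
 have q: "0 < ?q" using assms by simp
 have "{n. (alpha_n d \<alpha> n)^2 \<le> R} \<subseteq> {\<lfloor>(- sqrt R - \<alpha>) / ?q\<rfloor>..\<lceil>(sqrt R - \<alpha>) / ?q\<rceil>}"
 proof
  fix n assume "n \<in> {n. (alpha_n d \<alpha> n)^2 \<le> R}"
  then have "\<bar>alpha_n d \<alpha> n\<bar> \<le> sqrt R" by (simp add: real_le_rsqrt)
  moreover have "alpha_n d \<alpha> n = \<alpha> + of_int n * ?q" by (simp add: alpha_n_def)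
  moreover have "\<bar>x\<bar> \<le> r ==> x = \<alpha> + y ==> - r - \<alpha> \<le> y \<and> y \<le> r - \<alpha>" for x y r :: real by linarith
  ultimately have "- sqrt R - \<alpha> \<le> of_int n * ?q \<and> of_int n * ?q \<le> sqrt R - \<alpha>" by blast
  then have "(- sqrt R - \<alpha>) / ?q \<le> of_int n" "of_int n \<le> (sqrt R - \<alpha>) / ?q"
   using q by (simp_all only: pos_divide_le_eq pos_le_divide_eq)
  then show "n \<in> {\<lfloor>(- sqrt R - \<alpha>) / ?q\<rfloor>..\<lceil>(sqrt R - \<alpha>) / ?q\<rceil>}"
   by (simp add: floor_le_iff le_ceiling_iff)
 qed
 then show ?thesis by (rule finite_subset) simp
next
 case False
 then have "\<not> (alpha_n d \<alpha> n)^2 \<le> R" for n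
  using zero_le_power2[of "alpha_n d \<alpha> n"] by linarith
 then show ?thesis by simp
qed

text \<open>For large |alpha_n| both sides grow alike, with factor 2. Below the threshold 2 k^2 + 1
  there are finitely many indices, each with \<open>beta0\<close> nonzero because k is not a Wood
  frequency, and their ratios are summed into M.\<close>

lemma jw_le_beta0:
 assumes d: "0 < d" and nw: "\<not> wood d \<alpha> k"
 obtains M where "0 \<le> M" "\<And>n. jw d \<alpha> n \<le> M * cmod (beta0 d \<alpha> k n)"
proof -
 let ?S = "{n. (alpha_n d \<alpha> n)^2 \<le> 2 * k^2 + 1}"
 have nz: "0 < cmod (beta0 d \<alpha> k n)" for n using beta0_dir[OF nw, of n] by auto
 define M where "M = 2 + (\<Sum>n\<in>?S. jw d \<alpha> n / cmod (beta0 d \<alpha> k n))"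
 have t0: "0 \<le> jw d \<alpha> n / cmod (beta0 d \<alpha> k n)" for n using jw_pos[of d \<alpha> n] by simp
 have s0: "0 \<le> (\<Sum>n\<in>?S. jw d \<alpha> n / cmod (beta0 d \<alpha> k n))" by (intro sum_nonneg t0)
 have "jw d \<alpha> n \<le> M * cmod (beta0 d \<alpha> k n)" for n
 proof (cases "n \<in> ?S")
  case True
  then have "jw d \<alpha> n / cmod (beta0 d \<alpha> k n) \<le> (\<Sum>n\<in>?S. jw d \<alpha> n / cmod (beta0 d \<alpha> k n))"
   by (intro member_le_sum finite_alpha_small[OF d] t0) auto
  then have "jw d \<alpha> n / cmod (beta0 d \<alpha> k n) \<le> M" by (simp add: M_def)
  then show ?thesis using nz[of n] by (simp add: pos_divide_le_eq)
 next
  case False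
  let ?a = "(alpha_n d \<alpha> n)^2"
  have a: "2 * k^2 + 1 < ?a" using False by simp
  have "beta0 d \<alpha> k n ^ 2 = of_real (k^2 - ?a)" by (simp add: beta0_def)
  then have "cmod (beta0 d \<alpha> k n) ^ 2 = \<bar>k^2 - ?a\<bar>" by (metis norm_of_real norm_power)
  also have "\<dots> = ?a - k^2" using a zero_le_power2[of k] by linarith
  finally have "1 + ?a \<le> 4 * cmod (beta0 d \<alpha> k n) ^ 2" using a zero_le_power2[of k] by linarith
  then have "jw d \<alpha> n \<le> 2 * cmod (beta0 d \<alpha> k n)" unfolding jw_def
   by (intro real_le_lsqrt) (auto simp: power_mult_distrib)
  also have "\<dots> \<le> M * cmod (beta0 d \<alpha> k n)" using s0 by (intro mult_right_mono) (auto simp: M_def)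
  finally show ?thesis .
 qed
 then show ?thesis using that[of M] s0 by (simp add: M_def)
qed

lemma rapid_mono: "rapid C p ==> C \<le> C' ==> rapid C' p"
 unfolding rapid_def by (meson br_nonneg divide_right_mono order_trans zero_le_power)

lemma real_analytic_rapid:
 assumes d: "0 < d" and f: "real_analytic f" and p: "\<And>x. f (x + d) = f x"
 obtains C where "rapid C (per_coef d f)" "rapid C (per_coef d (deriv f))" "rapid C (per_coef d (\<lambda>x. (f x)^2 / 2))"
  "\<And>k. per_coef d (\<lambda>x. (f x)^2 / 2) k = infsum (\<lambda>m. per_coef d f (k - m) * per_coef d f m) UNIV / 2"
proof -
 note D = real_analytic_deriv[OF f]
 have p': "deriv f (x + d) = deriv f x" for x by (rule deriv_period_real[OF D(1) p])
 obtain B1 where B1: "Cb 5 B1 (\<lambda>x. of_real (f x))" using real_analytic_Cb[OF d f p] by blast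
 obtain B2 where B2: "Cb 5 B2 (\<lambda>x. of_real (deriv f x))" using real_analytic_Cb[OF d D(2) p'] by blast
 have ff: "Cb 5 (2 ^ 5 * B1 * B1) (\<lambda>x. of_real (f x) * of_real (f x))" by (rule Cb_mult[OF B1 B1])
 have sq: "per_coef d (\<lambda>x. (f x)^2 / 2) k = 1 / 2 * ccoef d (\<lambda>x. of_real (f x) * of_real (f x)) k" for k
  unfolding ccoef_cmult[symmetric] per_coef_ccoef by (simp add: power2_eq_square)
 have r1: "rapid (decK d 5 * B1) (per_coef d f)" unfolding per_coef_ccoef by (rule Cb_rapid[OF d B1]) (simp add: p)
 have r2: "rapid (decK d 5 * B2) (per_coef d (deriv f))" unfolding per_coef_ccoef by (rule Cb_rapid[OF d B2]) (simp add: p')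
 have r0: "rapid (decK d 5 * (2 ^ 5 * B1 * B1)) (ccoef d (\<lambda>x. of_real (f x) * of_real (f x)))"
  by (rule Cb_rapid[OF d ff]) (simp add: p)
 have r3: "rapid (decK d 5 * (2 ^ 5 * B1 * B1)) (per_coef d (\<lambda>x. (f x)^2 / 2))"
  unfolding rapid_def sq
 proof
  fix m
  have "cmod (1 / 2 * z) \<le> cmod z" for z :: complex by (simp add: norm_mult norm_divide)
  then show "cmod (1 / 2 * ccoef d (\<lambda>x. of_real (f x) * of_real (f x)) m) \<le> decK d 5 * (2 ^ 5 * B1 * B1) / br m ^ 5"
   using rapidD[OF r0] by (rule order_trans)
 qed
 let ?C = "max (decK d 5 * B1) (max (decK d 5 * B2) (decK d 5 * (2 ^ 5 * B1 * B1)))"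
 have c: "continuous_on UNIV f" by (intro continuous_at_imp_continuous_on ballI DERIV_isCont[OF D(1)])
 show ?thesis
 proof (rule that[of ?C])
  show "rapid ?C (per_coef d f)" by (rule rapid_mono[OF r1]) simp
  show "rapid ?C (per_coef d (deriv f))" by (rule rapid_mono[OF r2]) simp
  show "rapid ?C (per_coef d (\<lambda>x. (f x)^2 / 2))" by (rule rapid_mono[OF r3]) simp
  show "per_coef d (\<lambda>x. (f x)^2 / 2) k = infsum (\<lambda>m. per_coef d f (k - m) * per_coef d f m) UNIV / 2" for k
   unfolding sq ccoef_convolution[OF d c p r1[unfolded per_coef_ccoef]] by (simp add: per_coef_ccoef)
 qed
qed

theorem theorem1:
 fixes d \<alpha> k0 k1 \<sigma>1 :: real and L :: nat and Ft :: "real => real"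
 assumes "d > 0" and "k0 > 0" and "k1 > 0"
  and "\<not> wood d \<alpha> k0" and "\<not> wood d \<alpha> k1"
  and "\<sigma>1 > 0" and "L \<le> 2"
  and "real_analytic Ft" and "\<forall>x. Ft (x + d) = Ft x"
 shows "\<exists>\<epsilon>0>0. \<forall>\<epsilon>. 0 < \<epsilon> \<and> \<epsilon> < \<epsilon>0 \<longrightarrow>
      invertible_on_sob d \<alpha> (-1/2)
       (A10 d \<alpha> k0 (complex_of_real k1 + \<i> * complex_of_real \<sigma>1) L \<epsilon> Ft)"
proof -
 define \<kappa> where "\<kappa> = complex_of_real k1 + \<i> * complex_of_real \<sigma>1"
 have p: "Ft (x + d) = Ft x" for x using assms(9) by blast
 have im: "0 < Im (\<kappa>^2)" using assms by (simp add: \<kappa>_def power2_eq_square)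
 interpret beta_symbol d \<alpha> \<kappa> by unfold_locales (use assms(1) im in auto)
 interpret gk: green_kernel d Ft "deriv Ft" k0 \<alpha>
  by unfold_locales (use assms p real_analytic_deriv(1)[OF assms(8)] real_analytic_Cb[OF assms(1,8) p] in auto)
 obtain C where C: "rapid C (per_coef d Ft)" "rapid C (per_coef d (deriv Ft))" "rapid C (per_coef d (\<lambda>x. (Ft x)^2 / 2))"
  "\<And>k. per_coef d (\<lambda>x. (Ft x)^2 / 2) k = infsum (\<lambda>m. per_coef d Ft (k - m) * per_coef d Ft m) UNIV / 2"
  by (rule real_analytic_rapid[OF assms(1,8) p]) (rule that)
 obtain B where B: "0 \<le> B" "\<And>\<epsilon>. 0 < \<epsilon> ==> \<epsilon> \<le> 1 ==> \<exists>KM DM. mdec (B * \<epsilon>) KM \<and> mdec (B * \<epsilon>) (\<lambda>n j. of_real (jw d \<alpha> n) * DM n j) \<and>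
   (\<forall>c n. finite {n. c n \<noteq> 0} \<longrightarrow> qp_coef d \<alpha> (adj_double_layer d \<alpha> k0 (\<lambda>x. \<epsilon> * Ft x) c) n = (\<Sum>j | c j \<noteq> 0. KM n j * c j)) \<and>
   (\<forall>c n. finite {n. c n \<noteq> 0} \<longrightarrow> qp_coef d \<alpha> (single_layer d \<alpha> k0 (\<lambda>x. \<epsilon> * Ft x) c) n
     = (\<Sum>j | c j \<noteq> 0. (DM n j + (if n = j then \<i> / (2 * beta0 d \<alpha> k0 j) else 0)) * c j))"
  by (rule gk.layer_matrices) (rule that)
 obtain M0 where M0: "0 \<le> M0" "\<And>n. w n \<le> M0 * cmod (beta0 d \<alpha> k0 n)" by (rule jw_le_beta0[OF assms(1,4)]) (rule that)
 define \<beta> where "\<beta> = beta0 d \<alpha> k0"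
 have \<beta>0: "0 < cmod (\<beta> n)" for n using beta0_dir[OF assms(4), of n] by (auto simp: \<beta>_def)
 have w0: "0 < w n" for n by (rule jw_pos)
 have wc: "complex_of_real (w n) \<noteq> 0" for n using w0[of n] by simp
 \<comment> \<open>\<open>z0\<close> is the order-zero expansion term with the weight divided out,
   and the next definition is the flat single layer with the weight multiplied in; their product is
   b n / (2 beta0).\<close>
 define z0 where "z0 n = - \<i> * (b n / of_real (w n))" for n
 define \<gamma> where "\<gamma> n = of_real (w n) * (\<i> / (2 * \<beta> n))" for n
 have Z0: "Zmat Ft 0 = diagm z0" by (simp add: Zmat_def Let_def z0_def[abs_def])
 have z0_le: "cmod (z0 n) \<le> 1 + cmod \<kappa>" for n using norm_bw[of n] unfolding z0_def norm_mult by simp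
 have \<gamma>_le: "cmod (\<gamma> n) \<le> M0" for n
 proof -
  have "w n / cmod (\<beta> n) \<le> M0" using M0(2)[of n] \<beta>0[of n] by (simp add: pos_divide_le_eq \<beta>_def)
  then show ?thesis using w0[of n] M0(1) by (simp add: \<gamma>_def norm_mult norm_divide)
 qed
 define a where "a n = 1 / 2 + z0 n * \<gamma> n" for n
 have ii: "\<i> * (x * \<i>) = - x" for x
 proof -
  have "\<i> * (x * \<i>) = x * (\<i> * \<i>)" by (simp only: mult_ac)
  then show ?thesis by simp
 qed
 have a_eq: "a n = (1 + b n / \<beta> n) / 2" for n
  using wc[of n] by (simp add: a_def z0_def \<gamma>_def add_divide_distrib ii)
 have a_ge: "1 / 2 \<le> cmod (a n)" for n
 proof -
  have "0 \<le> Re (b n / \<beta> n)"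
   using beta0_dir[OF assms(4), of n] Re_b[of n] Im_b[of n] unfolding \<beta>_def
   by (auto simp: Re_divide intro!: divide_nonneg_nonneg add_nonneg_nonneg)
  then have "1 / 2 \<le> Re (a n)" by (simp add: a_eq)
  then show ?thesis using complex_Re_le_cmod[of "a n"] by linarith
 qed
 have a_le: "cmod (a n) \<le> 1 / 2 + (1 + cmod \<kappa>) * M0" for n
 proof -
  have "cmod (z0 n * \<gamma> n) \<le> (1 + cmod \<kappa>) * M0" unfolding norm_mult by (intro mult_mono z0_le \<gamma>_le) auto
  then show ?thesis unfolding a_def using norm_triangle_ineq[of "1 / 2" "z0 n * \<gamma> n"] by (simp add: norm_divide)
 qed
 have "\<forall>l. \<exists>M. mdec M (Zmat Ft l)" using mdec_Zmat[OF C] by blast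
 then obtain MZ where MZ: "\<And>l. mdec (MZ l) (Zmat Ft l)" by metis
 have MZ0: "0 \<le> MZ l" for l by (rule mdec_nonneg[OF MZ])
 have cK: "0 \<le> convK" using convK_ge1 by linarith
 \<comment> \<open>Three sources of size epsilon: the adjoint double layer; the order-zero term
   acting on the perturbation of the single layer; the terms l >= 1, where epsilon^l <= epsilon
   allows the whole weighted single layer with bound B + M0, flat part included.\<close>
 define K where "K = B + (1 + cmod \<kappa>) * B + (\<Sum>l\<in>{1..L}. convK * MZ l * (B + M0))"
 have K0: "0 \<le> K" unfolding K_def using B(1) M0(1) MZ0 cK by (intro add_nonneg_nonneg mult_nonneg_nonneg sum_nonneg) auto
 \<comment> \<open>The threshold gives convK K epsilon <= 1 / 4; K + 1 instead of K keeps the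
   denominator positive.\<close>
 have "invertible_on_sob d \<alpha> (-1/2) (A10 d \<alpha> k0 \<kappa> L \<epsilon> Ft)"
  if e: "0 < \<epsilon>" "\<epsilon> < min 1 (1 / (4 * convK * (K + 1)))" for \<epsilon>
 proof -
  have e1: "\<epsilon> \<le> 1" using e by simp
  obtain KM DM where KD: "mdec (B * \<epsilon>) KM" "mdec (B * \<epsilon>) (\<lambda>n j. of_real (w n) * DM n j)"
   and coefK: "\<And>c n. finite {n. c n \<noteq> 0} ==> qp_coef d \<alpha> (adj_double_layer d \<alpha> k0 (\<lambda>x. \<epsilon> * Ft x) c) n = (\<Sum>j | c j \<noteq> 0. KM n j * c j)"
   and coefS: "\<And>c n. finite {n. c n \<noteq> 0} ==> qp_coef d \<alpha> (single_layer d \<alpha> k0 (\<lambda>x. \<epsilon> * Ft x) c) n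
     = (\<Sum>j | c j \<noteq> 0. (DM n j + (if n = j then \<i> / (2 * beta0 d \<alpha> k0 j) else 0)) * c j)"
   using B(2)[OF e(1) e1] by blast
  define T where "T n j = of_real (w n) * DM n j + diagm \<gamma> n j" for n j
  have T: "mdec (B * \<epsilon> + M0) T" unfolding T_def by (intro mdec_add KD(2) mdec_diagm \<gamma>_le)
  have T': "mdec (B + M0) T"
   by (rule mdec_mono[OF T]) (use mult_left_mono[OF e1 B(1)] in simp)
  \<comment> \<open>The product of \<open>z0\<close> with the flat part of \<open>T\<close> is
    diagonal and belongs to \<open>a\<close>; everything else goes into \<open>E\<close>.\<close>
  define E where "E n j = KM n j + mmul (diagm z0) (\<lambda>n j. of_real (w n) * DM n j) n j
    + (\<Sum>l\<in>{1..L}. of_real (\<epsilon> ^ l) * mmul (Zmat Ft l) T n j)" for n j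
  have E: "mdec (K * \<epsilon>) E"
  proof -
   have 1: "mdec ((1 + cmod \<kappa>) * (B * \<epsilon>)) (mmul (diagm z0) (\<lambda>n j. of_real (w n) * DM n j))"
    unfolding mdec_def mmul_diagm_left
   proof (intro allI)
    fix n j
    have "cmod (z0 n * (of_real (w n) * DM n j)) \<le> (1 + cmod \<kappa>) * (B * \<epsilon> / br (n - j) ^ 3)"
     unfolding norm_mult[of "z0 n"] by (intro mult_mono z0_le mdecD[OF KD(2)]) auto
    then show "cmod (z0 n * (of_real (w n) * DM n j)) \<le> (1 + cmod \<kappa>) * (B * \<epsilon>) / br (n - j) ^ 3" by simp
   qed
   have 2: "mdec (\<Sum>l\<in>{1..L}. \<epsilon> * (convK * MZ l * (B + M0))) (\<lambda>n j. \<Sum>l\<in>{1..L}. of_real (\<epsilon> ^ l) * mmul (Zmat Ft l) T n j)"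
   proof (rule mdec_sum)
    fix l assume l: "l \<in> {1..L}"
    have "mdec (cmod (of_real (\<epsilon> ^ l)) * (convK * MZ l * (B + M0))) (\<lambda>n j. of_real (\<epsilon> ^ l) * mmul (Zmat Ft l) T n j)"
     by (rule mdec_scale[OF mdec_mmul[OF MZ T']])
    then show "mdec (\<epsilon> * (convK * MZ l * (B + M0))) (\<lambda>n j. of_real (\<epsilon> ^ l) * mmul (Zmat Ft l) T n j)"
    proof (rule mdec_mono)
     have "\<epsilon> ^ l \<le> \<epsilon> ^ 1" using e(1) e1 l by (intro power_decreasing) auto
     then have "cmod (of_real (\<epsilon> ^ l)) \<le> \<epsilon>" using e(1) by (simp add: norm_power)
     then show "cmod (of_real (\<epsilon> ^ l)) * (convK * MZ l * (B + M0)) \<le> \<epsilon> * (convK * MZ l * (B + M0))"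
      using cK MZ0 B(1) M0(1) by (intro mult_right_mono) auto
    qed
   qed simp
   have "mdec (B * \<epsilon> + (1 + cmod \<kappa>) * (B * \<epsilon>) + (\<Sum>l\<in>{1..L}. \<epsilon> * (convK * MZ l * (B + M0)))) E"
    unfolding E_def by (intro mdec_add KD(1) 1 2)
   moreover have "B * \<epsilon> + (1 + cmod \<kappa>) * (B * \<epsilon>) + (\<Sum>l\<in>{1..L}. \<epsilon> * (convK * MZ l * (B + M0))) = K * \<epsilon>"
    unfolding K_def sum_distrib_left[symmetric] by (simp add: algebra_simps)
   ultimately show ?thesis by simp
  qed
  have small: "convK * (K * \<epsilon>) \<le> 1 / 4"
  proof -
   have pos: "0 < 4 * convK * (K + 1)" using convK_ge1 K0 by (intro mult_pos_pos) auto
   have "\<epsilon> * (4 * convK * (K + 1)) < 1" using e(2) pos by (simp add: pos_less_divide_eq)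
   then have "4 * (convK * (K * \<epsilon>)) + 4 * (convK * \<epsilon>) < 1" by (simp add: algebra_simps)
   then show ?thesis using mult_nonneg_nonneg[OF cK less_imp_le[OF e(1)]] by linarith
  qed
  show ?thesis
  proof (rule invertible_on_sob_diag_plus_small[of a, OF a_ge a_le E small])
   fix c :: coeffs and n assume c: "finite {n. c n \<noteq> 0}"
   let ?F = "{j. c j \<noteq> 0}"
   define s where "s = qp_coef d \<alpha> (single_layer d \<alpha> k0 (\<lambda>x. \<epsilon> * Ft x) c)"
   have ws: "(\<lambda>n. of_real (w n) * s n) = (\<lambda>n. \<Sum>j\<in>?F. T n j * c j)"
   proof
    fix n
    have t: "of_real (w n) * ((DM n j + (if n = j then \<i> / (2 * beta0 d \<alpha> k0 j) else 0)) * c j) = T n j * c j" for j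
     by (simp add: T_def diagm_def \<gamma>_def \<beta>_def algebra_simps)
    show "of_real (w n) * s n = (\<Sum>j\<in>?F. T n j * c j)"
     unfolding s_def coefS[OF c] sum_distrib_left t ..
   qed
   \<comment> \<open>The index 0 is merely a centre of decay, as \<open>Yell_mapp\<close> asks for
     one.\<close>
   obtain D where D: "\<And>n. cmod (\<Sum>j\<in>?F. T n j * c j) \<le> D / br (n - 0) ^ 3"
    by (rule finite_combination_decay[OF T c]) (rule that)
   have Y: "Yell l d \<alpha> \<kappa> Ft s n = (\<Sum>j\<in>?F. mmul (Zmat Ft l) T n j * c j)" if "l \<le> 2" for l
   proof -
    have "cmod (of_real (w n) * s n) \<le> D / br (n - 0) ^ 3" for n using D[of n] fun_cong[OF ws, of n] by simp
    from Yell_mapp[OF C this that] show ?thesis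
     unfolding ws mapp_finite_combination[OF MZ T c] by simp
   qed
   have "YL L d \<alpha> \<kappa> \<epsilon> Ft s n = (\<Sum>l\<le>L. of_real (\<epsilon> ^ l) * (\<Sum>j\<in>?F. mmul (Zmat Ft l) T n j * c j))"
    unfolding YL_def by (intro sum.cong refl) (use Y assms(7) in simp)
   also have "{..L} = insert 0 {1..L}" by auto
   also have "(\<Sum>l\<in>insert 0 {1..L}. of_real (\<epsilon> ^ l) * (\<Sum>j\<in>?F. mmul (Zmat Ft l) T n j * c j))
    = (\<Sum>j\<in>?F. mmul (Zmat Ft 0) T n j * c j) + (\<Sum>l\<in>{1..L}. of_real (\<epsilon> ^ l) * (\<Sum>j\<in>?F. mmul (Zmat Ft l) T n j * c j))"
    by (subst sum.insert) auto
   also have "(\<Sum>l\<in>{1..L}. of_real (\<epsilon> ^ l) * (\<Sum>j\<in>?F. mmul (Zmat Ft l) T n j * c j))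
    = (\<Sum>j\<in>?F. (\<Sum>l\<in>{1..L}. of_real (\<epsilon> ^ l) * mmul (Zmat Ft l) T n j) * c j)"
    unfolding sum_distrib_left sum_distrib_right by (subst sum.swap) (simp only: mult.assoc)
   also have "(\<Sum>j\<in>?F. mmul (Zmat Ft 0) T n j * c j)
    = (\<Sum>j\<in>?F. mmul (diagm z0) (\<lambda>n j. of_real (w n) * DM n j) n j * c j) + z0 n * \<gamma> n * c n"
   proof -
    have "mmul (Zmat Ft 0) T n j * c j = mmul (diagm z0) (\<lambda>n j. of_real (w n) * DM n j) n j * c j + (if n = j then z0 n * \<gamma> n * c n else 0)" for j
     unfolding Z0 mmul_diagm_left T_def diagm_def by (simp add: algebra_simps)
    moreover have "(\<Sum>j\<in>?F. if n = j then z0 n * \<gamma> n * c n else 0) = z0 n * \<gamma> n * c n"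
     using c by (cases "c n = 0") auto
    ultimately show ?thesis by (simp add: sum.distrib)
   qed
   finally have YLs: "YL L d \<alpha> \<kappa> \<epsilon> Ft s n = (\<Sum>j\<in>?F. mmul (diagm z0) (\<lambda>n j. of_real (w n) * DM n j) n j * c j) + z0 n * \<gamma> n * c n
    + (\<Sum>j\<in>?F. (\<Sum>l\<in>{1..L}. of_real (\<epsilon> ^ l) * mmul (Zmat Ft l) T n j) * c j)" .
   have "A10 d \<alpha> k0 \<kappa> L \<epsilon> Ft c n = c n / 2 + (\<Sum>j\<in>?F. KM n j * c j) + YL L d \<alpha> \<kappa> \<epsilon> Ft s n"
    unfolding A10_def coefK[OF c] s_def ..
   then show "A10 d \<alpha> k0 \<kappa> L \<epsilon> Ft c n = a n * c n + (\<Sum>j\<in>?F. E n j * c j)"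
    unfolding YLs E_def distrib_right sum.distrib by (simp add: a_def distrib_right)
  qed
 qed
 moreover have "0 < min 1 (1 / (4 * convK * (K + 1)))" using convK_ge1 K0 by simp
 ultimately show ?thesis unfolding \<kappa>_def by blast
qed

end
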